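(* (1) Any Euclidean $m$-dimensional sphere of an $(m+1)$-dimensional vector subspace $E$ is $\Omega_\pi$-stable in $\mathbb R^{m+n}$, for any Riemannian fibration $\pi$ of $\mathbb R^{m+n}$ by totally geodesic fibres with $E$ as a fibre. (2) Let $M^m$ be a geodesic sphere of $\mathbb S^{m+1}$. Immersing $\mathbb S^{m+1}$ as a totally geodesic fibre in $\mathbb S^{m+n}$, where $m,n$ are such that $\pi:\mathbb S^{m+n}\to N$ is one of the Hopf fibrations $$\mathbb S^3\hookrightarrow\mathbb S^7\to\mathbb S^4(\tfrac12),\qquad \mathbb S^3\hookrightarrow\mathbb S^{4k+3}\to\mathbb{HP}^k\ (k\ge2),\qquad \mathbb S^7\hookrightarrow\mathbb S^{15}\to\mathbb S^8(\tfrac12),$$ defines an $\Omega_\pi$-unstable immersion $\phi:M^m\to\mathbb S^{m+n}$ with parallel mean curvature. (3) If $M^m$ is a geodesic sphere of a hyperbolic space $\mathbb H^{m+1}$, with $\mathbb H^{m+1}$ immersed as a fibre of a Riemannian fibration $\pi:\mathbb H^{m+n}\to N$ of the $(m+n)$-dimensional hyperbolic space, with $n\ge2$, by totally geodesic fibres, then the corresponding immersion $\phi:M^m\to\mathbb H^{m+n}$ is an $\Omega_\pi$-stable immersion with parallel mean curvature.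
   Context: A Riemannian fibration $\pi:\bar M^{m+n}\to N$ is a Riemannian submersion, here with (oriented) fibres $M'_y=\pi^{-1}(y)$ of dimension $m+1$, giving the orthogonal split $T\bar M=T\bar M^{\upsilon}\oplus T\bar M^h$ into vertical and horizontal spaces. It defines the rank-$(m+1)$ form on $\bar M$ $$\Omega_\pi(X_1,\dots,X_{m+1})=\mathrm{Vol}_y(X_1^\upsilon,\dots,X_{m+1}^\upsilon),\qquad X_i\in T_x\bar M,\ y=\pi(x),$$ with $\mathrm{Vol}_y$ the volume element of $M'_y$ and $X^\upsilon$ the vertical projection; it satisfies $|\Omega_\pi|\le1$ on orthonormal systems with equality on tangent spaces of the fibres. Spheres $\mathbb S^k$ are unit spheres, $\mathbb S^k(\frac12)$ are spheres of curvature $4$, $\mathbb{HP}^k$ is the quaternionic projective space with sectional curvature $1\le K\le4$. For an immersion $\phi:M^m\to\bar M$ with $M$ closed, oriented (suitably), lying as a hypersurface in a fibre, let $g=\phi^*\bar g$, $B$ the second fundamental form in $\bar M$, $H=\frac1m\mathrm{trace}_gB$, $NM$ the normal bundle with connection $\nabla^\perp$, $\bar\nabla$ the Levi-Civita connection of $\bar M$, $e_i$ a direct orthonormal frame of $M$ (identified with $d\phi(e_i)$). Parallel mean curvature: $\nabla^\perp H=0$. Let $\nu$ be the unit normal of $M$ in the fibre with $H=\|H\|\nu$ and $\Omega_\pi(\nu,e_1,\dots,e_m)=1$, and $NM=\mathbb R\nu\oplus F$ the orthogonal split. With $\Omega=\Omega_\pi$, $C_\Omega$ is the first-order differential operator with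 values in $C^\infty(NM)$, depending only on $W^\perp$, defined by: for all sections $W,W'$ of $\phi^{-1}T\bar M$, $$\int_M\bar g(C_\Omega(W),W')dM=\int_M\Big(\sum_i\tfrac12\big[\Omega(W^\perp,e_1,\dots,\nabla^\perp_{e_i}W'^\perp,\dots,e_m)+\Omega(W'^\perp,e_1,\dots,\nabla^\perp_{e_i}W^\perp,\dots,e_m)\big]+\tfrac12\big[(\bar\nabla_{W^\perp}\Omega)(W'^\perp,e_1,\dots,e_m)+(\bar\nabla_{W'^\perp}\Omega)(W^\perp,e_1,\dots,e_m)\big]\Big)dM.$$ Let $\bar R(X,Y)=-[\bar\nabla_X,\bar\nabla_Y]+\bar\nabla_{[X,Y]}$, $\bar R(W)=\sum_i(\bar R(e_i,W)e_i)^\perp$, $\tilde B(W)=\sum_{ij}\bar g(W,B(e_i,e_j))B(e_i,e_j)$ for $W\in NM$. Let $\mathcal F_M=\{f\in C^\infty(M):\int_Mf\,dM=0\}$, $\mathcal F_{M,\Omega}=\{f(\nu+N):f\in\mathcal F_M,\ N\in C^\infty(F)\}$ and $H^1_{0,T}(NM)$ the $H^1$-completion of the vector space it spans. $\phi$ is $\Omega$-stable if for all $W\in H^1_{0,T}(NM)$ $$I_\Omega(W,W)=\int_M\big(\|\nabla^\perp W\|^2-\bar g(\bar R(W),W)-\bar g(\tilde B(W),W)+m\|H\|\bar g(C_\Omega(W),W)\big)dM\ge0,$$ and $\Omega$-unstable otherwise. *)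

theory Defs
  imports "HOL-Analysis.Analysis"
begin

section \<open>Calculus on subsets of a vector space\<close>

text \<open>Differentiability class k on an open set.\<close>

primrec Ck_on :: "nat \<Rightarrow> 'a::real_normed_vector set \<Rightarrow> ('a \<Rightarrow> 'b::real_normed_vector) \<Rightarrow> bool" where
  "Ck_on 0 U f \<longleftrightarrow> continuous_on U f"
| "Ck_on (Suc k) U f \<longleftrightarrow>
     f differentiable_on U \<and> (\<forall>v. Ck_on k U (\<lambda>x. frechet_derivative f (at x) v))"

text \<open>On an arbitrary set, smooth means: locally the restriction of a smooth function.\<close>

definition smooth_on :: "'a::real_normed_vector set \<Rightarrow> ('a \<Rightarrow> 'b::real_normed_vector) \<Rightarrow> bool" where
  "smooth_on S f \<longleftrightarrow>
     (\<forall>x\<in>S. \<exists>U g. open U \<and> x \<in> U \<and> (\<forall>k. Ck_on k U g) \<and> (\<forall>y\<in>S \<inter> U. g y = f y))"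

text \<open>
  If \<open>S\<close> is a submanifold and \<open>X\<close> is tangent to \<open>S\<close> at \<open>p\<close>, then
  \<open>frechet_derivative f (at p within S) X\<close> is the derivative of \<open>f\<close> along \<open>X\<close>. It depends only
  on the values of \<open>f\<close> on \<open>S\<close>; the choice of the Frechet derivative within \<open>S\<close>
  only affects directions that are not tangent to \<open>S\<close>.
\<close>

definition tangent_space :: "'a::real_normed_vector set \<Rightarrow> 'a \<Rightarrow> 'a set" where
  "tangent_space S p =
     {v. \<exists>c \<epsilon>. \<epsilon> > 0 \<and> smooth_on {-\<epsilon><..<\<epsilon>} c \<and> (\<forall>t\<in>{-\<epsilon><..<\<epsilon>}. c t \<in> S) \<and> c 0 = p \<and>
          (c has_vector_derivative v) (at (0::real))}"


section \<open>Submanifolds of a pseudo-Euclidean space\<close>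

text \<open>
  The ambient manifold \<open>B\<close> is a submanifold of a vector space with a nondegenerate symmetric
  bilinear form \<open>b\<close> that is positive definite on the tangent spaces of \<open>B\<close>. The restriction of \<open>b\<close>
  is the Riemannian metric of \<open>B\<close>. This covers Euclidean space (\<open>B = UNIV\<close>, \<open>b\<close> the inner product),
  the unit sphere, and hyperbolic space as the hyperboloid in Minkowski space.
\<close>

definition proj :: "('a \<Rightarrow> 'a \<Rightarrow> real) \<Rightarrow> 'a::real_vector set \<Rightarrow> 'a \<Rightarrow> 'a" where
  "proj b T v = (THE w. w \<in> T \<and> (\<forall>t\<in>T. b (v - w) t = 0))"

text \<open>
  The Levi-Civita connection of \<open>B\<close> is the tangential part of the flat connection. Here the
  field \<open>Y\<close> of tangent vectors of \<open>B\<close> need only be defined along a submanifold \<open>S\<close> of \<open>B\<close>,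
  and \<open>X\<close> is tangent to \<open>S\<close> at \<open>p\<close>.
\<close>

definition conn ::
  "('a \<Rightarrow> 'a \<Rightarrow> real) \<Rightarrow> 'a set \<Rightarrow> 'a set \<Rightarrow> ('a \<Rightarrow> 'a) \<Rightarrow> 'a::real_normed_vector \<Rightarrow> 'a \<Rightarrow> 'a" where
  "conn b B S Y p X = proj b (tangent_space B p) (frechet_derivative Y (at p within S) X)"

text \<open>A tangent vector extended to a tangent field by projection, to evaluate tensors pointwise.\<close>

definition ext :: "('a \<Rightarrow> 'a \<Rightarrow> real) \<Rightarrow> 'a set \<Rightarrow> 'a::real_normed_vector \<Rightarrow> 'a \<Rightarrow> 'a" where
  "ext b S X = (\<lambda>x. proj b (tangent_space S x) X)"

definition normal_space ::
  "('a \<Rightarrow> 'a \<Rightarrow> real) \<Rightarrow> 'a set \<Rightarrow> 'a set \<Rightarrow> 'a::real_normed_vector \<Rightarrow> 'a set" where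
  "normal_space b B S p = {v \<in> tangent_space B p. \<forall>t\<in>tangent_space S p. b v t = 0}"

definition perp ::
  "('a \<Rightarrow> 'a \<Rightarrow> real) \<Rightarrow> 'a set \<Rightarrow> 'a set \<Rightarrow> ('a \<Rightarrow> 'a) \<Rightarrow> 'a::real_normed_vector \<Rightarrow> 'a" where
  "perp b B S W = (\<lambda>p. proj b (normal_space b B S p) (W p))"

definition normal_conn ::
  "('a \<Rightarrow> 'a \<Rightarrow> real) \<Rightarrow> 'a set \<Rightarrow> 'a set \<Rightarrow> ('a \<Rightarrow> 'a) \<Rightarrow> 'a::real_normed_vector \<Rightarrow> 'a \<Rightarrow> 'a" where
  "normal_conn b B S W p X = proj b (normal_space b B S p) (conn b B S W p X)"

definition second_ff ::
  "('a \<Rightarrow> 'a \<Rightarrow> real) \<Rightarrow> 'a set \<Rightarrow> 'a set \<Rightarrow> 'a::real_normed_vector \<Rightarrow> 'a \<Rightarrow> 'a \<Rightarrow> 'a" where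
  "second_ff b B S p X Y = proj b (normal_space b B S p) (conn b B S (ext b S Y) p X)"

definition totally_geodesic ::
  "('a \<Rightarrow> 'a \<Rightarrow> real) \<Rightarrow> 'a::real_normed_vector set \<Rightarrow> 'a set \<Rightarrow> bool" where
  "totally_geodesic b B S \<longleftrightarrow>
     (\<forall>p\<in>S. \<forall>X\<in>tangent_space S p. \<forall>Y\<in>tangent_space S p. second_ff b B S p X Y = 0)"

definition orthonormal_basis ::
  "('a \<Rightarrow> 'a \<Rightarrow> real) \<Rightarrow> 'a::real_vector set \<Rightarrow> ('i \<Rightarrow> 'a) \<Rightarrow> bool" where
  "orthonormal_basis b T e \<longleftrightarrow> (\<forall>i j. b (e i) (e j) = (if i = j then 1 else 0)) \<and> span (range e) = T"

definition mean_curv ::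
  "'m::finite itself \<Rightarrow> ('a \<Rightarrow> 'a \<Rightarrow> real) \<Rightarrow> 'a set \<Rightarrow> 'a set \<Rightarrow> 'a::real_normed_vector \<Rightarrow> 'a" where
  "mean_curv _ b B M p =
     (let e = (SOME e::'m \<Rightarrow> 'a. orthonormal_basis b (tangent_space M p) e)
      in (1 / real CARD('m)) *\<^sub>R (\<Sum>i\<in>UNIV. second_ff b B M p (e i) (e i)))"

definition parallel_mean_curv ::
  "'m::finite itself \<Rightarrow> ('a \<Rightarrow> 'a \<Rightarrow> real) \<Rightarrow> 'a::real_normed_vector set \<Rightarrow> 'a set \<Rightarrow> bool" where
  "parallel_mean_curv m b B M \<longleftrightarrow>
     (\<forall>p\<in>M. \<forall>X\<in>tangent_space M p. normal_conn b B M (mean_curv m b B M) p X = 0)"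

definition mean_curv_norm ::
  "'m::finite itself \<Rightarrow> ('a \<Rightarrow> 'a \<Rightarrow> real) \<Rightarrow> 'a set \<Rightarrow> 'a set \<Rightarrow> 'a::real_normed_vector \<Rightarrow> real" where
  "mean_curv_norm m b B M p = sqrt (b (mean_curv m b B M p) (mean_curv m b B M p))"

text \<open>Curvature tensor, with the sign convention \<open>R(X,Y) = -[D_X, D_Y] + D_[X,Y]\<close>.\<close>

definition curv ::
  "('a \<Rightarrow> 'a \<Rightarrow> real) \<Rightarrow> 'a set \<Rightarrow> 'a::real_normed_vector \<Rightarrow> 'a \<Rightarrow> 'a \<Rightarrow> 'a \<Rightarrow> 'a" where
  "curv b B p X Y Z =
     (let D = conn b B B; X' = ext b B X; Y' = ext b B Y; Z' = ext b B Z;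
          bracket = frechet_derivative Y' (at p within B) X - frechet_derivative X' (at p within B) Y
      in - (D (\<lambda>x. D Z' x (Y' x)) p X - D (\<lambda>x. D Z' x (X' x)) p Y) + D Z' p bracket)"

text \<open>
  The Riemannian measure of an m-dimensional submanifold: in every local parametrization it has the
  density \<open>sqrt (det (b (d_i \<psi>) (d_j \<psi>)))\<close> with respect to Lebesgue measure.
\<close>

definition local_parametrization ::
  "'a::real_normed_vector set \<Rightarrow> (real^'m) set \<Rightarrow> (real^'m::finite \<Rightarrow> 'a) \<Rightarrow> bool" where
  "local_parametrization M U \<psi> \<longleftrightarrow>
     open U \<and> smooth_on U \<psi> \<and> (\<forall>x\<in>U. inj (frechet_derivative \<psi> (at x))) \<and>
     openin (top_of_set M) (\<psi> ` U) \<and> (\<exists>\<psi>'. homeomorphism U (\<psi> ` U) \<psi> \<psi>')"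

definition is_riem_measure ::
  "'m::finite itself \<Rightarrow> ('a \<Rightarrow> 'a \<Rightarrow> real) \<Rightarrow> 'a::real_normed_vector set \<Rightarrow> 'a measure \<Rightarrow> bool" where
  "is_riem_measure _ b M \<mu> \<longleftrightarrow>
     sets \<mu> = sets borel \<and> emeasure \<mu> (- M) = 0 \<and>
     (\<forall>U. \<forall>\<psi>::real^'m \<Rightarrow> 'a. local_parametrization M U \<psi> \<longrightarrow>
        (\<forall>A\<in>sets borel. A \<subseteq> \<psi> ` U \<longrightarrow>
           emeasure \<mu> A =
             (\<integral>\<^sup>+x. ennreal (sqrt (det (\<chi> i j.
                   b (frechet_derivative \<psi> (at x) (axis i 1)) (frechet_derivative \<psi> (at x) (axis j 1)))))
                 * indicator {x\<in>U. \<psi> x \<in> A} x \<partial>lborel)))"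

definition riem_measure ::
  "'m::finite itself \<Rightarrow> ('a \<Rightarrow> 'a \<Rightarrow> real) \<Rightarrow> 'a::real_normed_vector set \<Rightarrow> 'a measure" where
  "riem_measure m b M = (SOME \<mu>. is_riem_measure m b M \<mu>)"


section \<open>Riemannian fibrations\<close>

text \<open>
  Abstract Riemannian manifolds, given by an atlas with values in a linear subspace
  (so that zero-dimensional manifolds are included) and the metric in each chart:
  \<open>metric N (U, \<phi>) (\<phi> p)\<close> is the metric at the point \<open>p\<close> in the coordinates \<open>\<phi>\<close>.
\<close>

record ('p, 'e) riem_manifold =
  mtop :: "'p topology"
  model :: "'e set"
  atlas :: "('p set \<times> ('p \<Rightarrow> 'e)) set"
  metric :: "'p set \<times> ('p \<Rightarrow> 'e) \<Rightarrow> 'e \<Rightarrow> 'e \<Rightarrow> 'e \<Rightarrow> real"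

definition riemannian_manifold :: "('p, 'e::euclidean_space) riem_manifold \<Rightarrow> bool" where
  "riemannian_manifold N \<longleftrightarrow>
     Hausdorff_space (mtop N) \<and> second_countable (mtop N) \<and> subspace (model N) \<and>
     topspace (mtop N) = (\<Union>(U, \<phi>)\<in>atlas N. U) \<and>
     (\<forall>(U, \<phi>)\<in>atlas N.
        openin (mtop N) U \<and> openin (top_of_set (model N)) (\<phi> ` U) \<and>
        homeomorphic_map (subtopology (mtop N) U) (top_of_set (\<phi> ` U)) \<phi> \<and>
        (\<forall>a\<in>\<phi> ` U.
           bilinear (metric N (U, \<phi>) a) \<and>
           (\<forall>v\<in>model N. \<forall>w\<in>model N. metric N (U, \<phi>) a v w = metric N (U, \<phi>) a w v) \<and>
           (\<forall>v\<in>model N. v \<noteq> 0 \<longrightarrow> metric N (U, \<phi>) a v v > 0)) \<and>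
        (\<forall>v\<in>model N. \<forall>w\<in>model N. smooth_on (\<phi> ` U) (\<lambda>a. metric N (U, \<phi>) a v w))) \<and>
     (\<forall>(U, \<phi>)\<in>atlas N. \<forall>(V, \<psi>)\<in>atlas N.
        smooth_on (\<phi> ` (U \<inter> V)) (\<psi> \<circ> inv_into U \<phi>) \<and>
        (\<forall>p\<in>U \<inter> V. \<forall>v\<in>model N. \<forall>w\<in>model N.
           let D = frechet_derivative (\<psi> \<circ> inv_into U \<phi>) (at (\<phi> p) within \<phi> ` (U \<inter> V))
           in metric N (U, \<phi>) (\<phi> p) v w = metric N (V, \<psi>) (\<psi> p) (D v) (D w)))"

definition fibre :: "'a set \<Rightarrow> ('a \<Rightarrow> 'p) \<Rightarrow> 'p \<Rightarrow> 'a set" where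
  "fibre B \<pi> y = {x\<in>B. \<pi> x = y}"

definition vertical :: "'a::real_normed_vector set \<Rightarrow> ('a \<Rightarrow> 'p) \<Rightarrow> 'a \<Rightarrow> 'a set" where
  "vertical B \<pi> x = tangent_space (fibre B \<pi> (\<pi> x)) x"

definition horizontal ::
  "('a \<Rightarrow> 'a \<Rightarrow> real) \<Rightarrow> 'a::real_normed_vector set \<Rightarrow> ('a \<Rightarrow> 'p) \<Rightarrow> 'a \<Rightarrow> 'a set" where
  "horizontal b B \<pi> x = {X\<in>tangent_space B x. \<forall>V\<in>vertical B \<pi> x. b X V = 0}"

definition riemannian_fibration ::
  "('a \<Rightarrow> 'a \<Rightarrow> real) \<Rightarrow> 'a::real_normed_vector set \<Rightarrow> ('a \<Rightarrow> 'p) \<Rightarrow>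
   ('p, 'e::euclidean_space) riem_manifold \<Rightarrow> bool" where
  "riemannian_fibration b B \<pi> N \<longleftrightarrow>
     riemannian_manifold N \<and> continuous_map (top_of_set B) (mtop N) \<pi> \<and> \<pi> ` B = topspace (mtop N) \<and>
     (\<forall>(U, \<phi>)\<in>atlas N.
        smooth_on {x\<in>B. \<pi> x \<in> U} (\<phi> \<circ> \<pi>) \<and>
        (\<forall>x\<in>B. \<pi> x \<in> U \<longrightarrow>
           (let D = frechet_derivative (\<phi> \<circ> \<pi>) (at x within {x\<in>B. \<pi> x \<in> U})
            in D ` tangent_space B x = model N \<and>
               (\<forall>X\<in>horizontal b B \<pi> x. \<forall>Y\<in>horizontal b B \<pi> x.
                  metric N (U, \<phi>) (\<phi> (\<pi> x)) (D X) (D Y) = b X Y))))"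

text \<open>
  The fibres are oriented by positively oriented orthonormal bases \<open>u x\<close> of the vertical spaces.
  The index type \<open>'m option\<close> has \<open>m + 1\<close> elements; \<open>None\<close> is the first of the \<open>m + 1\<close> slots. In terms of
  \<open>u x\<close>, the volume element of the fibre is the determinant of the components of its arguments.
\<close>

definition Omega ::
  "('a \<Rightarrow> 'a \<Rightarrow> real) \<Rightarrow> 'a set \<Rightarrow> ('a \<Rightarrow> 'p) \<Rightarrow> ('a \<Rightarrow> 'm option \<Rightarrow> 'a) \<Rightarrow>
   'a::real_normed_vector \<Rightarrow> ('m::finite option \<Rightarrow> 'a) \<Rightarrow> real" where
  "Omega b B \<pi> u x X = det (\<chi> i j. b (proj b (vertical B \<pi> x) (X i)) (u x j))"

text \<open>
  The bases \<open>u x\<close> themselves are chosen pointwise and need not depend continuously on \<open>x\<close>; that the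
  orientations of the vertical spaces fit together is expressed by smoothness of the resulting form.
\<close>

definition fibre_orientation ::
  "('a \<Rightarrow> 'a \<Rightarrow> real) \<Rightarrow> 'a set \<Rightarrow> ('a \<Rightarrow> 'p) \<Rightarrow> ('a::real_normed_vector \<Rightarrow> 'm::finite option \<Rightarrow> 'a) \<Rightarrow> bool"
  where
  "fibre_orientation b B \<pi> u \<longleftrightarrow>
     (\<forall>x\<in>B. orthonormal_basis b (vertical B \<pi> x) (u x)) \<and>
     (\<forall>X::'m option \<Rightarrow> 'a. smooth_on B (\<lambda>x. Omega b B \<pi> u x (\<lambda>i. ext b B (X i) x)))"

text \<open>Covariant derivative of an \<open>(m + 1)\<close>-form \<open>\<omega>\<close> on \<open>B\<close>, by the Leibniz rule.\<close>

definition conn_form ::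
  "('a \<Rightarrow> 'a \<Rightarrow> real) \<Rightarrow> 'a set \<Rightarrow> ('a \<Rightarrow> ('i::finite \<Rightarrow> 'a) \<Rightarrow> real) \<Rightarrow>
   'a::real_normed_vector \<Rightarrow> 'a \<Rightarrow> ('i \<Rightarrow> 'a) \<Rightarrow> real" where
  "conn_form b B \<omega> p X Y =
     frechet_derivative (\<lambda>x. \<omega> x (\<lambda>i. ext b B (Y i) x)) (at p within B) X
     - (\<Sum>i\<in>UNIV. \<omega> p (Y(i := conn b B B (ext b B (Y i)) p X)))"


section \<open>Stability with respect to a form\<close>

text \<open>
  Throughout, \<open>M\<close> is a closed \<open>m\<close>-dimensional submanifold of \<open>B\<close> (the immersion is the inclusion)
  lying in the fibre \<open>\<Phi>\<close>, \<open>\<Omega>\<close> is the form of the fibration and \<open>\<nu>\<close> the unit normal of \<open>M\<close> in \<open>\<Phi>\<close>. The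
  orientation of \<open>M\<close> is the one for which the direct orthonormal bases satisfy
  \<open>\<Omega> (\<nu>, e_1, ..., e_m) = 1\<close>. If the mean curvature vanishes, both unit normals are admitted.
\<close>

definition adapted_normal ::
  "'m::finite itself \<Rightarrow> ('a \<Rightarrow> 'a \<Rightarrow> real) \<Rightarrow> 'a::real_normed_vector set \<Rightarrow> 'a set \<Rightarrow> 'a set \<Rightarrow>
   ('a \<Rightarrow> 'a) \<Rightarrow> bool" where
  "adapted_normal m b B \<Phi> M \<nu> \<longleftrightarrow>
     smooth_on M \<nu> \<and>
     (\<forall>p\<in>M. \<nu> p \<in> normal_space b \<Phi> M p \<and> b (\<nu> p) (\<nu> p) = 1 \<and>
            mean_curv m b B M p = mean_curv_norm m b B M p *\<^sub>R \<nu> p)"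

definition direct_frame ::
  "('a \<Rightarrow> 'a \<Rightarrow> real) \<Rightarrow> 'a set \<Rightarrow> ('a \<Rightarrow> ('m option \<Rightarrow> 'a) \<Rightarrow> real) \<Rightarrow> ('a \<Rightarrow> 'a) \<Rightarrow>
   'a::real_normed_vector \<Rightarrow> 'm \<Rightarrow> 'a" where
  "direct_frame b M \<Omega> \<nu> p =
     (SOME e. orthonormal_basis b (tangent_space M p) e \<and> \<Omega> p (case_option (\<nu> p) e) = 1)"

text \<open>Smooth sections of the pulled back tangent bundle of \<open>B\<close>, and of the normal bundle of \<open>M\<close>.\<close>

definition sections :: "'a::real_normed_vector set \<Rightarrow> 'a set \<Rightarrow> ('a \<Rightarrow> 'a) set" where
  "sections B M = {W. smooth_on M W \<and> (\<forall>p\<in>M. W p \<in> tangent_space B p)}"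

definition normal_sections ::
  "('a \<Rightarrow> 'a \<Rightarrow> real) \<Rightarrow> 'a::real_normed_vector set \<Rightarrow> 'a set \<Rightarrow> ('a \<Rightarrow> 'a) set" where
  "normal_sections b B M = {W. smooth_on M W \<and> (\<forall>p\<in>M. W p \<in> normal_space b B M p)}"

definition C_integrand ::
  "('a \<Rightarrow> 'a \<Rightarrow> real) \<Rightarrow> 'a set \<Rightarrow> 'a set \<Rightarrow> ('a \<Rightarrow> ('m::finite option \<Rightarrow> 'a) \<Rightarrow> real) \<Rightarrow> ('a \<Rightarrow> 'a) \<Rightarrow>
   ('a \<Rightarrow> 'a) \<Rightarrow> ('a \<Rightarrow> 'a) \<Rightarrow> 'a::real_normed_vector \<Rightarrow> real" where
  "C_integrand b B M \<Omega> \<nu> W W' p =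
     (let e = direct_frame b M \<Omega> \<nu> p; Wn = perp b B M W; Wn' = perp b B M W';
          D = (\<lambda>V i. normal_conn b B M V p (e i))
      in (\<Sum>i\<in>UNIV. 1/2 * (\<Omega> p (case_option (Wn p) (e(i := D Wn' i)))
                       + \<Omega> p (case_option (Wn' p) (e(i := D Wn i)))))
         + 1/2 * (conn_form b B \<Omega> p (Wn p) (case_option (Wn' p) e)
                + conn_form b B \<Omega> p (Wn' p) (case_option (Wn p) e)))"

text \<open>The values of \<open>C_op b B M \<Omega> \<nu> W\<close> on \<open>M\<close> are uniquely determined by the defining identity.\<close>

definition C_op ::
  "('a \<Rightarrow> 'a \<Rightarrow> real) \<Rightarrow> 'a set \<Rightarrow> 'a set \<Rightarrow> ('a \<Rightarrow> ('m::finite option \<Rightarrow> 'a) \<Rightarrow> real) \<Rightarrow> ('a \<Rightarrow> 'a) \<Rightarrow>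
   ('a::real_normed_vector \<Rightarrow> 'a) \<Rightarrow> 'a \<Rightarrow> 'a" where
  "C_op b B M \<Omega> \<nu> W =
     (SOME Z. Z \<in> normal_sections b B M \<and>
        (\<forall>W'\<in>sections B M.
           (LINT p:M|riem_measure TYPE('m) b M. b (Z p) (W' p))
           = (LINT p:M|riem_measure TYPE('m) b M. C_integrand b B M \<Omega> \<nu> W W' p)))"

definition R_op ::
  "('a \<Rightarrow> 'a \<Rightarrow> real) \<Rightarrow> 'a set \<Rightarrow> 'a set \<Rightarrow> ('m::finite \<Rightarrow> 'a) \<Rightarrow> 'a::real_normed_vector \<Rightarrow> 'a \<Rightarrow> 'a" where
  "R_op b B M e p w = (\<Sum>i\<in>UNIV. proj b (normal_space b B M p) (curv b B p (e i) w (e i)))"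

definition B_op ::
  "('a \<Rightarrow> 'a \<Rightarrow> real) \<Rightarrow> 'a set \<Rightarrow> 'a set \<Rightarrow> ('m::finite \<Rightarrow> 'a) \<Rightarrow> 'a::real_normed_vector \<Rightarrow> 'a \<Rightarrow> 'a" where
  "B_op b B M e p w =
     (\<Sum>i\<in>UNIV. \<Sum>j\<in>UNIV. b w (second_ff b B M p (e i) (e j)) *\<^sub>R second_ff b B M p (e i) (e j))"

definition normal_conn_norm_sq ::
  "('a \<Rightarrow> 'a \<Rightarrow> real) \<Rightarrow> 'a set \<Rightarrow> 'a set \<Rightarrow> ('m::finite \<Rightarrow> 'a) \<Rightarrow> ('a \<Rightarrow> 'a) \<Rightarrow> 'a::real_normed_vector \<Rightarrow> real"
  where
  "normal_conn_norm_sq b B M e W p =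
     (\<Sum>i\<in>UNIV. b (normal_conn b B M W p (e i)) (normal_conn b B M W p (e i)))"

definition I_form ::
  "('a \<Rightarrow> 'a \<Rightarrow> real) \<Rightarrow> 'a set \<Rightarrow> 'a set \<Rightarrow> ('a \<Rightarrow> ('m::finite option \<Rightarrow> 'a) \<Rightarrow> real) \<Rightarrow> ('a \<Rightarrow> 'a) \<Rightarrow>
   ('a::real_normed_vector \<Rightarrow> 'a) \<Rightarrow> real" where
  "I_form b B M \<Omega> \<nu> W =
     (LINT p:M|riem_measure TYPE('m) b M.
        (let e = direct_frame b M \<Omega> \<nu> p
         in normal_conn_norm_sq b B M e W p - b (R_op b B M e p (W p)) (W p)
            - b (B_op b B M e p (W p)) (W p)
            + real CARD('m) * mean_curv_norm TYPE('m) b B M p * b (C_op b B M \<Omega> \<nu> W p) (W p)))"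

definition H1_norm_sq ::
  "('a \<Rightarrow> 'a \<Rightarrow> real) \<Rightarrow> 'a set \<Rightarrow> 'a set \<Rightarrow> ('a \<Rightarrow> ('m::finite option \<Rightarrow> 'a) \<Rightarrow> real) \<Rightarrow> ('a \<Rightarrow> 'a) \<Rightarrow>
   ('a::real_normed_vector \<Rightarrow> 'a) \<Rightarrow> real" where
  "H1_norm_sq b B M \<Omega> \<nu> W =
     (LINT p:M|riem_measure TYPE('m) b M.
        b (W p) (W p) + normal_conn_norm_sq b B M (direct_frame b M \<Omega> \<nu> p) W p)"

definition mean_zero_functions ::
  "'m::finite itself \<Rightarrow> ('a \<Rightarrow> 'a \<Rightarrow> real) \<Rightarrow> 'a::real_normed_vector set \<Rightarrow> ('a \<Rightarrow> real) set" where
  "mean_zero_functions m b M = {f. smooth_on M f \<and> (LINT p:M|riem_measure m b M. f p) = 0}"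

text \<open>
  The linear span of the sections \<open>f (\<nu> + N)\<close> with \<open>f\<close> of mean zero and \<open>N\<close> normal and orthogonal
  to \<open>\<nu>\<close>. The coefficients of a linear combination are absorbed in the functions \<open>f\<close>.
\<close>

definition test_sections ::
  "'m::finite itself \<Rightarrow> ('a \<Rightarrow> 'a \<Rightarrow> real) \<Rightarrow> 'a::real_normed_vector set \<Rightarrow> 'a set \<Rightarrow> ('a \<Rightarrow> 'a) \<Rightarrow>
   ('a \<Rightarrow> 'a) set" where
  "test_sections m b B M \<nu> =
     {(\<lambda>p. \<Sum>k<(K::nat). f k p *\<^sub>R (\<nu> p + N k p)) | K f N.
        \<forall>k<K. f k \<in> mean_zero_functions m b M \<and> N k \<in> normal_sections b B M \<and>
              (\<forall>p\<in>M. b (N k p) (\<nu> p) = 0)}"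

text \<open>
  Elements of the \<open>H^1\<close>-completion of the test sections are represented by Cauchy sequences \<open>W\<close>; the
  quadratic form is continuous in the \<open>H^1\<close>-norm and extends to the completion as the limit \<open>L\<close>.
\<close>

definition omega_stable ::
  "('a \<Rightarrow> 'a \<Rightarrow> real) \<Rightarrow> 'a set \<Rightarrow> 'a set \<Rightarrow> ('a \<Rightarrow> ('m::finite option \<Rightarrow> 'a) \<Rightarrow> real) \<Rightarrow>
   ('a::real_normed_vector \<Rightarrow> 'a) \<Rightarrow> bool" where
  "omega_stable b B M \<Omega> \<nu> \<longleftrightarrow>
     (\<forall>W L. (\<forall>k::nat. W k \<in> test_sections TYPE('m) b B M \<nu>) \<and>
            (\<forall>\<epsilon>>0. \<exists>K. \<forall>j\<ge>K. \<forall>k\<ge>K. H1_norm_sq b B M \<Omega> \<nu> (\<lambda>p. W j p - W k p) < \<epsilon>) \<and>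
            (\<lambda>k. I_form b B M \<Omega> \<nu> (W k)) \<longlonglongrightarrow> L
            \<longrightarrow> L \<ge> 0)"


section \<open>Model spaces\<close>

definition minkowski :: "'a::real_inner \<times> real \<Rightarrow> 'a \<times> real \<Rightarrow> real" where
  "minkowski x y = fst x \<bullet> fst y - snd x * snd y"

definition hyperboloid :: "('a::real_inner \<times> real) set" where
  "hyperboloid = {x. minkowski x x = -1 \<and> snd x > 0}"

text \<open>
  Geodesic spheres of a totally geodesic submanifold \<open>\<Phi>\<close> of the unit sphere (a great sphere), resp. of the
  hyperboloid (a hyperbolic subspace), where the distance of \<open>\<Phi>\<close> is that of the ambient space.
\<close>

definition geodesic_sphere_in_S :: "'a::real_inner set \<Rightarrow> 'a set \<Rightarrow> bool" where
  "geodesic_sphere_in_S \<Phi> M \<longleftrightarrow>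
     (\<exists>c\<in>\<Phi>. \<exists>r. 0 < r \<and> r < pi \<and> M = {x\<in>\<Phi>. arccos (c \<bullet> x) = r})"

definition geodesic_sphere_in_H :: "('a::real_inner \<times> real) set \<Rightarrow> ('a \<times> real) set \<Rightarrow> bool" where
  "geodesic_sphere_in_H \<Phi> M \<longleftrightarrow>
     (\<exists>c\<in>\<Phi>. \<exists>r>0. M = {x\<in>\<Phi>. arcosh (- minkowski c x) = r})"


section \<open>Hopf fibrations\<close>

text \<open>Quaternions and octonions by the Cayley--Dickson construction.\<close>

type_synonym quat = "complex \<times> complex"
type_synonym octo = "quat \<times> quat"

definition quat_cnj :: "quat \<Rightarrow> quat" where
  "quat_cnj x = (cnj (fst x), - snd x)"

definition quat_mult :: "quat \<Rightarrow> quat \<Rightarrow> quat" where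
  "quat_mult x y =
     (fst x * fst y - cnj (snd y) * snd x, snd y * fst x + snd x * cnj (fst y))"

definition octo_cnj :: "octo \<Rightarrow> octo" where
  "octo_cnj x = (quat_cnj (fst x), - snd x)"

definition octo_mult :: "octo \<Rightarrow> octo \<Rightarrow> octo" where
  "octo_mult x y =
     (quat_mult (fst x) (fst y) - quat_mult (quat_cnj (snd y)) (snd x),
      quat_mult (snd y) (fst x) + quat_mult (snd x) (quat_cnj (fst y)))"

text \<open>The Hopf maps of the unit spheres onto the spheres of radius \<open>1/2\<close> (curvature 4).\<close>

definition hopf_quat :: "quat \<times> quat \<Rightarrow> quat \<times> real" where
  "hopf_quat x =
     (quat_mult (fst x) (quat_cnj (snd x)), ((norm (fst x))\<^sup>2 - (norm (snd x))\<^sup>2) / 2)"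

definition hopf_octo :: "octo \<times> octo \<Rightarrow> octo \<times> real" where
  "hopf_octo x =
     (octo_mult (fst x) (octo_cnj (snd x)), ((norm (fst x))\<^sup>2 - (norm (snd x))\<^sup>2) / 2)"

text \<open>Both maps are onto spheres of radius \<open>1/2\<close>; here is the easy inclusion.\<close>

lemma norm_sq_quat:
  "(norm (x::quat))\<^sup>2 = (Re (fst x))\<^sup>2 + (Im (fst x))\<^sup>2 + (Re (snd x))\<^sup>2 + (Im (snd x))\<^sup>2"
  by (simp add: norm_prod_def cmod_power2)

lemma norm_sq_prod: "(norm z)\<^sup>2 = (norm (fst z))\<^sup>2 + (norm (snd z))\<^sup>2"
  by (simp add: norm_prod_def)

lemma norm_quat_mult_cnj: "(norm (quat_mult x (quat_cnj y)))\<^sup>2 = (norm x)\<^sup>2 * (norm y)\<^sup>2"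
  by (simp add: norm_sq_quat quat_mult_def quat_cnj_def, algebra)

lemma norm_octo_mult_cnj:
  fixes x y :: octo
  shows "(norm (octo_mult x (octo_cnj y)))\<^sup>2 = (norm x)\<^sup>2 * (norm y)\<^sup>2"
  unfolding norm_sq_prod[of x] norm_sq_prod[of y] norm_sq_prod[of "octo_mult x (octo_cnj y)"]
  by (simp add: norm_sq_quat octo_mult_def octo_cnj_def quat_mult_def quat_cnj_def, algebra)

lemma half_sphere_aux:
  fixes a b c :: real
  assumes "a + b = 1" "c = a * b + ((a - b) / 2)\<^sup>2"
  shows "c = (1/2)\<^sup>2"
proof -
  have "c = (a + b)\<^sup>2 / 4" unfolding assms(2) by (simp add: power2_eq_square field_simps)
  then show ?thesis by (simp add: assms(1) power2_eq_square)
qed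

lemma hopf_quat_sphere: "hopf_quat ` sphere 0 1 \<subseteq> sphere 0 (1/2)"
proof
  fix z assume "z \<in> hopf_quat ` sphere 0 1"
  then obtain x where x: "norm x = 1" "z = hopf_quat x" by auto
  have "(norm z)\<^sup>2 = (1/2)\<^sup>2"
  proof (rule half_sphere_aux)
    show "(norm (fst x))\<^sup>2 + (norm (snd x))\<^sup>2 = 1" using norm_sq_prod[of x] x(1) by simp
    show "(norm z)\<^sup>2 = (norm (fst x))\<^sup>2 * (norm (snd x))\<^sup>2
            + (((norm (fst x))\<^sup>2 - (norm (snd x))\<^sup>2) / 2)\<^sup>2"
      unfolding norm_sq_prod[of z] unfolding x(2) hopf_quat_def
      by (simp add: norm_quat_mult_cnj power_divide)
  qed
  then have "norm z = 1/2" by (rule power2_eq_imp_eq) simp_all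
  then show "z \<in> sphere 0 (1/2)" by simp
qed

lemma hopf_octo_sphere: "hopf_octo ` sphere 0 1 \<subseteq> sphere 0 (1/2)"
proof
  fix z assume "z \<in> hopf_octo ` sphere 0 1"
  then obtain x where x: "norm x = 1" "z = hopf_octo x" by auto
  have "(norm z)\<^sup>2 = (1/2)\<^sup>2"
  proof (rule half_sphere_aux)
    show "(norm (fst x))\<^sup>2 + (norm (snd x))\<^sup>2 = 1" using norm_sq_prod[of x] x(1) by simp
    show "(norm z)\<^sup>2 = (norm (fst x))\<^sup>2 * (norm (snd x))\<^sup>2
            + (((norm (fst x))\<^sup>2 - (norm (snd x))\<^sup>2) / 2)\<^sup>2"
      unfolding norm_sq_prod[of z] unfolding x(2) hopf_octo_def
      by (simp add: norm_octo_mult_cnj power_divide)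
  qed
  then have "norm z = 1/2" by (rule power2_eq_imp_eq) simp_all
  then show "z \<in> sphere 0 (1/2)" by simp
qed

text \<open>
  A point of quaternionic projective space is the (right) quaternionic line through a nonzero
  vector. Its metric, with sectional curvature between 1 and 4, is the one that makes this map
  on the unit sphere a Riemannian submersion; the form \<open>Omega\<close> involves only the fibres of the map.
\<close>

definition hopf_HP :: "quat^'q \<Rightarrow> (quat^'q) set" where
  "hopf_HP x = range (\<lambda>h. \<chi> i. quat_mult (x $ i) h)"

end

(*
  In all cases M is a round sphere {a + rho J z. |z| = 1} in a space form of curvature eps, where J is
  a linear isometric embedding of R^(m+1), and M is umbilic in its fibre with principal curvature
  beta / rho (up to sign), where beta^2 + eps rho^2 = 1.

  The operator C vanishes. Its first-order terms are zero because the normal vectors of M have only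
  one vertical direction. For the terms with the derivative of Omega: V with <V, Z> = Omega(Z, e_1, ..., e_m)
  is a vertical field, so differentiating D pi(V) = 0, and the isometry condition of the submersion
  along the fibre, shows that (D_X Omega)(Y, e) is skew-symmetric in horizontal X, Y; and
  (D_X Omega)(nu, e) = 0 because Omega attains its maximum at (nu, e).

  Hence for W = w nu + U with U horizontal, I(W) = int |grad w|^2 - (m / rho^2) w^2 + |DU|^2 - m eps |U|^2.
  If eps <= 0 this is nonnegative, since the first eigenvalue of M on functions of mean zero is m / rho^2.
  If eps > 0 it is negative for a constant horizontal W = N: with the coordinate functions x_i of
  the unit sphere, N = sum x_i (nu + x_i N) - x_i nu lies in the span of the admissible sections.

  The eigenvalue bound is the Gaussian Poincare inequality for x |-> |x| f(x / |x|). The latter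
  follows by integrating a one-dimensional inequality for t |-> G (cos t x + sin t y) over independent
  Gaussian x and y, whose joint distribution is invariant under rotation.
*)

theory Submission
  imports Defs "HOL-Library.Option_ord" "HOL-Probability.Distributions" "HOL-Probability.Sinc_Integral"
begin

section \<open>Smooth maps and tangent vectors\<close>

lemma Ck_on_cong:
  assumes "open U" "\<And>x. x \<in> U \<Longrightarrow> f x = g x" "Ck_on k U f"
  shows "Ck_on k U g"
  using assms
proof (induction k arbitrary: f g)
  case 0
  then show ?case by (simp cong: continuous_on_cong)
next
  case (Suc k)
  have d: "g differentiable_on U"
    using Suc.prems by (auto simp: differentiable_on_def
        intro: differentiable_transform_within[of _ _ _ 1])
  have "Ck_on k U (\<lambda>x. frechet_derivative g (at x) v)" for v
  proof (rule Suc.IH[OF \<open>open U\<close>])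
    show "Ck_on k U (\<lambda>x. frechet_derivative f (at x) v)" using Suc.prems by simp
    show "frechet_derivative f (at x) v = frechet_derivative g (at x) v" if "x \<in> U" for x
      using Suc.prems that frechet_derivative_transform_within_open[of f x U g]
      by (auto simp: differentiable_on_eq_differentiable_at)
  qed
  with d show ?case by simp
qed

lemma Ck_on_Suc_imp: "open U \<Longrightarrow> Ck_on (Suc k) U f \<Longrightarrow> Ck_on k U f"
proof (induction k arbitrary: f)
  case 0
  then show ?case by (simp add: differentiable_imp_continuous_on)
next
  case (Suc k)
  then show ?case by simp
qed

lemma Ck_on_subset:
  assumes "open V" "V \<subseteq> U" "Ck_on k U f"
  shows "Ck_on k V f"
  using assms
  by (induction k arbitrary: f) (auto intro: continuous_on_subset differentiable_on_subset)

lemma Ck_onI: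
  assumes "open U" "\<And>x. x \<in> U \<Longrightarrow> (f has_derivative D x) (at x)"
    and "\<And>v. Ck_on k U (\<lambda>x. D x v)"
  shows "Ck_on (Suc k) U f"
proof -
  have "f differentiable_on U"
    using assms(1,2) by (meson differentiable_def differentiable_on_eq_differentiable_at)
  moreover have "Ck_on k U (\<lambda>x. frechet_derivative f (at x) v)" for v
    by (rule Ck_on_cong[OF assms(1) _ assms(3)[of v]]) (metis assms(2) frechet_derivative_at)
  ultimately show ?thesis by simp
qed

lemma Ck_on_SucD:
  assumes "open U" "Ck_on (Suc k) U f" "x \<in> U"
  shows "(f has_derivative frechet_derivative f (at x)) (at x)"
  using assms by (simp add: differentiable_on_eq_differentiable_at frechet_derivative_works)

lemma Ck_on_const [simp]: "open U \<Longrightarrow> Ck_on k U (\<lambda>x. c)"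
proof (induction k arbitrary: c)
  case (Suc k)
  show ?case by (rule Ck_onI[where D="\<lambda>_ _. 0"]) (use Suc in auto)
qed simp

lemma Ck_on_bounded_linear: 
  assumes "open U" "bounded_linear f"
  shows "Ck_on k U f"
proof (cases k)
  case 0
  then show ?thesis using assms by (simp add: linear_continuous_on)
next
  case (Suc j)
  show ?thesis unfolding Suc
    by (rule Ck_onI[where D="\<lambda>_. f"]) (use assms in \<open>auto intro: bounded_linear_imp_has_derivative\<close>)
qed

lemma Ck_on_add:
  assumes "open U"
  shows "Ck_on k U f \<Longrightarrow> Ck_on k U g \<Longrightarrow> Ck_on k U (\<lambda>x. f x + g x)"
proof (induction k arbitrary: f g)
  case 0
  then show ?case by (simp add: continuous_on_add)
next
  case (Suc k)
  show ?case
    by (rule Ck_onI[OF assms has_derivative_add[OF Ck_on_SucD[OF assms Suc.prems(1)] Ck_on_SucD[OF assms Suc.prems(2)]]])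
      (use Suc in auto)
qed

lemma Ck_on_bilinear:
  assumes "open U" "bounded_bilinear B"
  shows "Ck_on k U f \<Longrightarrow> Ck_on k U g \<Longrightarrow> Ck_on k U (\<lambda>x. B (f x) (g x))"
proof (induction k arbitrary: f g)
  case 0
  then show ?case by (simp add: bounded_bilinear.continuous_on[OF assms(2)])
next
  case (Suc k)
  have "Ck_on k U f" "Ck_on k U g" using Suc.prems by (auto intro: Ck_on_Suc_imp[OF assms(1)])
  then show ?case
    by (intro Ck_onI[OF assms(1) bounded_bilinear.FDERIV[OF assms(2) Ck_on_SucD[OF assms(1) Suc.prems(1)] Ck_on_SucD[OF assms(1) Suc.prems(2)]]]
       Ck_on_add[OF assms(1)] Suc.IH)
      (use Suc in auto)
qed

lemmas Ck_on_scaleR = Ck_on_bilinear[OF _ bounded_bilinear_scaleR]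

lemma Ck_on_mult:
  fixes f g :: "'a::real_normed_vector \<Rightarrow> real"
  shows "open U \<Longrightarrow> Ck_on k U f \<Longrightarrow> Ck_on k U g \<Longrightarrow> Ck_on k U (\<lambda>x. f x * g x)"
  using Ck_on_bilinear[OF _ bounded_bilinear_mult] .

lemma Ck_on_sum:
  assumes "open U" "\<And>i. i \<in> I \<Longrightarrow> Ck_on k U (f i)"
  shows "Ck_on k U (\<lambda>x. \<Sum>i\<in>I. f i x)"
  using assms(2) 
  by (induction I rule: infinite_finite_induct) (auto intro: Ck_on_add[OF assms(1)] Ck_on_const[OF assms(1)])

lemma Ck_on_linear_comp:
  assumes "open U" "bounded_linear h"
  shows "Ck_on k U f \<Longrightarrow> Ck_on k U (\<lambda>x. h (f x))"
proof (induction k arbitrary: f)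
  case 0
  then show ?case by (simp add: bounded_linear.continuous_on[OF assms(2)])
next
  case (Suc k)
  show ?case
    by (rule Ck_onI[OF assms(1) bounded_linear.has_derivative[OF assms(2) Ck_on_SucD[OF assms(1) Suc.prems]]])
      (use Suc in auto)
qed

lemma Ck_on_minus: "open U \<Longrightarrow> Ck_on k U f \<Longrightarrow> Ck_on k U (\<lambda>x. - f x)"
  by (rule Ck_on_linear_comp[OF _ bounded_linear_minus[OF bounded_linear_ident]])

lemma Ck_on_diff: "open U \<Longrightarrow> Ck_on k U f \<Longrightarrow> Ck_on k U g \<Longrightarrow> Ck_on k U (\<lambda>x. f x - g x)"
  using Ck_on_add[OF _ _ Ck_on_minus, of U k f g] by simp

lemma Ck_on_Pair:
  assumes "open U" 
  shows "Ck_on k U f \<Longrightarrow> Ck_on k U g \<Longrightarrow> Ck_on k U (\<lambda>x. (f x, g x))"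
proof (induction k arbitrary: f g)
  case 0
  then show ?case by (simp add: continuous_on_Pair)
next
  case (Suc k)
  show ?case
    by (rule Ck_onI[OF assms has_derivative_Pair[OF Ck_on_SucD[OF assms Suc.prems(1)] Ck_on_SucD[OF assms Suc.prems(2)]]])
      (use Suc in auto)
qed

lemma smooth_onE:
  assumes "smooth_on S f" "x \<in> S"
  obtains U g where "open U" "x \<in> U" "\<And>k. Ck_on k U g" "\<And>y. y \<in> S \<Longrightarrow> y \<in> U \<Longrightarrow> g y = f y"
proof -
  obtain U g where "open U \<and> x \<in> U \<and> (\<forall>k. Ck_on k U g) \<and> (\<forall>y\<in>S \<inter> U. g y = f y)"
    using bspec[OF assms(1)[unfolded smooth_on_def] assms(2)] by (elim exE)
  then show ?thesis by (intro that[of U g]) auto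
qed

lemma smooth_onI:
  assumes "open U" "S \<subseteq> U" "\<And>k. Ck_on k U g" "\<And>x. x \<in> S \<Longrightarrow> f x = g x"
  shows "smooth_on S f"
  unfolding smooth_on_def
  by (intro ballI exI[of _ U] exI[of _ g]) (use assms in auto)

lemma smooth_on_const [simp]: "smooth_on S (\<lambda>x. c)"
  by (rule smooth_onI[of UNIV _ "\<lambda>x. c"]) auto

lemma smooth_on_cong:
  assumes "smooth_on S f" "T \<subseteq> S" "\<And>x. x \<in> T \<Longrightarrow> f x = g x"
  shows "smooth_on T g"
  unfolding smooth_on_def
proof
  fix x assume "x \<in> T"
  with assms have "x \<in> S" by auto
  obtain U h where "open U" "x \<in> U" "\<And>k. Ck_on k U h" "\<And>y. y \<in> S \<Longrightarrow> y \<in> U \<Longrightarrow> h y = f y"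
    using smooth_onE[OF assms(1) \<open>x \<in> S\<close>] by blast
  with assms show "\<exists>U h. open U \<and> x \<in> U \<and> (\<forall>k. Ck_on k U h) \<and> (\<forall>y\<in>T \<inter> U. h y = g y)"
    by (intro exI[of _ U] exI[of _ h]) auto
qed

lemma smooth_on_add:
  assumes "smooth_on S f" "smooth_on S g"
  shows "smooth_on S (\<lambda>x. f x + g x)"
  unfolding smooth_on_def
proof
  fix x assume x: "x \<in> S"
  obtain U f' where f: "open U" "x \<in> U" "\<And>k. Ck_on k U f'" "\<And>y. y \<in> S \<Longrightarrow> y \<in> U \<Longrightarrow> f' y = f y"
    using smooth_onE[OF assms(1) x] by blast
  obtain V g' where g: "open V" "x \<in> V" "\<And>k. Ck_on k V g'" "\<And>y. y \<in> S \<Longrightarrow> y \<in> V \<Longrightarrow> g' y = g y"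
    using smooth_onE[OF assms(2) x] by blast
  have "Ck_on k (U \<inter> V) (\<lambda>x. f' x + g' x)" for k
    using f g by (intro Ck_on_add open_Int) (auto intro: Ck_on_subset[rotated -1])
  with f g show "\<exists>U h. open U \<and> x \<in> U \<and> (\<forall>k. Ck_on k U h) \<and> (\<forall>y\<in>S \<inter> U. h y = f y + g y)"
    by (intro exI[of _ "U \<inter> V"] exI[of _ "\<lambda>x. f' x + g' x"]) auto
qed

lemma smooth_on_bilinear:
  assumes "bounded_bilinear B" "smooth_on S f" "smooth_on S g"
  shows "smooth_on S (\<lambda>x. B (f x) (g x))"
  unfolding smooth_on_def
proof
  fix x assume x: "x \<in> S"
  obtain U f' where f: "open U" "x \<in> U" "\<And>k. Ck_on k U f'" "\<And>y. y \<in> S \<Longrightarrow> y \<in> U \<Longrightarrow> f' y = f y"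
    using smooth_onE[OF assms(2) x] by blast
  obtain V g' where g: "open V" "x \<in> V" "\<And>k. Ck_on k V g'" "\<And>y. y \<in> S \<Longrightarrow> y \<in> V \<Longrightarrow> g' y = g y"
    using smooth_onE[OF assms(3) x] by blast
  have "Ck_on k (U \<inter> V) (\<lambda>x. B (f' x) (g' x))" for k
    using f g by (intro Ck_on_bilinear[OF _ assms(1)] open_Int) (auto intro: Ck_on_subset[rotated -1])
  with f g show "\<exists>U h. open U \<and> x \<in> U \<and> (\<forall>k. Ck_on k U h) \<and> (\<forall>y\<in>S \<inter> U. h y = B (f y) (g y))"
    by (intro exI[of _ "U \<inter> V"] exI[of _ "\<lambda>x. B (f' x) (g' x)"]) auto
qed

lemmas smooth_on_scaleR = smooth_on_bilinear[OF bounded_bilinear_scaleR]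

lemma smooth_on_sum:
  assumes "\<And>i. i \<in> I \<Longrightarrow> smooth_on S (f i)"
  shows "smooth_on S (\<lambda>x. \<Sum>i\<in>I. f i x)"
  using assms
  by (induction I rule: infinite_finite_induct) (auto intro: smooth_on_add)

lemma smooth_on_imp_continuous_on:
  assumes "smooth_on S f" shows "continuous_on S f"
  unfolding continuous_on_eq_continuous_within
proof
  fix x assume x: "x \<in> S"
  obtain U g where U: "open U" "x \<in> U" "\<And>k. Ck_on k U g" "\<And>y. y \<in> S \<Longrightarrow> y \<in> U \<Longrightarrow> g y = f y"
    using smooth_onE[OF assms x] by blast
  have "continuous_on U g" using U(3)[of 0] by simp
  then have "continuous (at x within S) g"
    using U continuous_on_eq_continuous_at continuous_at_imp_continuous_at_within by blast
  then have "(g \<longlongrightarrow> g x) (at x within S)" by (simp add: continuous_within)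
  then have "(f \<longlongrightarrow> g x) (at x within S)"
    by (rule Lim_transform_eventually) (use U in \<open>auto simp: eventually_at_topological intro!: exI[of _ U]\<close>)
  then show "continuous (at x within S) f" using U x by (simp add: continuous_within)
qed

lemma smooth_on_open_imp_Ck:
  assumes "smooth_on S f" "open S"
  shows "Ck_on k S f"
proof -
  have "\<exists>V. open V \<and> x \<in> V \<and> V \<subseteq> S \<and> (\<forall>k. Ck_on k V f)" if xS: "x \<in> S" for x
  proof -
    obtain U g where U: "open U" "x \<in> U" "\<And>k. Ck_on k U g" "\<And>y. y \<in> S \<Longrightarrow> y \<in> U \<Longrightarrow> g y = f y"
      using smooth_onE[OF assms(1) xS] by blast
    have "Ck_on k (U \<inter> S) f" for k
      using U assms by (intro Ck_on_cong[of _ g f] Ck_on_subset[of "U \<inter> S" U]) auto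
    then show ?thesis using U xS assms by (intro exI[of _ "U \<inter> S"]) auto
  qed
  then have "\<forall>x\<in>S. \<exists>V. open V \<and> x \<in> V \<and> V \<subseteq> S \<and> Ck_on k V f" for k by metis
  then show ?thesis using assms(2)
  proof (induction k arbitrary: f)
    case 0
    have "\<exists>V. open V \<and> x \<in> V \<and> V \<subseteq> S \<and> continuous_on V f" if "x \<in> S" for x
      using 0(1)[of 0] that by auto
    then have "isCont f x" if "x \<in> S" for x
      using that continuous_on_eq_continuous_at by blast
    then show ?case by (simp add: continuous_at_imp_continuous_on)
  next
    case (Suc k)
    have "f differentiable (at x)" if "x \<in> S" for x
    proof -
      obtain V where "open V" "x \<in> V" "Ck_on (Suc k) V f" using Suc.prems(1)[of "Suc k"] \<open>x \<in> S\<close> by blast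
      then show ?thesis using Ck_on_SucD differentiable_def by blast
    qed
    then have d: "f differentiable_on S"
      by (simp add: differentiable_at_imp_differentiable_on)
    have "Ck_on k S (\<lambda>x. frechet_derivative f (at x) v)" for v
    proof (rule Suc.IH)
      show "\<forall>x\<in>S. \<exists>V. open V \<and> x \<in> V \<and> V \<subseteq> S \<and> Ck_on j V (\<lambda>x. frechet_derivative f (at x) v)" for j
      proof
        fix x assume "x \<in> S"
        then obtain V where "open V" "x \<in> V" "V \<subseteq> S" "Ck_on (Suc j) V f" using Suc.prems(1)[of "Suc j"] by blast
        then show "\<exists>V. open V \<and> x \<in> V \<and> V \<subseteq> S \<and> Ck_on j V (\<lambda>x. frechet_derivative f (at x) v)"
          by auto
      qed
    qed (use Suc in auto)
    with d show ?case by simp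
  qed
qed

lemma tangent_spaceE:
  assumes "v \<in> tangent_space S p"
  obtains c e where "0 < e" "smooth_on {-e<..<e} c" "\<And>t. t \<in> {-e<..<e} \<Longrightarrow> c t \<in> S" "c 0 = p"
    "(c has_vector_derivative v) (at (0::real))"
  using assms unfolding tangent_space_def by blast

lemma tangent_space_point: "v \<in> tangent_space S p \<Longrightarrow> p \<in> S"
  by (erule tangent_spaceE) force

lemma curve_has_vector_derivative:
  assumes "(f has_derivative D) (at p within S)" "c 0 = p" "0 < e"
    "\<And>t. t \<in> {-e<..<e} \<Longrightarrow> c t \<in> S" "(c has_vector_derivative v) (at (0::real))"
  shows "((\<lambda>t. f (c t)) has_vector_derivative D v) (at 0)"
proof -
  let ?I = "{-e<..<e}"
  have "(c has_vector_derivative v) (at 0 within ?I)"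
    using assms(5) has_vector_derivative_at_within by blast
  moreover have "(f has_derivative D) (at (c 0) within c ` ?I)"
    using assms(1,2,4) by (auto intro: has_derivative_subset)
  ultimately have "((f \<circ> c) has_vector_derivative D v) (at 0 within ?I)"
    by (rule vector_derivative_diff_chain_within)
  then show ?thesis using assms(3) by (simp add: at_within_open[of 0 ?I] o_def)
qed

lemma tangent_derivative_unique:
  assumes "X \<in> tangent_space S p" "(f has_derivative D) (at p within S)" "(f has_derivative D') (at p within S)"
  shows "D X = D' X"
proof -
  obtain c e where c: "0 < e" "\<And>t. t \<in> {-e<..<e} \<Longrightarrow> c t \<in> S" "c 0 = p"
    "(c has_vector_derivative X) (at (0::real))"
    using assms(1) by (blast elim: tangent_spaceE)
  show ?thesis
    using curve_has_vector_derivative[OF assms(2) c(3,1,2,4)]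
      curve_has_vector_derivative[OF assms(3) c(3,1,2,4)]
    by (rule vector_derivative_unique_at)
qed

lemma frechet_derivative_within_tangent:
  assumes "X \<in> tangent_space S p" "(f has_derivative D) (at p within S)"
  shows "frechet_derivative f (at p within S) X = D X"
  by (rule tangent_derivative_unique[OF assms(1) _ assms(2)])
    (use assms(2) in \<open>simp add: frechet_derivative_works[symmetric] differentiable_def; blast\<close>)

lemma smooth_on_has_derivative:
  assumes "smooth_on S f" "p \<in> S"
  shows "(f has_derivative frechet_derivative f (at p within S)) (at p within S)"
proof -
  obtain U g where U: "open U" "p \<in> U" "\<And>k. Ck_on k U g" "\<And>y. y \<in> S \<Longrightarrow> y \<in> U \<Longrightarrow> g y = f y"
    using smooth_onE[OF assms] by blast
  have "(g has_derivative frechet_derivative g (at p)) (at p within S)"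
    by (rule has_derivative_at_withinI[OF Ck_on_SucD[OF U(1) U(3)[of "Suc 0"] U(2)]])
  then have "(f has_derivative frechet_derivative g (at p)) (at p within S)"
    by (rule has_derivative_transform_eventually)
      (use U assms(2) in \<open>auto simp: eventually_at_topological intro!: exI[of _ U]\<close>)
  then show ?thesis by (simp add: frechet_derivative_works[symmetric] differentiable_def; blast)
qed

section \<open>Wirtinger's inequality\<close>

lemma Wirtinger_zeros:
  fixes f f' :: "real \<Rightarrow> real"
  assumes der: "\<And>t. (f has_real_derivative f' t) (at t)" and cont: "continuous_on UNIV f'"
    and z: "f 0 = 0" "f pi = 0"
  shows "integral {0..pi} (\<lambda>t. (f t)\<^sup>2) \<le> integral {0..pi} (\<lambda>t. (f' t)\<^sup>2)"
proof -
  have contf: "continuous_on UNIV f"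
    using der by (meson DERIV_continuous_on has_field_derivative_at_within)
  define h where "h t = (f' t)\<^sup>2 - (f t)\<^sup>2" for t
  have hint: "h integrable_on {a..b}" for a b
    unfolding h_def by (intro integrable_continuous_interval continuous_intros
        continuous_on_subset[OF contf] continuous_on_subset[OF cont]) auto
  define k where "k t = (f t)\<^sup>2 * (cos t / sin t)" for t
  have main: "integral {a..b} h \<ge> k b - k a" if ab: "0 < a" "a \<le> b" "b < pi" for a b
  proof -
    have s: "sin t \<noteq> 0" if "t \<in> {a..b}" for t using that ab sin_gt_zero[of t] by force
    have "((\<lambda>t. 2 * f t * f' t * (cos t / sin t) - (f t)\<^sup>2 * (1 + (cos t / sin t)\<^sup>2)) has_integral k b - k a) {a..b}"
    proof (rule fundamental_theorem_of_calculus[OF ab(2)])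
      fix t assume t: "t \<in> {a..b}"
      have eq: "1 + (cos t / sin t)\<^sup>2 = 1 / (sin t)\<^sup>2"
        using s[OF t] sin_cos_squared_add[of t] by (simp add: field_simps power2_eq_square)
      have "(k has_real_derivative 2 * f t * f' t * (cos t / sin t) - (f t)\<^sup>2 * (1 + (cos t / sin t)\<^sup>2)) (at t)"
        unfolding k_def eq
        apply (rule derivative_eq_intros der s[OF t] refl | simp)+
        apply (simp add: field_simps power2_eq_square s[OF t])
        using sin_cos_squared_add[of t] unfolding power2_eq_square by algebra
      then show "(k has_vector_derivative 2 * f t * f' t * (cos t / sin t) - (f t)\<^sup>2 * (1 + (cos t / sin t)\<^sup>2)) (at t within {a..b})"
        by (simp add: has_real_derivative_iff_has_vector_derivative has_vector_derivative_at_within)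
    qed
    moreover have "(h has_integral integral {a..b} h) {a..b}" using hint by (rule integrable_integral)
    ultimately show ?thesis
    proof (rule has_integral_le)
      fix t assume "t \<in> {a..b}"
      have "0 \<le> (f' t - f t * (cos t / sin t))\<^sup>2" by simp
      also have "\<dots> = h t - (2 * f t * f' t * (cos t / sin t) - (f t)\<^sup>2 * (1 + (cos t / sin t)\<^sup>2))"
        unfolding h_def by (simp add: power2_eq_square algebra_simps)
      finally show "2 * f t * f' t * (cos t / sin t) - (f t)\<^sup>2 * (1 + (cos t / sin t)\<^sup>2) \<le> h t" by simp
    qed
  qed
  have k0: "(k \<longlongrightarrow> 0) (at 0)"
  proof -
    have "((\<lambda>t. f t * (f t / t) * (cos t / (sin t / t))) \<longlongrightarrow> 0 * f' 0 * (cos 0 / 1)) (at 0)"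
    proof (intro tendsto_intros)
      show "(f \<longlongrightarrow> 0) (at 0)" using contf z(1) by (metis UNIV_I continuous_on_def)
      show "((\<lambda>t. f t / t) \<longlongrightarrow> f' 0) (at 0)" using der[of 0] z by (simp add: has_field_derivative_iff)
      show "((\<lambda>t::real. sin t / t) \<longlongrightarrow> 1) (at 0)" using DERIV_sin[of "0::real"] by (simp add: has_field_derivative_iff)
    qed auto
    then have "((\<lambda>t. f t * (f t / t) * (cos t / (sin t / t))) \<longlongrightarrow> 0) (at 0)" by simp
    then show ?thesis
      by (rule Lim_transform_eventually) (auto simp: k_def eventually_at_filter power2_eq_square)
  qed
  have kpi: "(k \<longlongrightarrow> 0) (at pi)"
  proof -
    have "((\<lambda>t. f t * (f t / (t - pi)) * (cos t / (sin t / (t - pi)))) \<longlongrightarrow> 0 * f' pi * (cos pi / cos pi)) (at pi)"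
    proof (intro tendsto_intros)
      show "(f \<longlongrightarrow> 0) (at pi)" using contf z(2) by (metis UNIV_I continuous_on_def)
      show "((\<lambda>t. f t / (t - pi)) \<longlongrightarrow> f' pi) (at pi)" using der[of pi] z by (simp add: has_field_derivative_iff)
      show "((\<lambda>t::real. sin t / (t - pi)) \<longlongrightarrow> cos pi) (at pi)" using DERIV_sin[of "pi::real"] by (simp add: has_field_derivative_iff)
    qed auto
    then have "((\<lambda>t. f t * (f t / (t - pi)) * (cos t / (sin t / (t - pi)))) \<longlongrightarrow> 0) (at pi)" by simp
    then show ?thesis
      by (rule Lim_transform_eventually) (auto simp: k_def eventually_at_filter power2_eq_square)
  qed
  have "((\<lambda>e. integral {0..pi - e} h - integral {0..e} h) \<longlongrightarrow> integral {0..pi - 0} h - integral {0..0} h) (at_right 0)"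
  proof (intro tendsto_diff)
    have c: "continuous_on {0..pi} (\<lambda>x. integral {0..x} h)"
      by (rule indefinite_integral_continuous_1[OF hint])
    have "((\<lambda>x. integral {0..x} h) \<longlongrightarrow> integral {0..0} h) (at 0 within {0..pi})"
      by (rule c[unfolded continuous_on_def, rule_format]) simp
    then show "((\<lambda>x. integral {0..x} h) \<longlongrightarrow> integral {0..0} h) (at_right 0)"
      by (simp add: at_within_Icc_at_right)
    have "((\<lambda>x. integral {0..x} h) \<longlongrightarrow> integral {0..pi} h) (at pi within {0..pi})"
      by (rule c[unfolded continuous_on_def, rule_format]) simp
    then have "((\<lambda>x. integral {0..x} h) \<longlongrightarrow> integral {0..pi} h) (at_left pi)"
      by (simp add: at_within_Icc_at_left)
    moreover have "filterlim (\<lambda>e. pi - e) (at_left pi) (at_right 0)"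
      unfolding filterlim_at by (auto simp: eventually_at_filter intro!: tendsto_eq_intros)
    ultimately show "((\<lambda>e. integral {0..pi - e} h) \<longlongrightarrow> integral {0..pi - 0} h) (at_right 0)"
      using filterlim_compose[of "\<lambda>x. integral {0..x} h" _ _ "\<lambda>e. pi - e"] by simp
  qed
  moreover have "((\<lambda>e. k (pi - e) - k e) \<longlongrightarrow> 0 - 0) (at_right 0)"
  proof (intro tendsto_diff)
    have "filterlim (\<lambda>e. pi - e) (at pi) (at_right 0)"
      unfolding filterlim_at by (auto simp: eventually_at_filter intro!: tendsto_eq_intros)
    then show "((\<lambda>e. k (pi - e)) \<longlongrightarrow> 0) (at_right 0)"
      by (rule filterlim_compose[OF kpi])
    show "(k \<longlongrightarrow> 0) (at_right 0)" using k0 by (simp add: filterlim_at_split)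
  qed
  moreover have "\<forall>\<^sub>F e in at_right 0. k (pi - e) - k e \<le> integral {0..pi - e} h - integral {0..e} h"
  proof -
    have "k (pi - e) - k e \<le> integral {0..pi - e} h - integral {0..e} h" if e: "0 < e" "e < pi / 2" for e
    proof -
      have "integral {0..e} h + integral {e..pi - e} h = integral {0..pi - e} h"
        by (rule Henstock_Kurzweil_Integration.integral_combine) (use e hint in auto)
      then show ?thesis using main[of e "pi - e"] e by simp
    qed
    then show ?thesis by (auto simp: eventually_at_right[of 0 "pi/2"] intro!: exI[of _ "pi/2"])
  qed
  ultimately have "0 - 0 \<le> integral {0..pi - 0} h - integral {0..0} h"
    by (intro tendsto_le[OF trivial_limit_at_right_real])
  then have "0 \<le> integral {0..pi} h" by simp
  also have "integral {0..pi} h = integral {0..pi} (\<lambda>t. (f' t)\<^sup>2) - integral {0..pi} (\<lambda>t. (f t)\<^sup>2)"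
    unfolding h_def
    by (intro Henstock_Kurzweil_Integration.integral_diff integrable_continuous_interval continuous_intros
        continuous_on_subset[OF contf] continuous_on_subset[OF cont]) auto
  finally show ?thesis by simp
qed

lemma integral_periodic_shift:
  fixes p :: "real \<Rightarrow> real"
  assumes cont: "continuous_on UNIV p" and per: "\<And>t. p (t + T) = p t" and c: "0 \<le> c" "c \<le> T"
  shows "integral {0..T} (\<lambda>t. p (t + c)) = integral {0..T} p"
proof -
  have i: "p integrable_on {a..b}" for a b
    by (intro integrable_continuous_interval continuous_on_subset[OF cont]) auto
  have "integral {0..T} (\<lambda>t. p (t + c)) = integral {c..T + c} p"
    using integral_shift_real_ivl[of c c "T + c" p] by simp
  also have "\<dots> = integral {c..T} p + integral {T..T + c} p"
    by (rule Henstock_Kurzweil_Integration.integral_combine[symmetric]) (use c i in auto)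
  also have "integral {T..T + c} p = integral {0..c} (\<lambda>t. p (t + T))"
    using integral_shift_real_ivl[of T T "T + c" p] by simp
  also have "\<dots> = integral {0..c} p" by (simp add: per)
  also have "integral {c..T} p + integral {0..c} p = integral {0..T} p"
    using Henstock_Kurzweil_Integration.integral_combine[of 0 c T p] c i by simp
  finally show ?thesis .
qed

lemma Wirtinger_antiperiodic:
  fixes f f' :: "real \<Rightarrow> real"
  assumes der: "\<And>t. (f has_real_derivative f' t) (at t)" and cont: "continuous_on UNIV f'"
    and anti: "\<And>t. f (t + pi) = - f t"
  shows "integral {0..pi} (\<lambda>t. (f t)\<^sup>2) \<le> integral {0..pi} (\<lambda>t. (f' t)\<^sup>2)"
proof -
  have contf: "continuous_on UNIV f"
    using der by (meson DERIV_continuous_on has_field_derivative_at_within)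
  have anti': "f' (t + pi) = - f' t" for t
  proof (rule DERIV_unique)
    show "((\<lambda>t. f (t + pi)) has_real_derivative f' (t + pi)) (at t)"
      using der[of "t + pi"] by (simp add: DERIV_shift)
    show "((\<lambda>t. f (t + pi)) has_real_derivative - f' t) (at t)"
      unfolding anti by (rule derivative_intros der)+
  qed
  have "\<exists>t0\<ge>0. t0 \<le> pi \<and> f t0 = 0"
  proof (cases "f 0 \<le> 0")
    case True
    then show ?thesis using IVT'[of f 0 0 pi] anti[of 0] continuous_on_subset[OF contf] by fastforce
  next
    case False
    then show ?thesis using IVT2'[of f pi 0 0] anti[of 0] continuous_on_subset[OF contf] by fastforce
  qed
  then obtain t0 where t0: "0 \<le> t0" "t0 \<le> pi" "f t0 = 0" by blast
  have "integral {0..pi} (\<lambda>t. (f (t + t0))\<^sup>2) \<le> integral {0..pi} (\<lambda>t. (f' (t + t0))\<^sup>2)"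
  proof (rule Wirtinger_zeros)
    show "((\<lambda>t. f (t + t0)) has_real_derivative f' (t + t0)) (at t)" for t
      using der[of "t + t0"] by (simp add: DERIV_shift)
    show "continuous_on UNIV (\<lambda>t. f' (t + t0))"
      by (rule continuous_on_compose2[OF cont]) (auto intro: continuous_intros)
  qed (use t0 anti[of t0] in \<open>auto simp: add.commute\<close>)
  also have "integral {0..pi} (\<lambda>t. (f' (t + t0))\<^sup>2) = integral {0..pi} (\<lambda>t. (f' t)\<^sup>2)"
    by (rule integral_periodic_shift[of "\<lambda>t. (f' t)\<^sup>2"])
      (use t0 anti' in \<open>auto intro!: continuous_intros cont\<close>)
  also have "integral {0..pi} (\<lambda>t. (f (t + t0))\<^sup>2) = integral {0..pi} (\<lambda>t. (f t)\<^sup>2)"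
    by (rule integral_periodic_shift[of "\<lambda>t. (f t)\<^sup>2"])
      (use t0 anti in \<open>auto intro!: continuous_intros contf\<close>)
  finally show ?thesis .
qed

lemma integral_double_periodic:
  fixes p :: "real \<Rightarrow> real"
  assumes cont: "continuous_on UNIV p" and per: "\<And>t. p (t + T) = p t" and T: "0 \<le> T"
  shows "integral {0..2 * T} p = 2 * integral {0..T} p"
proof -
  have i: "p integrable_on {a..b}" for a b
    by (intro integrable_continuous_interval continuous_on_subset[OF cont]) auto
  have "integral {0..2 * T} p = integral {0..T} p + integral {T..2 * T} p"
    by (rule Henstock_Kurzweil_Integration.integral_combine[symmetric]) (use T i in auto)
  also have "integral {T..2 * T} p = integral {0..T} (\<lambda>t. p (t + T))"
    using integral_shift_real_ivl[of T T "2 * T" p] by simp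
  finally show ?thesis by (simp add: per)
qed

lemma quarter_turn_inequality:
  fixes u u' :: "real \<Rightarrow> real"
  assumes der: "\<And>t. (u has_real_derivative u' t) (at t)" and cont: "continuous_on UNIV u'"
    and per: "\<And>t. u (t + 2 * pi) = u t"
  shows "integral {0..2 * pi} (\<lambda>t. (u (t + pi / 2) - u t)\<^sup>2) \<le> 2 * integral {0..2 * pi} (\<lambda>t. (u' t)\<^sup>2)"
proof -
  have contu: "continuous_on UNIV u"
    using der by (meson DERIV_continuous_on has_field_derivative_at_within)
  have dershift: "((\<lambda>t. u (t + c)) has_real_derivative u' (t + c)) (at t)" for c t
    using der[of "t + c"] by (simp add: DERIV_shift)
  have "(\<lambda>t. u (t + 2 * pi)) = u" using per by (rule ext)
  then have "(u has_real_derivative u' (t + 2 * pi)) (at t)" for t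
    using dershift[of "2 * pi" t] by simp
  then have per': "u' (t + 2 * pi) = u' t" for t
    using der[of t] by (rule DERIV_unique)
  define I where "I p = integral {0..2 * pi} p" for p :: "real \<Rightarrow> real"
  define C where "C p \<longleftrightarrow> continuous_on UNIV p" for p :: "real \<Rightarrow> real"
  have int: "p integrable_on {a..b}" if "C p" for p and a b
    using that unfolding C_def by (meson integrable_continuous_interval continuous_on_subset subset_UNIV)
  have Cs: "C (\<lambda>t. p (t + c))" if "C p" for p c
    using that unfolding C_def by (rule continuous_on_compose2) (auto intro: continuous_intros)
  have Ca2: "C (\<lambda>t. p t + q t)" "C (\<lambda>t. p t - q t)" "C (\<lambda>t. p t * q t)" if "C p" "C q" for p q
    using that unfolding C_def by (auto intro!: continuous_intros)
  have Ca1: "C (\<lambda>t. (p t)\<^sup>2)" "C (\<lambda>t. c * p t)" "C (\<lambda>t. p t / 2)" "C (\<lambda>t. - p t)" if "C p" for p c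
    using that unfolding C_def by (auto intro!: continuous_intros)
  note Ca = Ca1 Ca2
  have Iadd: "I (\<lambda>t. p t + q t) = I p + I q" if "C p" "C q" for p q
    unfolding I_def using that by (intro Henstock_Kurzweil_Integration.integral_add int)
  have Ic: "I (\<lambda>t. c * p t) = c * I p" for c p
    unfolding I_def by simp
  have Ile: "I p \<le> I q" if "C p" "C q" "\<And>t. p t \<le> q t" for p q
    unfolding I_def using that by (intro integral_le int) auto
  have Ishift: "I (\<lambda>t. p (t + c)) = I p" if "C p" "\<And>t. p (t + 2 * pi) = p t" "0 \<le> c" "c \<le> 2 * pi" for p c
    unfolding I_def using that by (intro integral_periodic_shift) (auto simp: C_def)
  have anti0: "I p = 0" if "C p" "\<And>t. p (t + c) = - p t" "\<And>t. p (t + 2 * pi) = p t" "0 \<le> c" "c \<le> 2 * pi" for p c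
    using Ishift[OF that(1,3-5)] that(2) Ic[of "-1" p] by simp
  define od e od' e' where "od t = (u t - u (t + pi)) / 2" and "e t = (u t + u (t + pi)) / 2"
    and "od' t = (u' t - u' (t + pi)) / 2" and "e' t = (u' t + u' (t + pi)) / 2" for t
  have Cu: "C u" "C u'" using contu cont by (auto simp: C_def)
  have Coe: "C od" "C e" "C od'" "C e'"
    unfolding od_def[abs_def] e_def[abs_def] od'_def[abs_def] e'_def[abs_def] by (auto intro!: Ca Cs Cu)
  have pp: "t + pi + pi = t + 2 * pi" for t::real by simp
  have oa: "od (t + pi) = - od t" and ea: "e (t + pi) = e t" and oa': "od' (t + pi) = - od' t" and ea': "e' (t + pi) = e' t" for t
    unfolding od_def e_def od'_def e'_def pp per per' by (simp_all add: field_simps)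
  have op: "od (t + 2 * pi) = od t" "od' (t + 2 * pi) = od' t" "e (t + 2 * pi) = e t" "e' (t + 2 * pi) = e' t" for t
    using oa[of "t + pi"] oa'[of "t + pi"] ea[of "t + pi"] ea'[of "t + pi"] oa[of t] oa'[of t] ea[of t] ea'[of t] unfolding pp by auto
  have dod: "(od has_real_derivative od' t) (at t)" and de: "(e has_real_derivative e' t) (at t)" for t
    unfolding od_def[abs_def] od'_def e_def[abs_def] e'_def by (auto intro!: derivative_eq_intros dershift der)
  have Wo: "I (\<lambda>t. (od t)\<^sup>2) \<le> I (\<lambda>t. (od' t)\<^sup>2)"
  proof -
    have "integral {0..pi} (\<lambda>t. (od t)\<^sup>2) \<le> integral {0..pi} (\<lambda>t. (od' t)\<^sup>2)"
      by (rule Wirtinger_antiperiodic[OF dod _ oa]) (use Coe in \<open>simp add: C_def\<close>)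
    then show ?thesis unfolding I_def
      using integral_double_periodic[of "\<lambda>t. (od t)\<^sup>2" pi] integral_double_periodic[of "\<lambda>t. (od' t)\<^sup>2" pi] Ca1(1)[OF Coe(1)] Ca1(1)[OF Coe(3)]
      by (simp add: oa oa' C_def)
  qed
  define g g' where "g t = e (t + pi / 2) - e t" and "g' t = e' (t + pi / 2) - e' t" for t
  have Cg: "C g" "C g'" unfolding g_def[abs_def] g'_def[abs_def] by (auto intro!: Ca Cs Coe)
  have hp: "t + pi / 2 + pi / 2 = t + pi" for t::real by simp
  have ga: "g (t + pi / 2) = - g t" "g' (t + pi / 2) = - g' t" for t
    unfolding g_def g'_def hp ea ea' by auto
  have dg: "(g has_real_derivative g' t) (at t)" for t
    unfolding g_def[abs_def] g'_def using de[of "t + pi / 2"] de[of t]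
    by (auto intro!: derivative_eq_intros simp: DERIV_shift)
  have Wg: "I (\<lambda>t. (g t)\<^sup>2) \<le> 1/4 * I (\<lambda>t. (g' t)\<^sup>2)"
  proof -
    define G G' where "G t = g (t / 2)" and "G' t = g' (t / 2) / 2" for t
    have "integral {0..pi} (\<lambda>t. (G t)\<^sup>2) \<le> integral {0..pi} (\<lambda>t. (G' t)\<^sup>2)"
    proof (rule Wirtinger_antiperiodic)
      show "(G has_real_derivative G' t) (at t)" for t
      proof -
        have "((\<lambda>t. t / 2) has_real_derivative 1 / 2) (at t)"
          by (auto intro!: derivative_eq_intros)
        from DERIV_chain2[OF dg this] show ?thesis unfolding G_def[abs_def] G'_def by simp
      qed
      show "continuous_on UNIV G'" unfolding G'_def
        using Cg by (auto simp: C_def intro!: continuous_intros intro: continuous_on_compose2)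
      show "G (t + pi) = - G t" for t unfolding G_def using ga(1)[of "t / 2"] by (simp add: add_divide_distrib)
    qed
    moreover have "integral {0..pi} (\<lambda>t. p (t / 2)) = I p / 2" if "C p" "\<And>t. p (t + pi / 2) = p t" for p
    proof -
      have "((\<lambda>t. p (t / 2)) has_integral 2 * integral {0..pi/2} p) {0..pi}"
        using has_integral_affinity'[of p "integral {0..pi/2} p" 0 "pi/2" "1/2" 0] int[OF that(1)]
        by (simp add: integrable_integral)
      moreover have "I p = 4 * integral {0..pi/2} p"
        using integral_double_periodic[of p "pi/2"] integral_double_periodic[of p "pi"] that(1) that(2) that(2)[of "t + pi/2" for t]
        unfolding hp I_def C_def by simp
      ultimately show ?thesis by (simp add: integral_unique)
    qed
    from this[of "\<lambda>t. (g t)\<^sup>2"] this[of "\<lambda>t. (g' t / 2)\<^sup>2"]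
    have "integral {0..pi} (\<lambda>t. (G t)\<^sup>2) = I (\<lambda>t. (g t)\<^sup>2) / 2" "integral {0..pi} (\<lambda>t. (G' t)\<^sup>2) = I (\<lambda>t. (g' t / 2)\<^sup>2) / 2"
      unfolding G_def G'_def using Ca1(1)[OF Cg(1)] Ca1(1)[OF Ca1(3)[OF Cg(2)]] by (simp_all add: ga)
    moreover have "I (\<lambda>t. (g' t / 2)\<^sup>2) = 1/4 * I (\<lambda>t. (g' t)\<^sup>2)"
      using Ic[of "1/4" "\<lambda>t. (g' t)\<^sup>2"] by (simp add: power_divide)
    ultimately show ?thesis by simp
  qed
  have Ig': "I (\<lambda>t. (g' t)\<^sup>2) \<le> 4 * I (\<lambda>t. (e' t)\<^sup>2)"
  proof -
    have "I (\<lambda>t. (g' t)\<^sup>2) \<le> I (\<lambda>t. 2 * (e' (t + pi/2))\<^sup>2 + 2 * (e' t)\<^sup>2)"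
    proof (rule Ile)
      show "(g' t)\<^sup>2 \<le> 2 * (e' (t + pi/2))\<^sup>2 + 2 * (e' t)\<^sup>2" for t
        unfolding g'_def using zero_le_power2[of "e' (t + pi/2) + e' t"] by (simp add: power2_eq_square algebra_simps)
    qed (use Cs[OF Coe(4), of "pi/2"] in \<open>auto intro!: Ca Coe Cg\<close>)
    also have "\<dots> = 2 * I (\<lambda>t. (e' (t + pi/2))\<^sup>2) + 2 * I (\<lambda>t. (e' t)\<^sup>2)"
      by (subst Iadd) (auto simp: Ic intro!: Ca Cs[of e'] Coe)
    also have "I (\<lambda>t. (e' (t + pi/2))\<^sup>2) = I (\<lambda>t. (e' t)\<^sup>2)"
      by (rule Ishift[of "\<lambda>t. (e' t)\<^sup>2"]) (auto intro!: Ca Coe simp: op)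
    finally show ?thesis by simp
  qed
  define k where "k t = od (t + pi / 2) - od t" for t
  have Ck: "C k" unfolding k_def[abs_def] by (auto intro!: Ca Cs Coe)
  have Ik: "I (\<lambda>t. (k t)\<^sup>2) = 2 * I (\<lambda>t. (od t)\<^sup>2)"
  proof -
    have "(\<lambda>t. (k t)\<^sup>2) = (\<lambda>t. ((od (t + pi/2))\<^sup>2 + (od t)\<^sup>2) + (-2) * (od (t + pi/2) * od t))"
      unfolding k_def by (auto simp: power2_eq_square algebra_simps)
    then have "I (\<lambda>t. (k t)\<^sup>2) = I (\<lambda>t. (od (t + pi/2))\<^sup>2) + I (\<lambda>t. (od t)\<^sup>2) + (-2) * I (\<lambda>t. od (t + pi/2) * od t)"
      using Cs[OF Coe(1), of "pi/2"] Coe(1) by (simp only:) (subst Iadd; (subst Iadd)?; (subst Ic)?; auto intro!: Ca)+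
    moreover have "I (\<lambda>t. (od (t + pi/2))\<^sup>2) = I (\<lambda>t. (od t)\<^sup>2)"
      by (rule Ishift[of "\<lambda>t. (od t)\<^sup>2"]) (auto intro!: Ca Coe simp: op)
    moreover have "I (\<lambda>t. od (t + pi/2) * od t) = 0"
    proof (rule anti0[of _ "pi/2"])
      have "t + 2 * pi + pi/2 = (t + pi/2) + 2 * pi" for t::real by simp
      then show "od (t + 2 * pi + pi / 2) * od (t + 2 * pi) = od (t + pi / 2) * od t" for t
        by (simp only: op)
      show "od (t + pi / 2 + pi / 2) * od (t + pi / 2) = - (od (t + pi / 2) * od t)" for t
        unfolding hp oa by simp
    qed (auto intro!: Ca Cs Coe)
    ultimately show ?thesis by simp
  qed
  have cross: "I (\<lambda>t. k t * g t) = 0"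
  proof (rule anti0[of _ pi])
    have "t + pi + pi/2 = (t + pi/2) + pi" "t + 2 * pi + pi/2 = (t + pi/2) + 2 * pi" for t::real by auto
    then show "k (t + pi) * g (t + pi) = - (k t * g t)" "k (t + 2 * pi) * g (t + 2 * pi) = k t * g t" for t
      unfolding k_def g_def by (simp_all only: oa ea op) (simp_all add: algebra_simps)
  qed (auto intro!: Ca Ck Cg)
  have "I (\<lambda>t. (u (t + pi/2) - u t)\<^sup>2) = I (\<lambda>t. ((k t)\<^sup>2 + (g t)\<^sup>2) + 2 * (k t * g t))"
  proof -
    have "u t = od t + e t" for t unfolding od_def e_def by (simp add: field_simps)
    then show ?thesis unfolding k_def g_def by (simp add: power2_eq_square algebra_simps)
  qed
  also have "\<dots> = I (\<lambda>t. (k t)\<^sup>2) + I (\<lambda>t. (g t)\<^sup>2) + 2 * I (\<lambda>t. k t * g t)"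
    by (subst Iadd; (subst Iadd)?; (subst Ic)?; auto intro!: Ca Ck Cg)
  also have "\<dots> \<le> 2 * I (\<lambda>t. (od' t)\<^sup>2) + 2 * I (\<lambda>t. (e' t)\<^sup>2)"
  proof -
    have "0 \<le> I (\<lambda>t. (e' t)\<^sup>2)" unfolding I_def by (rule integral_nonneg) (auto intro!: int Ca Coe)
    then show ?thesis using cross Ik Wo Wg Ig' by simp
  qed
  also have "\<dots> = 2 * I (\<lambda>t. (u' t)\<^sup>2)"
  proof -
    have "u' t = od' t + e' t" for t unfolding od'_def e'_def by (simp add: field_simps)
    then have "I (\<lambda>t. (u' t)\<^sup>2) = I (\<lambda>t. ((od' t)\<^sup>2 + (e' t)\<^sup>2) + 2 * (od' t * e' t))"
      by (simp add: power2_eq_square algebra_simps)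
    also have "\<dots> = I (\<lambda>t. (od' t)\<^sup>2) + I (\<lambda>t. (e' t)\<^sup>2) + 2 * I (\<lambda>t. od' t * e' t)"
      by (subst Iadd; (subst Iadd)?; (subst Ic)?; auto intro!: Ca Coe)
    also have "I (\<lambda>t. od' t * e' t) = 0"
      by (rule anti0[of _ pi]) (auto intro!: Ca Coe simp: oa' ea' op)
    finally show ?thesis by simp
  qed
  finally show ?thesis unfolding I_def .
qed

section \<open>Gaussian measures\<close>

definition gauss_density :: "'a::euclidean_space \<Rightarrow> real" where
  "gauss_density x = (\<Prod>b\<in>Basis. std_normal_density (x \<bullet> b))"

definition gauss :: "'a::euclidean_space measure" where
  "gauss = density lborel gauss_density"

lemma gauss_density_eq:
  "gauss_density (x::'a::euclidean_space) = (1 / sqrt (2 * pi)) ^ DIM('a) * exp (- (norm x)\<^sup>2 / 2)"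
proof -
  have "gauss_density x = (1 / sqrt (2 * pi)) ^ DIM('a) * exp (\<Sum>b\<in>Basis. - (x \<bullet> b)\<^sup>2 / 2)"
    by (simp add: gauss_density_def std_normal_density_def prod_dividef exp_sum power_divide)
  also have "(\<Sum>b\<in>Basis. - (x \<bullet> b)\<^sup>2 / 2) = - (norm x)\<^sup>2 / 2"
    unfolding power2_norm_eq_inner euclidean_inner[of x x]
    by (simp add: sum_negf sum_divide_distrib[symmetric] power2_eq_square)
  finally show ?thesis .
qed

lemma gauss_density_pos [simp]: "0 < gauss_density x"
  by (simp add: gauss_density_eq)

lemma gauss_density_nonneg [simp]: "0 \<le> gauss_density x"
  using gauss_density_pos[of x] by linarith

lemma gauss_density_measurable [measurable]: "gauss_density \<in> borel_measurable borel"
  unfolding gauss_density_def[abs_def] by measurable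

lemma sets_gauss [simp, measurable_cong]: "sets gauss = sets borel"
  by (simp add: gauss_def)

lemma space_gauss [simp]: "space gauss = UNIV"
  by (simp add: gauss_def)

lemma nn_integral_gauss:
  "f \<in> borel_measurable borel \<Longrightarrow> (\<integral>\<^sup>+x. f x \<partial>gauss) = (\<integral>\<^sup>+x. ennreal (gauss_density x) * f x \<partial>lborel)"
  unfolding gauss_def by (subst nn_integral_density) auto

lemma nn_integral_std_normal:
  "(\<integral>\<^sup>+x. ennreal (std_normal_density x) \<partial>lborel) = 1"
  "(\<integral>\<^sup>+x. ennreal (std_normal_density x * x\<^sup>2) \<partial>lborel) = 1"
  using std_normal_moment_even[of 0] std_normal_moment_even[of 1]
  by (auto dest!: has_bochner_integral_integral_eq[THEN sym] has_bochner_integral_integrable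
      simp: has_bochner_integral_iff nn_integral_eq_integral)

lemma gauss_moment2_basis:
  assumes "i \<in> Basis"
  shows "(\<integral>\<^sup>+x. ennreal ((x \<bullet> i)\<^sup>2) \<partial>gauss) = (1::ennreal)"
proof -
  have "(\<integral>\<^sup>+x. ennreal ((x \<bullet> i)\<^sup>2) \<partial>gauss)
      = (\<integral>\<^sup>+x. (\<Prod>b\<in>Basis. ennreal (std_normal_density (x \<bullet> b) * (if b = i then (x \<bullet> b)\<^sup>2 else 1))) \<partial>lborel)"
    using assms by (subst nn_integral_gauss) (auto intro!: nn_integral_cong
      simp: gauss_density_def prod_ennreal prod.distrib ennreal_mult[symmetric] prod_nonneg prod.delta)
  also have "\<dots> = (\<Prod>b\<in>Basis. \<integral>\<^sup>+s. ennreal (std_normal_density s * (if b = i then s\<^sup>2 else 1)) \<partial>lborel)"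
    by (subst nn_integral_lborel_prod[of "\<lambda>b s. ennreal (std_normal_density s * (if b = i then s\<^sup>2 else 1))"]) auto
  also have "\<dots> = 1"
  proof (rule prod.neutral, rule ballI)
    fix b :: 'a
    show "(\<integral>\<^sup>+s. ennreal (std_normal_density s * (if b = i then s\<^sup>2 else 1)) \<partial>lborel) = 1"
      by (cases "b = i") (simp_all add: nn_integral_std_normal)
  qed
  finally show ?thesis .
qed

lemma emeasure_gauss_UNIV: "emeasure gauss (UNIV :: 'a::euclidean_space set) = 1"
proof -
  have "emeasure gauss (UNIV :: 'a set) = (\<integral>\<^sup>+x. (\<Prod>b\<in>Basis. ennreal (std_normal_density ((x::'a) \<bullet> b))) \<partial>lborel)"
    by (simp add: gauss_def emeasure_density gauss_density_def prod_ennreal)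
  also have "\<dots> = (\<Prod>b\<in>(Basis :: 'a set). \<integral>\<^sup>+s. ennreal (std_normal_density s) \<partial>lborel)"
    by (subst nn_integral_lborel_prod[of "\<lambda>b s. ennreal (std_normal_density s)"]) auto
  finally show ?thesis by (simp add: nn_integral_std_normal)
qed

lemma prob_space_gauss: "prob_space gauss"
  by (rule prob_spaceI) (simp add: emeasure_gauss_UNIV)

lemma gauss_reflect:
  fixes f :: "'a::euclidean_space \<Rightarrow> ennreal"
  assumes [measurable]: "f \<in> borel_measurable borel" and i: "i \<in> Basis"
  shows "(\<integral>\<^sup>+x. f (x - (2 * (x \<bullet> i)) *\<^sub>R i) \<partial>gauss) = (\<integral>\<^sup>+x. f x \<partial>gauss)"
proof -
  define T where "T x = (\<Sum>j\<in>Basis. ((if j = i then -1 else 1) * (x \<bullet> j)) *\<^sub>R j)" for x :: 'a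
  have T: "T x = x - (2 * (x \<bullet> i)) *\<^sub>R i" for x
  proof (rule euclidean_eqI)
    fix j :: 'a assume "j \<in> Basis"
    then show "T x \<bullet> j = (x - (2 * (x \<bullet> i)) *\<^sub>R i) \<bullet> j"
      using i by (simp add: T_def inner_sum_left_Basis inner_diff_left inner_Basis)
  qed
  have T_meas[measurable]: "T \<in> borel_measurable borel" unfolding T_def[abs_def] by measurable
  define cc :: "'a \<Rightarrow> real" where "cc j = (if j = i then -1 else 1)" for j
  have "cc j \<noteq> 0" "\<bar>cc j\<bar> = 1" for j by (auto simp: cc_def)
  then have L: "distr lborel borel T = lborel"
    using lborel_affine_euclidean[of cc 0] by (simp add: T_def[abs_def] cc_def[symmetric] density_1)
  have n: "norm (T x) = norm x" for x
    unfolding norm_eq_sqrt_inner T using i by (simp add: inner_simps inner_commute)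
  have "(\<integral>\<^sup>+x. f x \<partial>gauss) = (\<integral>\<^sup>+x. ennreal (gauss_density x) * f x \<partial>distr lborel borel T)"
    by (simp add: nn_integral_gauss L)
  also have "\<dots> = (\<integral>\<^sup>+x. ennreal (gauss_density (T x)) * f (T x) \<partial>lborel)"
    by (subst nn_integral_distr) auto
  also have "\<dots> = (\<integral>\<^sup>+x. f (T x) \<partial>gauss)"
    by (subst nn_integral_gauss) (auto simp: gauss_density_eq n)
  finally show ?thesis by (simp add: T)
qed

lemma gauss_moment2:
  fixes v :: "'a::euclidean_space"
  shows "(\<integral>\<^sup>+x. ennreal ((v \<bullet> x)\<^sup>2) \<partial>gauss) = ennreal ((norm v)\<^sup>2)"
proof -
  have "(\<integral>\<^sup>+x. ennreal (((\<Sum>i\<in>A. (v \<bullet> i) *\<^sub>R i) \<bullet> x)\<^sup>2) \<partial>gauss) = ennreal (\<Sum>i\<in>A. (v \<bullet> i)\<^sup>2)"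
    if "finite A" "A \<subseteq> Basis" for A
    using that
  proof (induction A rule: finite_induct)
    case (insert k A)
    define z where "z = (\<Sum>i\<in>A. (v \<bullet> i) *\<^sub>R i)"
    have k: "k \<in> Basis" using insert by auto
    have zk: "z \<bullet> k = 0" unfolding z_def using insert.hyps insert.prems
      by (auto simp: inner_sum_left inner_Basis intro!: sum.neutral)
    define q where "q x = ((v \<bullet> k) * (k \<bullet> x) + z \<bullet> x)\<^sup>2" for x
    define R where "R x = x - (2 * (x \<bullet> k)) *\<^sub>R k" for x
    have [measurable]: "q \<in> borel_measurable borel" unfolding q_def[abs_def] by measurable
    have [measurable]: "R \<in> borel_measurable borel" unfolding R_def[abs_def] by measurable
    have qR: "q x + q (R x) = 2 * ((v \<bullet> k)\<^sup>2 * (x \<bullet> k)\<^sup>2 + (z \<bullet> x)\<^sup>2)" for x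
      unfolding q_def R_def using k zk
      by (simp add: inner_simps inner_commute power2_eq_square algebra_simps)
    have q0: "0 \<le> q x" for x by (simp add: q_def)
    have "(\<integral>\<^sup>+x. ennreal (q (R x)) \<partial>gauss) = (\<integral>\<^sup>+x. ennreal (q x) \<partial>gauss)"
      unfolding R_def by (rule gauss_reflect[OF _ k]) measurable
    then have "2 * (\<integral>\<^sup>+x. ennreal (q x) \<partial>gauss) = (\<integral>\<^sup>+x. ennreal (q x) \<partial>gauss) + (\<integral>\<^sup>+x. ennreal (q (R x)) \<partial>gauss)"
      by (simp only: mult_2)
    also have "\<dots> = (\<integral>\<^sup>+x. ennreal (q x) + ennreal (q (R x)) \<partial>gauss)"
      by (rule nn_integral_add[symmetric]) measurable
    also have "\<dots> = (\<integral>\<^sup>+x. 2 * (ennreal ((v \<bullet> k)\<^sup>2) * ennreal ((x \<bullet> k)\<^sup>2) + ennreal ((z \<bullet> x)\<^sup>2)) \<partial>gauss)"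
    proof (rule nn_integral_cong)
      fix x
      have "ennreal (q x) + ennreal (q (R x)) = ennreal (2 * ((v \<bullet> k)\<^sup>2 * (x \<bullet> k)\<^sup>2 + (z \<bullet> x)\<^sup>2))"
        unfolding qR[symmetric] by (rule ennreal_plus[symmetric]) (rule q0)+
      also have "\<dots> = 2 * (ennreal ((v \<bullet> k)\<^sup>2) * ennreal ((x \<bullet> k)\<^sup>2) + ennreal ((z \<bullet> x)\<^sup>2))"
        by (simp add: ennreal_mult)
      finally show "ennreal (q x) + ennreal (q (R x)) = \<dots>" .
    qed
    also have "\<dots> = 2 * (ennreal ((v \<bullet> k)\<^sup>2) * (\<integral>\<^sup>+x. ennreal ((x \<bullet> k)\<^sup>2) \<partial>gauss) + (\<integral>\<^sup>+x. ennreal ((z \<bullet> x)\<^sup>2) \<partial>gauss))"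
      by (simp add: nn_integral_cmult nn_integral_add)
    also have "\<dots> = 2 * ennreal ((v \<bullet> k)\<^sup>2 + (\<Sum>i\<in>A. (v \<bullet> i)\<^sup>2))"
      using insert gauss_moment2_basis[OF k] by (simp add: z_def sum_nonneg)
    finally have "(\<integral>\<^sup>+x. q x \<partial>gauss) = ennreal ((v \<bullet> k)\<^sup>2 + (\<Sum>i\<in>A. (v \<bullet> i)\<^sup>2))"
      by (subst (asm) ennreal_mult_cancel_left) auto
    moreover have "(\<Sum>i\<in>insert k A. (v \<bullet> i) *\<^sub>R i) \<bullet> x = (v \<bullet> k) * (k \<bullet> x) + z \<bullet> x" for x
      using insert.hyps unfolding z_def by (simp add: inner_add_left)
    ultimately show ?case using insert.hyps unfolding q_def by simp
  qed simp
  from this[of Basis] show ?thesis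
    unfolding power2_norm_eq_inner euclidean_inner[of v v]
    by (simp add: euclidean_representation power2_eq_square)
qed

lemma nn_integral_shear:
  fixes F :: "'a::euclidean_space \<times> 'a \<Rightarrow> ennreal"
  assumes [measurable]: "F \<in> borel_measurable borel"
  shows "(\<integral>\<^sup>+z. F (fst z + a *\<^sub>R snd z, snd z) \<partial>lborel) = (\<integral>\<^sup>+z. F z \<partial>lborel)"
    and "(\<integral>\<^sup>+z. F (fst z, snd z + a *\<^sub>R fst z) \<partial>lborel) = (\<integral>\<^sup>+z. F z \<partial>lborel)"
proof -
  have [measurable]: "F \<in> borel_measurable (borel \<Otimes>\<^sub>M borel)" by (simp add: borel_prod)
  have tr: "(\<integral>\<^sup>+x. f (x + c) \<partial>lborel) = (\<integral>\<^sup>+x. f x \<partial>lborel)" if [measurable]: "f \<in> borel_measurable borel" for f :: "'a \<Rightarrow> ennreal" and c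
  proof -
    have "(\<integral>\<^sup>+x. f x \<partial>lborel) = (\<integral>\<^sup>+x. f x \<partial>distr lborel borel ((+) c))"
      by (simp add: lborel_distr_plus)
    also have "\<dots> = (\<integral>\<^sup>+x. f (x + c) \<partial>lborel)" by (subst nn_integral_distr) (auto simp: add.commute)
    finally show ?thesis by simp
  qed
  have "(\<integral>\<^sup>+z. F (fst z + a *\<^sub>R snd z, snd z) \<partial>lborel) = (\<integral>\<^sup>+y. \<integral>\<^sup>+x. F (x + a *\<^sub>R y, y) \<partial>lborel \<partial>lborel)"
    unfolding lborel_prod[symmetric] by (subst lborel_pair.nn_integral_snd[symmetric]) (auto simp: split_beta')
  also have "\<dots> = (\<integral>\<^sup>+y. \<integral>\<^sup>+x. F (x, y) \<partial>lborel \<partial>lborel)"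
    by (intro nn_integral_cong tr) auto
  also have "\<dots> = (\<integral>\<^sup>+z. F z \<partial>lborel)"
    unfolding lborel_prod[symmetric] by (subst lborel_pair.nn_integral_snd[symmetric]) (auto simp: split_beta')
  finally show "(\<integral>\<^sup>+z. F (fst z + a *\<^sub>R snd z, snd z) \<partial>lborel) = (\<integral>\<^sup>+z. F z \<partial>lborel)" .
  have "(\<integral>\<^sup>+z. F (fst z, snd z + a *\<^sub>R fst z) \<partial>lborel) = (\<integral>\<^sup>+x. \<integral>\<^sup>+y. F (x, y + a *\<^sub>R x) \<partial>lborel \<partial>lborel)"
    unfolding lborel_prod[symmetric] by (subst lborel.nn_integral_fst[symmetric]) (auto simp: split_beta')
  also have "\<dots> = (\<integral>\<^sup>+x. \<integral>\<^sup>+y. F (x, y) \<partial>lborel \<partial>lborel)"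
    by (intro nn_integral_cong tr) auto
  also have "\<dots> = (\<integral>\<^sup>+z. F z \<partial>lborel)"
    unfolding lborel_prod[symmetric] by (subst lborel.nn_integral_fst[symmetric]) (auto simp: split_beta')
  finally show "(\<integral>\<^sup>+z. F (fst z, snd z + a *\<^sub>R fst z) \<partial>lborel) = (\<integral>\<^sup>+z. F z \<partial>lborel)" .
qed

text \<open>
  A rotation is a product of three shears, away from the half turns.
\<close>

lemma nn_integral_pair_rotation:
  fixes F :: "'a::euclidean_space \<times> 'a \<Rightarrow> ennreal"
  assumes F: "F \<in> borel_measurable borel" and cs: "c\<^sup>2 + s\<^sup>2 = 1"
  shows "(\<integral>\<^sup>+z. F (c *\<^sub>R fst z + s *\<^sub>R snd z, c *\<^sub>R snd z - s *\<^sub>R fst z) \<partial>lborel) = (\<integral>\<^sup>+z. F z \<partial>lborel)"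
proof -
  have main: "(\<integral>\<^sup>+z. F (c *\<^sub>R fst z + s *\<^sub>R snd z, c *\<^sub>R snd z - s *\<^sub>R fst z) \<partial>lborel) = (\<integral>\<^sup>+z. F z \<partial>lborel)"
    if s: "s \<noteq> 0" and cs: "c\<^sup>2 + s\<^sup>2 = 1" and F[measurable]: "F \<in> borel_measurable borel" for c s and F :: "'a \<times> 'a \<Rightarrow> ennreal"
  proof -
    define a where "a = (1 - c) / s"
    have e1: "1 - a * s = c" using s by (simp add: a_def)
    have "a * (1 + c) = s" using s cs by (simp add: a_def field_simps power2_eq_square)
    then have e2: "a + a * c = s" by (simp add: algebra_simps)
    define F1 where "F1 z = F (fst z + a *\<^sub>R snd z, snd z)" for z
    define F2 where "F2 z = F1 (fst z, snd z + (- s) *\<^sub>R fst z)" for z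
    have F1[measurable]: "F1 \<in> borel_measurable borel" unfolding F1_def[abs_def]
      by (rule measurable_compose[OF borel_measurable_continuous_onI F]) (intro continuous_intros)
    have F2: "F2 \<in> borel_measurable borel" unfolding F2_def[abs_def]
      by (rule measurable_compose[OF borel_measurable_continuous_onI F1]) (intro continuous_intros)
    have "F (c *\<^sub>R fst z + s *\<^sub>R snd z, c *\<^sub>R snd z - s *\<^sub>R fst z) = F2 (fst z + a *\<^sub>R snd z, snd z)" for z
    proof -
      obtain x y where z: "z = (x, y)" by (cases z)
      have "(x + a *\<^sub>R y) + a *\<^sub>R (y - s *\<^sub>R (x + a *\<^sub>R y)) = (1 - a * s) *\<^sub>R x + (a *\<^sub>R y + (a * (1 - a * s)) *\<^sub>R y)"
        by (simp add: scaleR_add_right scaleR_diff_right scaleR_diff_left algebra_simps)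
      also have "\<dots> = c *\<^sub>R x + s *\<^sub>R y" unfolding scaleR_left_distrib[symmetric] e1 e2 ..
      finally have "(x + a *\<^sub>R y) + a *\<^sub>R (y - s *\<^sub>R (x + a *\<^sub>R y)) = c *\<^sub>R x + s *\<^sub>R y" .
      moreover have "y - s *\<^sub>R (x + a *\<^sub>R y) = (1 - a * s) *\<^sub>R y - s *\<^sub>R x"
        by (simp add: algebra_simps)
      ultimately show ?thesis unfolding F2_def F1_def z fst_conv snd_conv e1 by simp
    qed
    then have "(\<integral>\<^sup>+z. F (c *\<^sub>R fst z + s *\<^sub>R snd z, c *\<^sub>R snd z - s *\<^sub>R fst z) \<partial>lborel) = (\<integral>\<^sup>+z. F2 z \<partial>lborel)"
      by (simp only: nn_integral_shear(1)[OF F2])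
    also have "\<dots> = (\<integral>\<^sup>+z. F1 z \<partial>lborel)"
      unfolding F2_def by (rule nn_integral_shear(2)[OF F1])
    also have "\<dots> = (\<integral>\<^sup>+z. F z \<partial>lborel)"
      unfolding F1_def by (rule nn_integral_shear(1)[OF F])
    finally show ?thesis .
  qed
  show ?thesis
  proof (cases "s = 0")
    case False
    then show ?thesis using main cs F by blast
  next
    case True
    then have "c = 1 \<or> c = -1" using cs by (simp add: power2_eq_1_iff)
    then show ?thesis
    proof
      assume "c = -1"
      have [measurable]: "F \<in> borel_measurable borel" by (rule F)
      have "(\<integral>\<^sup>+z. F z \<partial>lborel) = (\<integral>\<^sup>+z. F (snd z, - fst z) \<partial>lborel)"
        using main[of 1 0 F] by simp
      also have "\<dots> = (\<integral>\<^sup>+z. F (- fst z, - snd z) \<partial>lborel)"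
      proof -
        have "(\<lambda>z. F (snd z, - fst z)) \<in> borel_measurable borel"
          by (rule measurable_compose[OF borel_measurable_continuous_onI F]) (intro continuous_intros)
        then show ?thesis using main[of 1 0 "\<lambda>z. F (snd z, - fst z)"] by simp
      qed
      finally show ?thesis using True \<open>c = -1\<close> by simp
    qed (use True in simp)
  qed
qed

lemma nn_integral_gauss_pair:
  fixes \<Phi> :: "'a::euclidean_space \<times> 'a \<Rightarrow> ennreal"
  assumes M: "\<Phi> \<in> borel_measurable borel"
  shows "(\<integral>\<^sup>+x. \<integral>\<^sup>+y. \<Phi> (x, y) \<partial>gauss \<partial>gauss)
    = (\<integral>\<^sup>+z. ennreal (gauss_density (fst z) * gauss_density (snd z)) * \<Phi> z \<partial>lborel)"
proof -
  have [measurable]: "\<Phi> \<in> borel_measurable (borel \<Otimes>\<^sub>M borel)" using M by (simp add: borel_prod)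
  interpret prob_space "gauss :: 'a measure" by (rule prob_space_gauss)
  have "(\<lambda>x. \<integral>\<^sup>+y. \<Phi> (x, y) \<partial>gauss) \<in> borel_measurable borel"
    by measurable
  then have "(\<integral>\<^sup>+x. \<integral>\<^sup>+y. \<Phi> (x, y) \<partial>gauss \<partial>gauss)
     = (\<integral>\<^sup>+x. ennreal (gauss_density x) * (\<integral>\<^sup>+y. ennreal (gauss_density y) * \<Phi> (x, y) \<partial>lborel) \<partial>lborel)"
    by (subst nn_integral_gauss) (auto intro!: nn_integral_cong simp: nn_integral_gauss)
  also have "\<dots> = (\<integral>\<^sup>+x. (\<integral>\<^sup>+y. ennreal (gauss_density x * gauss_density y) * \<Phi> (x, y) \<partial>lborel) \<partial>lborel)"
    by (intro nn_integral_cong) (simp add: nn_integral_cmult[symmetric] ennreal_mult mult.assoc)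
  also have "\<dots> = (\<integral>\<^sup>+z. ennreal (gauss_density (fst z) * gauss_density (snd z)) * \<Phi> z \<partial>(lborel \<Otimes>\<^sub>M lborel))"
    by (subst lborel.nn_integral_fst[symmetric]) (auto simp: split_beta')
  finally show ?thesis by (simp add: lborel_prod)
qed

lemma nn_integral_gauss_rotation:
  fixes \<Phi> :: "'a::euclidean_space \<times> 'a \<Rightarrow> ennreal"
  assumes M: "\<Phi> \<in> borel_measurable borel" and cs: "c\<^sup>2 + s\<^sup>2 = 1"
  shows "(\<integral>\<^sup>+z. ennreal (gauss_density (fst z) * gauss_density (snd z)) * \<Phi> (c *\<^sub>R fst z + s *\<^sub>R snd z, c *\<^sub>R snd z - s *\<^sub>R fst z) \<partial>lborel)
    = (\<integral>\<^sup>+z. ennreal (gauss_density (fst z) * gauss_density (snd z)) * \<Phi> z \<partial>lborel)"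
proof -
  define F where "F z = ennreal (gauss_density (fst z) * gauss_density (snd z)) * \<Phi> z" for z :: "'a \<times> 'a"
  have [measurable]: "\<Phi> \<in> borel_measurable (borel \<Otimes>\<^sub>M borel)" using M by (simp add: borel_prod)
  have F: "F \<in> borel_measurable borel" unfolding F_def[abs_def] borel_prod[symmetric] by measurable
  have n: "(norm (c *\<^sub>R x + s *\<^sub>R y))\<^sup>2 + (norm (c *\<^sub>R y - s *\<^sub>R x))\<^sup>2 = (norm x)\<^sup>2 + (norm y)\<^sup>2" for x y :: 'a
  proof -
    have "(norm (c *\<^sub>R x + s *\<^sub>R y))\<^sup>2 + (norm (c *\<^sub>R y - s *\<^sub>R x))\<^sup>2 = (c\<^sup>2 + s\<^sup>2) * (x \<bullet> x) + (c\<^sup>2 + s\<^sup>2) * (y \<bullet> y)"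
      unfolding power2_norm_eq_inner by (simp add: inner_simps inner_commute power2_eq_square algebra_simps)
    then show ?thesis by (simp add: cs power2_norm_eq_inner)
  qed
  have "gauss_density (c *\<^sub>R x + s *\<^sub>R y) * gauss_density (c *\<^sub>R y - s *\<^sub>R x) = gauss_density x * gauss_density y" for x y :: 'a
  proof -
    have g: "gauss_density a * gauss_density b = ((1 / sqrt (2 * pi)) ^ DIM('a))\<^sup>2 * exp (- ((norm a)\<^sup>2 + (norm b)\<^sup>2) / 2)" for a b :: 'a
      by (simp add: gauss_density_eq power2_eq_square exp_add[symmetric] add_divide_distrib diff_divide_distrib)
    show ?thesis unfolding g n ..
  qed
  then show ?thesis using nn_integral_pair_rotation[OF F cs] by (simp add: F_def)
qed

text \<open>
  Needed because a homogeneous function of degree one is not differentiable at the origin: almost all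
  circles \<open>cos t x + sin t y\<close> avoid it.
\<close>

lemma AE_lborel_independent:
  assumes "2 \<le> DIM('a::euclidean_space)"
  shows "AE z in (lborel :: ('a \<times> 'a) measure). \<forall>c s. c\<^sup>2 + s\<^sup>2 = 1 \<longrightarrow> c *\<^sub>R fst z + s *\<^sub>R snd z \<noteq> 0"
proof -
  have "AE z in (lborel :: ('a \<times> 'a) measure). (fst z \<bullet> snd z)\<^sup>2 \<noteq> (fst z \<bullet> fst z) * (snd z \<bullet> snd z)"
  proof -
    have "AE x in (lborel :: 'a measure). AE y in lborel. (x \<bullet> y)\<^sup>2 \<noteq> (x \<bullet> x) * (y \<bullet> y)"
    proof -
      have *: "AE y in lborel. (x \<bullet> y)\<^sup>2 \<noteq> (x \<bullet> x) * (y \<bullet> y)" if x: "x \<noteq> 0" for x :: 'a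
      proof -
        have "dim (span {x}) < DIM('a)" using x assms dim_le_card'[of "{x}"] by simp
        then have "negligible (span {x})" by (simp add: negligible_lowdim)
        then have "AE y in lborel. y \<notin> span {x}"
          by (simp add: negligible_iff_null_sets AE_iff_null_sets)
            (metis (no_types, lifting) AE_not_in AE_completion_iff negligible_iff_null_sets)
        then show ?thesis
        proof (rule AE_mp, intro AE_I2 impI notI)
          fix y assume y: "y \<notin> span {x}" and eq: "(x \<bullet> y)\<^sup>2 = (x \<bullet> x) * (y \<bullet> y)"
          define w where "w = (x \<bullet> x) *\<^sub>R y - (x \<bullet> y) *\<^sub>R x"
          have "w \<bullet> w = (x \<bullet> x) * ((x \<bullet> x) * (y \<bullet> y) - (x \<bullet> y)\<^sup>2)"
            unfolding w_def by (simp add: inner_simps inner_commute power2_eq_square algebra_simps)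
          then have "w = 0" using eq by simp
          then have "y = ((x \<bullet> y) / (x \<bullet> x)) *\<^sub>R x" using x by (simp add: w_def vector_fraction_eq_iff eq_vector_fraction_iff)
          then show False using y by (metis span_base span_scale singletonI)
        qed
      qed
      have "AE x in (lborel :: 'a measure). x \<noteq> 0"
        by (rule AE_lborel_singleton)
      then show ?thesis by eventually_elim (rule *)
    qed
    moreover have "open {z :: 'a \<times> 'a. (fst z \<bullet> snd z)\<^sup>2 \<noteq> (fst z \<bullet> fst z) * (snd z \<bullet> snd z)}"
      by (intro open_Collect_neq continuous_intros)
    then have "{z \<in> space (lborel \<Otimes>\<^sub>M lborel). (fst z \<bullet> snd z)\<^sup>2 \<noteq> (fst z \<bullet> fst z) * (snd z \<bullet> (snd z :: 'a))} \<in> sets (lborel \<Otimes>\<^sub>M lborel)"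
      unfolding lborel_prod by (simp add: borel_open)
    ultimately show ?thesis
      unfolding lborel_prod[symmetric] 
      using lborel_pair.AE_pair_iff[of "\<lambda>x y. (x \<bullet> y)\<^sup>2 \<noteq> (x \<bullet> x) * (y \<bullet> (y::'a))"] by blast
  qed
  then show ?thesis
  proof (rule AE_mp, intro AE_I2 impI allI notI)
    fix z :: "'a \<times> 'a" and c s :: real
    assume ne: "(fst z \<bullet> snd z)\<^sup>2 \<noteq> (fst z \<bullet> fst z) * (snd z \<bullet> snd z)" and cs: "c\<^sup>2 + s\<^sup>2 = 1"
      and z: "c *\<^sub>R fst z + s *\<^sub>R snd z = 0"
    have "c * (fst z \<bullet> fst z) + s * (fst z \<bullet> snd z) = 0" "c * (fst z \<bullet> snd z) + s * (snd z \<bullet> snd z) = 0"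
      using arg_cong[OF z, of "\<lambda>w. fst z \<bullet> w"] arg_cong[OF z, of "\<lambda>w. w \<bullet> snd z"] by (simp_all add: inner_simps)
    then have "(c\<^sup>2 + s\<^sup>2) * ((fst z \<bullet> snd z)\<^sup>2 - (fst z \<bullet> fst z) * (snd z \<bullet> snd z)) = 0"
      unfolding power2_eq_square by algebra
    then show False using ne cs by simp
  qed
qed

theorem gauss_Poincare:
  fixes G :: "'a::euclidean_space \<Rightarrow> real" and g :: "'a \<Rightarrow> 'a"
  assumes dim: "2 \<le> DIM('a)"
    and der: "\<And>x. x \<noteq> 0 \<Longrightarrow> (G has_derivative (\<lambda>v. v \<bullet> g x)) (at x)"
    and cont: "continuous_on (- {0}) g"
    and Gm [measurable]: "G \<in> borel_measurable borel" and gm [measurable]: "g \<in> borel_measurable borel"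
    and bound: "\<And>x. \<bar>G x\<bar> \<le> K * norm x"
    and mean: "(\<integral>x. G x \<partial>gauss) = 0"
  shows "(\<integral>\<^sup>+x. ennreal ((G x)\<^sup>2) \<partial>gauss) \<le> (\<integral>\<^sup>+x. ennreal ((norm (g x))\<^sup>2) \<partial>gauss)"
proof -
  interpret prob_space "gauss :: 'a measure" by (rule prob_space_gauss)
  define W where "W z = ennreal (gauss_density (fst z) * gauss_density (snd z))" for z :: "'a \<times> 'a"
  have Wm: "W \<in> borel_measurable borel" unfolding W_def[abs_def] borel_prod[symmetric] by measurable
  define R where "R t z = (cos t *\<^sub>R fst z + sin t *\<^sub>R snd z, cos t *\<^sub>R snd z - sin t *\<^sub>R fst z)" for t :: real and z :: "'a \<times> 'a"
  define \<Phi>1 where "\<Phi>1 z = ennreal ((G (snd z) - G (fst z))\<^sup>2)" for z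
  define \<Phi>2 where "\<Phi>2 z = ennreal ((snd z \<bullet> g (fst z))\<^sup>2)" for z
  have \<Phi>1m: "\<Phi>1 \<in> borel_measurable borel" unfolding \<Phi>1_def[abs_def] borel_prod[symmetric] by measurable
  have \<Phi>2m: "\<Phi>2 \<in> borel_measurable borel" unfolding \<Phi>2_def[abs_def] borel_prod[symmetric] by measurable
  let ?T = "{0..2*pi}"
  have swap: "(\<integral>\<^sup>+z. W z * (\<integral>\<^sup>+t. \<Phi> (R t z) * indicator ?T t \<partial>lborel) \<partial>lborel) = ennreal (2 * pi) * (\<integral>\<^sup>+z. W z * \<Phi> z \<partial>lborel)"
    if \<Phi>: "\<Phi> \<in> borel_measurable borel" for \<Phi>
  proof -
    have Rm: "(\<lambda>p. R (snd p) (fst p)) \<in> borel_measurable borel" unfolding R_def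
      by (intro borel_measurable_continuous_onI continuous_intros)
    have 1: "(\<lambda>p. \<Phi> (R (snd p) (fst p))) \<in> borel_measurable (borel \<Otimes>\<^sub>M borel)"
      unfolding borel_prod by (rule measurable_compose[OF Rm \<Phi>])
    have 2: "(\<lambda>t. \<Phi> (R t z)) \<in> borel_measurable borel" for z
      by (rule measurable_compose[OF _ \<Phi>]) (unfold R_def, intro borel_measurable_continuous_onI continuous_intros)
    have 3: "(\<lambda>z. \<Phi> (R t z)) \<in> borel_measurable borel" for t
      by (rule measurable_compose[OF _ \<Phi>]) (unfold R_def, intro borel_measurable_continuous_onI continuous_intros)
    note [measurable] = 1 2 3 Wm
    have "(\<integral>\<^sup>+z. W z * (\<integral>\<^sup>+t. \<Phi> (R t z) * indicator ?T t \<partial>lborel) \<partial>lborel) = (\<integral>\<^sup>+z. (\<integral>\<^sup>+t. W z * \<Phi> (R t z) * indicator ?T t \<partial>lborel) \<partial>lborel)"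
      by (intro nn_integral_cong) (simp add: nn_integral_cmult[symmetric] mult.assoc)
    also have "\<dots> = (\<integral>\<^sup>+t. (\<integral>\<^sup>+z. W z * \<Phi> (R t z) * indicator ?T t \<partial>lborel) \<partial>lborel)"
      by (rule lborel_pair.Fubini'[symmetric]) (simp add: split_beta', measurable)
    also have "\<dots> = (\<integral>\<^sup>+t. (\<integral>\<^sup>+z. W z * \<Phi> z \<partial>lborel) * indicator ?T t \<partial>lborel)"
    proof (rule nn_integral_cong)
      fix t
      have "(\<integral>\<^sup>+z. W z * \<Phi> (R t z) * indicator ?T t \<partial>lborel) = (\<integral>\<^sup>+z. W z * \<Phi> (R t z) \<partial>lborel) * indicator ?T t"
        by (rule nn_integral_multc) measurable
      also have "(\<integral>\<^sup>+z. W z * \<Phi> (R t z) \<partial>lborel) = (\<integral>\<^sup>+z. W z * \<Phi> z \<partial>lborel)"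
        unfolding W_def R_def by (rule nn_integral_gauss_rotation[OF \<Phi>]) simp
      finally show "(\<integral>\<^sup>+z. W z * \<Phi> (R t z) * indicator ?T t \<partial>lborel) = (\<integral>\<^sup>+z. W z * \<Phi> z \<partial>lborel) * indicator ?T t" .
    qed
    also have "\<dots> = (\<integral>\<^sup>+z. W z * \<Phi> z \<partial>lborel) * ennreal (2 * pi)"
      by (subst nn_integral_cmult) auto
    finally show ?thesis by (simp add: mult.commute)
  qed
  have pointwise: "(\<integral>\<^sup>+t. \<Phi>1 (R t z) * indicator ?T t \<partial>lborel) \<le> 2 * (\<integral>\<^sup>+t. \<Phi>2 (R t z) * indicator ?T t \<partial>lborel)"
    if z: "\<forall>c s. c\<^sup>2 + s\<^sup>2 = 1 \<longrightarrow> c *\<^sub>R fst z + s *\<^sub>R snd z \<noteq> 0" for z :: "'a \<times> 'a"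
  proof -
    define X where "X t = cos t *\<^sub>R fst z + sin t *\<^sub>R snd z" for t
    define X' where "X' t = cos t *\<^sub>R snd z - sin t *\<^sub>R fst z" for t
    have R: "R t z = (X t, X' t)" for t by (simp add: R_def X_def X'_def)
    have X0: "X t \<noteq> 0" for t unfolding X_def using z sin_cos_squared_add2[of t] by (simp add: power2_eq_square)
    have Xs: "X (t + pi / 2) = X' t" for t by (simp add: X_def X'_def cos_add sin_add)
    define u u' where "u t = G (X t)" and "u' t = X' t \<bullet> g (X t)" for t
    have dX: "(X has_vector_derivative X' t) (at t)" for t
      unfolding X_def[abs_def] X'_def by (auto intro!: derivative_eq_intros simp: algebra_simps)
    have du: "(u has_real_derivative u' t) (at t)" for t
    proof -
      have "((G \<circ> X) has_vector_derivative (\<lambda>v. v \<bullet> g (X t)) (X' t)) (at t within UNIV)"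
        by (rule vector_derivative_diff_chain_within[OF has_vector_derivative_at_within[OF dX] has_derivative_at_withinI[OF der[OF X0]]])
      then show ?thesis
        by (simp add: u_def[abs_def] u'_def o_def has_real_derivative_iff_has_vector_derivative)
    qed
    have cX: "continuous_on UNIV X" "continuous_on UNIV X'"
      unfolding X_def[abs_def] X'_def[abs_def] by (intro continuous_intros)+
    have cu: "continuous_on UNIV u'"
      unfolding u'_def[abs_def]
      by (intro continuous_intros cX continuous_on_compose2[OF cont cX(1)]) (use X0 in auto)
    have cu': "continuous_on UNIV u" using du by (meson DERIV_continuous_on has_field_derivative_at_within)
    have per: "u (t + 2 * pi) = u t" for t unfolding u_def X_def by simp
    have ineq: "integral ?T (\<lambda>t. (u (t + pi / 2) - u t)\<^sup>2) \<le> 2 * integral ?T (\<lambda>t. (u' t)\<^sup>2)"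
      by (rule quarter_turn_inequality[OF du cu per])
    have conv: "(\<integral>\<^sup>+t. ennreal (p t) * indicator ?T t \<partial>lborel) = ennreal (integral ?T p)"
      if "continuous_on UNIV p" "\<And>t. 0 \<le> p t" for p :: "real \<Rightarrow> real"
    proof -
      have "set_integrable lborel ?T p"
        by (rule borel_integrable_atLeastAtMost') (rule continuous_on_subset[OF that(1)], simp)
      then have i: "integrable lborel (\<lambda>t. p t * indicator ?T t)" and e: "(\<integral>t. p t * indicator ?T t \<partial>lborel) = integral ?T p"
        using set_borel_integral_eq_integral(2)[of ?T p]
        by (simp_all add: set_integrable_def set_lebesgue_integral_def mult.commute)
      have "(\<integral>\<^sup>+t. ennreal (p t) * indicator ?T t \<partial>lborel) = (\<integral>\<^sup>+t. ennreal (p t * indicator ?T t) \<partial>lborel)"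
        by (intro nn_integral_cong) (simp split: split_indicator)
      also have "\<dots> = ennreal (integral ?T p)"
        unfolding e[symmetric] by (rule nn_integral_eq_integral[OF i]) (use that(2) in auto)
      finally show ?thesis .
    qed
    have "(\<integral>\<^sup>+t. \<Phi>1 (R t z) * indicator ?T t \<partial>lborel) = ennreal (integral ?T (\<lambda>t. (u (t + pi / 2) - u t)\<^sup>2))"
    proof (subst conv[symmetric])
      show "continuous_on UNIV (\<lambda>t. (u (t + pi / 2) - u t)\<^sup>2)"
        by (intro continuous_intros cu' continuous_on_compose2[OF cu']) auto
    qed (auto simp: \<Phi>1_def R u_def Xs)
    also have "\<dots> \<le> ennreal (2 * integral ?T (\<lambda>t. (u' t)\<^sup>2))" using ineq by (rule ennreal_leI)
    also have "\<dots> = 2 * ennreal (integral ?T (\<lambda>t. (u' t)\<^sup>2))"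
      by (subst ennreal_mult) (auto intro!: integral_nonneg integrable_continuous_interval continuous_intros continuous_on_subset[OF cu])
    also have "ennreal (integral ?T (\<lambda>t. (u' t)\<^sup>2)) = (\<integral>\<^sup>+t. \<Phi>2 (R t z) * indicator ?T t \<partial>lborel)"
    proof (subst conv[symmetric])
      show "continuous_on UNIV (\<lambda>t. (u' t)\<^sup>2)"
        by (intro continuous_intros cu)
    qed (auto simp: \<Phi>2_def R u'_def)
    finally show ?thesis .
  qed
  have "ennreal (2 * pi) * (\<integral>\<^sup>+z. W z * \<Phi>1 z \<partial>lborel) \<le> (\<integral>\<^sup>+z. 2 * (W z * (\<integral>\<^sup>+t. \<Phi>2 (R t z) * indicator ?T t \<partial>lborel)) \<partial>lborel)"
    unfolding swap[OF \<Phi>1m, symmetric]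
  proof (rule nn_integral_mono_AE, rule AE_mp[OF AE_lborel_independent[OF dim]], intro AE_I2 impI)
    fix z :: "'a \<times> 'a" assume "\<forall>c s. c\<^sup>2 + s\<^sup>2 = 1 \<longrightarrow> c *\<^sub>R fst z + s *\<^sub>R snd z \<noteq> 0"
    from pointwise[OF this] have "W z * (\<integral>\<^sup>+t. \<Phi>1 (R t z) * indicator ?T t \<partial>lborel) \<le> W z * (2 * (\<integral>\<^sup>+t. \<Phi>2 (R t z) * indicator ?T t \<partial>lborel))"
      by (rule mult_left_mono) simp
    then show "W z * (\<integral>\<^sup>+t. \<Phi>1 (R t z) * indicator ?T t \<partial>lborel) \<le> 2 * (W z * (\<integral>\<^sup>+t. \<Phi>2 (R t z) * indicator ?T t \<partial>lborel))"
      by (simp add: ac_simps)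
  qed
  also have "\<dots> = 2 * (\<integral>\<^sup>+z. (W z * (\<integral>\<^sup>+t. \<Phi>2 (R t z) * indicator ?T t \<partial>lborel)) \<partial>lborel)"
  proof (rule nn_integral_cmult)
    have "(\<lambda>p. \<Phi>2 (R (snd p) (fst p))) \<in> borel_measurable (borel \<Otimes>\<^sub>M borel)"
      unfolding borel_prod by (rule measurable_compose[OF _ \<Phi>2m]) (unfold R_def, intro borel_measurable_continuous_onI continuous_intros)
    note [measurable] = this Wm
    show "(\<lambda>z. W z * (\<integral>\<^sup>+t. \<Phi>2 (R t z) * indicator ?T t \<partial>lborel)) \<in> borel_measurable lborel"
      by measurable
  qed
  also have "\<dots> = ennreal (2 * pi) * (2 * (\<integral>\<^sup>+z. W z * \<Phi>2 z \<partial>lborel))"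
    unfolding swap[OF \<Phi>2m] by (simp add: ac_simps)
  finally have "(\<integral>\<^sup>+z. W z * \<Phi>1 z \<partial>lborel) \<le> 2 * (\<integral>\<^sup>+z. W z * \<Phi>2 z \<partial>lborel)"
    using ennreal_mult_le_mult_iff[of "ennreal (2 * pi)"] by simp
  then have ineq: "(\<integral>\<^sup>+x. \<integral>\<^sup>+y. \<Phi>1 (x, y) \<partial>gauss \<partial>gauss) \<le> 2 * (\<integral>\<^sup>+x. \<integral>\<^sup>+y. \<Phi>2 (x, y) \<partial>gauss \<partial>gauss)"
    unfolding nn_integral_gauss_pair[OF \<Phi>1m] nn_integral_gauss_pair[OF \<Phi>2m] W_def .
  have r: "(\<integral>\<^sup>+x. \<integral>\<^sup>+y. \<Phi>2 (x, y) \<partial>gauss \<partial>gauss) = (\<integral>\<^sup>+x. ennreal ((norm (g x))\<^sup>2) \<partial>gauss)"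
  proof (rule nn_integral_cong)
    show "(\<integral>\<^sup>+y. \<Phi>2 (x, y) \<partial>gauss) = ennreal ((norm (g x))\<^sup>2)" for x
      using gauss_moment2[of "g x"] by (simp add: \<Phi>2_def inner_commute[of "g x"])
  qed
  have G2: "integrable gauss (\<lambda>x. (G x)\<^sup>2)"
  proof (rule integrableI_bounded)
    have "(\<integral>\<^sup>+x. ennreal (norm ((G x)\<^sup>2)) \<partial>gauss) \<le> (\<integral>\<^sup>+x. ennreal (K\<^sup>2) * (\<Sum>i\<in>Basis. ennreal (((x::'a) \<bullet> i)\<^sup>2)) \<partial>gauss)"
    proof (rule nn_integral_mono)
      fix x :: 'a
      have "(G x)\<^sup>2 \<le> (K * norm x)\<^sup>2" using bound[of x] by (metis abs_ge_zero power2_abs power_mono)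
      also have "\<dots> = K\<^sup>2 * (\<Sum>i\<in>Basis. (x \<bullet> i)\<^sup>2)"
        unfolding power_mult_distrib power2_norm_eq_inner euclidean_inner[of x x] by (simp add: power2_eq_square)
      finally show "ennreal (norm ((G x)\<^sup>2)) \<le> ennreal (K\<^sup>2) * (\<Sum>i\<in>Basis. ennreal ((x \<bullet> i)\<^sup>2))"
        by (simp add: ennreal_mult[symmetric] sum_nonneg ennreal_leI)
    qed
    also have "\<dots> = ennreal (K\<^sup>2) * (\<Sum>i\<in>(Basis::'a set). 1)"
      by (simp add: nn_integral_cmult nn_integral_sum gauss_moment2_basis del: sum_ennreal)
    also have "\<dots> < \<infinity>" by (simp add: ennreal_mult_less_top of_nat_less_top)
    finally show "(\<integral>\<^sup>+x. ennreal (norm ((G x)\<^sup>2)) \<partial>gauss) < \<infinity>" .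
  qed measurable
  have G1: "integrable gauss G"
  proof (rule Bochner_Integration.integrable_bound)
    show "integrable gauss (\<lambda>x. 1 + (G x)\<^sup>2)" using G2 by simp
    show "AE x in gauss. norm (G x) \<le> norm (1 + (G x)\<^sup>2)"
    proof (rule AE_I2)
      fix x
      have "\<bar>G x\<bar> \<le> 1 + (G x)\<^sup>2"
        using zero_le_power2[of "\<bar>G x\<bar> - 1"] by (simp add: power2_eq_square algebra_simps)
      then show "norm (G x) \<le> norm (1 + (G x)\<^sup>2)" by simp
    qed
  qed measurable
  define V where "V = (\<integral>x. (G x)\<^sup>2 \<partial>gauss)"
  have V: "(\<integral>\<^sup>+x. ennreal ((G x)\<^sup>2) \<partial>gauss) = ennreal V" unfolding V_def
    by (rule nn_integral_eq_integral[OF G2]) auto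
  have V0: "0 \<le> V" unfolding V_def by (rule integral_nonneg_AE) auto
  have inner_int: "(\<integral>\<^sup>+y. \<Phi>1 (x, y) \<partial>gauss) = ennreal (V + (G x)\<^sup>2)" for x
  proof -
    have e: "(G y - G x)\<^sup>2 = (G y)\<^sup>2 - 2 * G x * G y + (G x)\<^sup>2" for y by (simp add: power2_eq_square algebra_simps)
    have i: "integrable gauss (\<lambda>y. (G y - G x)\<^sup>2)" unfolding e using G1 G2 by simp
    have "(\<integral>\<^sup>+y. \<Phi>1 (x, y) \<partial>gauss) = ennreal (\<integral>y. (G y - G x)\<^sup>2 \<partial>gauss)"
      unfolding \<Phi>1_def fst_conv snd_conv by (rule nn_integral_eq_integral[OF i]) auto
    also have "(\<integral>y. (G y - G x)\<^sup>2 \<partial>gauss) = V + (G x)\<^sup>2"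
      unfolding e V_def using G1 G2 mean prob_space by (simp add: measure_def emeasure_gauss_UNIV)
    finally show ?thesis .
  qed
  have l: "(\<integral>\<^sup>+x. \<integral>\<^sup>+y. \<Phi>1 (x, y) \<partial>gauss \<partial>gauss) = 2 * ennreal V"
  proof -
    have "(\<integral>\<^sup>+x. \<integral>\<^sup>+y. \<Phi>1 (x, y) \<partial>gauss \<partial>gauss) = (\<integral>\<^sup>+x. ennreal V + ennreal ((G x)\<^sup>2) \<partial>gauss)"
      using V0 by (simp add: inner_int)
    also have "\<dots> = ennreal V + ennreal V"
      by (subst nn_integral_add) (auto simp: V emeasure_gauss_UNIV)
    finally show ?thesis by (simp add: mult_2)
  qed
  show ?thesis
    using ineq unfolding l r V by (subst (asm) ennreal_mult_le_mult_iff) auto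
qed

section \<open>Riemannian measures\<close>

lemma nn_integral_set_lebesgue:
  fixes f :: "'a::euclidean_space \<Rightarrow> real"
  assumes "f absolutely_integrable_on S" "\<And>x. x \<in> S \<Longrightarrow> 0 \<le> f x"
  shows "(\<integral>\<^sup>+x. ennreal (f x) * indicator S x \<partial>lborel) = ennreal (integral S f)"
proof -
  have i: "integrable lebesgue (\<lambda>x. indicator S x *\<^sub>R f x)"
    using assms(1) by (simp add: set_integrable_def)
  have "(\<integral>\<^sup>+x. ennreal (f x) * indicator S x \<partial>lborel) = (\<integral>\<^sup>+x. ennreal (indicator S x *\<^sub>R f x) \<partial>lebesgue)"
    unfolding nn_integral_completion by (intro nn_integral_cong) (simp split: split_indicator)
  also have "\<dots> = ennreal (\<integral>x. indicator S x *\<^sub>R f x \<partial>lebesgue)"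
    by (rule nn_integral_eq_integral[OF i]) (use assms(2) in \<open>auto split: split_indicator\<close>)
  also have "(\<integral>x. indicator S x *\<^sub>R f x \<partial>lebesgue) = integral S f"
    using set_lebesgue_integral_eq_integral(2)[OF assms(1)] by (simp add: set_lebesgue_integral_def)
  finally show ?thesis .
qed

lemma nn_integral_change_of_variables:
  fixes f :: "real^'m::{finite,wellorder} \<Rightarrow> real" and F :: "real^'m::_ \<Rightarrow> real^'m::_"
  assumes S: "S \<in> sets borel" and FS: "F ` S \<in> sets borel"
    and der: "\<And>x. x \<in> S \<Longrightarrow> (F has_derivative F' x) (at x within S)"
    and inj: "inj_on F S"
    and f: "f \<in> borel_measurable borel" "\<And>z. 0 \<le> f z"
    and fin: "(\<integral>\<^sup>+z. ennreal (f z) * indicator (F ` S) z \<partial>lborel) < \<infinity>"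
  shows "(\<integral>\<^sup>+x. ennreal (\<bar>det (matrix (F' x))\<bar> * f (F x)) * indicator S x \<partial>lborel)
       = (\<integral>\<^sup>+z. ennreal (f z) * indicator (F ` S) z \<partial>lborel)"
proof -
  have "integrable lborel (\<lambda>z. indicator (F ` S) z *\<^sub>R f z)"
  proof (rule integrableI_bounded)
    have "(\<integral>\<^sup>+z. ennreal (norm (indicator (F ` S) z *\<^sub>R f z)) \<partial>lborel) = (\<integral>\<^sup>+z. ennreal (f z) * indicator (F ` S) z \<partial>lborel)"
      by (intro nn_integral_cong) (simp add: f split: split_indicator)
    then show "(\<integral>\<^sup>+z. ennreal (norm (indicator (F ` S) z *\<^sub>R f z)) \<partial>lborel) < \<infinity>" using fin by simp
  qed (use f FS in measurable)
  then have 1: "f absolutely_integrable_on (F ` S)"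
    unfolding set_integrable_def by (rule integrable_completion[THEN iffD2, rotated]) (use f FS in measurable)
  have cov: "(\<lambda>x. \<bar>det (matrix (F' x))\<bar> *\<^sub>R (vec (f (F x)) :: real^1)) absolutely_integrable_on S \<and>
           integral S (\<lambda>x. \<bar>det (matrix (F' x))\<bar> *\<^sub>R (vec (f (F x)) :: real^1)) = b
     \<longleftrightarrow> (\<lambda>z. vec (f z) :: real^1) absolutely_integrable_on (F ` S) \<and> integral (F ` S) (\<lambda>z. vec (f z) :: real^1) = b" for b
    by (rule has_absolute_integral_change_of_variables[OF _ der inj]) (use S in auto)
  then have "(\<lambda>x. \<bar>det (matrix (F' x))\<bar> * f (F x)) absolutely_integrable_on S \<and>
           integral S (\<lambda>x. \<bar>det (matrix (F' x))\<bar> * f (F x)) = integral (F ` S) f"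
    using 1 cov[of "vec (integral (F ` S) f)"]
    by (simp add: absolutely_integrable_on_1_iff integral_on_1_eq vec_eq_iff)
  then show ?thesis
    using 1 f nn_integral_set_lebesgue[of "F ` S" f] nn_integral_set_lebesgue[of S "\<lambda>x. \<bar>det (matrix (F' x))\<bar> * f (F x)"]
    by simp
qed

definition gram :: "('a \<Rightarrow> 'a \<Rightarrow> real) \<Rightarrow> (real^'m::finite \<Rightarrow> 'a) \<Rightarrow> real^'m^'m" where
  "gram b f = (\<chi> i j. b (f (axis i 1)) (f (axis j 1)))"

lemma gram_compose:
  fixes b :: "'a::real_vector \<Rightarrow> 'a \<Rightarrow> real" and f :: "real^'m::finite \<Rightarrow> 'a" and g :: "real^'m::finite \<Rightarrow> real^'m::finite"
  assumes b: "bilinear b" and f: "linear f" and g: "linear g"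
  shows "gram b (f \<circ> g) = transpose (matrix g) ** gram b f ** matrix g"
proof -
  have fg: "f (g (axis i 1)) = (\<Sum>k\<in>UNIV. matrix g $ k $ i *\<^sub>R f (axis k 1))" for i
  proof -
    have "g (axis i 1) = (\<Sum>k\<in>UNIV. (g (axis i 1) $ k) *\<^sub>R axis k 1)"
      using basis_expansion[of "g (axis i 1)"] by (simp add: scalar_mult_eq_scaleR)
    then have "f (g (axis i 1)) = (\<Sum>k\<in>UNIV. (g (axis i 1) $ k) *\<^sub>R f (axis k 1))"
      by (metis (no_types, lifting) f linear_scale linear_sum sum.cong)
    then show ?thesis by (simp add: matrix_def)
  qed
  have "b (f (g (axis i 1))) (f (g (axis j 1))) = (\<Sum>k\<in>UNIV. \<Sum>l\<in>UNIV. matrix g $ k $ i * (matrix g $ l $ j * b (f (axis k 1)) (f (axis l 1))))" for i j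
    unfolding fg by (simp only: bilinear_sum[OF b] sum.cartesian_product[symmetric] bilinear_lmul[OF b] bilinear_rmul[OF b] real_scaleR_def mult.left_commute)
  moreover have "(transpose (matrix g) ** gram b f ** matrix g) $ i $ j
      = (\<Sum>k\<in>UNIV. \<Sum>l\<in>UNIV. matrix g $ k $ i * (matrix g $ l $ j * b (f (axis k 1)) (f (axis l 1))))" for i j
    by (subst sum.swap) (simp add: gram_def matrix_matrix_mult_def transpose_def sum_distrib_left sum_distrib_right ac_simps)
  ultimately show ?thesis by (simp add: vec_eq_iff gram_def)
qed

lemma det_gram_compose:
  fixes b :: "'a::real_vector \<Rightarrow> 'a \<Rightarrow> real" and f :: "real^'m::finite \<Rightarrow> 'a" and g :: "real^'m::finite \<Rightarrow> real^'m::finite"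
  assumes "bilinear b" "linear f" "linear g"
  shows "sqrt (det (gram b (f \<circ> g))) = \<bar>det (matrix g)\<bar> * sqrt (det (gram b f))"
proof -
  have "det (gram b (f \<circ> g)) = (det (matrix g))\<^sup>2 * det (gram b f)"
    unfolding gram_compose[OF assms] det_mul det_transpose by (simp add: power2_eq_square)
  then show ?thesis by (simp add: real_sqrt_mult)
qed

lemma is_riem_measure_chart:
  fixes M :: "'v::euclidean_space set" and \<Psi> :: "real^'m::{finite,wellorder} \<Rightarrow> 'v" and \<theta> :: "'v \<Rightarrow> real^'m::_"
    and b :: "'v \<Rightarrow> 'v \<Rightarrow> real"
  assumes \<delta>_def: "\<And>x. \<delta> x = sqrt (det (gram b (\<Psi>' x)))"
    and b: "bilinear b" and M: "closed M" "p0 \<in> M"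
    and \<Psi>: "\<And>x. (\<Psi> has_derivative \<Psi>' x) (at x)" "range \<Psi> = M - {p0}"
    and \<theta>: "\<And>y. y \<in> M - {p0} \<Longrightarrow> (\<theta> has_derivative \<theta>' y) (at y)" "\<And>x. \<theta> (\<Psi> x) = x"
    and \<delta>: "continuous_on UNIV \<delta>" "\<And>x. 0 \<le> \<delta> x" "(\<integral>\<^sup>+x. ennreal (\<delta> x) \<partial>lborel) < \<infinity>"
  shows "is_riem_measure TYPE('m) b M (distr (density lborel \<delta>) borel \<Psi>)"
proof -
  let ?\<mu> = "distr (density lborel \<delta>) borel \<Psi>"
  have \<Psi>c: "continuous_on UNIV \<Psi>" using \<Psi>(1) has_derivative_continuous_on by blast
  have [measurable]: "\<Psi> \<in> borel_measurable borel" "\<delta> \<in> borel_measurable borel"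
    using \<Psi>c \<delta>(1) by (auto intro: borel_measurable_continuous_onI)
  have em: "emeasure ?\<mu> A = (\<integral>\<^sup>+z. ennreal (\<delta> z) * indicator {z. \<Psi> z \<in> A} z \<partial>lborel)" if "A \<in> sets borel" for A
  proof -
    have [measurable]: "\<Psi> -` A \<in> sets borel" using measurable_sets[of \<Psi> borel borel A] that by simp
    have "emeasure ?\<mu> A = emeasure (density lborel \<delta>) (\<Psi> -` A)" using that by (simp add: emeasure_distr)
    also have "\<dots> = (\<integral>\<^sup>+z. ennreal (\<delta> z) * indicator (\<Psi> -` A) z \<partial>lborel)" by (rule emeasure_density) auto
    finally show ?thesis by (simp add: vimage_def)
  qed
  show ?thesis unfolding is_riem_measure_def
  proof (intro conjI allI impI ballI)
    show "sets ?\<mu> = sets borel" by simp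
    have "\<Psi> z \<in> M" for z using \<Psi>(2) by auto
    then show "emeasure ?\<mu> (- M) = 0" using M by (subst em) auto
    fix U and \<psi> :: "real^'m::_ \<Rightarrow> 'v" and A
    assume lp: "local_parametrization M U \<psi>" and A: "A \<in> sets borel" "A \<subseteq> \<psi> ` U"
    have U: "open U" and sm: "smooth_on U \<psi>" using lp by (auto simp: local_parametrization_def)
    obtain \<psi>' where "homeomorphism U (\<psi> ` U) \<psi> \<psi>'" using lp by (auto simp: local_parametrization_def)
    then have inj: "inj_on \<psi> U" by (metis homeomorphism_def inj_on_inverseI)
    have \<psi>M: "\<psi> ` U \<subseteq> M" using lp by (auto simp: local_parametrization_def openin_subset[of "top_of_set M", simplified])
    have d\<psi>: "(\<psi> has_derivative frechet_derivative \<psi> (at x)) (at x)" if "x \<in> U" for x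
      using Ck_on_SucD[OF U smooth_on_open_imp_Ck[OF sm U, of "Suc 0"] that] .
    have \<psi>c: "continuous_on U \<psi>" using sm by (rule smooth_on_imp_continuous_on)
    define U' where "U' = {x \<in> U. \<psi> x \<noteq> p0}"
    have U': "open U'"
      unfolding U'_def using continuous_open_preimage[OF \<psi>c U, of "- {p0}"] by (simp add: open_Compl vimage_def Int_def)
    define F where "F x = \<theta> (\<psi> x)" for x
    define F' where "F' x = \<theta>' (\<psi> x) \<circ> frechet_derivative \<psi> (at x)" for x
    have inM: "\<psi> x \<in> M - {p0}" if "x \<in> U'" for x using that \<psi>M by (auto simp: U'_def)
    have dF: "(F has_derivative F' x) (at x)" if "x \<in> U'" for x
      using diff_chain_at[OF d\<psi> \<theta>(1)[OF inM]] that unfolding F_def[abs_def] F'_def U'_def by (simp add: o_def)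
    have \<Psi>F: "\<Psi> (F x) = \<psi> x" if x: "x \<in> U'" for x
    proof -
      obtain z where "\<psi> x = \<Psi> z" using inM[OF x] \<Psi>(2) by blast
      then show ?thesis by (simp add: F_def \<theta>(2))
    qed
    have injF: "inj_on F U'"
      using inj unfolding inj_on_def by (metis (no_types, lifting) U'_def \<Psi>F mem_Collect_eq)
    have jac: "sqrt (det (gram b (frechet_derivative \<psi> (at x)))) = \<bar>det (matrix (F' x))\<bar> * \<delta> (F x)" if x: "x \<in> U'" for x
    proof -
      have "((\<Psi> \<circ> F) has_derivative (\<Psi>' (F x) \<circ> F' x)) (at x)"
        by (rule diff_chain_at[OF dF[OF x] \<Psi>(1)])
      then have "(\<psi> has_derivative (\<Psi>' (F x) \<circ> F' x)) (at x)"
        by (rule has_derivative_transform_within_open[OF _ U' x]) (simp add: \<Psi>F)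
      then have e: "frechet_derivative \<psi> (at x) = \<Psi>' (F x) \<circ> F' x"
        using d\<psi>[of x] x has_derivative_unique unfolding U'_def by blast
      show ?thesis unfolding e \<delta>_def
        by (rule det_gram_compose[OF b]) (use \<Psi>(1) dF[OF x] has_derivative_linear in blast)+
    qed
    define S where "S = {x \<in> U'. \<psi> x \<in> A}"
    have S: "S \<in> sets borel"
    proof -
      have "continuous_on U' \<psi>" by (rule continuous_on_subset[OF \<psi>c]) (auto simp: U'_def)
      then have "\<psi> \<in> borel_measurable (restrict_space borel U')" by (rule borel_measurable_continuous_on_restrict)
      from measurable_sets[OF this A(1)] have "\<psi> -` A \<inter> U' \<in> sets (restrict_space borel U')"
        by (simp add: space_restrict_space)
      moreover have "S = \<psi> -` A \<inter> U'" by (auto simp: S_def)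
      ultimately show ?thesis using U' by (simp add: sets_restrict_space_iff)
    qed
    have FS: "F ` S = {z. \<Psi> z \<in> A}"
    proof safe
      fix x assume "x \<in> S" then show "\<Psi> (F x) \<in> A" by (simp add: S_def \<Psi>F)
    next
      fix z assume z: "\<Psi> z \<in> A"
      then obtain x where x: "x \<in> U" "\<psi> x = \<Psi> z" using A(2) by auto
      moreover have "\<Psi> z \<noteq> p0" using \<Psi>(2) by auto
      ultimately have "x \<in> S" "F x = z" using z by (auto simp: S_def U'_def F_def \<theta>(2))
      then show "z \<in> F ` S" by blast
    qed
    have FSb: "F ` S \<in> sets borel" unfolding FS using measurable_sets[of \<Psi> borel borel A] A(1) by (simp add: vimage_def)
    have "emeasure ?\<mu> A = (\<integral>\<^sup>+z. ennreal (\<delta> z) * indicator (F ` S) z \<partial>lborel)"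
      by (simp add: em A FS)
    also have "\<dots> = (\<integral>\<^sup>+x. ennreal (\<bar>det (matrix (F' x))\<bar> * \<delta> (F x)) * indicator S x \<partial>lborel)"
    proof (rule nn_integral_change_of_variables[symmetric, OF S FSb])
      show "(F has_derivative F' x) (at x within S)" if "x \<in> S" for x
        using that dF by (auto simp: S_def intro: has_derivative_at_withinI)
      show "inj_on F S" using injF by (rule inj_on_subset) (auto simp: S_def)
      have "(\<integral>\<^sup>+z. ennreal (\<delta> z) * indicator (F ` S) z \<partial>lborel) \<le> (\<integral>\<^sup>+x. ennreal (\<delta> x) \<partial>lborel)"
        by (intro nn_integral_mono) (simp split: split_indicator)
      then show "(\<integral>\<^sup>+z. ennreal (\<delta> z) * indicator (F ` S) z \<partial>lborel) < \<infinity>" using \<delta>(3) by (rule le_less_trans)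
    qed (use \<delta> in auto)
    also have "\<dots> = (\<integral>\<^sup>+x. ennreal (sqrt (det (gram b (frechet_derivative \<psi> (at x))))) * indicator {x\<in>U. \<psi> x \<in> A} x \<partial>lborel)"
    proof (rule nn_integral_cong_AE)
      have "\<exists>a. \<forall>x\<in>U. \<psi> x = p0 \<longrightarrow> x = a" using inj by (metis inj_onD)
      then obtain a where a: "\<And>x. x \<in> U \<Longrightarrow> \<psi> x = p0 \<Longrightarrow> x = a" by blast
      have "AE x in lborel. x \<noteq> a" by (rule AE_lborel_singleton)
      then show "AE x in lborel. ennreal (\<bar>det (matrix (F' x))\<bar> * \<delta> (F x)) * indicator S x
          = ennreal (sqrt (det (gram b (frechet_derivative \<psi> (at x))))) * indicator {x\<in>U. \<psi> x \<in> A} x"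
      proof eventually_elim
        case (elim x)
        then show ?case using a[of x] jac[of x] by (auto simp: S_def U'_def split: split_indicator)
      qed
    qed
    finally show "emeasure ?\<mu> A = (\<integral>\<^sup>+x. ennreal (sqrt (det (\<chi> i j.
                   b (frechet_derivative \<psi> (at x) (axis i 1)) (frechet_derivative \<psi> (at x) (axis j 1)))))
                 * indicator {x\<in>U. \<psi> x \<in> A} x \<partial>lborel)"
      unfolding gram_def .
  qed
qed

lemma Ck_on_compose:
  fixes f :: "'a::real_normed_vector \<Rightarrow> 'b::euclidean_space"
  assumes "open U" "open V" "f ` U \<subseteq> V"
  shows "Ck_on k V g \<Longrightarrow> Ck_on k U f \<Longrightarrow> Ck_on k U (\<lambda>x. g (f x))"
proof (induction k arbitrary: g)
  case 0
  then show ?case using assms(3) by (auto intro: continuous_on_compose2)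
next
  case (Suc k)
  have fU: "Ck_on k U f" using Suc.prems(2) assms(1) by (rule Ck_on_Suc_imp[rotated])
  have dg: "(g has_derivative frechet_derivative g (at (f x))) (at (f x))" if "x \<in> U" for x
    using Ck_on_SucD[OF assms(2) Suc.prems(1), of "f x"] that assms(3) by auto
  have df: "(f has_derivative frechet_derivative f (at x)) (at x)" if "x \<in> U" for x
    by (rule Ck_on_SucD[OF assms(1) Suc.prems(2) that])
  show ?case
  proof (rule Ck_onI[OF assms(1)])
    fix x assume x: "x \<in> U"
    have "((g \<circ> f) has_derivative (frechet_derivative g (at (f x)) \<circ> frechet_derivative f (at x))) (at x)"
      by (rule diff_chain_at[OF df[OF x] dg[OF x]])
    then show "((\<lambda>x. g (f x)) has_derivative (\<lambda>v. frechet_derivative g (at (f x)) (frechet_derivative f (at x) v))) (at x)"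
      by (simp add: o_def)
  next
    fix v
    have "Ck_on k U (\<lambda>x. \<Sum>i\<in>Basis. (frechet_derivative f (at x) v \<bullet> i) *\<^sub>R frechet_derivative g (at (f x)) i)"
    proof (rule Ck_on_sum[OF assms(1)], rule Ck_on_scaleR[OF assms(1)])
      fix i :: 'b
      show "Ck_on k U (\<lambda>x. frechet_derivative f (at x) v \<bullet> i)"
        by (rule Ck_on_linear_comp[OF assms(1) bounded_linear_inner_left]) (use Suc.prems in simp)
      show "Ck_on k U (\<lambda>x. frechet_derivative g (at (f x)) i)"
        by (rule Suc.IH[OF _ fU]) (use Suc.prems in simp)
    qed
    then show "Ck_on k U (\<lambda>x. frechet_derivative g (at (f x)) (frechet_derivative f (at x) v))"
    proof (rule Ck_on_cong[OF assms(1), rotated])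
      fix x assume "x \<in> U"
      then have l: "linear (frechet_derivative g (at (f x)))" using dg has_derivative_linear by blast
      show "(\<Sum>i\<in>Basis. (frechet_derivative f (at x) v \<bullet> i) *\<^sub>R frechet_derivative g (at (f x)) i)
          = frechet_derivative g (at (f x)) (frechet_derivative f (at x) v)"
        by (subst (3) euclidean_representation[symmetric]) (simp add: linear_sum[OF l] linear_scale[OF l])
    qed
  qed
qed

lemma smooth_on_compose:
  fixes f :: "'a::real_normed_vector \<Rightarrow> 'b::euclidean_space"
  assumes U: "open U" and f: "\<And>k. Ck_on k U f" "f ` U \<subseteq> S" and g: "smooth_on S g"
  shows "smooth_on U (\<lambda>x. g (f x))"
  unfolding smooth_on_def
proof
  fix x assume x: "x \<in> U"
  then have "f x \<in> S" using f(2) by auto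
  obtain V h where V: "open V" "f x \<in> V" "\<And>k. Ck_on k V h" "\<And>y. y \<in> S \<Longrightarrow> y \<in> V \<Longrightarrow> h y = g y"
    using smooth_onE[OF g \<open>f x \<in> S\<close>] by blast
  define U' where "U' = U \<inter> f -` V"
  have U': "open U'" unfolding U'_def
    using f(1)[of 0] U V(1) by (simp add: continuous_open_preimage)
  have "Ck_on k U' (\<lambda>x. h (f x))" for k
    by (rule Ck_on_compose[OF U' V(1) _ V(3)])
      (auto simp: U'_def intro: Ck_on_subset[OF U'[unfolded U'_def] _ f(1)])
  moreover have "h (f y) = g (f y)" if "y \<in> U'" for y
    using that f(2) by (intro V(4)) (auto simp: U'_def)
  ultimately show "\<exists>U' h'. open U' \<and> x \<in> U' \<and> (\<forall>k. Ck_on k U' h') \<and> (\<forall>y\<in>U \<inter> U'. h' y = g (f y))"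
    using U' V x by (intro exI[of _ U'] exI[of _ "\<lambda>x. h (f x)"]) (auto simp: U'_def)
qed

definition sqpow :: "real \<Rightarrow> real \<Rightarrow> 'a::real_inner \<Rightarrow> real" where
  "sqpow c s x = (c + x \<bullet> x) powr s"

lemma sqpow_pos: "0 < c + x \<bullet> x \<Longrightarrow> 0 < sqpow c s x"
  by (simp add: sqpow_def)

lemma sqpow_has_derivative:
  assumes "0 < c + x \<bullet> x"
  shows "(sqpow c s has_derivative (\<lambda>h. 2 * s * (x \<bullet> h) * sqpow c (s - 1) x)) (at x)"
proof -
  have 1: "((\<lambda>x. c + x \<bullet> x) has_derivative (\<lambda>h. 2 * (x \<bullet> h))) (at x)"
    by (auto intro!: derivative_eq_intros simp: inner_commute)
  have "((\<lambda>x. (c + x \<bullet> x) powr s) has_derivative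
      (\<lambda>h. (c + x \<bullet> x) powr s * (0 * ln (c + x \<bullet> x) + 2 * (x \<bullet> h) * s / (c + x \<bullet> x)))) (at x)"
    by (rule has_derivative_powr[OF 1 has_derivative_const]) (use assms in auto)
  moreover have "(c + x \<bullet> x) powr (s - 1) = (c + x \<bullet> x) powr s / (c + x \<bullet> x)"
    using assms by (simp add: powr_diff)
  ultimately show ?thesis
    unfolding sqpow_def[abs_def] by (simp add: ac_simps)
qed

lemma Ck_on_inner:
  assumes "open U" "Ck_on k U f" "Ck_on k U g"
  shows "Ck_on k U (\<lambda>x. f x \<bullet> g x)"
  by (rule Ck_on_bilinear[OF assms(1) bounded_bilinear_inner assms(2,3)])

lemma Ck_on_ident: "open U \<Longrightarrow> Ck_on k U (\<lambda>x. x)"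
  by (rule Ck_on_bounded_linear) auto

lemma open_sqpow_domain: "open {x::'a::real_inner. 0 < c + x \<bullet> x}"
  by (intro open_Collect_less continuous_intros)

lemma Ck_on_sqpow: "Ck_on k {x. 0 < c + x \<bullet> x} (sqpow c s :: 'a::real_inner \<Rightarrow> real)"
proof (induction k arbitrary: s)
  case 0
  show ?case unfolding sqpow_def[abs_def] Ck_on.simps
    by (intro continuous_intros) auto
next
  case (Suc k)
  show ?case
  proof (rule Ck_onI[OF open_sqpow_domain sqpow_has_derivative])
    fix v :: 'a
    show "Ck_on k {x. 0 < c + x \<bullet> x} (\<lambda>x. 2 * s * (x \<bullet> v) * sqpow c (s - 1) x)"
      by (intro Ck_on_mult open_sqpow_domain Ck_on_inner Ck_on_ident Ck_on_const Suc.IH)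
  qed auto
qed

lemma det_identity_minus_rank_one:
  fixes x :: "real^'m::finite"
  shows "det (\<chi> i j. (if i = j then 1 else 0) - t * (x $ i * x $ j)) = 1 - t * (x \<bullet> x)"
proof -
  obtain k :: 'm where True by blast
  obtain f :: "real^'m \<Rightarrow> real^'m" where f: "orthogonal_transformation f" "f (norm x *\<^sub>R axis k 1) = x"
    using orthogonal_transformation_exists[of "norm x *\<^sub>R axis k (1::real)" x] by auto
  define A where "A = matrix f"
  have lf: "linear f" using f(1) by (simp add: orthogonal_transformation_def)
  have oA: "orthogonal_matrix A" unfolding A_def using f(1) orthogonal_transformation_matrix by blast
  have xi: "x $ i = norm x * A $ i $ k" for i
    using arg_cong[OF f(2), of "\<lambda>v. v $ i"] by (simp add: linear_scale[OF lf] A_def matrix_def)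
  have AA: "(\<Sum>l\<in>UNIV. A $ i $ l * A $ j $ l) = (if i = j then 1 else 0)" for i j
  proof -
    have "A ** transpose A = mat 1" using oA by (simp add: orthogonal_matrix_def)
    from arg_cong[OF this, of "\<lambda>B. B $ i $ j"] show ?thesis
      by (simp add: matrix_matrix_mult_def transpose_def mat_def)
  qed
  define D :: "real^'m^'m" where "D = (\<chi> i j. if i = j then (if i = k then 1 - t * (x \<bullet> x) else 1) else 0)"
  have "(\<chi> i j. (if i = j then 1 else 0) - t * (x $ i * x $ j)) = A ** D ** transpose A"
  proof -
    have "(A ** D ** transpose A) $ i $ j = (if i = j then 1 else 0) - t * (x $ i * x $ j)" for i j
    proof -
      have "(A ** D ** transpose A) $ i $ j = (\<Sum>l\<in>UNIV. A $ i $ l * (if l = k then 1 - t * (x \<bullet> x) else 1) * A $ j $ l)"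
        by (simp add: matrix_matrix_mult_def transpose_def D_def if_distrib[of "\<lambda>z. _ * z"] sum.delta cong: if_cong)
      also have "\<dots> = (\<Sum>l\<in>UNIV. A $ i $ l * A $ j $ l - (if l = k then t * (x \<bullet> x) * A $ i $ l * A $ j $ l else 0))"
        by (intro sum.cong) (auto simp: algebra_simps)
      also have "\<dots> = (if i = j then 1 else 0) - t * (x \<bullet> x) * A $ i $ k * A $ j $ k"
        by (simp add: sum_subtractf AA)
      also have "\<dots> = (if i = j then 1 else 0) - t * (x $ i * x $ j)"
        by (simp add: xi dot_square_norm power2_eq_square)
      finally show ?thesis .
    qed
    then show ?thesis by (simp add: vec_eq_iff)
  qed
  moreover have "det A * det A = 1"
    using det_orthogonal_matrix[OF oA] by auto
  moreover have "det D = 1 - t * (x \<bullet> x)"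
    by (subst det_diagonal) (auto simp: D_def prod.delta)
  ultimately show ?thesis by (simp add: det_mul det_transpose ac_simps)
qed

section \<open>Round spheres in linear subspaces\<close>

definition stereographic :: "'a::real_inner \<Rightarrow> 'a \<times> real" where
  "stereographic x = ((2 * sqpow 1 (-1) x) *\<^sub>R x, 1 - 2 * sqpow 1 (-1) x)"

definition gnomonic :: "real \<Rightarrow> 'a::real_inner \<Rightarrow> 'a \<times> real" where
  "gnomonic s x = sqpow 1 (-1/2) x *\<^sub>R (x, s)"

lemma sqpow_one_pos [simp]: "0 < 1 + x \<bullet> (x::'a::real_inner)"
  by (simp add: add_pos_nonneg)

lemma sqpow_one_domain [simp]: "{x::'a::real_inner. 0 < 1 + x \<bullet> x} = UNIV"
  by simp

lemma sqpow_minus_one: "sqpow 1 (-1) x = 1 / (1 + x \<bullet> (x::'a::real_inner))"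
  using sqpow_one_pos[of x] by (simp add: sqpow_def powr_minus divide_inverse)

lemma sqpow_minus_one_mult: "sqpow 1 (-1) x * (1 + x \<bullet> (x::'a::real_inner)) = 1"
proof -
  have "1 + x \<bullet> x \<noteq> 0" using sqpow_one_pos[of x] by linarith
  then show ?thesis by (simp add: sqpow_minus_one)
qed

lemma sqpow_minus_two: "sqpow 1 (-2) x = (sqpow 1 (-1) x)\<^sup>2"
  unfolding sqpow_def power2_eq_square powr_add[symmetric] by (rule arg_cong[where f="(powr) _"]) simp

lemma sqpow_half_sq: "(sqpow 1 (-1/2) x)\<^sup>2 = sqpow 1 (-1) x"
  by (simp add: sqpow_def power2_eq_square powr_add[symmetric])

lemma sqpow_three_half: "sqpow 1 (-3/2) x = (sqpow 1 (-1/2) x) ^ 3"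
  unfolding sqpow_def power3_eq_cube powr_add[symmetric] by (rule arg_cong[where f="(powr) _"]) simp

lemma norm_stereographic: "norm (stereographic x) = 1"
proof -
  define l where "l = sqpow 1 (-1) x"
  have l: "l * (1 + x \<bullet> x) = 1" unfolding l_def by (rule sqpow_minus_one_mult)
  have "(norm (stereographic x))\<^sup>2 = 4 * l * (l * (1 + x \<bullet> x)) + 1 - 4 * l"
    unfolding power2_norm_eq_inner stereographic_def l_def[symmetric]
    by (simp add: inner_prod_def power2_eq_square algebra_simps)
  then have "(norm (stereographic x))\<^sup>2 = 1\<^sup>2" by (simp add: l)
  then show ?thesis by (rule power2_eq_imp_eq) auto
qed

lemma norm_gnomonic: "s\<^sup>2 = 1 \<Longrightarrow> norm (gnomonic s x) = 1"
proof -
  assume s: "s\<^sup>2 = 1"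
  have "(norm (gnomonic s x))\<^sup>2 = (sqpow 1 (-1/2) x)\<^sup>2 * (1 + x \<bullet> x)"
    unfolding gnomonic_def power2_norm_eq_inner using s
    by (simp add: inner_prod_def power2_eq_square algebra_simps)
  then have "(norm (gnomonic s x))\<^sup>2 = 1\<^sup>2"
    unfolding sqpow_half_sq by (simp add: sqpow_minus_one_mult)
  then show ?thesis by (rule power2_eq_imp_eq) auto
qed

lemma Ck_stereographic: "Ck_on k UNIV (stereographic :: 'a::real_inner \<Rightarrow> _)"
  unfolding stereographic_def[abs_def]
  using Ck_on_sqpow[of k 1 "-1", where 'a='a]
  by (intro Ck_on_Pair Ck_on_scaleR Ck_on_diff Ck_on_mult Ck_on_const Ck_on_ident open_UNIV) auto

lemma Ck_gnomonic: "Ck_on k UNIV (gnomonic s :: 'a::real_inner \<Rightarrow> _)"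
  unfolding gnomonic_def[abs_def]
  using Ck_on_sqpow[of k 1 "-1/2", where 'a='a]
  by (intro Ck_on_Pair Ck_on_scaleR Ck_on_diff Ck_on_mult Ck_on_const Ck_on_ident open_UNIV) auto

lemma stereographic_has_derivative:
  "(stereographic has_derivative (\<lambda>h. ((2 * sqpow 1 (-1) x) *\<^sub>R h - (4 * (x \<bullet> h) * sqpow 1 (-2) x) *\<^sub>R x,
      4 * (x \<bullet> h) * sqpow 1 (-2) x))) (at (x::'a::real_inner))"
proof -
  have d: "(sqpow 1 (-1) has_derivative (\<lambda>h. - 2 * (x \<bullet> h) * sqpow 1 (-2) x)) (at x)"
    using sqpow_has_derivative[of 1 x "-1"] by simp
  show ?thesis
    unfolding stereographic_def[abs_def]
    by (rule has_derivative_eq_rhs, (rule derivative_intros d)+) (auto simp: algebra_simps fun_eq_iff)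
qed

lemma stereographic_conformal:
  fixes x h k :: "'a::real_inner"
  defines "D \<equiv> \<lambda>h. ((2 * sqpow 1 (-1) x) *\<^sub>R h - (4 * (x \<bullet> h) * sqpow 1 (-2) x) *\<^sub>R x,
      4 * (x \<bullet> h) * sqpow 1 (-2) x)"
  shows "D h \<bullet> D k = (2 * sqpow 1 (-1) x)\<^sup>2 * (h \<bullet> k)"
proof -
  define l where "l = sqpow 1 (-1) x"
  have l: "l * (1 + x \<bullet> x) = 1" unfolding l_def by (rule sqpow_minus_one_mult)
  have "D h \<bullet> D k = 4 * l\<^sup>2 * (h \<bullet> k) - 16 * l ^ 3 * (x \<bullet> h) * (x \<bullet> k) + 16 * l ^ 3 * (x \<bullet> h) * (x \<bullet> k) * (l * (1 + x \<bullet> x))"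
    unfolding D_def sqpow_minus_two l_def[symmetric]
    by (simp add: inner_prod_def inner_diff_left inner_diff_right inner_commute power2_eq_square power3_eq_cube algebra_simps)
  then show ?thesis unfolding l by (simp add: l_def power2_eq_square)
qed

lemma gnomonic_has_derivative:
  "(gnomonic s has_derivative (\<lambda>h. sqpow 1 (-1/2) x *\<^sub>R (h, 0) - ((x \<bullet> h) * sqpow 1 (-3/2) x) *\<^sub>R (x, s))) (at (x::'a::real_inner))"
proof -
  have d: "(sqpow 1 (-1/2) has_derivative (\<lambda>h. - ((x \<bullet> h) * sqpow 1 (-3/2) x))) (at x)"
    using sqpow_has_derivative[of 1 x "-1/2"] by simp
  show ?thesis
    unfolding gnomonic_def[abs_def]
    by (rule has_derivative_eq_rhs, (rule derivative_intros d)+) (auto simp: algebra_simps fun_eq_iff)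
qed

lemma gnomonic_metric:
  fixes x h k :: "'a::real_inner" and s :: real
  defines "w \<equiv> sqpow 1 (-1/2) x" and "D \<equiv> \<lambda>h. sqpow 1 (-1/2) x *\<^sub>R (h, 0) - ((x \<bullet> h) * sqpow 1 (-3/2) x) *\<^sub>R (x, s)"
  assumes s: "s\<^sup>2 = 1"
  shows "D h \<bullet> D k = w\<^sup>2 * (h \<bullet> k - w\<^sup>2 * ((x \<bullet> h) * (x \<bullet> k)))"
proof -
  have l: "w\<^sup>2 * (1 + x \<bullet> x) = 1" unfolding w_def sqpow_half_sq by (rule sqpow_minus_one_mult)
  have "D h \<bullet> D k = w\<^sup>2 * (h \<bullet> k) - 2 * w ^ 4 * ((x \<bullet> h) * (x \<bullet> k)) + w ^ 4 * ((x \<bullet> h) * (x \<bullet> k)) * (w\<^sup>2 * (s\<^sup>2 + x \<bullet> x))"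
    unfolding D_def sqpow_three_half w_def[symmetric]
    by (simp add: inner_prod_def inner_diff_left inner_diff_right inner_commute power2_eq_square power3_eq_cube power4_eq_xxxx algebra_simps)
  then show ?thesis unfolding s l by (simp add: power2_eq_square power4_eq_xxxx algebra_simps)
qed

text \<open>
  The \<open>m\<close>-sphere \<open>{a + \<rho> J z | norm z = 1}\<close>; the product \<open>(real^'m) \<times> real\<close> is a convenient model of an
  \<open>(m + 1)\<close>-dimensional Euclidean space. Below, \<open>Ei p\<close> is the unit vector \<open>z\<close> that belongs to \<open>p\<close>.
\<close>

locale sphere_embedding =
  fixes b :: "'v::euclidean_space \<Rightarrow> 'v \<Rightarrow> real" and a :: 'v and \<rho> :: real
    and J :: "(real^'m::{finite,wellorder}) \<times> real \<Rightarrow> 'v"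
  assumes bil: "bilinear b" and sym: "b x y = b y x" and linJ: "linear J"
    and bJ: "b (J z) (J z') = z \<bullet> z'" and rho: "0 < \<rho>"
begin

definition E where "E z = a + \<rho> *\<^sub>R J z"
definition M where "M = E ` sphere 0 1"
definition Ji where "Ji v = (\<Sum>k\<in>Basis. b v (J k) *\<^sub>R k)"
definition Ei where "Ei v = Ji ((1 / \<rho>) *\<^sub>R (v - a))"

lemma lin_b: "linear (b x)" "linear (\<lambda>x. b x y)"
  using bil by (auto simp: bilinear_def)

lemma linJi: "linear Ji"
  unfolding Ji_def by (rule linearI) (simp_all add: bilinear_ladd[OF bil] bilinear_lmul[OF bil] sum.distrib scaleR_left_distrib scaleR_sum_right)

lemma Ji_J [simp]: "Ji (J z) = z"
  unfolding Ji_def bJ by (rule euclidean_representation)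

lemma Ei_E [simp]: "Ei (E z) = z"
  unfolding Ei_def E_def using rho by simp

lemma bounded_linear_J: "bounded_linear J" "bounded_linear Ji"
  using linJ linJi by (simp_all add: linear_conv_bounded_linear)

lemma J_diff: "J (x - y) = J x - J y" and J_scale: "J (c *\<^sub>R x) = c *\<^sub>R J x" and J_add: "J (x + y) = J x + J y"
  by (simp_all add: linear_diff[OF linJ] linear_scale[OF linJ] linear_add[OF linJ])

lemma inj_J: "inj J"
  by (metis Ji_J injI)

lemma Ck_E: "open U \<Longrightarrow> Ck_on k U E"
  unfolding E_def[abs_def]
  by (intro Ck_on_add Ck_on_const Ck_on_bounded_linear bounded_linear_compose[OF bounded_linear_scaleR_right] bounded_linear_J)

lemma Ck_Ei: "open U \<Longrightarrow> Ck_on k U Ei"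
  unfolding Ei_def[abs_def]
  by (intro Ck_on_linear_comp[OF _ bounded_linear_J(2)] Ck_on_linear_comp[OF _ bounded_linear_scaleR_right] Ck_on_diff Ck_on_const Ck_on_ident)

lemma continuous_E: "continuous_on U E" "continuous_on V Ei"
  using Ck_E[of UNIV 0] Ck_Ei[of UNIV 0] by (auto elim: continuous_on_subset)

lemma E_has_derivative: "(E has_derivative (\<lambda>h. \<rho> *\<^sub>R J h)) F"
  unfolding E_def[abs_def]
  by (rule has_derivative_eq_rhs, (rule derivative_intros bounded_linear_imp_has_derivative bounded_linear_J)+) simp

lemma compact_M: "compact M"
  unfolding M_def by (intro compact_continuous_image continuous_E) auto

lemma M_iff: "p \<in> M \<longleftrightarrow> norm (Ei p) = 1 \<and> p = E (Ei p)"
  unfolding M_def by auto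

lemma E_in_M [simp]: "E z \<in> M \<longleftrightarrow> norm z = 1"
  by (auto simp: M_iff)

definition stereo where "stereo x = E (stereographic x)"
definition gnomo where "gnomo s x = E (gnomonic s x)"
definition stereo' where "stereo' x h = \<rho> *\<^sub>R J ((2 * sqpow 1 (-1) x) *\<^sub>R h - (4 * (x \<bullet> h) * sqpow 1 (-2) x) *\<^sub>R x,
      4 * (x \<bullet> h) * sqpow 1 (-2) x)"
definition gnomo' where "gnomo' s x h = \<rho> *\<^sub>R J (sqpow 1 (-1/2) x *\<^sub>R (h, 0) - ((x \<bullet> h) * sqpow 1 (-3/2) x) *\<^sub>R (x, s))"

lemma stereo_has_derivative: "(stereo has_derivative stereo' x) (at x)"
  using diff_chain_at[OF stereographic_has_derivative E_has_derivative]
  unfolding stereo_def[abs_def] stereo'_def[abs_def] o_def .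

lemma gnomo_has_derivative: "(gnomo s has_derivative gnomo' s x) (at x)"
  using diff_chain_at[OF gnomonic_has_derivative E_has_derivative]
  unfolding gnomo_def[abs_def] gnomo'_def[abs_def] o_def .

lemma b_rho_J: "b (\<rho> *\<^sub>R J x) (\<rho> *\<^sub>R J y) = \<rho>\<^sup>2 * (x \<bullet> y)"
  by (simp add: bilinear_lmul[OF bil] bilinear_rmul[OF bil] bJ power2_eq_square)

lemma gram_stereo: "sqrt (det (gram b (stereo' x))) = (\<rho> * (2 * sqpow 1 (-1) x)) ^ CARD('m)"
proof -
  define l where "l = \<rho> * (2 * sqpow 1 (-1) x)"
  have l0: "0 \<le> l" using rho sqpow_pos[of 1 x "-1"] by (simp add: l_def less_imp_le)
  have "gram b (stereo' x) = (\<chi> i j. if i = j then l\<^sup>2 else 0)"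
    unfolding gram_def stereo'_def b_rho_J stereographic_conformal
    by (simp add: vec_eq_iff inner_axis_axis l_def power_mult_distrib)
  then have "det (gram b (stereo' x)) = (l\<^sup>2) ^ CARD('m)"
    by (simp add: det_diagonal)
  also have "\<dots> = (l ^ CARD('m))\<^sup>2" by (simp add: power_mult[symmetric] mult.commute)
  finally show ?thesis using l0 by (simp add: l_def)
qed

lemma gram_gnomo:
  assumes "s\<^sup>2 = 1"
  shows "sqrt (det (gram b (gnomo' s x))) = \<rho> ^ CARD('m) * sqpow 1 (-1/2) x ^ (CARD('m) + 1)"
proof -
  define w where "w = sqpow 1 (-1/2) x"
  have w0: "0 < w" by (simp add: w_def sqpow_pos)
  have l: "w\<^sup>2 * (1 + x \<bullet> x) = 1" unfolding w_def sqpow_half_sq by (rule sqpow_minus_one_mult)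
  have ax: "axis i (1::real) $ j = (if i = j then 1 else 0)" for i j :: 'm by (simp add: axis_def)
  have "gram b (gnomo' s x) = (\<rho>\<^sup>2 * w\<^sup>2) *\<^sub>R (\<chi> i j. (if i = j then 1 else 0) - w\<^sup>2 * (x $ i * x $ j))"
    unfolding gram_def gnomo'_def b_rho_J gnomonic_metric[OF assms]
    by (simp add: vec_eq_iff inner_axis_axis inner_axis w_def ax)
  also have "\<dots> = (\<chi> i. (\<rho>\<^sup>2 * w\<^sup>2) *s (\<chi> j. (if i = j then 1 else 0) - w\<^sup>2 * (x $ i * x $ j)))"
    by (simp add: vec_eq_iff)
  finally have "det (gram b (gnomo' s x)) = (\<rho>\<^sup>2 * w\<^sup>2) ^ CARD('m) * (1 - w\<^sup>2 * (x \<bullet> x))"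
    by (simp add: det_rows_mul det_identity_minus_rank_one)
  also have "1 - w\<^sup>2 * (x \<bullet> x) = w\<^sup>2" using l by (simp add: algebra_simps)
  also have "(\<rho>\<^sup>2 * w\<^sup>2) ^ CARD('m) * w\<^sup>2 = (\<rho> ^ CARD('m) * w ^ (CARD('m) + 1))\<^sup>2"
    by (simp add: power_mult_distrib power_add power_mult[symmetric] mult.commute[of 2] ac_simps)
  finally show ?thesis using w0 rho by (simp add: w_def)
qed

end

lemma nn_integral_inverse_one_plus_square: "(\<integral>\<^sup>+s. ennreal (1 / (1 + s\<^sup>2)) \<partial>lborel) < \<infinity>"
proof -
  have "integrable lborel (\<lambda>s::real. inverse (1 + s\<^sup>2))"
    using integrable_inverse_1_plus_square by (simp add: set_integrable_def einterval_def)
  then have "(\<integral>\<^sup>+s. ennreal (norm (inverse (1 + s\<^sup>2) :: real)) \<partial>lborel) < \<infinity>"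
    by (simp only: integrable_iff_bounded simp_thms)
  moreover have "(\<integral>\<^sup>+s. ennreal (1 / (1 + s\<^sup>2)) \<partial>lborel) = (\<integral>\<^sup>+s. ennreal (norm (inverse (1 + s\<^sup>2) :: real)) \<partial>lborel)"
    by (intro nn_integral_cong) (simp add: divide_inverse)
  ultimately show ?thesis by simp
qed

lemma nn_integral_sqpow_finite:
  "(\<integral>\<^sup>+x. ennreal (sqpow 1 (-1) x ^ CARD('m)) \<partial>(lborel :: (real^'m::finite) measure)) < \<infinity>"
proof -
  have le: "sqpow 1 (-1) x ^ CARD('m) \<le> (\<Prod>b\<in>Basis. 1 / (1 + (x \<bullet> b)\<^sup>2))" for x :: "real^'m"
  proof -
    have "sqpow 1 (-1) x ^ CARD('m) = (\<Prod>b\<in>(Basis :: (real^'m) set). sqpow 1 (-1) x)" by simp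
    also have "\<dots> \<le> (\<Prod>b\<in>Basis. 1 / (1 + (x \<bullet> b)\<^sup>2))"
    proof (rule prod_mono, safe)
      fix b :: "real^'m" assume "b \<in> Basis"
      have "(x \<bullet> b)\<^sup>2 \<le> x \<bullet> x"
        using Basis_le_norm[OF \<open>b \<in> Basis\<close>, of x] by (metis abs_le_square_iff abs_norm_cancel power2_norm_eq_inner)
      then show "sqpow 1 (-1) x \<le> 1 / (1 + (x \<bullet> b)\<^sup>2)"
        unfolding sqpow_minus_one by (intro divide_left_mono) (auto simp: add_pos_nonneg)
      show "0 \<le> sqpow 1 (-1) x" using sqpow_pos[of 1 x "-1"] by simp
    qed
    finally show ?thesis .
  qed
  have "(\<integral>\<^sup>+x. ennreal (sqpow 1 (-1) x ^ CARD('m)) \<partial>(lborel :: (real^'m) measure))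
      \<le> (\<integral>\<^sup>+x. (\<Prod>b\<in>Basis. ennreal (1 / (1 + (x \<bullet> b)\<^sup>2))) \<partial>(lborel :: (real^'m) measure))"
    by (intro nn_integral_mono) (simp add: prod_ennreal ennreal_leI[OF le])
  also have "\<dots> = (\<Prod>b\<in>(Basis :: (real^'m) set). \<integral>\<^sup>+s. ennreal (1 / (1 + s\<^sup>2)) \<partial>lborel)"
    by (rule nn_integral_lborel_prod) auto
  also have "\<dots> < \<infinity>"
    using nn_integral_inverse_one_plus_square by (simp add: power_less_top_ennreal)
  finally show ?thesis .
qed

lemma local_parametrizationI:
  fixes \<Psi> :: "real^'m::finite \<Rightarrow> 'v::real_normed_vector"
  assumes Ck: "\<And>k. Ck_on k UNIV \<Psi>" and op: "openin (top_of_set M) (range \<Psi>)"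
    and \<theta>: "\<And>x. \<theta> (\<Psi> x) = x" "\<And>x. \<theta> differentiable (at (\<Psi> x))"
  shows "local_parametrization M UNIV \<Psi>"
  unfolding local_parametrization_def
proof (intro conjI ballI)
  show "smooth_on UNIV \<Psi>" by (rule smooth_onI[of UNIV _ \<Psi>]) (use Ck in auto)
  have "continuous_on (range \<Psi>) \<theta>"
    using \<theta>(2) by (intro continuous_at_imp_continuous_on) (auto intro: differentiable_imp_continuous_within)
  moreover have "continuous_on UNIV \<Psi>" using Ck[of 0] by simp
  ultimately show "\<exists>\<psi>'. homeomorphism UNIV (range \<Psi>) \<Psi> \<psi>'"
    using \<theta>(1) by (intro exI[of _ \<theta>]) (auto simp: homeomorphism_def image_image)
  fix x
  have d: "(\<Psi> has_derivative frechet_derivative \<Psi> (at x)) (at x)"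
    by (rule Ck_on_SucD[OF open_UNIV Ck[of "Suc 0"]]) simp
  have d': "(\<theta> has_derivative frechet_derivative \<theta> (at (\<Psi> x))) (at (\<Psi> x))"
    using \<theta>(2) by (simp add: frechet_derivative_works[symmetric])
  have "((\<theta> \<circ> \<Psi>) has_derivative (frechet_derivative \<theta> (at (\<Psi> x)) \<circ> frechet_derivative \<Psi> (at x))) (at x)"
    by (rule diff_chain_at[OF d d'])
  then have "((\<lambda>x. x) has_derivative (frechet_derivative \<theta> (at (\<Psi> x)) \<circ> frechet_derivative \<Psi> (at x))) (at x)"
    by (simp add: o_def \<theta>(1))
  then have "frechet_derivative \<theta> (at (\<Psi> x)) \<circ> frechet_derivative \<Psi> (at x) = (\<lambda>x. x)"
    using has_derivative_ident has_derivative_unique by blast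
  then show "inj (frechet_derivative \<Psi> (at x))"
    by (metis comp_apply injI)
qed (use op in auto)

context sphere_embedding
begin

lemma Ei_has_derivative: "(Ei has_derivative (\<lambda>h. Ji ((1 / \<rho>) *\<^sub>R h))) F"
  unfolding Ei_def[abs_def]
  by (rule has_derivative_eq_rhs, (rule bounded_linear.has_derivative[OF bounded_linear_J(2)] derivative_intros)+) simp

definition stereo_inv where "stereo_inv v = (1 / (1 - snd (Ei v))) *\<^sub>R fst (Ei v)"
definition gnomo_inv where "gnomo_inv s v = (s / snd (Ei v)) *\<^sub>R fst (Ei v)"

lemma stereo_inv_differentiable: "snd (Ei y) \<noteq> 1 \<Longrightarrow> stereo_inv differentiable (at y)"
  unfolding stereo_inv_def[abs_def] differentiable_def
  by (rule exI, (rule derivative_intros Ei_has_derivative | simp)+)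

lemma gnomo_inv_differentiable: "snd (Ei y) \<noteq> 0 \<Longrightarrow> gnomo_inv s differentiable (at y)"
  unfolding gnomo_inv_def[abs_def] differentiable_def
  by (rule exI, (rule derivative_intros Ei_has_derivative | simp)+)

lemma sqpow_pos': "0 < sqpow 1 s (x::'x::real_inner)"
  by (rule sqpow_pos) simp

lemma stereo_inv: "stereo_inv (stereo x) = x" "snd (Ei (stereo x)) \<noteq> 1"
  using sqpow_pos'[of "-1" x] by (auto simp: stereo_inv_def stereo_def stereographic_def)

lemma gnomo_inv: "s\<^sup>2 = 1 \<Longrightarrow> gnomo_inv s (gnomo s x) = x" "s\<^sup>2 = 1 \<Longrightarrow> snd (Ei (gnomo s x)) \<noteq> 0"
  using sqpow_pos'[of "-1/2" x] by (auto simp: gnomo_inv_def gnomo_def gnomonic_def power2_eq_square)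

lemma range_stereo: "range stereo = M - {E (0, 1)}"
proof safe
  fix x show "stereo x \<in> M" by (simp add: stereo_def norm_stereographic)
  assume "stereo x = E (0, 1)"
  then show False using stereo_inv(2)[of x] by simp
next
  fix p assume p: "p \<in> M" "p \<notin> range stereo"
  obtain y s where ys: "Ei p = (y, s)" by (cases "Ei p")
  then have n: "y \<bullet> y + s * s = 1" and pE: "p = E (y, s)" using p(1) unfolding M_iff norm_eq_1 by (auto simp: inner_prod_def)
  show "p = E (0, 1)"
  proof (rule ccontr)
    assume ne: "p \<noteq> E (0, 1)"
    have s1: "s \<noteq> 1" using ne n pE by auto
    define x where "x = (1 / (1 - s)) *\<^sub>R y"
    have "1 + x \<bullet> x = 2 / (1 - s)"
    proof -
      have "1 + x \<bullet> x = ((1 - s)\<^sup>2 + y \<bullet> y) / (1 - s)\<^sup>2" using s1 by (simp add: x_def add_divide_distrib power2_eq_square)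
      also have "(1 - s)\<^sup>2 + y \<bullet> y = 2 * (1 - s)" using n by (simp add: power2_eq_square algebra_simps)
      finally show ?thesis using s1 by (simp add: power2_eq_square del: right_diff_distrib_numeral)
    qed
    then have "2 * sqpow 1 (-1) x = 1 - s" by (simp add: sqpow_minus_one)
    then have "stereographic x = (y, s)" unfolding stereographic_def x_def using s1 by simp
    then have "p = stereo x" by (simp add: stereo_def pE)
    then show False using p(2) by blast
  qed
qed

lemma range_gnomo:
  assumes s: "s\<^sup>2 = 1"
  shows "range (gnomo s) = {p \<in> M. 0 < s * snd (Ei p)}"
proof safe
  fix x show "gnomo s x \<in> M" by (simp add: gnomo_def norm_gnomonic s)
  show "0 < s * snd (Ei (gnomo s x))"
  proof -
    have "s * snd (Ei (gnomo s x)) = s\<^sup>2 * sqpow 1 (-1/2) x"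
      by (simp add: gnomo_def gnomonic_def power2_eq_square)
    then show ?thesis using s sqpow_pos'[of "-1/2" x] by simp
  qed
next
  fix p assume p: "p \<in> M" "0 < s * snd (Ei p)"
  obtain y r where ys: "Ei p = (y, r)" by (cases "Ei p")
  then have n: "y \<bullet> y + r * r = 1" and pE: "p = E (y, r)" and r: "0 < s * r" using p unfolding M_iff norm_eq_1 by (auto simp: inner_prod_def)
  have r0: "r \<noteq> 0" using r by auto
  define x where "x = (s / r) *\<^sub>R y"
  have "1 + x \<bullet> x = (r * r + s\<^sup>2 * (y \<bullet> y)) / (r * r)"
    unfolding x_def using r0 by (simp add: field_simps power2_eq_square)
  then have "1 + x \<bullet> x = 1 / (r * r)" using s n by (simp add: add.commute)
  then have "(sqpow 1 (-1/2) x)\<^sup>2 = (s * r)\<^sup>2" unfolding sqpow_half_sq sqpow_minus_one using s by (simp add: power2_eq_square ac_simps)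
  then have w: "sqpow 1 (-1/2) x = s * r"
    by (rule power2_eq_imp_eq) (use r sqpow_pos'[of "-1/2" x] in auto)
  have "gnomonic s x = (y, r)"
  proof -
    have "s * r * (s / r) = 1" "s * r * s = r" using s r0 by (simp_all add: power2_eq_square algebra_simps)
    then show ?thesis unfolding gnomonic_def w by (simp only: x_def scaleR_Pair scaleR_scaleR real_scaleR_def scaleR_one)
  qed
  then show "p \<in> range (gnomo s)" by (auto simp: gnomo_def pE image_iff intro: exI[of _ x])
qed

lemma local_parametrization_stereo: "local_parametrization M UNIV stereo"
proof (rule local_parametrizationI[of _ _ stereo_inv])
  show "Ck_on k UNIV stereo" for k
    unfolding stereo_def[abs_def] by (rule Ck_on_compose[OF open_UNIV open_UNIV _ Ck_E Ck_stereographic]) auto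
  have "M - {E (0,1)} = M \<inter> - {E (0,1)}" by auto
  then show "openin (top_of_set M) (range stereo)"
    unfolding range_stereo openin_open by (metis open_Compl closed_singleton)
qed (use stereo_inv stereo_inv_differentiable in auto)

lemma local_parametrization_gnomo: "s\<^sup>2 = 1 \<Longrightarrow> local_parametrization M UNIV (gnomo s)"
proof (rule local_parametrizationI[of _ _ "gnomo_inv s"])
  assume s: "s\<^sup>2 = 1"
  show "Ck_on k UNIV (gnomo s)" for k
    unfolding gnomo_def[abs_def] by (rule Ck_on_compose[OF open_UNIV open_UNIV _ Ck_E Ck_gnomonic]) auto
  have "open {p. 0 < s * snd (Ei p)}"
    by (intro open_Collect_less continuous_intros continuous_on_compose2[OF continuous_on_snd[OF continuous_on_id] continuous_E(2)]) auto
  moreover have "range (gnomo s) = M \<inter> {p. 0 < s * snd (Ei p)}" using range_gnomo[OF s] by auto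
  ultimately show "openin (top_of_set M) (range (gnomo s))"
    unfolding openin_open by blast
qed (use gnomo_inv gnomo_inv_differentiable in auto)

lemma riem_measure_exists: "is_riem_measure TYPE('m) b M (riem_measure TYPE('m) b M)"
proof -
  let ?\<delta> = "\<lambda>x::real^'m::_. (\<rho> * (2 * sqpow 1 (-1) x)) ^ CARD('m)"
  have "is_riem_measure TYPE('m) b M (distr (density lborel ?\<delta>) borel stereo)"
  proof (rule is_riem_measure_chart[where \<Psi>'=stereo' and \<theta>=stereo_inv and \<theta>'="\<lambda>y. frechet_derivative stereo_inv (at y)" and ?p0.0="E (0, 1)"])
    show "?\<delta> x = sqrt (det (gram b (stereo' x)))" for x by (simp add: gram_stereo)
    show "E (0, 1) \<in> M" by (simp add: norm_Pair)
    show "(stereo_inv has_derivative frechet_derivative stereo_inv (at y)) (at y)" if "y \<in> M - {E (0, 1)}" for y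
    proof -
      have "snd (Ei y) \<noteq> 1" using that stereo_inv(2) unfolding range_stereo[symmetric] by auto
      then show ?thesis using stereo_inv_differentiable by (simp add: frechet_derivative_works[symmetric])
    qed
    show "continuous_on UNIV ?\<delta>"
      using Ck_on_sqpow[of 0 1 "-1", where 'a="real^'m::_"] by (intro continuous_intros) simp
    show "0 \<le> ?\<delta> x" for x using rho sqpow_pos'[of "-1" x] by (simp add: less_imp_le)
    have "(\<integral>\<^sup>+x. ennreal (?\<delta> x) \<partial>(lborel :: (real^'m::_) measure)) = (\<integral>\<^sup>+x. ennreal ((2 * \<rho>) ^ CARD('m)) * ennreal (sqpow 1 (-1) x ^ CARD('m)) \<partial>(lborel :: (real^'m::_) measure))"
    proof (rule nn_integral_cong)
      fix x :: "real^'m::_"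
      have "?\<delta> x = (2 * \<rho>) ^ CARD('m) * sqpow 1 (-1) x ^ CARD('m)" by (simp add: power_mult_distrib)
      then show "ennreal (?\<delta> x) = ennreal ((2 * \<rho>) ^ CARD('m)) * ennreal (sqpow 1 (-1) x ^ CARD('m))"
        using rho sqpow_pos'[of "-1" x] by (simp add: ennreal_mult less_imp_le)
    qed
    also have "\<dots> = ennreal ((2 * \<rho>) ^ CARD('m)) * (\<integral>\<^sup>+x. ennreal (sqpow 1 (-1) x ^ CARD('m)) \<partial>(lborel :: (real^'m::_) measure))"
    proof (rule nn_integral_cmult)
      have "continuous_on UNIV (sqpow 1 (-1) :: real^'m::_ \<Rightarrow> real)" using Ck_on_sqpow[of 0 1 "-1", where 'a="real^'m::_"] by simp
      then have "(sqpow 1 (-1) :: real^'m::_ \<Rightarrow> real) \<in> borel_measurable borel" by (rule borel_measurable_continuous_onI)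
      then show "(\<lambda>x::real^'m::_. ennreal (sqpow 1 (-1) x ^ CARD('m))) \<in> borel_measurable lborel" by measurable
    qed
    also have "\<dots> < \<infinity>" using nn_integral_sqpow_finite[where 'm='m] by (simp add: ennreal_mult_less_top)
    finally show "(\<integral>\<^sup>+x. ennreal (?\<delta> x) \<partial>(lborel :: (real^'m::_) measure)) < \<infinity>" .
  qed (use bil compact_imp_closed[OF compact_M] stereo_has_derivative range_stereo stereo_inv in auto)
  then show ?thesis unfolding riem_measure_def by (rule someI)
qed

end

lemma negligible_AE_lborel: "negligible N \<Longrightarrow> AE x in lborel. x \<notin> N"
  using AE_not_in[of N lebesgue] by (simp add: negligible_iff_null_sets AE_completion_iff)

lemma nn_integral_lborel_scale:
  fixes f :: "'a::euclidean_space \<Rightarrow> ennreal"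
  assumes [measurable]: "f \<in> borel_measurable borel" and c: "0 < c"
  shows "(\<integral>\<^sup>+x. f x \<partial>lborel) = ennreal (c ^ DIM('a)) * (\<integral>\<^sup>+x. f (c *\<^sub>R x) \<partial>lborel)"
proof -
  have "(\<integral>\<^sup>+x. f x \<partial>lborel) = (\<integral>\<^sup>+x. f x \<partial>density (distr lborel borel (\<lambda>x. 0 + c *\<^sub>R x)) (\<lambda>_. \<bar>c\<bar> ^ DIM('a)))"
    using c by (subst lborel_affine[of c 0]) auto
  also have "\<dots> = ennreal (c ^ DIM('a)) * (\<integral>\<^sup>+x. f (c *\<^sub>R x) \<partial>lborel)"
    using c by (subst nn_integral_density; (subst nn_integral_cmult)?; (subst nn_integral_distr)?) auto
  finally show ?thesis .
qed

context sphere_embedding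
begin

abbreviation mu :: "'v measure" where "mu \<equiv> riem_measure TYPE('m) b M"

lemma sets_mu [measurable_cong]: "sets mu = sets borel" and emeasure_mu_compl: "emeasure mu (- M) = 0"
  using riem_measure_exists unfolding is_riem_measure_def by blast+

lemma space_mu [simp]: "space mu = UNIV"
  using sets_mu by (simp add: sets_eq_imp_space_eq[of mu borel])

lemma M_borel [measurable]: "M \<in> sets borel"
  using compact_M by (simp add: borel_compact)

lemma emeasure_mu_chart:
  fixes \<Psi> :: "real^'m::_ \<Rightarrow> 'v"
  assumes lp: "local_parametrization M UNIV \<Psi>" and d: "\<And>x. (\<Psi> has_derivative \<Psi>' x) (at x)"
    and A: "A \<in> sets borel" "A \<subseteq> range \<Psi>"
  shows "emeasure mu A = (\<integral>\<^sup>+x. ennreal (sqrt (det (gram b (\<Psi>' x)))) * indicator {x. \<Psi> x \<in> A} x \<partial>lborel)"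
proof -
  have "emeasure mu A = (\<integral>\<^sup>+x. ennreal (sqrt (det (gram b (frechet_derivative \<Psi> (at x))))) * indicator {x\<in>UNIV. \<Psi> x \<in> A} x \<partial>lborel)"
    using riem_measure_exists lp A unfolding is_riem_measure_def gram_def by blast
  then show ?thesis by (simp add: frechet_derivative_at[OF d, symmetric])
qed

definition hemi where "hemi s = {p \<in> M. 0 < s * snd (Ei p)}"

lemma Ei_measurable [measurable]: "Ei \<in> borel_measurable borel"
  by (rule borel_measurable_continuous_onI) (rule continuous_E)

lemma E_measurable [measurable]: "E \<in> borel_measurable borel"
  by (rule borel_measurable_continuous_onI) (rule continuous_E)

lemma snd_Ei_measurable [measurable]: "(\<lambda>p. snd (Ei p)) \<in> borel_measurable borel"
  by (rule borel_measurable_continuous_onI) (intro continuous_intros continuous_E)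

lemma hemi_borel [measurable]: "hemi s \<in> sets borel"
proof -
  have "hemi s = M \<inter> {p \<in> space borel. 0 < s * snd (Ei p)}" by (auto simp: hemi_def)
  then show ?thesis by (simp only:) measurable
qed

lemma emeasure_mu_hemi:
  assumes s: "s\<^sup>2 = 1" and A: "A \<in> sets borel"
  shows "emeasure mu (A \<inter> hemi s)
    = (\<integral>\<^sup>+x. ennreal (\<rho> ^ CARD('m) * sqpow 1 (-1/2) x ^ (CARD('m) + 1)) * indicator A (gnomo s x) \<partial>lborel)"
proof -
  have r: "hemi s = range (gnomo s)" unfolding hemi_def range_gnomo[OF s] ..
  have "emeasure mu (A \<inter> hemi s) = (\<integral>\<^sup>+x. ennreal (sqrt (det (gram b (gnomo' s x)))) * indicator {x. gnomo s x \<in> A \<inter> hemi s} x \<partial>lborel)"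
    by (rule emeasure_mu_chart[OF local_parametrization_gnomo[OF s] gnomo_has_derivative]) (auto simp: r intro: sets.Int[OF A hemi_borel[of s], unfolded r])
  then show ?thesis unfolding gram_gnomo[OF s] r by (simp add: indicator_def)
qed

lemma emeasure_mu_equator: "emeasure mu {p \<in> M. snd (Ei p) = 0} = 0"
proof -
  let ?A = "{p \<in> M. snd (Ei p) = 0}"
  have "?A = M \<inter> {p \<in> space borel. snd (Ei p) = 0}" by auto
  then have A: "?A \<in> sets borel" by (simp only:) measurable
  have "?A \<subseteq> range stereo" unfolding range_stereo by auto
  then have "emeasure mu ?A = (\<integral>\<^sup>+x. ennreal (sqrt (det (gram b (stereo' x)))) * indicator {x. stereo x \<in> ?A} x \<partial>lborel)"
    by (rule emeasure_mu_chart[OF local_parametrization_stereo stereo_has_derivative A])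
  also have "\<dots> = (\<integral>\<^sup>+x. 0 \<partial>(lborel :: (real^'m::_) measure))"
  proof (rule nn_integral_cong_AE)
    have "AE x in lborel. x \<notin> sphere (0 :: real^'m::_) 1"
      by (rule negligible_AE_lborel[OF negligible_sphere])
    then show "AE x in lborel. ennreal (sqrt (det (gram b (stereo' x)))) * indicator {x. stereo x \<in> ?A} x = 0"
    proof eventually_elim
      case (elim x)
      have "snd (Ei (stereo x)) \<noteq> 0"
      proof
        assume "snd (Ei (stereo x)) = 0"
        then have "2 * sqpow 1 (-1) x = 1" by (simp add: stereo_def stereographic_def)
        then have "x \<bullet> x = 1" using sqpow_minus_one_mult[of x] by algebra
        then show False using elim by (simp add: norm_eq_1)
      qed
      then show ?case by simp
    qed
  qed
  finally show ?thesis by simp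
qed

lemma emeasure_mu_split:
  assumes A: "A \<in> sets borel"
  shows "emeasure mu A = emeasure mu (A \<inter> hemi 1) + emeasure mu (A \<inter> hemi (-1))"
proof -
  have [measurable]: "A \<in> sets borel" by (rule A)
  have "{p \<in> M. snd (Ei p) = 0} = M \<inter> {p \<in> space borel. snd (Ei p) = 0}" by auto
  then have "{p \<in> M. snd (Ei p) = 0} \<in> sets borel" by (simp only:) measurable
  then have n: "- M \<in> null_sets mu" "{p \<in> M. snd (Ei p) = 0} \<in> null_sets mu"
    using emeasure_mu_compl emeasure_mu_equator by (auto simp: null_sets_def sets_mu)
  have "AE p in mu. p \<in> M \<and> snd (Ei p) \<noteq> 0"
    using AE_not_in[OF n(1)] AE_not_in[OF n(2)] by eventually_elim auto
  then have "emeasure mu A = emeasure mu ((A \<inter> hemi 1) \<union> (A \<inter> hemi (-1)))"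
    by (intro emeasure_eq_AE) (auto simp: hemi_def sets_mu elim: eventually_mono)
  also have "\<dots> = emeasure mu (A \<inter> hemi 1) + emeasure mu (A \<inter> hemi (-1))"
    by (rule plus_emeasure[symmetric]) (auto simp: hemi_def sets_mu)
  finally show ?thesis .
qed

definition T :: "(real^'m::_) \<times> real \<Rightarrow> 'v" where "T x = E (sgn x)"

lemma T_measurable [measurable]: "T \<in> borel_measurable borel"
  unfolding T_def[abs_def] sgn_div_norm by measurable

lemma T_scale: "0 < c \<Longrightarrow> T (c *\<^sub>R x) = T x"
  by (simp add: T_def sgn_scaleR)

lemma T_in_M: "x \<noteq> 0 \<Longrightarrow> T x \<in> M"
  by (simp add: T_def norm_sgn)

definition radial :: "(real \<Rightarrow> ennreal) \<Rightarrow> ennreal" where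
  "radial h = (\<integral>\<^sup>+r. h r * ennreal (r ^ CARD('m)) * indicator {0<..} r \<partial>lborel)"

lemma polar_hemi:
  fixes h :: "real \<Rightarrow> ennreal"
  assumes h[measurable]: "h \<in> borel_measurable borel" and A[measurable]: "A \<in> sets borel" and s: "s\<^sup>2 = 1"
  shows "ennreal (\<rho> ^ CARD('m)) * (\<integral>\<^sup>+x. h (norm x) * indicator A (T x) * indicator {0<..} (s * snd x) \<partial>lborel)
      = radial h * emeasure mu (A \<inter> hemi s)"
proof -
  have s0: "s = 1 \<or> s = -1" using s by (simp add: power2_eq_1_iff)
  define w where "w y = sqpow 1 (-1/2) y" for y :: "real^'m::_"
  have w0: "0 < w y" for y by (simp add: w_def sqpow_pos')
  have [measurable]: "w \<in> borel_measurable borel"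
    unfolding w_def[abs_def] using Ck_on_sqpow[of 0 1 "-1/2", where 'a="real^'m::_"]
    by (intro borel_measurable_continuous_onI) simp
  have "(\<lambda>x::(real^'m::_) \<times> real. s * snd x) \<in> borel_measurable borel"
    by (intro borel_measurable_continuous_onI continuous_intros)
  note [measurable] = measurable_compose[OF this borel_measurable_indicator[of "{0<..}"]]
  have Fm: "(\<lambda>x. h (norm x) * indicator A (T x) * indicator {0<..} (s * snd x)) \<in> borel_measurable borel"
    (is "?F \<in> _")
    by measurable
  have Fm': "?F \<in> borel_measurable (borel \<Otimes>\<^sub>M borel)" using Fm by (simp add: borel_prod)
  have gm: "gnomo s \<in> borel_measurable borel"
    using gnomo_has_derivative by (intro borel_measurable_continuous_onI) (meson has_derivative_continuous_on)
  note [measurable] = Fm' gm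
  have nrm: "norm (\<bar>r\<bar> *\<^sub>R y, r) = \<bar>r\<bar> / w y" "T (\<bar>r\<bar> *\<^sub>R y, r) = gnomo s y" if r: "0 < s * r" for r y
  proof -
    have e: "(\<bar>r\<bar> *\<^sub>R y, r) = \<bar>r\<bar> *\<^sub>R (y, s)" using s0 r by auto
    have g: "(y, s) = (1 / w y) *\<^sub>R gnomonic s y" using w0[of y] by (simp add: gnomonic_def w_def)
    have n: "norm (y, s) = 1 / w y" unfolding g using norm_gnomonic[OF s, of y] w0[of y] by simp
    show "norm (\<bar>r\<bar> *\<^sub>R y, r) = \<bar>r\<bar> / w y" unfolding e norm_scaleR n by simp
    have "r \<noteq> 0" using r by auto
    then show "T (\<bar>r\<bar> *\<^sub>R y, r) = gnomo s y"
      unfolding e g using w0[of y] by (simp add: T_scale) (simp add: T_def gnomo_def sgn_div_norm norm_gnomonic[OF s])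
  qed
  have "(\<integral>\<^sup>+x. ?F x \<partial>lborel) = (\<integral>\<^sup>+r. \<integral>\<^sup>+z. ?F (z, r) \<partial>lborel \<partial>lborel)"
    unfolding lborel_prod[symmetric] by (subst lborel_pair.nn_integral_snd[symmetric]) auto
  also have "\<dots> = (\<integral>\<^sup>+r. \<integral>\<^sup>+y. ennreal (\<bar>r\<bar> ^ CARD('m)) * (h (\<bar>r\<bar> / w y) * indicator A (gnomo s y)) * indicator {0<..} (s * r) \<partial>lborel \<partial>lborel)"
  proof (rule nn_integral_cong)
    fix r
    show "(\<integral>\<^sup>+z. ?F (z, r) \<partial>lborel) = (\<integral>\<^sup>+y. ennreal (\<bar>r\<bar> ^ CARD('m)) * (h (\<bar>r\<bar> / w y) * indicator A (gnomo s y)) * indicator {0<..} (s * r) \<partial>lborel)"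
    proof (cases "0 < s * r")
      case True
      then have r: "0 < \<bar>r\<bar>" by auto
      have "(\<integral>\<^sup>+z. ?F (z, r) \<partial>lborel) = ennreal (\<bar>r\<bar> ^ CARD('m)) * (\<integral>\<^sup>+y. ?F (\<bar>r\<bar> *\<^sub>R y, r) \<partial>lborel)"
        by (subst nn_integral_lborel_scale[OF _ r]) auto
      also have "\<dots> = ennreal (\<bar>r\<bar> ^ CARD('m)) * (\<integral>\<^sup>+y. h (\<bar>r\<bar> / w y) * indicator A (gnomo s y) \<partial>lborel)"
        using True by (simp add: nrm)
      finally show ?thesis using True by (simp add: nn_integral_cmult)
    qed auto
  qed
  also have "\<dots> = (\<integral>\<^sup>+y. \<integral>\<^sup>+r. ennreal (\<bar>r\<bar> ^ CARD('m)) * (h (\<bar>r\<bar> / w y) * indicator A (gnomo s y)) * indicator {0<..} (s * r) \<partial>lborel \<partial>lborel)"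
    by (rule lborel_pair.Fubini') measurable
  also have "\<dots> = (\<integral>\<^sup>+y. ennreal (w y ^ (CARD('m) + 1)) * indicator A (gnomo s y) * radial h \<partial>lborel)"
  proof (rule nn_integral_cong)
    fix y
    have "(\<integral>\<^sup>+r. ennreal (\<bar>r\<bar> ^ CARD('m)) * (h (\<bar>r\<bar> / w y) * indicator A (gnomo s y)) * indicator {0<..} (s * r) \<partial>lborel)
      = ennreal \<bar>s * w y\<bar> * (\<integral>\<^sup>+q. ennreal (\<bar>0 + s * w y * q\<bar> ^ CARD('m)) * (h (\<bar>0 + s * w y * q\<bar> / w y) * indicator A (gnomo s y)) * indicator {0<..} (s * (0 + s * w y * q)) \<partial>lborel)"
      by (rule nn_integral_real_affine) (use w0[of y] s0 in \<open>auto, measurable\<close>)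
    also have "\<dots> = ennreal (w y) * (\<integral>\<^sup>+q. ennreal (w y ^ CARD('m)) * indicator A (gnomo s y) * (h q * ennreal (q ^ CARD('m)) * indicator {0<..} q) \<partial>lborel)"
    proof (rule arg_cong2[where f=times, OF _ nn_integral_cong])
      show "ennreal \<bar>s * w y\<bar> = ennreal (w y)" using w0[of y] s0 by (auto simp: abs_mult)
      fix q
      have e1: "s * (0 + s * w y * q) = w y * q" using s by (simp add: power2_eq_square mult.assoc[symmetric])
      have e2: "\<bar>0 + s * w y * q\<bar> = w y * q" if "0 < q" using that w0[of y] s0 by (auto simp: abs_mult)
      have e3: "w y * q / w y = q" using w0[of y] by simp
      show "ennreal (\<bar>0 + s * w y * q\<bar> ^ CARD('m)) * (h (\<bar>0 + s * w y * q\<bar> / w y) * indicator A (gnomo s y)) * indicator {0<..} (s * (0 + s * w y * q))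
        = ennreal (w y ^ CARD('m)) * indicator A (gnomo s y) * (h q * ennreal (q ^ CARD('m)) * indicator {0<..} q)"
      proof (cases "0 < q")
        case True
        show ?thesis unfolding e1 e2[OF True] e3 using True w0[of y]
          by (simp add: power_mult_distrib ennreal_mult less_imp_le ac_simps)
      next
        case False
        then have "\<not> 0 < w y * q" using w0[of y] by (simp add: zero_less_mult_iff)
        then show ?thesis unfolding e1 using False by simp
      qed
    qed
    also have "\<dots> = ennreal (w y) * (ennreal (w y ^ CARD('m)) * indicator A (gnomo s y) * radial h)"
      unfolding radial_def by (subst nn_integral_cmult) auto
    also have "\<dots> = ennreal (w y ^ (CARD('m) + 1)) * indicator A (gnomo s y) * radial h"
      using w0[of y] by (simp add: ennreal_mult less_imp_le ac_simps)
    finally show "(\<integral>\<^sup>+r. ennreal (\<bar>r\<bar> ^ CARD('m)) * (h (\<bar>r\<bar> / w y) * indicator A (gnomo s y)) * indicator {0<..} (s * r) \<partial>lborel)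
      = ennreal (w y ^ (CARD('m) + 1)) * indicator A (gnomo s y) * radial h" .
  qed
  also have "\<dots> = (\<integral>\<^sup>+y. ennreal (w y ^ (CARD('m) + 1)) * indicator A (gnomo s y) \<partial>lborel) * radial h"
    by (rule nn_integral_multc) measurable
  finally have "ennreal (\<rho> ^ CARD('m)) * (\<integral>\<^sup>+x. ?F x \<partial>lborel)
     = radial h * (ennreal (\<rho> ^ CARD('m)) * (\<integral>\<^sup>+y. ennreal (w y ^ (CARD('m) + 1)) * indicator A (gnomo s y) \<partial>lborel))"
    by (simp add: ac_simps)
  also have "ennreal (\<rho> ^ CARD('m)) * (\<integral>\<^sup>+y. ennreal (w y ^ (CARD('m) + 1)) * indicator A (gnomo s y) \<partial>lborel) = emeasure mu (A \<inter> hemi s)"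
    unfolding emeasure_mu_hemi[OF s A] w_def[symmetric]
    using rho w0 by (subst nn_integral_cmult[symmetric]) (auto intro!: nn_integral_cong simp: ennreal_mult less_imp_le mult.assoc)
  finally show ?thesis .
qed

lemma polar:
  fixes h :: "real \<Rightarrow> ennreal"
  assumes h[measurable]: "h \<in> borel_measurable borel" and A[measurable]: "A \<in> sets borel"
  shows "ennreal (\<rho> ^ CARD('m)) * (\<integral>\<^sup>+x. h (norm x) * indicator A (T x) \<partial>lborel) = radial h * emeasure mu A"
proof -
  have m: "(\<lambda>x::(real^'m::_) \<times> real. h (norm x) * indicator A (T x) * indicator {0<..} (s * snd x)) \<in> borel_measurable borel" for s
  proof -
    have "(\<lambda>x::(real^'m::_) \<times> real. s * snd x) \<in> borel_measurable borel"
      by (intro borel_measurable_continuous_onI continuous_intros)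
    note [measurable] = measurable_compose[OF this borel_measurable_indicator[of "{0<..}"]]
    show ?thesis by measurable
  qed
  have "(\<integral>\<^sup>+x. h (norm x) * indicator A (T x) \<partial>lborel)
    = (\<integral>\<^sup>+x. h (norm x) * indicator A (T x) * indicator {0<..} (1 * snd x) + h (norm x) * indicator A (T x) * indicator {0<..} (-1 * snd x) \<partial>lborel)"
  proof (rule nn_integral_cong_AE)
    have "negligible {x :: (real^'m::_) \<times> real. x \<bullet> (0, 1) = 0}"
      by (rule negligible_standard_hyperplane) (simp add: Basis_prod_def)
    from negligible_AE_lborel[OF this]
    show "AE x in lborel. h (norm x) * indicator A (T x) = h (norm x) * indicator A (T x) * indicator {0<..} (1 * snd x) + h (norm x) * indicator A (T x) * indicator {0<..} (-1 * snd x)"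
      by eventually_elim (auto simp: inner_prod_def split: split_indicator)
  qed
  also have "\<dots> = (\<integral>\<^sup>+x. h (norm x) * indicator A (T x) * indicator {0<..} (1 * snd x) \<partial>lborel) + (\<integral>\<^sup>+x. h (norm x) * indicator A (T x) * indicator {0<..} (-1 * snd x) \<partial>lborel)"
    by (rule nn_integral_add; unfold measurable_lborel2; rule m)
  finally show ?thesis
    using polar_hemi[OF h A, of 1] polar_hemi[OF h A, of "-1"] emeasure_mu_split[OF A]
    by (simp add: distrib_left)
qed

lemma polar_measure:
  fixes h :: "real \<Rightarrow> ennreal"
  assumes h[measurable]: "h \<in> borel_measurable borel"
  shows "distr (density lborel (\<lambda>x. h (norm x))) borel T = density mu (\<lambda>_. ennreal (1 / \<rho> ^ CARD('m)) * radial h)"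
proof (rule measure_eqI)
  fix A assume "A \<in> sets (distr (density lborel (\<lambda>x. h (norm x))) borel T)"
  then have A[measurable]: "A \<in> sets borel" by simp
  have "T -` A \<in> sets borel" using measurable_sets[OF T_measurable A] by simp
  then have "emeasure (distr (density lborel (\<lambda>x. h (norm x))) borel T) A = (\<integral>\<^sup>+x. h (norm x) * indicator A (T x) \<partial>lborel)"
    by (simp add: emeasure_distr emeasure_density indicator_def vimage_def cong: if_cong)
  also have "\<dots> = ennreal (1 / \<rho> ^ CARD('m)) * (ennreal (\<rho> ^ CARD('m)) * (\<integral>\<^sup>+x. h (norm x) * indicator A (T x) \<partial>lborel))"
    unfolding mult.assoc[symmetric] using rho by (simp add: ennreal_mult[symmetric])
  also have "\<dots> = ennreal (1 / \<rho> ^ CARD('m)) * radial h * emeasure mu A" by (simp add: polar ac_simps)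
  finally show "emeasure (distr (density lborel (\<lambda>x. h (norm x))) borel T) A = emeasure (density mu (\<lambda>_. ennreal (1 / \<rho> ^ CARD('m)) * radial h)) A"
    by (simp add: emeasure_density_const sets_mu)
qed (simp add: sets_mu)

end

definition orthonormal :: "('a \<Rightarrow> 'a \<Rightarrow> real) \<Rightarrow> ('i \<Rightarrow> 'a) \<Rightarrow> bool" where
  "orthonormal b e \<longleftrightarrow> (\<forall>i j. b (e i) (e j) = (if i = j then 1 else 0))"

lemma orthonormalD: "orthonormal b e \<Longrightarrow> b (e i) (e j) = (if i = j then 1 else 0)"
  by (simp add: orthonormal_def)

lemma orthonormal_inj:
  assumes "orthonormal b e" shows "inj e"
proof (rule injI)
  fix i j assume "e i = e j"
  then have "b (e i) (e i) = b (e i) (e j)" by simp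
  then show "i = j" using orthonormalD[OF assms, of i i] orthonormalD[OF assms, of i j] by (auto split: if_splits)
qed

lemma orthonormal_basis_iff: "orthonormal_basis b S e \<longleftrightarrow> orthonormal b e \<and> span (range e) = S"
  by (simp add: orthonormal_basis_def orthonormal_def)

lemma orthonormal_coeff:
  assumes "bilinear b" "orthonormal b e"
  shows "b (\<Sum>i\<in>UNIV. c i *\<^sub>R e i) (e (j::'i::finite)) = c j"
proof -
  have l: "linear (\<lambda>x. b x y)" for y using assms(1) by (simp add: bilinear_def)
  show ?thesis
    by (simp add: linear_sum[OF l] bilinear_lmul[OF assms(1)] orthonormalD[OF assms(2)] sum.delta if_distrib[of "times _"] cong: if_cong)
qed

lemma orthonormal_expand:
  fixes e :: "'i::finite \<Rightarrow> 'a::real_vector"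
  assumes "bilinear b" "orthonormal b e" "v \<in> span (range e)"
  shows "v = (\<Sum>i\<in>UNIV. b v (e i) *\<^sub>R e i)"
proof -
  have "\<exists>c. v = (\<Sum>i\<in>UNIV. c i *\<^sub>R e i)"
    using assms(3)
  proof (induction rule: span_induct_alt)
    case base
    show ?case by (rule exI[of _ "\<lambda>_. 0"]) simp
  next
    case (step k x y)
    then obtain i c where "x = e i" "y = (\<Sum>i\<in>UNIV. c i *\<^sub>R e i)" by auto
    then show ?case
      by (intro exI[of _ "\<lambda>j. (if j = i then k else 0) + c j"])
        (simp add: scaleR_left_distrib sum.distrib if_distrib[of "\<lambda>z. z *\<^sub>R _"] cong: if_cong)
  qed
  then obtain c where c: "v = (\<Sum>i\<in>UNIV. c i *\<^sub>R e i)" by blast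
  then have "b v (e j) = c j" for j using orthonormal_coeff[OF assms(1,2)] by simp
  then show ?thesis using c by simp
qed

lemma orthonormal_Parseval:
  fixes e :: "'i::finite \<Rightarrow> 'a::real_vector"
  assumes "bilinear b" "orthonormal b e" "v \<in> span (range e)" 
  shows "b w v = (\<Sum>i\<in>UNIV. b v (e i) * b w (e i))"
proof -
  have l: "linear (b w)" using assms(1) by (simp add: bilinear_def)
  have "b w v = b w (\<Sum>i\<in>UNIV. b v (e i) *\<^sub>R e i)" using orthonormal_expand[OF assms] by simp
  then show ?thesis by (simp add: linear_sum[OF l] bilinear_rmul[OF assms(1)])
qed

lemma orthonormal_independent:
  fixes e :: "'i::finite \<Rightarrow> 'a::real_vector"
  assumes "bilinear b" "orthonormal b e"
  shows "independent (range e)"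
proof (rule independent_if_scalars_zero)
  fix f x assume s: "(\<Sum>x\<in>range e. f x *\<^sub>R x) = 0" and "x \<in> range e"
  then obtain j where x: "x = e j" by auto
  have "(\<Sum>i\<in>UNIV. f (e i) *\<^sub>R e i) = 0"
    using s by (simp add: sum.reindex[OF orthonormal_inj[OF assms(2)]])
  then have "b 0 (e j) = f (e j)" using orthonormal_coeff[OF assms, of "\<lambda>i. f (e i)" j] by simp
  then show "f x = 0" by (simp add: x bilinear_lzero[OF assms(1)])
qed simp

lemma orthonormal_span:
  fixes e :: "'i::finite \<Rightarrow> 'a::euclidean_space"
  assumes "bilinear b" "orthonormal b e" "range e \<subseteq> K" "subspace K" "dim K = CARD('i)"
  shows "span (range e) = K"
proof (rule antisym)
  show "span (range e) \<subseteq> K" using assms(3,4) by (rule span_minimal)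
  have "card (range e) = CARD('i)" using orthonormal_inj[OF assms(2)] by (simp add: card_image)
  then show "K \<subseteq> span (range e)"
    using card_ge_dim_independent[OF assms(3) orthonormal_independent[OF assms(1,2)]] assms(5) by simp
qed

lemma dim_orthonormal_span:
  fixes e :: "'i::finite \<Rightarrow> 'a::euclidean_space"
  assumes "bilinear b" "orthonormal b e"
  shows "dim (span (range e)) = CARD('i)"
  using orthonormal_independent[OF assms] orthonormal_inj[OF assms(2)]
  by (simp add: dim_eq_card_independent card_image)

lemma orthonormal_set_exists:
  fixes b :: "'a::euclidean_space \<Rightarrow> 'a \<Rightarrow> real"
  assumes b: "bilinear b" and sym: "\<And>x y. b x y = b y x"
  shows "subspace K \<Longrightarrow> (\<And>k. k \<in> K \<Longrightarrow> k \<noteq> 0 \<Longrightarrow> 0 < b k k) \<Longrightarrow> dim K = n \<Longrightarrow>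
    \<exists>B. B \<subseteq> K \<and> finite B \<and> card B = n \<and> (\<forall>x\<in>B. \<forall>y\<in>B. b x y = (if x = y then 1 else 0))"
proof (induction n arbitrary: K)
  case 0
  then show ?case by (intro exI[of _ "{}"]) auto
next
  case (Suc n)
  then have "\<exists>k\<in>K. k \<noteq> 0" using dim_eq_0[of K] by auto
  then obtain k where k: "k \<in> K" "k \<noteq> 0" by blast
  then have bk: "0 < b k k" using Suc.prems by blast
  define u where "u = (1 / sqrt (b k k)) *\<^sub>R k"
  have u: "u \<in> K" using k Suc.prems(1) by (simp add: u_def subspace_mul)
  have uu: "b u u = 1" using bk by (simp add: u_def bilinear_lmul[OF b] bilinear_rmul[OF b])
  define K' where "K' = {v \<in> K. b v u = 0}"
  have K': "subspace K'"
    using Suc.prems(1) unfolding subspace_def K'_def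
    by (auto simp: bilinear_lzero[OF b] bilinear_ladd[OF b] bilinear_lmul[OF b])
  have uK': "u \<notin> span K'" using K' uu by (auto simp: K'_def span_eq_iff[THEN iffD2])
  have "span (insert u K') = K"
  proof
    show "span (insert u K') \<subseteq> K" using u Suc.prems(1) by (intro span_minimal) (auto simp: K'_def)
    show "K \<subseteq> span (insert u K')"
    proof
      fix v assume v: "v \<in> K"
      have "v - b v u *\<^sub>R u \<in> K'"
        using v u uu Suc.prems(1) by (simp add: K'_def subspace_diff subspace_mul bilinear_lsub[OF b] bilinear_lmul[OF b])
      then have "(v - b v u *\<^sub>R u) + b v u *\<^sub>R u \<in> span (insert u K')"
        by (intro span_add span_scale) (auto intro: span_base)
      then show "v \<in> span (insert u K')" by simp
    qed
  qed
  then have "dim K = dim (insert u K')" by (metis dim_span)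
  then have "dim K' = n" using Suc.prems(3) uK' by (simp add: dim_insert)
  then obtain B where B: "B \<subseteq> K'" "finite B" "card B = n" "\<forall>x\<in>B. \<forall>y\<in>B. b x y = (if x = y then 1 else 0)"
    using Suc.IH[OF K'] Suc.prems(2) by (auto simp: K'_def)
  have "u \<notin> B" using B(1) uK' span_base by blast
  then show ?case using B u uu
    by (intro exI[of _ "insert u B"]) (auto simp: K'_def sym)
qed

lemma orthonormal_exists:
  fixes b :: "'a::euclidean_space \<Rightarrow> 'a \<Rightarrow> real"
  assumes b: "bilinear b" "\<And>x y. b x y = b y x" and K: "subspace K" "dim K = CARD('i::finite)"
    and pos: "\<And>k. k \<in> K \<Longrightarrow> k \<noteq> 0 \<Longrightarrow> 0 < b k k"
  shows "\<exists>e::'i \<Rightarrow> 'a. orthonormal b e \<and> span (range e) = K"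
proof -
  obtain B where B: "B \<subseteq> K" "finite B" "card B = CARD('i)" "\<forall>x\<in>B. \<forall>y\<in>B. b x y = (if x = y then 1 else 0)"
    using orthonormal_set_exists[OF b K(1) pos K(2)] by blast
  then obtain e where e: "bij_betw e (UNIV :: 'i set) B"
    using finite_same_card_bij[of "UNIV :: 'i set" B] by auto
  have "orthonormal b e"
    using B(4) e unfolding orthonormal_def bij_betw_def by (metis UNIV_I imageI inj_eq)
  moreover have "range e \<subseteq> K" using e B(1) by (auto simp: bij_betw_def)
  ultimately show ?thesis using orthonormal_span[OF b(1) _ _ K] by blast
qed

lemma Ck_norm: "Ck_on k (- {0}) (norm :: 'a::real_inner \<Rightarrow> real)"
proof -
  have "Ck_on k (- {0}) (sqpow 0 (1/2) :: 'a \<Rightarrow> real)"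
    by (rule Ck_on_subset[OF _ _ Ck_on_sqpow]) auto
  then show ?thesis
    by (rule Ck_on_cong[rotated -1]) (auto simp: sqpow_def norm_eq_sqrt_inner powr_half_sqrt)
qed

lemma Ck_sgn: "Ck_on k (- {0}) (sgn :: 'a::real_inner \<Rightarrow> 'a)"
proof -
  have "Ck_on k (- {0}) (sqpow 0 (-1/2) :: 'a \<Rightarrow> real)"
    by (rule Ck_on_subset[OF _ _ Ck_on_sqpow]) auto
  then have "Ck_on k (- {0}) (\<lambda>x::'a. sqpow 0 (-1/2) x *\<^sub>R x)"
    by (intro Ck_on_scaleR Ck_on_ident) auto
  then show ?thesis
    by (rule Ck_on_cong[rotated -1]) (auto simp: sqpow_def sgn_div_norm norm_eq_sqrt_inner powr_half_sqrt powr_minus)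
qed

lemma sgn_has_derivative:
  fixes x :: "'a::real_inner"
  assumes "x \<noteq> 0"
  shows "(sgn has_derivative (\<lambda>v. (1 / norm x) *\<^sub>R (v - (sgn x \<bullet> v) *\<^sub>R sgn x))) (at x)"
proof -
  have n: "(norm has_derivative (\<lambda>v. v \<bullet> sgn x)) (at x)"
    using has_derivative_norm[OF assms] .
  have "((\<lambda>x. inverse (norm x) *\<^sub>R x) has_derivative
      (\<lambda>v. inverse (norm x) *\<^sub>R v + (- (inverse (norm x) * (v \<bullet> sgn x) * inverse (norm x))) *\<^sub>R x)) (at x)"
    by (rule has_derivative_scaleR[OF Deriv.has_derivative_inverse[OF _ n] has_derivative_ident]) (use assms in simp)
  moreover have "inverse (norm x) *\<^sub>R v + (- (inverse (norm x) * (v \<bullet> sgn x) * inverse (norm x))) *\<^sub>R x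
      = (1 / norm x) *\<^sub>R (v - (sgn x \<bullet> v) *\<^sub>R sgn x)" for v
  proof -
    have "v \<bullet> sgn x = sgn x \<bullet> v" by (rule inner_commute)
    then show ?thesis
      unfolding scaleR_diff_right by (simp add: sgn_div_norm[of x] divide_inverse)
  qed
  moreover have "sgn = (\<lambda>x::'a. inverse (norm x) *\<^sub>R x)" by (simp add: fun_eq_iff sgn_div_norm)
  ultimately show ?thesis by simp
qed

context sphere_embedding
begin

definition V where "V = measure mu UNIV"

lemma gauss_density_radial: "\<exists>W. W \<in> borel_measurable borel \<and> (\<forall>x::(real^'m::_) \<times> real. gauss_density x = W (norm x)) \<and> (\<forall>r. 0 \<le> W r)"
  by (rule exI[of _ "\<lambda>r. (1 / sqrt (2 * pi)) ^ DIM((real^'m::_) \<times> real) * exp (- r\<^sup>2 / 2)"])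
    (auto simp: gauss_density_eq)

lemma polar_gauss_exists:
  fixes H :: "real \<Rightarrow> real"
  assumes H[measurable]: "H \<in> borel_measurable borel" and H0: "\<And>r. 0 \<le> H r"
  shows "\<exists>k. distr (density gauss (\<lambda>x. ennreal (H (norm x)))) borel T = density mu (\<lambda>_. k)"
proof -
  obtain W where W[measurable]: "W \<in> borel_measurable borel" and We: "\<And>x::(real^'m::_) \<times> real. gauss_density x = W (norm x)" and W0: "\<And>r. 0 \<le> W r"
    using gauss_density_radial by blast
  have "density gauss (\<lambda>x. ennreal (H (norm x))) = density lborel (\<lambda>x::(real^'m::_) \<times> real. ennreal (W (norm x)) * ennreal (H (norm x)))"
    unfolding gauss_def We by (rule density_density_eq) measurable
  then have e: "density gauss (\<lambda>x. ennreal (H (norm x))) = density lborel (\<lambda>x::(real^'m::_) \<times> real. (\<lambda>r. ennreal (W r) * ennreal (H r)) (norm x))"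
    by simp
  show ?thesis unfolding e by (rule exI, rule polar_measure) measurable
qed

lemma mu_mass: "0 < V" "emeasure mu UNIV = ennreal V" "finite_measure mu"
proof -
  obtain k where k: "distr (density gauss (\<lambda>x. ennreal 1)) borel T = density mu (\<lambda>_. k)"
    using polar_gauss_exists[of "\<lambda>_. 1"] by auto
  have "emeasure (distr (density gauss (\<lambda>x. ennreal 1)) borel T) UNIV = 1"
    by (simp add: emeasure_distr emeasure_density emeasure_gauss_UNIV)
  then have 1: "k * emeasure mu UNIV = 1"
    unfolding k using emeasure_density_const[of UNIV mu k] by (simp add: sets_mu)
  then have n: "emeasure mu UNIV \<noteq> \<infinity>" "emeasure mu UNIV \<noteq> 0"
    by (auto simp: ennreal_mult_top split: if_splits)
  show fin: "finite_measure mu" by (rule finite_measureI) (use n in simp)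
  then show e: "emeasure mu UNIV = ennreal V" unfolding V_def
    by (simp add: finite_measure.emeasure_eq_measure)
  then show "0 < V" using n by (metis V_def ennreal_0 less_eq_real_def measure_nonneg)
qed

lemma polar_gauss:
  fixes H :: "real \<Rightarrow> real"
  assumes H[measurable]: "H \<in> borel_measurable borel" and H0: "\<And>r. 0 \<le> H r"
    and C: "(\<integral>\<^sup>+x. ennreal (H (norm x)) \<partial>(gauss :: ((real^'m::_) \<times> real) measure)) = ennreal C" "0 \<le> C"
  shows "distr (density gauss (\<lambda>x. ennreal (H (norm x)))) borel T = density mu (\<lambda>_. ennreal (C / V))"
proof -
  obtain k where k: "distr (density gauss (\<lambda>x. ennreal (H (norm x)))) borel T = density mu (\<lambda>_. k)"
    using polar_gauss_exists[OF H H0] by auto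
  have "emeasure (distr (density gauss (\<lambda>x. ennreal (H (norm x)))) borel T) UNIV = ennreal C"
    using C by (simp add: emeasure_distr emeasure_density)
  then have "k * ennreal V = ennreal C"
    unfolding k using emeasure_density_const[of UNIV mu k] mu_mass by (simp add: sets_mu)
  then have "k = ennreal (C / V)"
    using mu_mass(1) by (metis divide_ennreal C(2) ennreal_mult_divide_eq ennreal_neq_top ennreal_eq_0_iff linorder_not_le)
  then show ?thesis using k by simp
qed

lemma nn_integral_gauss_norm_sq: "(\<integral>\<^sup>+x. ennreal ((norm x)\<^sup>2) \<partial>(gauss :: 'x::euclidean_space measure)) = ennreal (real DIM('x))"
proof -
  have "(\<integral>\<^sup>+x. ennreal ((norm x)\<^sup>2) \<partial>(gauss :: 'x measure)) = (\<integral>\<^sup>+x. (\<Sum>i\<in>Basis. ennreal ((x \<bullet> i)\<^sup>2)) \<partial>(gauss :: 'x measure))"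
    unfolding power2_norm_eq_inner by (intro nn_integral_cong) (simp add: euclidean_inner[of x x for x] power2_eq_square)
  also have "\<dots> = (\<Sum>i\<in>(Basis :: 'x set). 1)"
    by (simp add: nn_integral_sum gauss_moment2_basis del: sum_ennreal)
  finally show ?thesis by (simp add: ennreal_of_nat_eq_real_of_nat)
qed

lemma mu_AE_M: "AE p in mu. p \<in> M"
proof -
  have "- M \<in> null_sets mu" using emeasure_mu_compl by (auto simp: null_sets_def sets_mu)
  from AE_not_in[OF this] show ?thesis by simp
qed

lemma integrable_mu_continuous:
  fixes f :: "'v \<Rightarrow> real"
  assumes "continuous_on M f"
  shows "set_integrable mu M f"
  unfolding set_integrable_def
proof -
  interpret finite_measure mu by (rule mu_mass)
  have "bounded (f ` M)" using assms compact_M by (intro compact_imp_bounded compact_continuous_image)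
  then obtain K where K: "\<And>p. p \<in> M \<Longrightarrow> norm (f p) \<le> K" by (auto simp: bounded_iff)
  show "integrable mu (\<lambda>p. indicator M p *\<^sub>R f p)"
  proof (rule integrable_const_bound[of _ "max K 0"])
    show "AE p in mu. norm (indicator M p *\<^sub>R f p) \<le> max K 0"
      using K by (intro AE_I2) (auto split: split_indicator intro: max.coboundedI1)
    show "(\<lambda>p. indicator M p *\<^sub>R f p) \<in> borel_measurable mu"
      using borel_measurable_continuous_on_indicator[OF M_borel assms] by (simp add: measurable_cong_sets[OF sets_mu refl])
  qed
qed

lemma integral_gauss_T:
  fixes F :: "'v \<Rightarrow> real" and H :: "real \<Rightarrow> real"
  assumes F[measurable]: "F \<in> borel_measurable borel"
    and H[measurable]: "H \<in> borel_measurable borel" and H0: "\<And>r. 0 \<le> H r"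
    and C: "(\<integral>\<^sup>+x. ennreal (H (norm x)) \<partial>(gauss :: ((real^'m::_) \<times> real) measure)) = ennreal C" "0 \<le> C"
  shows "(\<integral>x. H (norm x) * F (T x) \<partial>gauss) = C / V * (\<integral>p. F p \<partial>mu)"
    and "(\<And>p. 0 \<le> F p) \<Longrightarrow> (\<integral>\<^sup>+x. ennreal (H (norm x) * F (T x)) \<partial>gauss) = ennreal (C / V) * (\<integral>\<^sup>+p. ennreal (F p) \<partial>mu)"
proof -
  have V0: "0 \<le> C / V" using C(2) mu_mass(1) by simp
  have [measurable]: "F \<in> borel_measurable mu" by (simp add: measurable_cong_sets[OF sets_mu refl])
  have "(\<integral>x. H (norm x) * F (T x) \<partial>gauss) = (\<integral>x. F (T x) \<partial>density gauss (\<lambda>x. ennreal (H (norm x))))"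
    by (subst integral_density) (auto simp: H0)
  also have "\<dots> = (\<integral>p. F p \<partial>distr (density gauss (\<lambda>x. ennreal (H (norm x)))) borel T)"
    by (subst integral_distr) auto
  also have "\<dots> = (\<integral>p. F p \<partial>density mu (\<lambda>_. ennreal (C / V)))"
    by (simp only: polar_gauss[OF H H0 C])
  also have "\<dots> = C / V * (\<integral>p. F p \<partial>mu)"
    by (subst integral_density) (auto simp: V0)
  finally show "(\<integral>x. H (norm x) * F (T x) \<partial>gauss) = C / V * (\<integral>p. F p \<partial>mu)" .
  assume F0: "\<And>p. 0 \<le> F p"
  have "(\<integral>\<^sup>+x. ennreal (H (norm x) * F (T x)) \<partial>gauss) = (\<integral>\<^sup>+x. ennreal (F (T x)) \<partial>density gauss (\<lambda>x. ennreal (H (norm x))))"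
    by (subst nn_integral_density) (auto simp: H0 F0 ennreal_mult)
  also have "\<dots> = (\<integral>\<^sup>+p. ennreal (F p) \<partial>distr (density gauss (\<lambda>x. ennreal (H (norm x)))) borel T)"
    by (subst nn_integral_distr) auto
  also have "\<dots> = (\<integral>\<^sup>+p. ennreal (F p) \<partial>density mu (\<lambda>_. ennreal (C / V)))"
    by (simp only: polar_gauss[OF H H0 C])
  also have "\<dots> = ennreal (C / V) * (\<integral>\<^sup>+p. ennreal (F p) \<partial>mu)"
    by (subst nn_integral_density) (auto simp: nn_integral_cmult)
  finally show "(\<integral>\<^sup>+x. ennreal (H (norm x) * F (T x)) \<partial>gauss) = ennreal (C / V) * (\<integral>\<^sup>+p. ennreal (F p) \<partial>mu)" .
qed

lemma gauss_norm_moment1: "\<exists>C\<ge>0. (\<integral>\<^sup>+x. ennreal (norm x) \<partial>(gauss :: ((real^'m::_) \<times> real) measure)) = ennreal C"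
proof -
  have "(\<integral>\<^sup>+x. ennreal (norm x) \<partial>(gauss :: ((real^'m::_) \<times> real) measure)) \<le> (\<integral>\<^sup>+x. 1 + ennreal ((norm x)\<^sup>2) \<partial>(gauss :: ((real^'m::_) \<times> real) measure))"
  proof (rule nn_integral_mono)
    fix x :: "(real^'m::_) \<times> real"
    have "norm x \<le> 1 + (norm x)\<^sup>2"
    proof -
      have "0 \<le> (norm x - 1)\<^sup>2" by simp
      then have "2 * norm x \<le> 1 + (norm x)\<^sup>2" by (simp add: power2_eq_square algebra_simps)
      then show ?thesis using norm_ge_zero[of x] by linarith
    qed
    then show "ennreal (norm x) \<le> 1 + ennreal ((norm x)\<^sup>2)"
      by (metis ennreal_1 ennreal_leI ennreal_plus zero_le_one zero_le_power2)
  qed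
  also have "\<dots> = 1 + ennreal (real DIM((real^'m::_) \<times> real))"
    by (subst nn_integral_add) (auto simp: emeasure_gauss_UNIV nn_integral_gauss_norm_sq simp del: DIM_prod)
  also have "\<dots> < \<infinity>" by simp
  finally show ?thesis
    by (metis ennreal_cases enn2real_nonneg less_irrefl infinity_ennreal_def)
qed

lemma integral_mu_odd:
  fixes l :: "(real^'m::_) \<times> real"
  shows "(LINT p:M|mu. Ei p \<bullet> l) = 0"
proof -
  define F where "F p = indicator M p * (Ei p \<bullet> l)" for p
  have Fm: "F \<in> borel_measurable borel"
    unfolding F_def[abs_def]
    by (intro borel_measurable_times borel_measurable_indicator M_borel borel_measurable_inner Ei_measurable borel_measurable_const)
  obtain C where C: "0 \<le> C" "(\<integral>\<^sup>+x. ennreal (norm x) \<partial>(gauss :: ((real^'m::_) \<times> real) measure)) = ennreal C"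
    using gauss_norm_moment1 by blast
  have FT: "F (T x) = sgn x \<bullet> l" if "x \<noteq> 0" for x
    using that T_in_M[OF that] by (simp add: F_def) (simp add: T_def)
  have e: "(1 / V) * (\<integral>p. F p \<partial>mu) = (\<integral>x. 1 * F (T x) \<partial>gauss)"
    using integral_gauss_T(1)[OF Fm, of "\<lambda>_. 1" 1] by (simp add: emeasure_gauss_UNIV)
  also have "(\<integral>x. 1 * F (T x) \<partial>gauss) = (\<integral>x. sgn x \<bullet> l \<partial>(gauss :: ((real^'m::_) \<times> real) measure))"
  proof (rule integral_cong_AE)
    have "AE x in (lborel :: ((real^'m::_) \<times> real) measure). x \<noteq> 0" by (rule AE_lborel_singleton)
    then show "AE x in gauss. 1 * F (T x) = sgn x \<bullet> l"
      unfolding gauss_def by (subst AE_density) (auto simp: FT elim: eventually_mono)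
  qed (use Fm in \<open>auto simp: sgn_div_norm\<close>)
  also have "\<dots> = 0"
  proof -
    have "distr lborel borel (\<lambda>x :: (real^'m::_) \<times> real. - x) = lborel"
      using lborel_affine[of "-1::real" "0 :: (real^'m::_) \<times> real"] by (simp add: density_1)
    note d = this
    have g: "gauss_density (- x) = gauss_density x" for x :: "(real^'m::_) \<times> real" by (simp add: gauss_density_eq)
    have [measurable]: "(\<lambda>x::(real^'m::_) \<times> real. sgn x \<bullet> l) \<in> borel_measurable borel" by (simp add: sgn_div_norm)
    have "(\<integral>x. sgn x \<bullet> l \<partial>(gauss :: ((real^'m::_) \<times> real) measure)) = (\<integral>x. gauss_density x * (sgn x \<bullet> l) \<partial>distr lborel borel uminus)"
      unfolding gauss_def d by (subst integral_density) auto
    also have "\<dots> = (\<integral>x. - (gauss_density x * (sgn x \<bullet> l)) \<partial>lborel)"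
      by (subst integral_distr) (auto simp: g sgn_minus)
    also have "\<dots> = - (\<integral>x. sgn x \<bullet> l \<partial>gauss)"
      unfolding gauss_def by (subst integral_density) auto
    finally show ?thesis by simp
  qed
  finally have "(\<integral>p. F p \<partial>mu) = 0" using mu_mass(1) by simp
  then show ?thesis by (simp add: set_lebesgue_integral_def F_def)
qed

end

section \<open>The Poincare inequality on round spheres\<close>

lemma inner_bilinear: "bilinear (inner :: 'x::real_inner \<Rightarrow> 'x \<Rightarrow> real)"
  using bounded_bilinear_inner bilinear_conv_bounded_bilinear
  by (simp add: bilinear_def inner_add_left inner_add_right linear_iff)

context sphere_embedding
begin

lemma Ck_T: "Ck_on k (- {0}) T"
  unfolding T_def[abs_def]
  by (rule Ck_on_compose[OF _ open_UNIV _ Ck_E Ck_sgn]) auto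

lemma T_has_derivative:
  assumes "x \<noteq> 0"
  shows "(T has_derivative (\<lambda>v. (\<rho> / norm x) *\<^sub>R J (v - (sgn x \<bullet> v) *\<^sub>R sgn x))) (at x)"
proof -
  have "((E \<circ> sgn) has_derivative ((\<lambda>h. \<rho> *\<^sub>R J h) \<circ> (\<lambda>v. (1 / norm x) *\<^sub>R (v - (sgn x \<bullet> v) *\<^sub>R sgn x)))) (at x)"
    by (rule diff_chain_at[OF sgn_has_derivative[OF assms] E_has_derivative])
  moreover have "T = E \<circ> sgn" by (simp add: fun_eq_iff T_def)
  moreover have "((\<lambda>h. \<rho> *\<^sub>R J h) \<circ> (\<lambda>v. (1 / norm x) *\<^sub>R (v - (sgn x \<bullet> v) *\<^sub>R sgn x))) = (\<lambda>v. (\<rho> / norm x) *\<^sub>R J (v - (sgn x \<bullet> v) *\<^sub>R sgn x))"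
    by (simp add: fun_eq_iff J_scale)
  ultimately show ?thesis by simp
qed

lemma cone_extension_has_derivative:
  assumes f: "smooth_on M f" and x: "x \<noteq> 0"
  shows "((\<lambda>x. norm x * f (T x)) has_derivative
    (\<lambda>v. (sgn x \<bullet> v) * f (T x) + \<rho> * frechet_derivative f (at (T x) within M) (J (v - (sgn x \<bullet> v) *\<^sub>R sgn x)))) (at x)"
proof -
  let ?D = "frechet_derivative f (at (T x) within M)"
  let ?U = "- {0 :: (real^'m::_) \<times> real}"
  have D: "(f has_derivative ?D) (at (T x) within M)" by (rule smooth_on_has_derivative[OF f T_in_M[OF x]])
  have l: "linear ?D" using D has_derivative_linear by blast
  have "(f has_derivative ?D) (at (T x) within T ` ?U)"
    by (rule has_derivative_subset[OF D]) (auto intro: T_in_M)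
  then have "((f \<circ> T) has_derivative (?D \<circ> (\<lambda>v. (\<rho> / norm x) *\<^sub>R J (v - (sgn x \<bullet> v) *\<^sub>R sgn x)))) (at x within ?U)"
    by (rule diff_chain_within[OF has_derivative_at_withinI[OF T_has_derivative[OF x]]])
  moreover have "at x within ?U = at x" by (rule at_within_open) (use x in auto)
  ultimately have fT: "((\<lambda>x. f (T x)) has_derivative (\<lambda>v. (\<rho> / norm x) * ?D (J (v - (sgn x \<bullet> v) *\<^sub>R sgn x)))) (at x)"
    by (simp add: o_def linear_scale[OF l])
  have n: "(norm has_derivative (\<lambda>v. v \<bullet> sgn x)) (at x)"
    using has_derivative_norm[OF x] .
  have "((\<lambda>x. norm x * f (T x)) has_derivative (\<lambda>v. norm x * ((\<rho> / norm x) * ?D (J (v - (sgn x \<bullet> v) *\<^sub>R sgn x))) + (v \<bullet> sgn x) * f (T x))) (at x)"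
    by (rule has_derivative_mult[OF n fT])
  moreover have "norm x * ((\<rho> / norm x) * ?D (J (v - (sgn x \<bullet> v) *\<^sub>R sgn x))) + (v \<bullet> sgn x) * f (T x)
     = (sgn x \<bullet> v) * f (T x) + \<rho> * ?D (J (v - (sgn x \<bullet> v) *\<^sub>R sgn x))" for v
    using x by (simp add: inner_commute[of v])
  ultimately show ?thesis by simp
qed

definition frame :: "'v \<Rightarrow> ('m \<Rightarrow> 'v) \<Rightarrow> bool" where
  "frame p e \<longleftrightarrow> orthonormal b e \<and> (\<forall>i. \<exists>v. e i = J v \<and> v \<bullet> Ei p = 0)"

lemma cone_gradient:
  assumes f: "smooth_on M f" and x: "x \<noteq> 0" and fr: "frame (T x) e"
    and g: "\<And>v. v \<bullet> g = (sgn x \<bullet> v) * f (T x) + \<rho> * frechet_derivative f (at (T x) within M) (J (v - (sgn x \<bullet> v) *\<^sub>R sgn x))"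
  shows "(norm g)\<^sup>2 = (f (T x))\<^sup>2 + \<rho>\<^sup>2 * (\<Sum>i\<in>UNIV. (frechet_derivative f (at (T x) within M) (e i))\<^sup>2)"
proof -
  let ?D = "frechet_derivative f (at (T x) within M)"
  have D: "(f has_derivative ?D) (at (T x) within M)" by (rule smooth_on_has_derivative[OF f T_in_M[OF x]])
  have l: "linear ?D" using D has_derivative_linear by blast
  obtain v where v: "\<And>i. e i = J (v i)" "\<And>i. v i \<bullet> sgn x = 0"
    using fr unfolding frame_def T_def by (metis Ei_E)
  have vv: "v i \<bullet> v j = (if i = j then 1 else 0)" for i j
    using fr v(1) bJ unfolding frame_def orthonormal_def by metis
  have ss: "sgn x \<bullet> sgn x = 1" using x by (simp add: norm_sgn dot_square_norm)
  define w where "w = case_option (sgn x) v"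
  have w: "orthonormal inner w"
    unfolding orthonormal_def w_def using v(2) vv ss by (auto simp: inner_commute split: option.splits)
  have "span (range w) = UNIV"
    by (rule orthonormal_span[OF inner_bilinear w]) (auto simp: card_UNIV_option card_image UNIV_option_conv)
  then have "g \<bullet> g = (\<Sum>i\<in>UNIV. (g \<bullet> w i) * (g \<bullet> w i))"
    using orthonormal_Parseval[OF inner_bilinear w, of g g] by simp
  also have "\<dots> = (g \<bullet> sgn x)\<^sup>2 + (\<Sum>i\<in>UNIV. (g \<bullet> v i)\<^sup>2)"
    unfolding UNIV_option_conv by (simp add: w_def sum.reindex power2_eq_square)
  finally have "g \<bullet> g = (g \<bullet> sgn x)\<^sup>2 + (\<Sum>i\<in>UNIV. (g \<bullet> v i)\<^sup>2)" .
  moreover have "g \<bullet> sgn x = f (T x)" using g[of "sgn x"] ss by (simp add: inner_commute linear_0[OF l] linear_0[OF linJ])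
  moreover have "(g \<bullet> v i)\<^sup>2 = \<rho>\<^sup>2 * (?D (e i))\<^sup>2" for i
    using g[of "v i"] v by (simp add: inner_commute power_mult_distrib)
  ultimately show ?thesis by (simp add: power2_norm_eq_inner sum_distrib_left)
qed

theorem Poincare:
  fixes f q :: "'v \<Rightarrow> real"
  assumes f: "smooth_on M f" and mean: "(LINT p:M|mu. f p) = 0"
    and q: "\<And>p. p \<in> M \<Longrightarrow> \<exists>e. frame p e \<and> q p = (\<Sum>i\<in>UNIV. (frechet_derivative f (at p within M) (e i))\<^sup>2)"
  shows "set_integrable mu M q" "set_integrable mu M (\<lambda>p. (f p)\<^sup>2)"
    "real CARD('m) * (LINT p:M|mu. (f p)\<^sup>2) \<le> \<rho>\<^sup>2 * (LINT p:M|mu. q p)"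
proof -
  let ?X = "UNIV :: ((real^'m::_) \<times> real) set"
  let ?G = "\<lambda>x. norm x * f (T x)"
  let ?U = "- {0 :: (real^'m::_) \<times> real}"
  have cf: "continuous_on M f" by (rule smooth_on_imp_continuous_on[OF f])
  have bdd: "bounded (f ` M)" using cf compact_M by (intro compact_imp_bounded compact_continuous_image)
  then obtain K where K: "\<And>p. p \<in> M \<Longrightarrow> norm (f p) \<le> K" by (auto simp: bounded_iff)
  have CkG: "Ck_on k ?U ?G" for k
  proof -
    have "smooth_on ?U (\<lambda>x. f (T x))"
      by (rule smooth_on_compose[OF _ Ck_T _ f]) (auto intro: T_in_M)
    then have "Ck_on k ?U (\<lambda>x. f (T x))" by (rule smooth_on_open_imp_Ck) auto
    then show ?thesis by (intro Ck_on_mult Ck_norm) auto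
  qed
  define G where "G x = (if x = 0 then 0 else norm x * f (T x))" for x
  define g where "g x = (if x = 0 then 0 else \<Sum>k\<in>Basis. frechet_derivative ?G (at x) k *\<^sub>R k)" for x
  have GCk: "Ck_on k ?U G" for k
    by (rule Ck_on_cong[OF _ _ CkG]) (auto simp: G_def)
  have dG': "(?G has_derivative frechet_derivative ?G (at x)) (at x)" if "x \<noteq> 0" for x
    by (rule Ck_on_SucD[OF _ CkG[of "Suc 0"]]) (use that in auto)
  have gv: "v \<bullet> g x = frechet_derivative ?G (at x) v" if "x \<noteq> 0" for x v
  proof -
    have l: "linear (frechet_derivative ?G (at x))" using dG'[OF that] has_derivative_linear by blast
    have "frechet_derivative ?G (at x) v = frechet_derivative ?G (at x) (\<Sum>k\<in>Basis. (v \<bullet> k) *\<^sub>R k)"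
      by (simp add: euclidean_representation)
    then show ?thesis using that
      by (simp add: g_def linear_sum[OF l] linear_scale[OF l] inner_sum_right mult.commute)
  qed
  have gv': "v \<bullet> g x = (sgn x \<bullet> v) * f (T x) + \<rho> * frechet_derivative f (at (T x) within M) (J (v - (sgn x \<bullet> v) *\<^sub>R sgn x))"
    if "x \<noteq> 0" for x v
    unfolding gv[OF that] frechet_derivative_at[OF cone_extension_has_derivative[OF f that], symmetric] ..
  have gq: "(norm (g x))\<^sup>2 = (f (T x))\<^sup>2 + \<rho>\<^sup>2 * q (T x)" if x0: "x \<noteq> 0" for x
  proof -
    obtain e where "frame (T x) e" "q (T x) = (\<Sum>i\<in>UNIV. (frechet_derivative f (at (T x) within M) (e i))\<^sup>2)"
      using q[OF T_in_M[OF x0]] by blast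
    then show ?thesis using cone_gradient[OF f x0 _ gv'[OF x0]] by simp
  qed
  have dG: "(G has_derivative (\<lambda>v. v \<bullet> g x)) (at x)" if "x \<noteq> 0" for x
  proof -
    have "(G has_derivative frechet_derivative ?G (at x)) (at x)"
      by (rule has_derivative_transform_within_open[OF dG'[OF that], of ?U]) (use that in \<open>auto simp: G_def\<close>)
    then show ?thesis by (simp add: gv[OF that])
  qed
  have cg: "continuous_on ?U g"
  proof -
    have "continuous_on ?U (\<lambda>x. \<Sum>k\<in>Basis. frechet_derivative ?G (at x) k *\<^sub>R k)"
    proof (intro continuous_intros)
      show "continuous_on ?U (\<lambda>x. frechet_derivative ?G (at x) k)" for k
        using CkG[of "Suc 0"] unfolding Ck_on.simps by blast
    qed
    then show ?thesis by (rule continuous_on_eq) (auto simp: g_def)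
  qed
  have Um: "?U \<in> sets borel" by simp
  have Gm[measurable]: "G \<in> borel_measurable borel"
  proof -
    have "(\<lambda>x. indicator ?U x *\<^sub>R G x) \<in> borel_measurable borel"
      by (rule borel_measurable_continuous_on_indicator[OF Um]) (use GCk[of 0] in simp)
    moreover have "(\<lambda>x. indicator ?U x *\<^sub>R G x) = G" by (auto simp: fun_eq_iff G_def split: split_indicator)
    ultimately show ?thesis by simp
  qed
  have gm[measurable]: "g \<in> borel_measurable borel"
  proof -
    have "(\<lambda>x. indicator ?U x *\<^sub>R g x) \<in> borel_measurable borel"
      by (rule borel_measurable_continuous_on_indicator[OF Um cg])
    moreover have "(\<lambda>x. indicator ?U x *\<^sub>R g x) = g" by (auto simp: fun_eq_iff g_def split: split_indicator)
    ultimately show ?thesis by simp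
  qed
  define F where "F p = indicator M p * f p" for p
  define Q where "Q p = indicator M p * q p" for p
  have Fm[measurable]: "F \<in> borel_measurable borel"
    using borel_measurable_continuous_on_indicator[OF M_borel cf] by (simp add: F_def[abs_def])
  have cq: "continuous_on M q"
  proof -
    have "continuous_on M (\<lambda>p. ((norm (g (Ei p)))\<^sup>2 - (f p)\<^sup>2) / \<rho>\<^sup>2)"
      by (intro continuous_intros cf continuous_on_compose2[OF cg continuous_E(2)]) (use rho in \<open>auto simp: M_iff\<close>)
    then show ?thesis
    proof (rule continuous_on_eq)
      fix p assume p: "p \<in> M"
      then have n: "norm (Ei p) = 1" and "T (Ei p) = p" by (auto simp: M_iff T_def sgn_div_norm)
      then have "(norm (g (Ei p)))\<^sup>2 = (f p)\<^sup>2 + \<rho>\<^sup>2 * q p" using gq[of "Ei p"] by fastforce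
      then show "((norm (g (Ei p)))\<^sup>2 - (f p)\<^sup>2) / \<rho>\<^sup>2 = q p" using rho by simp
    qed
  qed
  then have Qm[measurable]: "Q \<in> borel_measurable borel"
    using borel_measurable_continuous_on_indicator[OF M_borel cq] by (simp add: Q_def[abs_def])
  show iq: "set_integrable mu M q" by (rule integrable_mu_continuous[OF cq])
  show if2: "set_integrable mu M (\<lambda>p. (f p)\<^sup>2)" by (rule integrable_mu_continuous) (intro continuous_intros cf)
  have q0: "0 \<le> q p" if "p \<in> M" for p using q[OF that] by (auto intro!: sum_nonneg)
  have Q0: "0 \<le> Q p" for p by (auto simp: Q_def q0 split: split_indicator)
  have AE0: "AE x in (gauss :: ((real^'m::_) \<times> real) measure). x \<noteq> 0"
  proof -
    have "AE x in (lborel :: ((real^'m::_) \<times> real) measure). x \<noteq> 0" by (rule AE_lborel_singleton)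
    then show ?thesis unfolding gauss_def by (subst AE_density) (auto elim: eventually_mono)
  qed
  have FT: "F (T x) = f (T x)" "Q (T x) = q (T x)" if "x \<noteq> 0" for x
    using T_in_M[OF that] by (auto simp: F_def Q_def)
  have meanG: "(\<integral>x. G x \<partial>gauss) = 0"
  proof -
    obtain C where C: "0 \<le> C" "(\<integral>\<^sup>+x. ennreal (norm x) \<partial>(gauss :: ((real^'m::_) \<times> real) measure)) = ennreal C"
      using gauss_norm_moment1 by blast
    have C': "(\<integral>\<^sup>+x. ennreal \<bar>norm x\<bar> \<partial>(gauss :: ((real^'m::_) \<times> real) measure)) = ennreal C"
      using C by simp
    have "(\<integral>x. G x \<partial>gauss) = (\<integral>x. \<bar>norm x\<bar> * F (T x) \<partial>gauss)"
    proof (rule integral_cong_AE)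
      show "AE x in gauss. G x = \<bar>norm x\<bar> * F (T x)"
        using AE0 by (auto simp: G_def FT elim: eventually_mono)
    qed measurable
    also have "\<dots> = C / V * (\<integral>p. F p \<partial>mu)"
      by (rule integral_gauss_T(1)[OF Fm _ _ C' C(1)]) auto
    also have "(\<integral>p. F p \<partial>mu) = 0" using mean by (simp add: set_lebesgue_integral_def F_def)
    finally show ?thesis by simp
  qed
  have bound: "\<bar>G x\<bar> \<le> K * norm x" for x
    using K[OF T_in_M[of x]] by (auto simp: G_def abs_mult mult.commute intro: mult_left_mono)
  have main: "(\<integral>\<^sup>+x. ennreal ((G x)\<^sup>2) \<partial>gauss) \<le> (\<integral>\<^sup>+x. ennreal ((norm (g x))\<^sup>2) \<partial>gauss)"
    by (rule gauss_Poincare[OF _ dG cg Gm gm bound meanG]) (auto simp: Suc_le_eq)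
  have "(\<integral>\<^sup>+x. ennreal ((G x)\<^sup>2) \<partial>gauss) = (\<integral>\<^sup>+x. ennreal ((norm x)\<^sup>2 * (F (T x))\<^sup>2) \<partial>gauss)"
    by (rule nn_integral_cong_AE) (use AE0 in \<open>auto simp: G_def FT power_mult_distrib elim: eventually_mono\<close>)
  also have "\<dots> = ennreal (real DIM((real^'m::_) \<times> real) / V) * (\<integral>\<^sup>+p. ennreal ((F p)\<^sup>2) \<partial>mu)"
    by (rule integral_gauss_T(2)[where H="\<lambda>r. r\<^sup>2"]) (auto simp: nn_integral_gauss_norm_sq simp del: DIM_prod)
  finally have l: "(\<integral>\<^sup>+x. ennreal ((G x)\<^sup>2) \<partial>gauss) = ennreal (real (CARD('m) + 1) / V) * (\<integral>\<^sup>+p. ennreal ((F p)\<^sup>2) \<partial>mu)"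
    by simp
  have "(\<integral>\<^sup>+x. ennreal ((norm (g x))\<^sup>2) \<partial>gauss) = (\<integral>\<^sup>+x. ennreal (1 * ((F (T x))\<^sup>2 + \<rho>\<^sup>2 * Q (T x))) \<partial>gauss)"
    by (rule nn_integral_cong_AE) (use AE0 in \<open>auto simp: gq FT elim: eventually_mono\<close>)
  also have "\<dots> = ennreal (1 / V) * (\<integral>\<^sup>+p. ennreal ((F p)\<^sup>2 + \<rho>\<^sup>2 * Q p) \<partial>mu)"
    by (rule integral_gauss_T(2)[where H="\<lambda>r. 1"]) (auto simp: emeasure_gauss_UNIV Q0)
  finally have r: "(\<integral>\<^sup>+x. ennreal ((norm (g x))\<^sup>2) \<partial>gauss) = ennreal (1 / V) * (\<integral>\<^sup>+p. ennreal ((F p)\<^sup>2 + \<rho>\<^sup>2 * Q p) \<partial>mu)" .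
  have iF: "integrable mu (\<lambda>p. (F p)\<^sup>2)" and eF: "(\<integral>p. (F p)\<^sup>2 \<partial>mu) = (LINT p:M|mu. (f p)\<^sup>2)"
  proof -
    have e: "(F p)\<^sup>2 = indicator M p *\<^sub>R (f p)\<^sup>2" for p by (auto simp: F_def split: split_indicator)
    show "integrable mu (\<lambda>p. (F p)\<^sup>2)" unfolding e using if2 by (simp add: set_integrable_def)
    show "(\<integral>p. (F p)\<^sup>2 \<partial>mu) = (LINT p:M|mu. (f p)\<^sup>2)" unfolding e set_lebesgue_integral_def ..
  qed
  have iQ: "integrable mu Q" and eQ: "(\<integral>p. Q p \<partial>mu) = (LINT p:M|mu. q p)"
    using iq by (simp_all add: set_integrable_def set_lebesgue_integral_def Q_def[abs_def])
  define a2 where "a2 = (LINT p:M|mu. (f p)\<^sup>2)"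
  define q2 where "q2 = (LINT p:M|mu. q p)"
  have a0: "0 \<le> a2" unfolding a2_def eF[symmetric] by (rule integral_nonneg_AE) auto
  have q20: "0 \<le> q2" unfolding q2_def eQ[symmetric] by (rule integral_nonneg_AE) (use Q0 in auto)
  have n1: "(\<integral>\<^sup>+p. ennreal ((F p)\<^sup>2) \<partial>mu) = ennreal a2"
    unfolding a2_def eF[symmetric] by (rule nn_integral_eq_integral[OF iF]) auto
  have n2: "(\<integral>\<^sup>+p. ennreal ((F p)\<^sup>2 + \<rho>\<^sup>2 * Q p) \<partial>mu) = ennreal (a2 + \<rho>\<^sup>2 * q2)"
  proof -
    have "(\<integral>\<^sup>+p. ennreal ((F p)\<^sup>2 + \<rho>\<^sup>2 * Q p) \<partial>mu) = ennreal (\<integral>p. (F p)\<^sup>2 + \<rho>\<^sup>2 * Q p \<partial>mu)"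
      by (rule nn_integral_eq_integral) (use iF iQ Q0 in auto)
    then show ?thesis using iF iQ by (simp add: a2_def q2_def eF eQ)
  qed
  have "ennreal (real (CARD('m) + 1) / V * a2) \<le> ennreal (1 / V * (a2 + \<rho>\<^sup>2 * q2))"
    using main mu_mass(1) a0 q20 unfolding l r n1 n2 by (simp add: ennreal_mult[symmetric] del: ennreal_plus)
  then have "real (CARD('m) + 1) / V * a2 \<le> 1 / V * (a2 + \<rho>\<^sup>2 * q2)"
    using mu_mass(1) a0 q20 by (subst (asm) ennreal_le_iff; simp)
  then have "real (CARD('m) + 1) * a2 \<le> a2 + \<rho>\<^sup>2 * q2"
    using mu_mass(1) by (simp add: field_simps)
  then show "real CARD('m) * (LINT p:M|mu. (f p)\<^sup>2) \<le> \<rho>\<^sup>2 * (LINT p:M|mu. q p)"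
    unfolding a2_def q2_def by (simp add: algebra_simps)
qed

end

lemma proj_eqI:
  assumes b: "bilinear b" and T: "subspace T" and pos: "\<And>t. t \<in> T \<Longrightarrow> t \<noteq> 0 \<Longrightarrow> 0 < b t t"
    and w: "w \<in> T" "\<And>t. t \<in> T \<Longrightarrow> b (v - w) t = 0"
  shows "proj b T v = w"
  unfolding proj_def
proof (rule the_equality)
  show "w \<in> T \<and> (\<forall>t\<in>T. b (v - w) t = 0)" using w by blast
  fix w' assume w': "w' \<in> T \<and> (\<forall>t\<in>T. b (v - w') t = 0)"
  then have d: "w - w' \<in> T" using w(1) T by (simp add: subspace_diff)
  have "b (w - w') (w - w') = b ((v - w') - (v - w)) (w - w')" by simp
  also have "\<dots> = 0" using w(2)[OF d] w' d unfolding bilinear_lsub[OF b] by simp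
  finally show "w' = w" using pos[OF d] by force
qed

lemma Ck_trig: "Ck_on k UNIV (\<lambda>t::real. cos (s * t) *\<^sub>R x + sin (s * t) *\<^sub>R (y::'a::real_normed_vector))"
proof (induction k arbitrary: x y)
  case 0
  show ?case by (simp, intro continuous_intros)
next
  case (Suc k)
  show ?case
  proof (rule Ck_onI[OF open_UNIV])
    fix t :: real
    show "((\<lambda>t. cos (s * t) *\<^sub>R x + sin (s * t) *\<^sub>R y) has_derivative
      (\<lambda>v. cos (s * t) *\<^sub>R ((v * s) *\<^sub>R y) + sin (s * t) *\<^sub>R (- (v * s) *\<^sub>R x))) (at t)"
      by (auto intro!: derivative_eq_intros simp: algebra_simps)
  qed (rule Suc.IH)
qed

lemma Ck_exp: "Ck_on k UNIV (\<lambda>t::real. exp (s * t) *\<^sub>R (x::'a::real_normed_vector))"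
proof (induction k arbitrary: x)
  case 0
  show ?case by (simp, intro continuous_intros)
next
  case (Suc k)
  show ?case
  proof (rule Ck_onI[OF open_UNIV])
    fix t :: real
    show "((\<lambda>t. exp (s * t) *\<^sub>R x) has_derivative (\<lambda>v. exp (s * t) *\<^sub>R ((v * s) *\<^sub>R x))) (at t)"
      by (auto intro!: derivative_eq_intros simp: algebra_simps)
  qed (rule Suc.IH)
qed

lemma tangent_spaceI:
  assumes "\<And>k. Ck_on k UNIV c" "\<And>t. c t \<in> S" "c 0 = p" "(c has_vector_derivative v) (at (0::real))"
  shows "v \<in> tangent_space S p"
proof -
  have "smooth_on {-1<..<1} c" by (rule smooth_onI[of UNIV _ c]) (use assms in auto)
  then show ?thesis unfolding tangent_space_def using assms by (intro CollectI exI[of _ c] exI[of _ 1]) auto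
qed

lemma tangent_space_mono: "S \<subseteq> S' \<Longrightarrow> tangent_space S p \<subseteq> tangent_space S' p"
  unfolding tangent_space_def by blast

lemma zero_tangent: "p \<in> S \<Longrightarrow> 0 \<in> tangent_space S p"
  by (rule tangent_spaceI[of "\<lambda>_. p"]) auto

lemma vector_derivative_const_on_interval:
  assumes "(\<phi> has_vector_derivative d) (at (0::real))" "0 < e" "\<And>t. t \<in> {-e<..<e} \<Longrightarrow> \<phi> t = k"
  shows "d = 0"
proof -
  have "((\<lambda>t. k) has_vector_derivative d) (at (0::real))"
    by (rule has_vector_derivative_transform_within_open[OF assms(1), of "{-e<..<e}"]) (use assms in auto)
  then show ?thesis using has_vector_derivative_const vector_derivative_unique_at by blast
qed

lemma vector_derivative_in_subspace:
  fixes L :: "'a::euclidean_space set"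
  assumes "(c has_vector_derivative v) (at (0::real))" "0 < e" "\<And>t. t \<in> {-e<..<e} \<Longrightarrow> c t \<in> L" "subspace L"
  shows "v \<in> L"
proof -
  obtain y z where yz: "y \<in> span L" "\<And>w. w \<in> span L \<Longrightarrow> orthogonal z w" "v = y + z"
    using orthogonal_subspace_decomp_exists[of L v] by blast
  have sL: "span L = L" using assms(4) by (rule span_eq_iff[THEN iffD2])
  have "((\<lambda>t. z \<bullet> c t) has_vector_derivative z \<bullet> v) (at 0)"
    by (rule bounded_linear.has_vector_derivative[OF bounded_linear_inner_right assms(1)])
  then have "z \<bullet> v = 0"
    by (rule vector_derivative_const_on_interval[OF _ assms(2)]) (use assms(3) yz(2) sL in \<open>auto simp: orthogonal_def\<close>)
  then have "z = 0" using yz by (simp add: inner_add_right orthogonal_def)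
  then show ?thesis using yz sL by simp
qed

lemma tangent_space_in_subspace:
  assumes "v \<in> tangent_space S p" "S \<subseteq> L" "subspace L"
  shows "v \<in> (L :: 'a::euclidean_space set)"
proof -
  obtain c e where c: "0 < e" "\<And>t. t \<in> {-e<..<e} \<Longrightarrow> c t \<in> S" "c 0 = p" "(c has_vector_derivative v) (at (0::real))"
    using assms(1) by (blast elim: tangent_spaceE)
  show ?thesis by (rule vector_derivative_in_subspace[OF c(4,1) _ assms(3)]) (use c(2) assms(2) in blast)
qed

lemma within_derivative_in_subspace:
  fixes f :: "'b::real_normed_vector \<Rightarrow> 'a::euclidean_space"
  assumes "(f has_derivative D) (at p within S)" "X \<in> tangent_space S p" "\<And>x. x \<in> S \<Longrightarrow> f x \<in> L" "subspace L"
  shows "D X \<in> L"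
proof -
  obtain c e where c: "0 < e" "\<And>t. t \<in> {-e<..<e} \<Longrightarrow> c t \<in> S" "c 0 = p" "(c has_vector_derivative X) (at (0::real))"
    using assms(2) by (blast elim: tangent_spaceE)
  have "((\<lambda>t. f (c t)) has_vector_derivative D X) (at 0)"
    by (rule curve_has_vector_derivative[OF assms(1) c(3,1,2,4)])
  then show ?thesis
    by (rule vector_derivative_in_subspace[OF _ c(1) _ assms(4)]) (rule assms(3)[OF c(2)])
qed

lemma frechet_derivative_tangent_cong:
  assumes "X \<in> tangent_space S p" "(g has_derivative D) (at p within S)" "\<And>x. x \<in> S \<Longrightarrow> f x = g x"
  shows "frechet_derivative f (at p within S) X = D X"
proof -
  have "p \<in> S" using assms(1) by (rule tangent_space_point)
  then have "(f has_derivative D) (at p within S)"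
    by (rule has_derivative_transform) (use assms in auto)
  then show ?thesis by (rule frechet_derivative_within_tangent[OF assms(1)])
qed

section \<open>Spheres in space forms\<close>

text \<open>
  The ambient space \<open>B\<close> is \<open>{x. b x x = \<epsilon>}\<close> (one sheet of it) for \<open>\<epsilon> = \<plusminus>1\<close> and a Euclidean space for \<open>\<epsilon> = 0\<close>. The unit
  normal of the sphere in its fibre is \<open>q + \<beta> J z\<close>, and \<open>L\<close> is the linear span of the fibre. For a geodesic sphere
  with centre \<open>c\<close> and radius \<open>r\<close>, one has \<open>a = cos r c\<close>, \<open>q = - sin r c\<close>, \<open>\<rho> = sin r\<close>, \<open>\<beta> = cos r\<close> in the unit sphere,
  \<open>a = cosh r c\<close>, \<open>q = sinh r c\<close>, \<open>\<rho> = sinh r\<close>, \<open>\<beta> = cosh r\<close> in the hyperboloid, and \<open>a = c\<close>, \<open>q = 0\<close>, \<open>\<rho> = r\<close>, \<open>\<beta> = 1\<close>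
  in the flat case. The space \<open>F\<close> of constant vectors below is horizontal along the fibre.
\<close>

locale space_form_sphere = sphere_embedding b a \<rho> J
  for b :: "'v::euclidean_space \<Rightarrow> 'v \<Rightarrow> real" and a :: 'v and \<rho> :: real
    and J :: "(real^'m::{finite,wellorder}) \<times> real \<Rightarrow> 'v" +
  fixes \<epsilon> :: real and B :: "'v set" and q :: 'v and \<beta> :: real and L :: "'v set"
  assumes eps: "\<epsilon> * \<epsilon> * \<epsilon> = \<epsilon>"
    and TB: "\<And>p. p \<in> B \<Longrightarrow> tangent_space B p = {v. \<epsilon> * b p v = 0}"
    and Bn: "\<And>p. p \<in> B \<Longrightarrow> \<epsilon> * b p p = \<epsilon> * \<epsilon>"
    and pos: "\<And>p v. p \<in> B \<Longrightarrow> \<epsilon> * b p v = 0 \<Longrightarrow> v \<noteq> 0 \<Longrightarrow> 0 < b v v"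
    and MB: "M \<subseteq> B"
    and aJ: "\<And>z. \<epsilon> * b a (J z) = 0" and qJ: "\<And>z. b q (J z) = 0"
    and rel: "\<beta> *\<^sub>R q = - (\<epsilon> * \<rho>) *\<^sub>R a"
    and \<beta>2: "\<beta>\<^sup>2 + \<epsilon> * \<rho>\<^sup>2 = 1" and qq: "b q q + \<beta>\<^sup>2 = 1" and aq: "\<epsilon> * (b a q + \<rho> * \<beta>) = 0"
    and L: "subspace L" "a \<in> L" "q \<in> L" "\<And>z. J z \<in> L"
    and Lorth: "\<And>v l. (\<And>z. b v (J z) = 0) \<Longrightarrow> \<epsilon> * b a v = 0 \<Longrightarrow> b q v = 0 \<Longrightarrow> l \<in> L \<Longrightarrow> b v l = 0"
begin

declare split_paired_Ex [simp del] split_paired_All [simp del]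

lemmas bl = bilinear_ladd[OF bil] bilinear_lmul[OF bil] bilinear_lsub[OF bil] bilinear_lneg[OF bil] bilinear_lzero[OF bil]
lemmas br = bilinear_radd[OF bil] bilinear_rmul[OF bil] bilinear_rsub[OF bil] bilinear_rneg[OF bil] bilinear_rzero[OF bil]

definition F where "F = {v. \<forall>l\<in>L. b v l = 0}"

lemma subspace_F: "subspace F"
  unfolding subspace_def F_def by (simp add: bl)

definition n where "n x = q + \<beta> *\<^sub>R J (Ei x)"

lemma bounded_bilinear_b: "bounded_bilinear b"
  using bil by (simp add: bilinear_conv_bounded_bilinear)

lemma subspace_TB: "p \<in> B \<Longrightarrow> subspace (tangent_space B p)"
  unfolding TB subspace_def by (auto simp: br distrib_left)

lemma pos_TB: "p \<in> B \<Longrightarrow> v \<in> tangent_space B p \<Longrightarrow> v \<noteq> 0 \<Longrightarrow> 0 < b v v"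
  using pos TB by auto

lemma proj_TB:
  assumes p: "p \<in> B"
  shows "proj b (tangent_space B p) v = v - (\<epsilon> * b p v) *\<^sub>R p"
proof (rule proj_eqI[OF bil subspace_TB[OF p] pos_TB[OF p]])
  have "\<epsilon> * b p (v - (\<epsilon> * b p v) *\<^sub>R p) = \<epsilon> * b p v - \<epsilon> * b p v * (\<epsilon> * b p p)"
    by (simp add: br algebra_simps)
  also have "\<dots> = b p v * (\<epsilon> - \<epsilon> * \<epsilon> * \<epsilon>)" unfolding Bn[OF p] by (simp add: algebra_simps)
  finally show "v - (\<epsilon> * b p v) *\<^sub>R p \<in> tangent_space B p" using eps by (simp add: TB[OF p])
  fix t assume "t \<in> tangent_space B p"
  then have "\<epsilon> * b p t = 0" by (simp add: TB[OF p])
  then show "b (v - (v - (\<epsilon> * b p v) *\<^sub>R p)) t = 0" by (auto simp: bl)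
qed

lemma proj_TB_tangent: "p \<in> B \<Longrightarrow> v \<in> tangent_space B p \<Longrightarrow> proj b (tangent_space B p) v = v"
  by (simp only: proj_TB) (simp add: TB)

lemma proj_TB_in: "p \<in> B \<Longrightarrow> proj b (tangent_space B p) v \<in> tangent_space B p"
proof -
  assume p: "p \<in> B"
  have "\<epsilon> * b p (v - (\<epsilon> * b p v) *\<^sub>R p) = \<epsilon> * b p v - \<epsilon> * b p v * (\<epsilon> * b p p)"
    by (simp add: br algebra_simps)
  also have "\<dots> = b p v * (\<epsilon> - \<epsilon> * \<epsilon> * \<epsilon>)" unfolding Bn[OF p] by (simp add: algebra_simps)
  finally show ?thesis unfolding proj_TB[OF p] using eps by (simp add: TB[OF p])
qed

lemma ext_B: "x \<in> B \<Longrightarrow> ext b B X x = X - (\<epsilon> * b x X) *\<^sub>R x"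
  by (simp add: ext_def proj_TB)

lemma pE: "p \<in> M \<Longrightarrow> p = a + \<rho> *\<^sub>R J (Ei p)"
  by (metis E_def M_iff)

lemma Ei_unit: "p \<in> M \<Longrightarrow> Ei p \<bullet> Ei p = 1"
  by (simp add: M_iff norm_eq_1)

lemma tangent_M:
  assumes p: "p \<in> M"
  shows "tangent_space M p = {J v | v. v \<bullet> Ei p = 0}"
proof (intro equalityI subsetI)
  fix X assume "X \<in> tangent_space M p"
  then obtain c e where c: "0 < e" "\<And>t. t \<in> {-e<..<e} \<Longrightarrow> c t \<in> M" "c 0 = p" "(c has_vector_derivative X) (at (0::real))"
    by (blast elim: tangent_spaceE)
  define z where "z t = Ei (c t)" for t
  define w where "w = Ji ((1 / \<rho>) *\<^sub>R X)"
  have dz: "(z has_vector_derivative w) (at 0)"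
    unfolding z_def[abs_def] w_def by (rule curve_has_vector_derivative[OF Ei_has_derivative c(3,1,2,4)])
  have "((\<lambda>t. z t \<bullet> z t) has_vector_derivative z 0 \<bullet> w + w \<bullet> z 0) (at 0)"
    by (rule bounded_bilinear.has_vector_derivative[OF bounded_bilinear_inner dz dz])
  then have "z 0 \<bullet> w + w \<bullet> z 0 = 0"
    by (rule vector_derivative_const_on_interval[OF _ c(1)]) (use Ei_unit[OF c(2)] in \<open>auto simp: z_def\<close>)
  then have wz: "w \<bullet> Ei p = 0" by (simp add: z_def c(3) inner_commute)
  have "((\<lambda>t. E (z t)) has_vector_derivative \<rho> *\<^sub>R J w) (at 0)"
    using vector_derivative_diff_chain_within[OF has_vector_derivative_at_within[OF dz] E_has_derivative, of UNIV] by (simp add: o_def)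
  then have "((\<lambda>t. c t - E (z t)) has_vector_derivative X - \<rho> *\<^sub>R J w) (at 0)"
    by (rule has_vector_derivative_diff[OF c(4)])
  then have "X - \<rho> *\<^sub>R J w = 0"
    by (rule vector_derivative_const_on_interval[OF _ c(1)]) (use c(2) in \<open>auto simp: z_def M_iff\<close>)
  then have "X = J (\<rho> *\<^sub>R w)" by (simp add: J_scale)
  then show "X \<in> {J v | v. v \<bullet> Ei p = 0}" using wz by auto
next
  fix X assume "X \<in> {J v | v. v \<bullet> Ei p = 0}"
  then obtain v where X: "X = J v" "v \<bullet> Ei p = 0" by blast
  define w where "w = sgn v"
  define s where "s = norm v / \<rho>"
  define c where "c t = E (cos (s * t) *\<^sub>R Ei p + sin (s * t) *\<^sub>R w)" for t
  show "X \<in> tangent_space M p"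
  proof (cases "v = 0")
    case True
    then show ?thesis using X p zero_tangent by (simp add: linear_0[OF linJ])
  next
    case False
    then have ww: "w \<bullet> w = 1" "w \<bullet> Ei p = 0" using X(2) by (auto simp: w_def sgn_div_norm dot_square_norm power2_eq_square)
    show ?thesis
    proof (rule tangent_spaceI[of c])
      show "Ck_on k UNIV c" for k unfolding c_def[abs_def]
        by (rule Ck_on_compose[OF open_UNIV open_UNIV _ Ck_E Ck_trig]) auto
      show "c t \<in> M" for t
      proof -
        have "(cos (s * t) *\<^sub>R Ei p + sin (s * t) *\<^sub>R w) \<bullet> (cos (s * t) *\<^sub>R Ei p + sin (s * t) *\<^sub>R w) = (cos (s * t))\<^sup>2 + (sin (s * t))\<^sup>2"
          using ww Ei_unit[OF p] by (simp add: inner_simps inner_commute power2_eq_square)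
        then show ?thesis by (simp add: c_def norm_eq_1)
      qed
      show "c 0 = p" using p by (simp add: c_def M_iff)
      have "((\<lambda>t. cos (s * t) *\<^sub>R Ei p + sin (s * t) *\<^sub>R w) has_vector_derivative s *\<^sub>R w) (at 0)"
        by (auto intro!: derivative_eq_intros)
      then have "(c has_vector_derivative \<rho> *\<^sub>R J (s *\<^sub>R w)) (at 0)"
        using vector_derivative_diff_chain_within[OF has_vector_derivative_at_within E_has_derivative, of "\<lambda>t. cos (s * t) *\<^sub>R Ei p + sin (s * t) *\<^sub>R w" "s *\<^sub>R w" 0 UNIV]
        by (simp add: o_def c_def[abs_def])
      moreover have "\<rho> *\<^sub>R J (s *\<^sub>R w) = X" using False rho by (simp add: X(1) J_scale[symmetric] s_def w_def sgn_div_norm)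
      ultimately show "(c has_vector_derivative X) (at 0)" by simp
    qed
  qed
qed

lemma TM_image: "p \<in> M \<Longrightarrow> tangent_space M p = J ` {v. Ei p \<bullet> v = 0}"
  unfolding tangent_M by (auto simp: inner_commute)

lemma subspace_TM: "p \<in> M \<Longrightarrow> subspace (tangent_space M p)"
  unfolding TM_image by (rule linear_subspace_image[OF linJ subspace_hyperplane])

lemma dim_TM: "p \<in> M \<Longrightarrow> dim (tangent_space M p) = CARD('m)"
proof -
  assume p: "p \<in> M"
  then have "Ei p \<noteq> 0" using Ei_unit by fastforce
  have "dim (tangent_space M p) = dim {v. Ei p \<bullet> v = 0}"
    unfolding TM_image[OF p] by (rule dim_image_eq[OF linJ]) (rule inj_on_subset[OF inj_J subset_UNIV])
  then show ?thesis using dim_hyperplane[OF \<open>Ei p \<noteq> 0\<close>] by simp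
qed

lemma TM_B: "p \<in> M \<Longrightarrow> X \<in> tangent_space M p \<Longrightarrow> X \<in> tangent_space B p"
  using tangent_space_mono[OF MB] by blast

lemma TM_L: "p \<in> M \<Longrightarrow> X \<in> tangent_space M p \<Longrightarrow> X \<in> L"
  using L by (auto simp: tangent_M)

lemma p_B: "p \<in> M \<Longrightarrow> p \<in> B"
  using MB by auto

lemma p_L: "p \<in> M \<Longrightarrow> p \<in> L"
  using L pE by (metis subspace_add subspace_mul)

lemma n_L: "n x \<in> L"
  unfolding n_def using L by (simp add: subspace_add subspace_mul)

lemma n_unit: "p \<in> M \<Longrightarrow> b (n p) (n p) = 1"
  using qq Ei_unit qJ by (simp add: n_def bl br bJ sym[of "J _" q] power2_eq_square)

lemma n_TB: "p \<in> M \<Longrightarrow> n p \<in> tangent_space B p"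
proof -
  assume p: "p \<in> M"
  have "b p (n p) = b (a + \<rho> *\<^sub>R J (Ei p)) (n p)" using pE[OF p] by simp
  also have "\<dots> = b a q + \<beta> * b a (J (Ei p)) + \<rho> * \<beta>"
    using Ei_unit[OF p] qJ by (simp add: n_def bl br bJ sym[of "J _" q] algebra_simps)
  finally have "\<epsilon> * b p (n p) = \<epsilon> * (b a q + \<rho> * \<beta>) + \<beta> * (\<epsilon> * b a (J (Ei p)))" by (simp add: algebra_simps)
  then show ?thesis using aq aJ by (simp add: TB[OF p_B[OF p]])
qed

lemma n_TM: "p \<in> M \<Longrightarrow> X \<in> tangent_space M p \<Longrightarrow> b (n p) X = 0"
  using qJ by (auto simp: tangent_M n_def bl br bJ inner_commute)

lemma J_radial:
  assumes p: "p \<in> M"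
  shows "J (Ei p) = \<beta> *\<^sub>R n p + (\<epsilon> * \<rho>) *\<^sub>R p"
proof -
  have "\<beta> *\<^sub>R n p + (\<epsilon> * \<rho>) *\<^sub>R (a + \<rho> *\<^sub>R J (Ei p)) = (\<beta> *\<^sub>R q + (\<epsilon> * \<rho>) *\<^sub>R a) + (\<beta>\<^sup>2 + \<epsilon> * \<rho>\<^sup>2) *\<^sub>R J (Ei p)"
    unfolding n_def by (simp add: algebra_simps power2_eq_square)
  then show ?thesis using rel \<beta>2 pE[OF p] by simp
qed

definition N where "N p = normal_space b B M p"

lemma N_iff: "w \<in> N p \<longleftrightarrow> w \<in> tangent_space B p \<and> (\<forall>t\<in>tangent_space M p. b w t = 0)"
  by (simp add: N_def normal_space_def)

lemma subspace_N: "p \<in> M \<Longrightarrow> subspace (N p)"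
  using subspace_TB[OF p_B[of p]] by (auto simp: subspace_def N_iff bl)

lemma F_TB: "p \<in> L \<Longrightarrow> p \<in> B \<Longrightarrow> h \<in> F \<Longrightarrow> h \<in> tangent_space B p"
  by (simp add: TB F_def sym[of p h])

lemma F_N: "p \<in> M \<Longrightarrow> h \<in> F \<Longrightarrow> h \<in> N p"
  using F_TB[OF p_L p_B] TM_L unfolding N_iff by (auto simp: F_def)

lemma n_N: "p \<in> M \<Longrightarrow> n p \<in> N p"
  using n_TB n_TM by (simp add: N_iff)

lemma N_decomp:
  assumes p: "p \<in> M" and w: "w \<in> N p"
  shows "w - b w (n p) *\<^sub>R n p \<in> F"
proof -
  define v where "v = w - b w (n p) *\<^sub>R n p"
  have vN: "v \<in> N p" using subspace_N[OF p] w n_N[OF p] by (simp add: v_def subspace_diff subspace_mul)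
  have vn: "b v (n p) = 0" using n_unit[OF p] by (simp add: v_def bl)
  have vp: "\<epsilon> * b p v = 0" using vN by (simp add: N_iff TB[OF p_B[OF p]])
  have vy: "b v (J (Ei p)) = 0"
    unfolding J_radial[OF p] using vn vp by (auto simp: br sym[of v p])
  have vJ: "b v (J z) = 0" for z
  proof -
    have "J (z - (z \<bullet> Ei p) *\<^sub>R Ei p) \<in> tangent_space M p"
      unfolding tangent_M[OF p] using Ei_unit[OF p] by (auto simp: inner_diff_left)
    then have "b v (J (z - (z \<bullet> Ei p) *\<^sub>R Ei p)) = 0" using vN by (simp add: N_iff)
    then show ?thesis using vy by (simp add: J_diff J_scale br)
  qed
  have "b p v = b (a + \<rho> *\<^sub>R J (Ei p)) v" using pE[OF p] by simp
  also have "\<dots> = b a v + \<rho> * b v (J (Ei p))" by (simp add: bl sym[of "J _" v])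
  finally have "\<epsilon> * b a v = 0" using vp vy by simp
  moreover have "b q v = 0" using vn vy by (simp add: n_def br sym[of q v])
  ultimately show ?thesis using vJ Lorth unfolding F_def v_def[symmetric] by blast
qed

lemma proj_N:
  assumes p: "p \<in> M" and t: "t \<in> tangent_space M p" and w: "w \<in> N p"
  shows "proj b (normal_space b B M p) (t + w) = w"
  unfolding N_def[symmetric]
proof (rule proj_eqI[OF bil subspace_N[OF p] _ w])
  show "0 < b t t" if "t \<in> N p" "t \<noteq> 0" for t using pos_TB[OF p_B[OF p]] that by (simp add: N_iff)
  show "b (t + w - w) t' = 0" if "t' \<in> N p" for t' using t that by (simp add: N_iff sym[of t t'])
qed

lemma proj_N_self: "p \<in> M \<Longrightarrow> w \<in> N p \<Longrightarrow> proj b (normal_space b B M p) w = w"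
  using proj_N[of p 0 w] zero_tangent[of p M] by simp

lemma frame_iff: "p \<in> M \<Longrightarrow> frame p e \<longleftrightarrow> orthonormal b e \<and> range e \<subseteq> tangent_space M p"
  by (auto simp: frame_def tangent_M)

lemma frame_basis:
  assumes p: "p \<in> M"
  shows "orthonormal_basis b (tangent_space M p) e \<longleftrightarrow> frame p e"
proof
  assume "orthonormal_basis b (tangent_space M p) e"
  then show "frame p e" unfolding frame_iff[OF p] orthonormal_basis_iff
    using span_superset[of "range e"] by simp
next
  assume "frame p e"
  then have e: "orthonormal b e" "range e \<subseteq> tangent_space M p" unfolding frame_iff[OF p] by blast+
  then show "orthonormal_basis b (tangent_space M p) e"
    unfolding orthonormal_basis_iff using orthonormal_span[OF bil e subspace_TM[OF p] dim_TM[OF p]] by blast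
qed

lemma frame_exists:
  assumes p: "p \<in> M" shows "\<exists>e. frame p e"
proof -
  have "\<exists>e::'m \<Rightarrow> 'v. orthonormal b e \<and> span (range e) = tangent_space M p"
    by (rule orthonormal_exists[OF bil sym subspace_TM[OF p] dim_TM[OF p]])
      (rule pos_TB[OF p_B[OF p] TM_B[OF p]])
  then show ?thesis using frame_basis[OF p] by (auto simp: orthonormal_basis_iff)
qed

lemma frame_tangent: "p \<in> M \<Longrightarrow> frame p e \<Longrightarrow> e i \<in> tangent_space M p"
  by (auto simp: frame_iff)

lemma frame_span: "p \<in> M \<Longrightarrow> frame p e \<Longrightarrow> span (range e) = tangent_space M p"
  using frame_basis[of p e] by (simp add: orthonormal_basis_iff)

lemma TB_decomp:
  assumes p: "p \<in> M" and v: "v \<in> tangent_space B p"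
  shows "\<exists>t\<in>tangent_space M p. \<exists>w\<in>N p. v = t + w"
proof -
  obtain e where e: "frame p e" using frame_exists[OF p] by blast
  have oe: "orthonormal b e" using e by (simp add: frame_def)
  define t where "t = (\<Sum>i\<in>UNIV. b v (e i) *\<^sub>R e i)"
  have t: "t \<in> tangent_space M p"
    unfolding t_def using subspace_TM[OF p] frame_tangent[OF p e] by (intro subspace_sum subspace_mul)
  have "b (v - t) s = 0" if s: "s \<in> tangent_space M p" for s
  proof -
    have "b (v - t) (e i) = 0" for i using orthonormal_coeff[OF bil oe] by (simp add: t_def bl)
    moreover have "s \<in> span (range e)" using frame_span[OF p e] s by simp
    ultimately show ?thesis using orthonormal_Parseval[OF bil oe, of s "v - t"] by simp
  qed
  then have "v - t \<in> N p" using v TM_B[OF p t] subspace_TB[OF p_B[OF p]] by (simp add: N_iff subspace_diff)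
  then show ?thesis using t by (intro bexI[of _ t] bexI[of _ "v - t"]) auto
qed

lemma proj_N_in:
  assumes p: "p \<in> M" and v: "v \<in> tangent_space B p"
  shows "proj b (normal_space b B M p) v \<in> N p"
proof -
  obtain t w where "t \<in> tangent_space M p" "w \<in> N p" "v = t + w" using TB_decomp[OF p v] by blast
  then show ?thesis using proj_N[OF p] by simp
qed

end

context space_form_sphere
begin

lemma conn_eq:
  assumes "X \<in> tangent_space S p" "(g has_derivative D) (at p within S)" "\<And>x. x \<in> S \<Longrightarrow> f x = g x"
  shows "conn b B S f p X = proj b (tangent_space B p) (D X)"
proof -
  have "frechet_derivative f (at p within S) X = D X" by (rule frechet_derivative_tangent_cong[OF assms(1,2)]) (rule assms(3))
  then show ?thesis by (simp add: conn_def)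
qed

lemma proj_TB_radial:
  assumes p: "p \<in> M"
  shows "proj b (tangent_space B p) (c *\<^sub>R J (Ei p)) = (c * \<beta>) *\<^sub>R n p"
proof -
  have "\<epsilon> * b p (n p) = 0" using n_TB[OF p] by (simp add: TB[OF p_B[OF p]])
  then have "\<epsilon> * b p (J (Ei p)) = \<epsilon> * \<rho> * (\<epsilon> * b p p)"
    unfolding J_radial[OF p] by (auto simp: br algebra_simps)
  also have "\<dots> = \<epsilon> * \<rho>" unfolding Bn[OF p_B[OF p]] using eps by (auto simp: ac_simps)
  finally have e: "\<epsilon> * b p (J (Ei p)) = \<epsilon> * \<rho>" .
  have "proj b (tangent_space B p) (c *\<^sub>R J (Ei p)) = c *\<^sub>R J (Ei p) - (c * (\<epsilon> * b p (J (Ei p)))) *\<^sub>R p"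
    unfolding proj_TB[OF p_B[OF p]] by (simp add: br ac_simps)
  also have "\<dots> = (c * \<beta>) *\<^sub>R n p" unfolding e by (subst J_radial[OF p]) (simp add: algebra_simps)
  finally show ?thesis .
qed

lemma ext_M: "x \<in> M \<Longrightarrow> ext b M (J v) x = J (v - (v \<bullet> Ei x) *\<^sub>R Ei x)"
  unfolding ext_def
proof (rule proj_eqI[OF bil subspace_TM])
  assume x: "x \<in> M"
  show "0 < b t t" if "t \<in> tangent_space M x" "t \<noteq> 0" for t
    using pos_TB[OF p_B[OF x] TM_B[OF x that(1)] that(2)] .
  show "J (v - (v \<bullet> Ei x) *\<^sub>R Ei x) \<in> tangent_space M x"
    unfolding tangent_M[OF x] using Ei_unit[OF x] by (auto simp: inner_diff_left)
  show "b (J v - J (v - (v \<bullet> Ei x) *\<^sub>R Ei x)) t = 0" if "t \<in> tangent_space M x" for t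
    using that unfolding tangent_M[OF x] by (auto simp: J_diff J_scale bl bJ inner_commute)
qed

lemma Ji_tangent: "Ji ((1 / \<rho>) *\<^sub>R J v) = (1 / \<rho>) *\<^sub>R v"
  using linear_scale[OF linJi, of "1 / \<rho>" "J v"] by simp

lemma second_ff_M:
  assumes p: "p \<in> M" and X: "X \<in> tangent_space M p" and Y: "Y \<in> tangent_space M p"
  shows "second_ff b B M p X Y = - (\<beta> / \<rho> * b X Y) *\<^sub>R n p"
proof -
  obtain v w where v: "X = J v" "v \<bullet> Ei p = 0" and w: "Y = J w" "w \<bullet> Ei p = 0" using X Y unfolding tangent_M[OF p] by blast
  let ?D = "\<lambda>h. J (0 - ((w \<bullet> Ei p) *\<^sub>R Ji ((1 / \<rho>) *\<^sub>R h) + (w \<bullet> Ji ((1 / \<rho>) *\<^sub>R h)) *\<^sub>R Ei p))"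
  have "((\<lambda>x. J (w - (w \<bullet> Ei x) *\<^sub>R Ei x)) has_derivative ?D) (at p within M)"
    by (intro bounded_linear.has_derivative[OF bounded_linear_J(1)] has_derivative_diff has_derivative_scaleR
        has_derivative_inner_right Ei_has_derivative has_derivative_const)
  then have "conn b B M (ext b M Y) p X = proj b (tangent_space B p) (?D X)"
    by (rule conn_eq[OF X]) (simp add: w(1) ext_M)
  also have "?D X = (- (b X Y / \<rho>)) *\<^sub>R J (Ei p)"
    using v w by (simp add: Ji_tangent bJ inner_commute linear_neg[OF linJ] J_scale)
  also have "proj b (tangent_space B p) ((- (b X Y / \<rho>)) *\<^sub>R J (Ei p)) = - (\<beta> / \<rho> * b X Y) *\<^sub>R n p"
    unfolding proj_TB_radial[OF p] by (simp add: ac_simps)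
  finally have "conn b B M (ext b M Y) p X = - (\<beta> / \<rho> * b X Y) *\<^sub>R n p" .
  then show ?thesis
    unfolding second_ff_def using proj_N_self[OF p, of "- (\<beta> / \<rho> * b X Y) *\<^sub>R n p"] n_N[OF p] subspace_N[OF p] subspace_mul by metis
qed

lemma frame_second_ff:
  assumes p: "p \<in> M" and e: "frame p e"
  shows "second_ff b B M p (e i) (e j) = (if i = j then - (\<beta> / \<rho>) *\<^sub>R n p else 0)"
  using second_ff_M[OF p frame_tangent[OF p e] frame_tangent[OF p e]] e
  by (simp add: frame_def orthonormalD)

lemma mean_curv_M:
  assumes p: "p \<in> M"
  shows "mean_curv TYPE('m) b B M p = - (\<beta> / \<rho>) *\<^sub>R n p"
proof -
  define e where "e = (SOME e::'m \<Rightarrow> 'v. orthonormal_basis b (tangent_space M p) e)"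
  have "\<exists>e::'m \<Rightarrow> 'v. orthonormal_basis b (tangent_space M p) e" using frame_exists[OF p] frame_basis[OF p] by simp
  then have "orthonormal_basis b (tangent_space M p) e" unfolding e_def by (rule someI_ex)
  then have "frame p e" by (simp add: frame_basis[OF p])
  then have "(\<Sum>i\<in>UNIV. second_ff b B M p (e i) (e i)) = (\<Sum>i\<in>(UNIV :: 'm set). - (\<beta> / \<rho>) *\<^sub>R n p)"
    using frame_second_ff[OF p] by simp
  also have "\<dots> = real CARD('m) *\<^sub>R (- (\<beta> / \<rho>) *\<^sub>R n p)" by (simp add: sum_constant_scaleR)
  finally show ?thesis unfolding mean_curv_def Let_def e_def[symmetric] by simp
qed

lemma mean_curv_norm_M: "p \<in> M \<Longrightarrow> mean_curv_norm TYPE('m) b B M p = \<bar>\<beta>\<bar> / \<rho>"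
  unfolding mean_curv_norm_def using rho n_unit
  by (simp add: mean_curv_M bl br) (simp add: real_sqrt_mult[symmetric] real_sqrt_divide)

lemma n_has_derivative: "(n has_derivative (\<lambda>h. \<beta> *\<^sub>R J (Ji ((1 / \<rho>) *\<^sub>R h)))) Q"
  unfolding n_def[abs_def]
  by (rule has_derivative_eq_rhs, (rule derivative_intros bounded_linear.has_derivative[OF bounded_linear_J(1)] Ei_has_derivative)+) simp

lemma parallel_mean_curv_M: "parallel_mean_curv TYPE('m) b B M"
  unfolding parallel_mean_curv_def
proof (intro ballI)
  fix p X assume p: "p \<in> M" and X: "X \<in> tangent_space M p"
  obtain v where v: "X = J v" "v \<bullet> Ei p = 0" using X unfolding tangent_M[OF p] by blast
  have "((\<lambda>x. - (\<beta> / \<rho>) *\<^sub>R n x) has_derivative (\<lambda>h. - (\<beta> / \<rho>) *\<^sub>R (\<beta> *\<^sub>R J (Ji ((1 / \<rho>) *\<^sub>R h))))) (at p within M)"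
    by (rule has_derivative_scaleR_right[OF n_has_derivative])
  then have "conn b B M (mean_curv TYPE('m) b B M) p X = proj b (tangent_space B p) (- (\<beta> / \<rho>) *\<^sub>R (\<beta> *\<^sub>R J (Ji ((1 / \<rho>) *\<^sub>R X))))"
    by (rule conn_eq[OF X]) (simp add: mean_curv_M)
  also have "- (\<beta> / \<rho>) *\<^sub>R (\<beta> *\<^sub>R J (Ji ((1 / \<rho>) *\<^sub>R X))) = (- (\<beta> / \<rho>) * \<beta> / \<rho>) *\<^sub>R X"
    unfolding v(1) Ji_tangent by (simp add: J_scale)
  finally have "conn b B M (mean_curv TYPE('m) b B M) p X = proj b (tangent_space B p) ((- (\<beta> / \<rho>) * \<beta> / \<rho>) *\<^sub>R X)" .
  moreover have s: "(- (\<beta> / \<rho>) * \<beta> / \<rho>) *\<^sub>R X \<in> tangent_space M p" using X subspace_TM[OF p] subspace_mul by blast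
  ultimately have "conn b B M (mean_curv TYPE('m) b B M) p X = (- (\<beta> / \<rho>) * \<beta> / \<rho>) *\<^sub>R X + 0"
    using proj_TB_tangent[OF p_B[OF p] TM_B[OF p s]] by simp
  moreover have "0 \<in> N p" using subspace_N[OF p] by (rule subspace_0)
  ultimately show "normal_conn b B M (mean_curv TYPE('m) b B M) p X = 0"
    unfolding normal_conn_def using proj_N[OF p s] by metis
qed

lemma b_has_derivative: "((\<lambda>x. b x Y) has_derivative (\<lambda>h. b h Y)) Q"
  by (rule bounded_linear_imp_has_derivative) (rule bounded_bilinear.bounded_linear_left[OF bounded_bilinear_b])

lemma ext_B_has_derivative:
  "((\<lambda>x. Z - (\<epsilon> * b x Z) *\<^sub>R x) has_derivative (\<lambda>h. - ((\<epsilon> * b p Z) *\<^sub>R h + (\<epsilon> * b h Z) *\<^sub>R p))) (at p within S)"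
  by (rule has_derivative_eq_rhs, (rule derivative_intros b_has_derivative)+) simp

lemma conn_ext_B:
  assumes p: "p \<in> B" and X: "X \<in> tangent_space B p"
  shows "conn b B B (ext b B Z) p X = - (\<epsilon> * b p Z) *\<^sub>R X"
proof -
  have eX: "\<epsilon> * b p X = 0" using X by (simp add: TB[OF p])
  have "conn b B B (ext b B Z) p X = proj b (tangent_space B p) (- ((\<epsilon> * b p Z) *\<^sub>R X + (\<epsilon> * b X Z) *\<^sub>R p))"
    by (rule conn_eq[OF X ext_B_has_derivative]) (simp add: ext_B)
  also have "\<dots> = - (\<epsilon> * b p Z) *\<^sub>R X + (- (\<epsilon> * b X Z) + (\<epsilon> * b p Z) * (\<epsilon> * b p X) + \<epsilon> * b X Z * (\<epsilon> * b p p)) *\<^sub>R p"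
    unfolding proj_TB[OF p] by (simp add: br algebra_simps)
  also have "- (\<epsilon> * b X Z) + (\<epsilon> * b p Z) * (\<epsilon> * b p X) + \<epsilon> * b X Z * (\<epsilon> * b p p) = b X Z * (\<epsilon> * \<epsilon> * \<epsilon> - \<epsilon>)"
    unfolding Bn[OF p] eX by (simp add: algebra_simps)
  finally show ?thesis using eps by simp
qed

lemma curv_B:
  assumes p: "p \<in> B" and X: "X \<in> tangent_space B p" and Y: "Y \<in> tangent_space B p" and Z: "Z \<in> tangent_space B p"
  shows "curv b B p X Y Z = (\<epsilon> * b X Z) *\<^sub>R Y - (\<epsilon> * b Y Z) *\<^sub>R X"
proof -
  have e0: "\<epsilon> * b p X = 0" "\<epsilon> * b p Y = 0" "\<epsilon> * b p Z = 0" using X Y Z by (simp_all add: TB[OF p])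
  have ext_in: "ext b B V x \<in> tangent_space B x" if "x \<in> B" for V x
    unfolding ext_def by (rule proj_TB_in[OF that])
  have main: "conn b B B (\<lambda>x. conn b B B (ext b B Z) x (ext b B V x)) p W = - (\<epsilon> * b W Z) *\<^sub>R V"
    if V: "V \<in> tangent_space B p" and W: "W \<in> tangent_space B p" for V W
  proof -
    have ev: "\<epsilon> * b p V = 0" using V by (simp add: TB[OF p])
    have d1: "((\<lambda>x. - (\<epsilon> * b x Z)) has_derivative (\<lambda>h. - (\<epsilon> * b h Z))) (at p within B)"
      by (rule has_derivative_eq_rhs, (rule derivative_intros b_has_derivative)+) simp
    have "conn b B B (\<lambda>x. conn b B B (ext b B Z) x (ext b B V x)) p W
      = proj b (tangent_space B p) ((- (\<epsilon> * b p Z)) *\<^sub>R (- ((\<epsilon> * b p V) *\<^sub>R W + (\<epsilon> * b W V) *\<^sub>R p)) + (- (\<epsilon> * b W Z)) *\<^sub>R (V - (\<epsilon> * b p V) *\<^sub>R p))"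
      by (rule conn_eq[OF W has_derivative_scaleR[OF d1 ext_B_has_derivative]])
        (simp only: conn_ext_B[OF _ ext_in], simp add: ext_B)
    also have "\<dots> = proj b (tangent_space B p) (- (\<epsilon> * b W Z) *\<^sub>R V)"
      unfolding e0 ev by simp
    also have "\<dots> = - (\<epsilon> * b W Z) *\<^sub>R V"
      by (rule proj_TB_tangent[OF p]) (use V subspace_TB[OF p] subspace_mul in blast)
    finally show ?thesis .
  qed
  have fd: "frechet_derivative (ext b B V) (at p within B) W = - ((\<epsilon> * b p V) *\<^sub>R W + (\<epsilon> * b W V) *\<^sub>R p)"
    if "W \<in> tangent_space B p" for V W
    by (rule frechet_derivative_tangent_cong[OF that ext_B_has_derivative]) (simp add: ext_B)
  have br0: "frechet_derivative (ext b B Y) (at p within B) X - frechet_derivative (ext b B X) (at p within B) Y = 0"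
    unfolding fd[OF X] fd[OF Y] e0 by (simp add: sym[of X Y])
  have "conn b B B (ext b B Z) p 0 = 0"
    using conn_ext_B[OF p subspace_0[OF subspace_TB[OF p]]] by simp
  then show ?thesis
    unfolding curv_def Let_def br0 main[OF Y X] main[OF X Y] by simp
qed

lemma R_op_M:
  assumes p: "p \<in> M" and e: "frame p e" and w: "w \<in> N p"
  shows "R_op b B M e p w = (real CARD('m) * \<epsilon>) *\<^sub>R w"
proof -
  have "proj b (normal_space b B M p) (curv b B p (e i) w (e i)) = \<epsilon> *\<^sub>R w" for i
  proof -
    have t: "e i \<in> tangent_space M p" by (rule frame_tangent[OF p e])
    have "curv b B p (e i) w (e i) = (\<epsilon> * b (e i) (e i)) *\<^sub>R w - (\<epsilon> * b w (e i)) *\<^sub>R e i"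
      using w by (intro curv_B[OF p_B[OF p]] TM_B[OF p t]) (simp add: N_iff)
    also have "\<dots> = 0 + \<epsilon> *\<^sub>R w" using e w t by (simp add: frame_def orthonormalD N_iff)
    finally show ?thesis
      using proj_N[OF p subspace_0[OF subspace_TM[OF p]] subspace_mul[OF subspace_N[OF p] w, of \<epsilon>]] by simp
  qed
  then show ?thesis unfolding R_op_def by (simp add: sum_constant_scaleR)
qed

lemma B_op_M:
  assumes p: "p \<in> M" and e: "frame p e"
  shows "b (B_op b B M e p w) w = real CARD('m) * (\<beta> / \<rho>)\<^sup>2 * (b w (n p))\<^sup>2"
proof -
  have "B_op b B M e p w = (\<Sum>i\<in>(UNIV :: 'm set). ((\<beta> / \<rho>)\<^sup>2 * b w (n p)) *\<^sub>R n p)"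
    unfolding B_op_def frame_second_ff[OF p e]
    by (intro sum.cong refl) (simp add: if_distrib[of "b w"] br if_distrib[of "\<lambda>z. z *\<^sub>R _"] power2_eq_square cong: if_cong)
  then show ?thesis by (simp add: sum_constant_scaleR bl sym[of "n p" w] power2_eq_square)
qed

end

section \<open>Spheres in fibres of a fibration\<close>

lemma det_le_of_norm_bound:
  fixes A :: "real^'n::{finite,wellorder}^'n::_"
  assumes k: "0 < k" and le: "\<And>x. norm (A *v x) \<le> k * norm x"
  shows "\<bar>det A\<bar> \<le> k ^ CARD('n)"
proof -
  let ?B = "cball (0::real^'n::_) 1"
  have l: "linear (\<lambda>x. A *v x)" by (rule matrix_vector_mul_linear)
  have l': "linear (\<lambda>x::real^'n::_. k *\<^sub>R x)" by (rule linear_scale_self)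
  have sub: "(\<lambda>x. A *v x) ` ?B \<subseteq> (\<lambda>x. k *\<^sub>R x) ` ?B"
  proof
    fix y assume "y \<in> (\<lambda>x. A *v x) ` ?B"
    then obtain x where x: "y = A *v x" "norm x \<le> 1" by auto
    have "k * norm x \<le> k * 1" by (rule mult_left_mono) (use x(2) k in auto)
    then have "norm y \<le> k" using le[of x] x(1) by simp
    then have "(1 / k) *\<^sub>R y \<in> ?B" using k by (simp add: divide_le_eq)
    moreover have "y = k *\<^sub>R ((1 / k) *\<^sub>R y)" using k by simp
    ultimately show "y \<in> (\<lambda>x. k *\<^sub>R x) ` ?B" by blast
  qed
  have "measure lebesgue ((\<lambda>x. A *v x) ` ?B) \<le> measure lebesgue ((\<lambda>x. k *\<^sub>R x) ` ?B)"
    by (rule measure_mono_fmeasurable[OF sub])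
      (use measurable_linear_image[OF l, of ?B] measurable_linear_image[OF l', of ?B] in \<open>auto simp: fmeasurableD\<close>)
  then have "\<bar>det (matrix (\<lambda>x. A *v x))\<bar> * measure lebesgue ?B \<le> \<bar>det (matrix (\<lambda>x::real^'n::_. k *\<^sub>R x))\<bar> * measure lebesgue ?B"
    using measure_linear_image[OF l, of ?B] measure_linear_image[OF l', of ?B] by simp
  moreover have "0 < measure lebesgue ?B" using content_cball_pos[of 1 "0::real^'n::_"] by simp
  ultimately have "\<bar>det A\<bar> \<le> \<bar>det (matrix (\<lambda>x::real^'n::_. k *\<^sub>R x))\<bar>" by simp
  also have "\<dots> = k ^ CARD('n)" using k det_matrix_scaleR[of k, where 'n='n] by simp
  finally show ?thesis .
qed

lemma det_two_proportional_rows: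
  fixes A :: "real^'n::finite^'n"
  assumes "i \<noteq> j" "\<And>k. A $ i $ k = c * r k" "\<And>k. A $ j $ k = d * r k"
  shows "det A = 0"
proof -
  define A' :: "real^'n^'n" where "A' = (\<chi> k. if k = i \<or> k = j then vec_lambda r else A $ k)"
  have "A = (\<chi> k. (if k = i then c else if k = j then d else 1) *s A' $ k)"
    using assms by (auto simp: vec_eq_iff A'_def)
  then have "det A = prod (\<lambda>k. if k = i then c else if k = j then d else 1) UNIV * det A'"
    by (metis det_rows_mul vec_lambda_eta)
  moreover have "det A' = 0"
    by (rule det_identical_rows[OF assms(1)]) (simp add: A'_def row_def vec_eq_iff)
  ultimately show ?thesis by simp
qed

locale fibred_sphere = space_form_sphere b a \<rho> J \<epsilon> B q \<beta> L
  for b :: "'v::euclidean_space \<Rightarrow> 'v \<Rightarrow> real" and a :: 'v and \<rho> :: real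
    and J :: "(real^'m::{finite,wellorder}) \<times> real \<Rightarrow> 'v"
    and \<epsilon> :: real and B :: "'v set" and q :: 'v and \<beta> :: real and L :: "'v set" +
  fixes \<pi> :: "'v \<Rightarrow> 'p" and u :: "'v \<Rightarrow> 'm option \<Rightarrow> 'v" and yy :: 'p and \<nu> :: "'v \<Rightarrow> 'v"
  assumes M_fibre: "M \<subseteq> fibre B \<pi> yy" and fibre_L: "fibre B \<pi> yy \<subseteq> L"
    and orient: "fibre_orientation b B \<pi> u"
    and adapted: "adapted_normal TYPE('m) b B (fibre B \<pi> yy) M \<nu>"
begin

abbreviation "\<Phi> \<equiv> fibre B \<pi> yy"
abbreviation "\<Omega> \<equiv> Omega b B \<pi> u"

lemma u_vertical: "x \<in> B \<Longrightarrow> orthonormal b (u x)" "x \<in> B \<Longrightarrow> span (range (u x)) = vertical B \<pi> x"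
  using orient by (auto simp: fibre_orientation_def orthonormal_basis_iff)

lemma fibre_B: "fibre B \<pi> y \<subseteq> B"
  by (auto simp: fibre_def)

lemma vertical_TB: "v \<in> vertical B \<pi> x \<Longrightarrow> v \<in> tangent_space B x"
  unfolding vertical_def using tangent_space_mono[OF fibre_B] by blast

lemma vertical_fibre: "p \<in> \<Phi> \<Longrightarrow> vertical B \<pi> p = tangent_space \<Phi> p"
  by (simp add: vertical_def fibre_def)

lemma vertical_L: "p \<in> \<Phi> \<Longrightarrow> v \<in> vertical B \<pi> p \<Longrightarrow> v \<in> L"
  unfolding vertical_fibre by (rule tangent_space_in_subspace[OF _ fibre_L L(1)])

lemma subspace_vertical: "x \<in> B \<Longrightarrow> subspace (vertical B \<pi> x)"
  using u_vertical(2) by (metis subspace_span)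

lemma u_in: "x \<in> B \<Longrightarrow> u x j \<in> vertical B \<pi> x"
  using u_vertical(2)[of x] span_base[of "u x j" "range (u x)"] by auto

lemma u_TB: "x \<in> B \<Longrightarrow> \<epsilon> * b x (u x j) = 0"
  using vertical_TB[OF u_in, of x j] TB by auto

definition om where "om x X = det (\<chi> i j. b (X i) (u x j))"

lemma proj_vertical:
  assumes x: "x \<in> B"
  shows "proj b (vertical B \<pi> x) v = (\<Sum>j\<in>UNIV. b v (u x j) *\<^sub>R u x j)"
proof (rule proj_eqI[OF bil subspace_vertical[OF x]])
  show "0 < b t t" if "t \<in> vertical B \<pi> x" "t \<noteq> 0" for t using pos_TB[OF x vertical_TB] that by blast
  show "(\<Sum>j\<in>UNIV. b v (u x j) *\<^sub>R u x j) \<in> vertical B \<pi> x"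
    using subspace_vertical[OF x] u_in[OF x] by (intro subspace_sum subspace_mul)
  fix t assume "t \<in> vertical B \<pi> x"
  then have t: "t \<in> span (range (u x))" using u_vertical(2)[OF x] by simp
  have "b (v - (\<Sum>j\<in>UNIV. b v (u x j) *\<^sub>R u x j)) (u x i) = 0" for i
    using orthonormal_coeff[OF bil u_vertical(1)[OF x]] by (simp add: bl)
  then show "b (v - (\<Sum>j\<in>UNIV. b v (u x j) *\<^sub>R u x j)) t = 0"
    using orthonormal_Parseval[OF bil u_vertical(1)[OF x] t] by simp
qed

lemma Omega_om: "x \<in> B \<Longrightarrow> \<Omega> x X = om x X"
  unfolding Omega_def om_def using orthonormal_coeff[OF bil u_vertical(1)[of x]] by (simp add: proj_vertical)

lemma om_ext:
  assumes x: "x \<in> B" shows "\<Omega> x (\<lambda>i. ext b B (X i) x) = om x X"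
proof -
  have "b (X i - (\<epsilon> * b x (X i)) *\<^sub>R x) (u x j) = b (X i) (u x j)" for i j
    using u_TB[OF x, of j] by (auto simp: bl)
  then show ?thesis by (simp add: Omega_om[OF x] om_def ext_B[OF x])
qed

lemma om_smooth: "smooth_on B (\<lambda>x. om x X)"
proof (rule smooth_on_cong[of B "\<lambda>x. \<Omega> x (\<lambda>i. ext b B (X i) x)"])
  show "smooth_on B (\<lambda>x. \<Omega> x (\<lambda>i. ext b B (X i) x))" using orient by (simp add: fibre_orientation_def)
qed (auto simp: om_ext)

lemma om_zero: "(\<And>j. b (X i) (u x j) = 0) \<Longrightarrow> om x X = 0"
  unfolding om_def by (rule det_zero_row(1)[of i]) (simp add: row_def vec_eq_iff)

lemma om_proportional: "i \<noteq> k \<Longrightarrow> (\<And>j. b (X i) (u x j) = c * r j) \<Longrightarrow> (\<And>j. b (X k) (u x j) = d * r j) \<Longrightarrow> om x X = 0"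
  unfolding om_def by (rule det_two_proportional_rows[of i k _ c r d]) auto

lemma om_linear: "om x (case_option (c *\<^sub>R Y0 + W) e) = c * om x (case_option Y0 e) + om x (case_option W e)"
proof -
  have r: "(\<chi> i j. b (case_option Y0 e i) (u x j)) = (\<chi> i. if i = None then (\<chi> j. b Y0 (u x j)) else (\<chi> j. b (case_option 0 e i) (u x j)))" for Y0
    by (auto simp: vec_eq_iff split: option.splits)
  have s: "(\<chi> j. b (c *\<^sub>R Y0 + W) (u x j)) = c *s (\<chi> j. b Y0 (u x j)) + (\<chi> j. b W (u x j))"
    by (simp add: vec_eq_iff bl)
  show ?thesis unfolding om_def r s det_row_add det_row_mul ..
qed

lemma M_Phi: "p \<in> M \<Longrightarrow> p \<in> \<Phi>"
  using M_fibre by auto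

lemma nu_props:
  assumes p: "p \<in> M"
  shows "\<nu> p \<in> vertical B \<pi> p" "\<nu> p \<in> N p" "\<nu> p \<in> L" "b (\<nu> p) (\<nu> p) = 1" "\<nu> p = b (\<nu> p) (n p) *\<^sub>R n p" "(b (\<nu> p) (n p))\<^sup>2 = 1"
proof -
  have a: "\<nu> p \<in> normal_space b \<Phi> M p" "b (\<nu> p) (\<nu> p) = 1" using adapted p by (auto simp: adapted_normal_def)
  show v: "\<nu> p \<in> vertical B \<pi> p" using a(1) vertical_fibre[OF M_Phi[OF p]] by (simp add: normal_space_def)
  show N: "\<nu> p \<in> N p" using a(1) vertical_TB[OF v] by (simp add: normal_space_def N_iff)
  show nL: "\<nu> p \<in> L" using vertical_L[OF M_Phi[OF p] v] .
  show "b (\<nu> p) (\<nu> p) = 1" by (rule a(2))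
  define w where "w = \<nu> p - b (\<nu> p) (n p) *\<^sub>R n p"
  have "w \<in> F" "w \<in> L" using N_decomp[OF p N] nL n_L L(1) by (auto simp: w_def subspace_diff subspace_mul)
  then have "b w w = 0" by (simp add: F_def)
  moreover have "w \<in> tangent_space B p" using F_TB[OF p_L[OF p] p_B[OF p] \<open>w \<in> F\<close>] .
  ultimately have "w = 0" using pos_TB[OF p_B[OF p]] by force
  then show e: "\<nu> p = b (\<nu> p) (n p) *\<^sub>R n p" by (simp add: w_def)
  have "b (\<nu> p) (\<nu> p) = (b (\<nu> p) (n p))\<^sup>2" by (subst (2) e) (simp add: br power2_eq_square)
  then show "(b (\<nu> p) (n p))\<^sup>2 = 1" using a(2) by simp
qed

lemma nu_beta:
  assumes p: "p \<in> M" and "\<beta> \<noteq> 0"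
  shows "\<nu> p = - sgn \<beta> *\<^sub>R n p"
proof -
  have "- (\<beta> / \<rho>) *\<^sub>R n p = (\<bar>\<beta>\<bar> / \<rho>) *\<^sub>R \<nu> p"
    using adapted p mean_curv_M[OF p] mean_curv_norm_M[OF p] by (auto simp: adapted_normal_def)
  then have "(\<rho> / \<bar>\<beta>\<bar>) *\<^sub>R (- (\<beta> / \<rho>) *\<^sub>R n p) = (\<rho> / \<bar>\<beta>\<bar>) *\<^sub>R ((\<bar>\<beta>\<bar> / \<rho>) *\<^sub>R \<nu> p)" by (rule arg_cong)
  then show ?thesis using assms(2) rho by (cases "0 < \<beta>") simp_all
qed

definition adapted_frame :: "'v \<Rightarrow> ('m \<Rightarrow> 'v) \<Rightarrow> bool" where
  "adapted_frame p e \<longleftrightarrow> frame p e \<and> om p (case_option (\<nu> p) e) = 1"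

lemma nu_frame:
  assumes p: "p \<in> M" and e: "frame p e"
  shows "orthonormal b (case_option (\<nu> p) e)" "span (range (case_option (\<nu> p) e)) = vertical B \<pi> p"
proof -
  have t: "e i \<in> tangent_space M p" for i using frame_tangent[OF p e] .
  have ne: "b (\<nu> p) (e i) = 0" for i using nu_props(2)[OF p] t by (simp add: N_iff)
  then have ne': "b (e i) (\<nu> p) = 0" for i by (simp add: sym[of "e i"])
  show o: "orthonormal b (case_option (\<nu> p) e)"
    using e nu_props(4)[OF p] ne ne' unfolding orthonormal_def frame_def by (auto split: option.splits)
  have "e i \<in> vertical B \<pi> p" for i
    unfolding vertical_fibre[OF M_Phi[OF p]] using tangent_space_mono[OF M_fibre] t by blast
  then have "range (case_option (\<nu> p) e) \<subseteq> vertical B \<pi> p"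
    using nu_props(1)[OF p] by (auto split: option.splits)
  moreover have "dim (vertical B \<pi> p) = CARD('m option)"
    using dim_orthonormal_span[OF bil u_vertical(1)] u_vertical(2) p_B[OF p] by metis
  ultimately show "span (range (case_option (\<nu> p) e)) = vertical B \<pi> p"
    using orthonormal_span[OF bil o _ subspace_vertical[OF p_B[OF p]]] by blast
qed

lemma om_frame:
  assumes p: "p \<in> M" and e: "frame p e"
  shows "om p (case_option (\<nu> p) e) = 1 \<or> om p (case_option (\<nu> p) e) = - 1"
proof -
  define w where "w = case_option (\<nu> p) e"
  define A :: "real^'m option^'m option" where "A = (\<chi> i j. b (w i) (u p j))"
  have w: "orthonormal b w" "span (range w) = vertical B \<pi> p" unfolding w_def using nu_frame[OF p e] by auto
  have "A ** transpose A = mat 1"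
  proof -
    have "(A ** transpose A) $ i $ k = b (w i) (w k)" for i k
    proof -
      have "w k \<in> span (range (u p))" unfolding u_vertical(2)[OF p_B[OF p]] w(2)[symmetric] by (simp add: span_base)
      from orthonormal_Parseval[OF bil u_vertical(1)[OF p_B[OF p]] this, of "w i"]
      show ?thesis by (simp add: A_def matrix_matrix_mult_def transpose_def mult.commute)
    qed
    then show ?thesis using w(1) by (simp add: vec_eq_iff mat_def orthonormalD)
  qed
  then have "orthogonal_matrix A" by (simp add: orthogonal_matrix_def matrix_left_right_inverse)
  then show ?thesis using det_orthogonal_matrix unfolding om_def w_def[symmetric] A_def by blast
qed

lemma adapted_frame_exists:
  assumes p: "p \<in> M" shows "\<exists>e. adapted_frame p e"
proof -
  obtain e where e: "frame p e" using frame_exists[OF p] by blast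
  obtain k :: 'm where True by blast
  show ?thesis
  proof (cases "om p (case_option (\<nu> p) e) = 1")
    case True
    then show ?thesis using e by (auto simp: adapted_frame_def)
  next
    case False
    then have m1: "om p (case_option (\<nu> p) e) = - 1" using om_frame[OF p e] by blast
    define e' where "e' = e(k := - e k)"
    have "orthonormal b e'" using e unfolding frame_def orthonormal_def e'_def by (auto simp: bl br)
    moreover have "range e' \<subseteq> tangent_space M p"
      using frame_tangent[OF p e] subspace_TM[OF p] by (auto simp: e'_def subspace_neg)
    ultimately have f: "frame p e'" by (simp add: frame_iff[OF p])
    have "(\<chi> i j. b (case_option (\<nu> p) e' i) (u p j)) = (\<chi> i. (if i = Some k then -1 else 1) *s (\<chi> j. b (case_option (\<nu> p) e i) (u p j)))"
      by (auto simp: vec_eq_iff e'_def bl split: option.splits)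
    then have "om p (case_option (\<nu> p) e') = (\<Prod>i\<in>UNIV. if i = Some k then -1 else 1) * om p (case_option (\<nu> p) e)"
      unfolding om_def by (simp only: det_rows_mul)
    then have "om p (case_option (\<nu> p) e') = 1" using m1 by (simp add: prod.delta)
    then show ?thesis using f by (auto simp: adapted_frame_def)
  qed
qed

lemma direct_frame_adapted:
  assumes p: "p \<in> M" shows "adapted_frame p (direct_frame b M \<Omega> \<nu> p)"
proof -
  have "orthonormal_basis b (tangent_space M p) e \<and> \<Omega> p (case_option (\<nu> p) e) = 1 \<longleftrightarrow> adapted_frame p e" for e
    by (simp add: adapted_frame_def frame_basis[OF p] Omega_om[OF p_B[OF p]])
  then have "direct_frame b M \<Omega> \<nu> p = (SOME e. adapted_frame p e)" by (simp add: direct_frame_def)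
  then show ?thesis using adapted_frame_exists[OF p] by (simp add: someI_ex)
qed

definition Dom where "Dom p X Y0 e = frechet_derivative (\<lambda>x. om x (case_option Y0 e)) (at p within B) X"

lemma om_has_derivative: "p \<in> B \<Longrightarrow> ((\<lambda>x. om x Y) has_derivative frechet_derivative (\<lambda>x. om x Y) (at p within B)) (at p within B)"
  by (rule smooth_on_has_derivative[OF om_smooth])

lemma conn_form_Dom:
  assumes p: "p \<in> B" and X: "X \<in> tangent_space B p" and Y0: "Y0 \<in> tangent_space B p" and e: "\<And>i. e i \<in> tangent_space B p"
  shows "conn_form b B \<Omega> p X (case_option Y0 e) = Dom p X Y0 e"
proof -
  let ?Y = "case_option Y0 e"
  have Y: "?Y i \<in> tangent_space B p" for i using Y0 e by (auto split: option.splits)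
  have "conn b B B (ext b B (?Y i)) p X = 0" for i
    using conn_ext_B[OF p X] Y[of i] by (simp add: TB[OF p])
  then have z: "\<Omega> p (?Y(i := conn b B B (ext b B (?Y i)) p X)) = 0" for i
    unfolding Omega_om[OF p] by (intro om_zero[of _ i]) (simp add: bl)
  have "frechet_derivative (\<lambda>x. \<Omega> x (\<lambda>i. ext b B (?Y i) x)) (at p within B) X = Dom p X Y0 e"
    unfolding Dom_def by (rule frechet_derivative_tangent_cong[OF X om_has_derivative[OF p]]) (simp add: om_ext)
  then show ?thesis unfolding conn_form_def by (simp add: z)
qed

lemma Dom_linear:
  assumes p: "p \<in> B"
  shows "X \<in> tangent_space B p \<Longrightarrow> Dom p X (c *\<^sub>R Y0 + W) e = c * Dom p X Y0 e + Dom p X W e"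
    and "Dom p (c *\<^sub>R X + X') Y0 e = c * Dom p X Y0 e + Dom p X' Y0 e"
proof -
  have "linear (frechet_derivative (\<lambda>x. om x (case_option Y0 e)) (at p within B))"
    using om_has_derivative[OF p] has_derivative_linear by blast
  then show "Dom p (c *\<^sub>R X + X') Y0 e = c * Dom p X Y0 e + Dom p X' Y0 e"
    unfolding Dom_def by (simp add: linear_add linear_scale)
  assume X: "X \<in> tangent_space B p"
  show "Dom p X (c *\<^sub>R Y0 + W) e = c * Dom p X Y0 e + Dom p X W e"
    unfolding Dom_def
    by (rule frechet_derivative_tangent_cong[OF X has_derivative_add[OF has_derivative_mult_right[OF om_has_derivative[OF p]] om_has_derivative[OF p]]])
      (simp add: om_linear)
qed

lemma Dom_nu_horizontal:
  assumes p: "p \<in> M" and h: "h \<in> F"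
  shows "Dom p (\<nu> p) h e = 0"
proof -
  have "\<nu> p \<in> tangent_space \<Phi> p" using nu_props(1)[OF p] vertical_fibre[OF M_Phi[OF p]] by simp
  then obtain c r where c: "0 < r" "\<And>t. t \<in> {-r<..<r} \<Longrightarrow> c t \<in> \<Phi>" "c 0 = p" "(c has_vector_derivative \<nu> p) (at (0::real))"
    by (blast elim: tangent_spaceE)
  have "((\<lambda>t. om (c t) (case_option h e)) has_vector_derivative Dom p (\<nu> p) h e) (at 0)"
    unfolding Dom_def
    by (rule curve_has_vector_derivative[OF om_has_derivative[OF p_B[OF p]] c(3,1) _ c(4)]) (use c(2) fibre_B in blast)
  then show ?thesis
  proof (rule vector_derivative_const_on_interval[OF _ c(1)])
    fix t assume "t \<in> {-r<..<r}"
    then have ct: "c t \<in> \<Phi>" by (rule c(2))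
    show "om (c t) (case_option h e) = 0"
    proof (rule om_zero[of _ None])
      fix j
      have "u (c t) j \<in> L" using vertical_L[OF ct u_in] ct fibre_B by blast
      then show "b (case_option h e None) (u (c t) j) = 0" using h by (simp add: F_def)
    qed
  qed
qed

end

context fibred_sphere
begin

lemma neg_eps_le: "- \<epsilon> \<le> \<epsilon> * \<epsilon>"
proof -
  have "\<epsilon> * (\<epsilon> - 1) * (\<epsilon> + 1) = 0" using eps by (simp add: algebra_simps)
  then have "\<epsilon> = 0 \<or> \<epsilon> = 1 \<or> \<epsilon> = -1" by auto
  then show ?thesis by auto
qed

lemma om_bound:
  assumes x: "x \<in> B" and Y: "orthonormal b Y"
  shows "(om x Y)\<^sup>2 \<le> (1 + \<epsilon> * \<epsilon> * (\<Sum>i\<in>UNIV. (b x (Y i))\<^sup>2)) ^ CARD('m option)"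
proof -
  define g where "g = 1 + \<epsilon> * \<epsilon> * (\<Sum>i\<in>UNIV. (b x (Y i))\<^sup>2)"
  have g1: "1 \<le> g" unfolding g_def by (simp add: sum_nonneg)
  define A :: "real^'m option^'m option" where "A = (\<chi> i j. b (Y i) (u x j))"
  have "norm (transpose A *v v) \<le> sqrt g * norm v" for v
  proof -
    define y where "y = (\<Sum>i\<in>UNIV. (v $ i) *\<^sub>R Y i)"
    have lin1: "linear (\<lambda>z. b z w)" and lin2: "linear (b w)" for w using lin_b by auto
    have yj: "(transpose A *v v) $ j = b y (u x j)" for j
      unfolding y_def by (simp add: linear_sum[OF lin1] bl A_def matrix_vector_mult_def transpose_def mult.commute)
    have "v \<bullet> v = b y y"
    proof -
      have "b y (Y i) = v $ i" for i unfolding y_def by (rule orthonormal_coeff[OF bil Y])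
      then have "b y y = (\<Sum>i\<in>UNIV. v $ i * v $ i)" by (subst (2) y_def) (simp add: linear_sum[OF lin2] br)
      then show ?thesis by (simp add: inner_vec_def)
    qed
    define t where "t = y - (\<epsilon> * b x y) *\<^sub>R x"
    define P where "P = (\<Sum>j\<in>UNIV. b y (u x j) *\<^sub>R u x j)"
    have tT: "t \<in> tangent_space B x" using proj_TB_in[OF x, of y] by (simp add: proj_TB[OF x] t_def)
    have PT: "P \<in> tangent_space B x" unfolding P_def
      using subspace_TB[OF x] vertical_TB[OF u_in[OF x]] by (intro subspace_sum subspace_mul)
    have uu: "b t (u x j) = b y (u x j)" for j using u_TB[OF x, of j] by (auto simp: t_def bl)
    have Pu: "b P (u x j) = b y (u x j)" for j unfolding P_def by (rule orthonormal_coeff[OF bil u_vertical(1)[OF x]])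
    have tP: "b t P = (\<Sum>j\<in>UNIV. (b y (u x j))\<^sup>2)" "b P P = (\<Sum>j\<in>UNIV. (b y (u x j))\<^sup>2)"
      by (subst P_def, simp add: linear_sum[OF lin2] br uu power2_eq_square)
        (subst (2) P_def, simp add: linear_sum[OF lin2] br Pu power2_eq_square)
    have "0 \<le> b (t - P) (t - P)"
      using pos_TB[OF x subspace_diff[OF subspace_TB[OF x] tT PT]] by (cases "t - P = 0") (auto simp: bl less_imp_le)
    then have "(\<Sum>j\<in>UNIV. (b y (u x j))\<^sup>2) \<le> b t t" using tP by (simp add: bl br sym[of P t])
    also have "b t t = b y y - \<epsilon> * (b x y)\<^sup>2"
    proof -
      have "b t t = b y y - 2 * \<epsilon> * (b x y)\<^sup>2 + \<epsilon> * (b x y)\<^sup>2 * (\<epsilon> * b x x)"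
        unfolding t_def by (simp add: bl br sym[of y x] power2_eq_square algebra_simps)
      also have "\<epsilon> * (b x y)\<^sup>2 * (\<epsilon> * b x x) = (\<epsilon> * \<epsilon> * \<epsilon>) * (b x y)\<^sup>2" unfolding Bn[OF x] by (simp add: ac_simps)
      finally show ?thesis unfolding eps by simp
    qed
    also have "\<dots> \<le> b y y + \<epsilon> * \<epsilon> * (b x y)\<^sup>2"
      using mult_right_mono[OF neg_eps_le, of "(b x y)\<^sup>2"] by simp
    finally have le: "(\<Sum>j\<in>UNIV. (b y (u x j))\<^sup>2) \<le> b y y + \<epsilon> * \<epsilon> * (b x y)\<^sup>2" .
    have cs: "(b x y)\<^sup>2 \<le> (v \<bullet> v) * (\<Sum>i\<in>UNIV. (b x (Y i))\<^sup>2)"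
    proof -
      have "b x y = (\<Sum>i\<in>UNIV. v $ i * b x (Y i))" unfolding y_def by (simp add: linear_sum[OF lin2] br)
      also have "\<dots>\<^sup>2 \<le> (\<Sum>i\<in>UNIV. (v $ i)\<^sup>2) * (\<Sum>i\<in>UNIV. (b x (Y i))\<^sup>2)" by (rule Cauchy_Schwarz_ineq_sum)
      finally show ?thesis by (simp add: inner_vec_def power2_eq_square)
    qed
    have "\<epsilon> * \<epsilon> * (b x y)\<^sup>2 \<le> \<epsilon> * \<epsilon> * ((v \<bullet> v) * (\<Sum>i\<in>UNIV. (b x (Y i))\<^sup>2))"
      by (rule mult_left_mono[OF cs]) simp
    then have "(\<Sum>j\<in>UNIV. (b y (u x j))\<^sup>2) \<le> g * (v \<bullet> v)"
      using le unfolding g_def \<open>v \<bullet> v = b y y\<close> by (simp add: algebra_simps)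
    then have "(norm (transpose A *v v))\<^sup>2 \<le> g * (norm v)\<^sup>2"
      unfolding power2_norm_eq_inner inner_vec_def[of "transpose A *v v"] yj by (simp add: power2_eq_square)
    also have "\<dots> = (sqrt g * norm v)\<^sup>2" using g1 by (simp add: power_mult_distrib)
    finally show ?thesis by (rule power2_le_imp_le) (use g1 in simp)
  qed
  then have "\<bar>det (transpose A)\<bar> \<le> sqrt g ^ CARD('m option)"
    by (intro det_le_of_norm_bound) (use g1 in auto)
  then have "\<bar>om x Y\<bar>\<^sup>2 \<le> (sqrt g ^ CARD('m option))\<^sup>2"
    unfolding det_transpose om_def A_def by (intro power_mono) auto
  also have "\<dots> = ((sqrt g)\<^sup>2) ^ CARD('m option)" by (simp only: power_mult[symmetric] mult.commute)
  also have "\<dots> = g ^ CARD('m option)" using g1 by simp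
  finally show ?thesis by (simp add: g_def)
qed

text \<open>
  The arguments are kept constant, so they cease to be tangent to \<open>B\<close> away from \<open>p\<close>; the bound on \<open>om\<close> exceeds \<open>1\<close>
  by a term of second order only.
\<close>

lemma Dom_nu:
  assumes p: "p \<in> M" and e: "adapted_frame p e" and X: "X \<in> tangent_space B p"
  shows "Dom p X (\<nu> p) e = 0"
proof -
  define Y where "Y = case_option (\<nu> p) e"
  have fe: "frame p e" and om1: "om p Y = 1" using e by (auto simp: adapted_frame_def Y_def)
  have oY: "orthonormal b Y" unfolding Y_def by (rule nu_frame(1)[OF p fe])
  have YT: "\<epsilon> * b p (Y i) = 0" for i
    using nu_props(2)[OF p] TM_B[OF p frame_tangent[OF p fe]] by (auto simp: Y_def N_iff TB[OF p_B[OF p]] split: option.splits)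
  obtain c r where c: "0 < r" "\<And>t. t \<in> {-r<..<r} \<Longrightarrow> c t \<in> B" "c 0 = p" "(c has_vector_derivative X) (at (0::real))"
    using X by (blast elim: tangent_spaceE)
  define d where "d = Dom p X (\<nu> p) e"
  define k where "k = CARD('m option)"
  define \<phi> where "\<phi> t = om (c t) Y" for t
  define g where "g t = 1 + \<epsilon> * \<epsilon> * (\<Sum>i\<in>UNIV. (b (c t) (Y i))\<^sup>2)" for t
  have d\<phi>: "(\<phi> has_vector_derivative d) (at 0)"
    unfolding \<phi>_def[abs_def] d_def Dom_def Y_def[symmetric]
    by (rule curve_has_vector_derivative[OF om_has_derivative[OF p_B[OF p]] c(3,1,2,4)])
  have db: "((\<lambda>t. b (c t) (Y i)) has_real_derivative b X (Y i)) (at 0)" for i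
  proof -
    have "((\<lambda>t. b (c t) (Y i)) has_vector_derivative b X (Y i)) (at 0)"
      by (rule curve_has_vector_derivative[OF b_has_derivative[of "Y i" "at p within B"] c(3,1,2,4)])
    then show ?thesis by (simp add: has_real_derivative_iff_has_vector_derivative)
  qed
  have dg: "(g has_real_derivative \<epsilon> * \<epsilon> * (\<Sum>i\<in>UNIV. 2 * (b (c 0) (Y i) * b X (Y i)))) (at 0)"
    unfolding g_def[abs_def] by (auto intro!: derivative_eq_intros db simp: mult.commute)
  have "\<epsilon> * \<epsilon> * (\<Sum>i\<in>UNIV. 2 * (b (c 0) (Y i) * b X (Y i))) = \<epsilon> * (\<Sum>i\<in>UNIV. 2 * ((\<epsilon> * b p (Y i)) * b X (Y i)))"
    by (simp add: c(3) sum_distrib_left ac_simps)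
  also have "\<dots> = 0" unfolding YT by simp
  finally have s: "\<epsilon> * \<epsilon> * (\<Sum>i\<in>UNIV. 2 * (b (c 0) (Y i) * b X (Y i))) = 0" .
  have dg0: "(g has_real_derivative 0) (at 0)" using dg unfolding s .
  have "\<epsilon> * \<epsilon> * (\<Sum>i\<in>UNIV. (b p (Y i))\<^sup>2) = (\<Sum>i\<in>UNIV. (\<epsilon> * b p (Y i))\<^sup>2)"
    by (simp add: sum_distrib_left power2_eq_square ac_simps)
  also have "\<dots> = 0" unfolding YT by simp
  finally have g0: "g 0 = 1" by (simp add: g_def c(3))
  have \<phi>0: "\<phi> 0 = 1" by (simp add: \<phi>_def c(3) om1)
  have d\<phi>': "(\<phi> has_real_derivative d) (at 0)" using d\<phi> by (simp add: has_real_derivative_iff_has_vector_derivative)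
  have dh: "((\<lambda>t. g t ^ k - (\<phi> t)\<^sup>2) has_real_derivative real k * 0 * g 0 ^ (k - 1) - 2 * d * \<phi> 0) (at 0)"
    by (auto intro!: derivative_eq_intros dg0 d\<phi>')
  have "real k * 0 * g 0 ^ (k - 1) - 2 * d * \<phi> 0 = 0"
  proof (rule DERIV_local_min[OF dh c(1)], intro allI impI)
    fix t assume "\<bar>0 - t\<bar> < r"
    then have "c t \<in> B" by (intro c(2)) auto
    then have "(\<phi> t)\<^sup>2 \<le> g t ^ k" unfolding \<phi>_def g_def k_def by (rule om_bound[OF _ oY])
    then show "g 0 ^ k - (\<phi> 0)\<^sup>2 \<le> g t ^ k - (\<phi> t)\<^sup>2" by (simp add: g0 \<phi>0)
  qed
  then show ?thesis by (simp add: \<phi>0 d_def)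
qed

definition skew where
  "skew \<longleftrightarrow> (\<forall>p e X Y. p \<in> M \<and> adapted_frame p e \<and> X \<in> F \<and> Y \<in> F \<longrightarrow> Dom p X Y e + Dom p Y X e = 0)"

lemma N_decomp_nu:
  assumes p: "p \<in> M" and w: "w \<in> N p"
  shows "\<exists>c h. h \<in> F \<and> w = c *\<^sub>R \<nu> p + h"
proof -
  have "(b w (n p) * b (\<nu> p) (n p)) *\<^sub>R (b (\<nu> p) (n p) *\<^sub>R n p) = (b w (n p) * (b (\<nu> p) (n p))\<^sup>2) *\<^sub>R n p"
    by (simp add: power2_eq_square mult.assoc)
  then have "b w (n p) *\<^sub>R n p = (b w (n p) * b (\<nu> p) (n p)) *\<^sub>R \<nu> p"
    using nu_props(5,6)[OF p] by simp
  then show ?thesis using N_decomp[OF p w]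
    by (intro exI[of _ "b w (n p) * b (\<nu> p) (n p)"] exI[of _ "w - b w (n p) *\<^sub>R n p"]) simp
qed

lemma om_normal_normal:
  assumes p: "p \<in> M" and w: "w \<in> N p" and d: "d \<in> N p"
  shows "om p (case_option w (e(i := d))) = 0"
proof -
  obtain c h where c: "h \<in> F" "w = c *\<^sub>R \<nu> p + h" using N_decomp_nu[OF p w] by blast
  obtain c' h' where c': "h' \<in> F" "d = c' *\<^sub>R \<nu> p + h'" using N_decomp_nu[OF p d] by blast
  have uL: "u p j \<in> L" for j using vertical_L[OF M_Phi[OF p] u_in[OF p_B[OF p]]] .
  show ?thesis
    by (rule om_proportional[of None "Some i" _ _ c "\<lambda>j. b (\<nu> p) (u p j)" c'])
      (use c c' uL in \<open>simp_all add: bl F_def\<close>)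
qed

lemma perp_N: "p \<in> M \<Longrightarrow> W p \<in> tangent_space B p \<Longrightarrow> perp b B M W p \<in> N p"
  unfolding perp_def by (rule proj_N_in)

lemma normal_conn_N: "p \<in> M \<Longrightarrow> normal_conn b B M W p X \<in> N p"
  unfolding normal_conn_def conn_def by (intro proj_N_in proj_TB_in p_B)

lemma C_integrand_zero:
  assumes sk: skew and p: "p \<in> M" and W: "W p \<in> tangent_space B p" and W': "W' p \<in> tangent_space B p"
  shows "C_integrand b B M \<Omega> \<nu> W W' p = 0"
proof -
  define e where "e = direct_frame b M \<Omega> \<nu> p"
  define w where "w = perp b B M W p"
  define w' where "w' = perp b B M W' p"
  have e: "adapted_frame p e" unfolding e_def by (rule direct_frame_adapted[OF p])
  have eT: "e i \<in> tangent_space B p" for i using e TM_B[OF p frame_tangent[OF p]] by (auto simp: adapted_frame_def)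
  have wN: "w \<in> N p" "w' \<in> N p" unfolding w_def w'_def using perp_N[where W=W, OF p W] perp_N[where W=W', OF p W'] by auto
  have B: "p \<in> B" by (rule p_B[OF p])
  have T: "w \<in> tangent_space B p" "w' \<in> tangent_space B p" using wN by (auto simp: N_iff)
  have \<nu>T: "\<nu> p \<in> tangent_space B p" using nu_props(2)[OF p] by (simp add: N_iff)
  have FT: "h \<in> tangent_space B p" if "h \<in> F" for h using F_TB[OF p_L[OF p] B that] .
  have half: "Dom p x y e = c' * 0 + Dom p h h' e"
    if "x = c *\<^sub>R \<nu> p + h" "y = c' *\<^sub>R \<nu> p + h'" "h \<in> F" "h' \<in> F" for x y c c' h h'
  proof -
    have xT: "x \<in> tangent_space B p" using that \<nu>T FT subspace_TB[OF B] by (simp add: subspace_add subspace_mul)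
    have "Dom p x y e = c' * Dom p x (\<nu> p) e + Dom p x h' e" unfolding that(2) by (rule Dom_linear(1)[OF B xT])
    also have "Dom p x (\<nu> p) e = 0" by (rule Dom_nu[OF p e xT])
    also have "Dom p x h' e = c * Dom p (\<nu> p) h' e + Dom p h h' e" unfolding that(1) by (rule Dom_linear(2)[OF B])
    also have "Dom p (\<nu> p) h' e = 0" by (rule Dom_nu_horizontal[OF p that(4)])
    finally show ?thesis by simp
  qed
  obtain c h where c: "h \<in> F" "w = c *\<^sub>R \<nu> p + h" using N_decomp_nu[OF p wN(1)] by blast
  obtain c' h' where c': "h' \<in> F" "w' = c' *\<^sub>R \<nu> p + h'" using N_decomp_nu[OF p wN(2)] by blast
  have "Dom p w w' e + Dom p w' w e = Dom p h h' e + Dom p h' h e"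
    using half[OF c(2) c'(2) c(1) c'(1)] half[OF c'(2) c(2) c'(1) c(1)] by simp
  also have "\<dots> = 0" using sk p e c(1) c'(1) unfolding skew_def by blast
  finally have D: "conn_form b B \<Omega> p w (case_option w' e) + conn_form b B \<Omega> p w' (case_option w e) = 0"
    using conn_form_Dom[OF B T(1) T(2), of e] conn_form_Dom[OF B T(2) T(1), of e] eT by simp
  have z: "\<Omega> p (case_option w (e(i := normal_conn b B M (perp b B M W') p (e i)))) = 0"
    "\<Omega> p (case_option w' (e(i := normal_conn b B M (perp b B M W) p (e i)))) = 0" for i
    unfolding Omega_om[OF B] using om_normal_normal[OF p] wN normal_conn_N[OF p] by blast+
  show ?thesis
    unfolding C_integrand_def Let_def e_def[symmetric] w_def[symmetric] w'_def[symmetric] z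
    using D by simp
qed

lemma zero_normal_section: "(\<lambda>p. 0) \<in> normal_sections b B M"
  using subspace_0[OF subspace_N] by (simp add: normal_sections_def N_def)

lemma normal_section_N: "W \<in> normal_sections b B M \<Longrightarrow> p \<in> M \<Longrightarrow> W p \<in> N p"
  by (simp add: normal_sections_def N_def)

lemma C_op_zero:
  assumes sk: skew and W: "\<And>p. p \<in> M \<Longrightarrow> W p \<in> tangent_space B p"
  shows "C_op b B M \<Omega> \<nu> W \<in> normal_sections b B M" "AE p in mu. p \<in> M \<longrightarrow> C_op b B M \<Omega> \<nu> W p = 0"
proof -
  let ?P = "\<lambda>Z. Z \<in> normal_sections b B M \<and>
        (\<forall>W'\<in>sections B M. (LINT p:M|mu. b (Z p) (W' p)) = (LINT p:M|mu. C_integrand b B M \<Omega> \<nu> W W' p))"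
  have c0: "(LINT p:M|mu. C_integrand b B M \<Omega> \<nu> W W' p) = 0" if "W' \<in> sections B M" for W'
  proof -
    have "(LINT p:M|mu. C_integrand b B M \<Omega> \<nu> W W' p) = (LINT p:M|mu. 0)"
      by (rule set_lebesgue_integral_cong) (use that W in \<open>auto simp: sections_def C_integrand_zero[OF sk] sets_mu\<close>)
    then show ?thesis by simp
  qed
  have "?P (\<lambda>p. 0)" using zero_normal_section c0 by (simp add: bl)
  define Z where "Z = C_op b B M \<Omega> \<nu> W"
  have PZ: "?P Z" unfolding Z_def C_op_def by (rule someI[of ?P]) fact
  have Z2: "Z \<in> normal_sections b B M" using PZ by (rule conjunct1)
  have Z3: "(LINT p:M|mu. b (Z p) (W' p)) = 0" if "W' \<in> sections B M" for W'
    using conjunct2[OF PZ] c0[OF that] that by simp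
  note Z = Z_def[symmetric] Z2 Z3
  show "C_op b B M \<Omega> \<nu> W \<in> normal_sections b B M" using Z2 by (simp only: Z_def)
  have "Z \<in> sections B M" using Z(2) by (auto simp: sections_def normal_sections_def normal_space_def)
  then have i0: "(LINT p:M|mu. b (Z p) (Z p)) = 0" by (rule Z(3))
  have cZ: "continuous_on M Z" using Z(2) by (auto simp: normal_sections_def intro: smooth_on_imp_continuous_on)
  have int: "set_integrable mu M (\<lambda>p. b (Z p) (Z p))"
    by (rule integrable_mu_continuous) (rule bounded_bilinear.continuous_on[OF bounded_bilinear_b cZ cZ])
  have ZT: "Z p \<in> tangent_space B p" if "p \<in> M" for p using normal_section_N[OF Z(2) that] by (simp add: N_iff)
  have nn: "0 \<le> indicator M p *\<^sub>R b (Z p) (Z p)" for p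
    using pos_TB[OF p_B ZT, of p] by (cases "Z p = 0") (auto simp: bl less_imp_le split: split_indicator)
  have "AE p in mu. indicator M p *\<^sub>R b (Z p) (Z p) = 0"
    using integral_nonneg_eq_0_iff_AE[OF int[unfolded set_integrable_def]] nn i0 by (simp add: set_lebesgue_integral_def)
  then show "AE p in mu. p \<in> M \<longrightarrow> C_op b B M \<Omega> \<nu> W p = 0" unfolding Z_def[symmetric]
  proof eventually_elim
    case (elim p)
    show ?case
    proof
      assume p: "p \<in> M"
      then have "b (Z p) (Z p) = 0" using elim by simp
      then show "Z p = 0" using pos_TB[OF p_B[OF p] ZT[OF p]] by force
    qed
  qed
qed

end

section \<open>The second variation\<close>

context fibred_sphere
begin

definition integrand where
  "integrand W p = (let e = direct_frame b M \<Omega> \<nu> p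
         in normal_conn_norm_sq b B M e W p - b (R_op b B M e p (W p)) (W p)
            - b (B_op b B M e p (W p)) (W p)
            + real CARD('m) * mean_curv_norm TYPE('m) b B M p * b (C_op b B M \<Omega> \<nu> W p) (W p))"

lemma I_form_integrand: "I_form b B M \<Omega> \<nu> W = (LINT p:M|mu. integrand W p)"
  unfolding I_form_def integrand_def ..

lemma integrand_N:
  assumes p: "p \<in> M" and W: "W p \<in> N p"
  shows "integrand W p = normal_conn_norm_sq b B M (direct_frame b M \<Omega> \<nu> p) W p - real CARD('m) * \<epsilon> * b (W p) (W p)
      - real CARD('m) * (\<beta> / \<rho>)\<^sup>2 * (b (W p) (n p))\<^sup>2 + real CARD('m) * (\<bar>\<beta>\<bar> / \<rho>) * b (C_op b B M \<Omega> \<nu> W p) (W p)"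
proof -
  have e: "frame p (direct_frame b M \<Omega> \<nu> p)" using direct_frame_adapted[OF p] by (simp add: adapted_frame_def)
  show ?thesis
    unfolding integrand_def Let_def R_op_M[OF p e W] B_op_M[OF p e] mean_curv_norm_M[OF p] by (simp add: bl)
qed

lemma normal_conn_constant:
  assumes p: "p \<in> M" and X: "X \<in> tangent_space M p" and c: "\<And>x. x \<in> M \<Longrightarrow> W x = c"
  shows "normal_conn b B M W p X = 0"
proof -
  have "conn b B M W p X = proj b (tangent_space B p) 0"
    by (rule conn_eq[OF X has_derivative_const[of c]]) (rule c)
  also have "\<dots> = 0" by (rule proj_TB_tangent[OF p_B[OF p] subspace_0[OF subspace_TB[OF p_B[OF p]]]])
  finally show ?thesis
    unfolding normal_conn_def using proj_N_self[OF p subspace_0[OF subspace_N[OF p]]] by simp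
qed

lemma normal_conn_split:
  assumes p: "p \<in> M" and X: "X \<in> tangent_space M p"
    and W: "\<And>x. x \<in> M \<Longrightarrow> W x = (w x * s) *\<^sub>R n x + U x"
    and w: "smooth_on M w" and U: "smooth_on M U" "\<And>x. x \<in> M \<Longrightarrow> U x \<in> F"
  shows "\<exists>h\<in>F. normal_conn b B M W p X = (frechet_derivative w (at p within M) X * s) *\<^sub>R n p + h"
proof
  let ?Dw = "frechet_derivative w (at p within M)" and ?DU = "frechet_derivative U (at p within M)"
  have dw: "(w has_derivative ?Dw) (at p within M)" and dU: "(U has_derivative ?DU) (at p within M)"
    using smooth_on_has_derivative[OF w p] smooth_on_has_derivative[OF U(1) p] by auto
  show h: "?DU X \<in> F" by (rule within_derivative_in_subspace[OF dU X U(2) subspace_F])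
  obtain v where v: "X = J v" using X unfolding tangent_M[OF p] by blast
  have dJ: "\<beta> *\<^sub>R J (Ji ((1 / \<rho>) *\<^sub>R X)) = (\<beta> / \<rho>) *\<^sub>R X" unfolding v Ji_tangent by (simp add: J_scale)
  define t where "t = (w p * s * (\<beta> / \<rho>)) *\<^sub>R X"
  define r where "r = (?Dw X * s) *\<^sub>R n p + ?DU X"
  have t: "t \<in> tangent_space M p" unfolding t_def using X subspace_TM[OF p] by (simp add: subspace_mul)
  have r: "r \<in> N p" unfolding r_def using n_N[OF p] F_N[OF p h] subspace_N[OF p] by (simp add: subspace_add subspace_mul)
  have "conn b B M W p X = proj b (tangent_space B p) ((w p * s) *\<^sub>R (\<beta> *\<^sub>R J (Ji ((1 / \<rho>) *\<^sub>R X))) + (?Dw X * s) *\<^sub>R n p + ?DU X)"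
    by (rule conn_eq[OF X has_derivative_add[OF has_derivative_scaleR[OF has_derivative_mult_left[OF dw] n_has_derivative] dU]]) (rule W)
  also have "(w p * s) *\<^sub>R (\<beta> *\<^sub>R J (Ji ((1 / \<rho>) *\<^sub>R X))) + (?Dw X * s) *\<^sub>R n p + ?DU X = t + r"
    unfolding dJ t_def r_def by simp
  also have "proj b (tangent_space B p) (t + r) = t + r"
    using TM_B[OF p t] r subspace_TB[OF p_B[OF p]] by (intro proj_TB_tangent p_B[OF p]) (simp add: N_iff subspace_add)
  finally show "normal_conn b B M W p X = (?Dw X * s) *\<^sub>R n p + ?DU X"
    unfolding normal_conn_def using proj_N[OF p t r] by (simp add: r_def)
qed

lemma F_nonneg: "p \<in> M \<Longrightarrow> h \<in> F \<Longrightarrow> 0 \<le> b h h"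
  using pos_TB[OF p_B F_TB[OF p_L p_B]] by (cases "h = 0") (auto simp: bl less_imp_le)

lemma I_form_nonneg:
  assumes sk: skew and eps0: "\<epsilon> \<le> 0" and \<beta>0: "\<beta> \<noteq> 0" and W: "W \<in> test_sections TYPE('m) b B M \<nu>"
  shows "0 \<le> I_form b B M \<Omega> \<nu> W"
proof -
  obtain K f Nk where W_def: "W = (\<lambda>p. \<Sum>k<(K::nat). f k p *\<^sub>R (\<nu> p + Nk k p))"
    and f: "\<And>k. k < K \<Longrightarrow> f k \<in> mean_zero_functions TYPE('m) b M"
    and Nk: "\<And>k. k < K \<Longrightarrow> Nk k \<in> normal_sections b B M"
    and Nn: "\<And>k p. k < K \<Longrightarrow> p \<in> M \<Longrightarrow> b (Nk k p) (\<nu> p) = 0"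
    using W unfolding test_sections_def by blast
  define s where "s = - sgn \<beta>"
  have s2: "s * s = 1" using \<beta>0 by (simp add: s_def sgn_real_def)
  define w where "w p = (\<Sum>k<K. f k p)" for p
  define U where "U p = (\<Sum>k<K. f k p *\<^sub>R Nk k p)" for p
  have fs: "smooth_on M (f k)" and f0: "(LINT p:M|mu. f k p) = 0" if "k < K" for k
    using f[OF that] by (auto simp: mean_zero_functions_def)
  have ws: "smooth_on M w" unfolding w_def[abs_def] by (rule smooth_on_sum) (use fs in auto)
  have Us: "smooth_on M U" unfolding U_def[abs_def]
    by (intro smooth_on_sum smooth_on_scaleR) (use fs Nk in \<open>auto simp: normal_sections_def\<close>)
  have NF: "Nk k p \<in> F" if "k < K" "p \<in> M" for k p
  proof -
    have "b (Nk k p) (n p) = 0"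
      using Nn[OF that] nu_beta[OF that(2) \<beta>0] \<beta>0 by (simp add: br sgn_real_def split: if_splits)
    then show ?thesis using N_decomp[OF that(2) normal_section_N[OF Nk[OF that(1)] that(2)]] by simp
  qed
  have UF: "U p \<in> F" if "p \<in> M" for p
    unfolding U_def using NF that subspace_F by (intro subspace_sum subspace_mul) auto
  have We: "W p = (w p * s) *\<^sub>R n p + U p" if "p \<in> M" for p
    unfolding W_def w_def U_def nu_beta[OF that \<beta>0] s_def[symmetric]
    by (simp add: scaleR_add_right sum.distrib scaleR_sum_left[symmetric] sum_distrib_right)
  have WN: "W p \<in> N p" if "p \<in> M" for p
    unfolding We[OF that] using n_N[OF that] F_N[OF that UF[OF that]] subspace_N[OF that] by (simp add: subspace_add subspace_mul)
  define e where "e p = direct_frame b M \<Omega> \<nu> p" for p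
  have e: "frame p (e p)" if "p \<in> M" for p using direct_frame_adapted[OF that] by (simp add: adapted_frame_def e_def)
  define qq where "qq p = (\<Sum>i\<in>UNIV. (frechet_derivative w (at p within M) (e p i))\<^sup>2)" for p
  have mean: "(LINT p:M|mu. w p) = 0"
  proof -
    have "(LINT p:M|mu. w p) = (\<Sum>k<K. LINT p:M|mu. f k p)"
      unfolding w_def set_lebesgue_integral_def scaleR_sum_right
      by (rule Bochner_Integration.integral_sum)
        (use integrable_mu_continuous[OF smooth_on_imp_continuous_on[OF fs]] in \<open>auto simp: set_integrable_def\<close>)
    then show ?thesis using f0 by simp
  qed
  have P: "set_integrable mu M qq" "set_integrable mu M (\<lambda>p. (w p)\<^sup>2)"
    "real CARD('m) * (LINT p:M|mu. (w p)\<^sup>2) \<le> \<rho>\<^sup>2 * (LINT p:M|mu. qq p)"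
    using Poincare[OF ws mean, of qq] e by (auto simp: qq_def)
  have lower: "qq p - real CARD('m) / \<rho>\<^sup>2 * (w p)\<^sup>2 + real CARD('m) * (\<bar>\<beta>\<bar> / \<rho>) * b (C_op b B M \<Omega> \<nu> W p) (W p) \<le> integrand W p"
    if p: "p \<in> M" for p
  proof -
    have Un: "b (U p) (n p) = 0" using UF[OF p] n_L by (simp add: F_def)
    have nu: "b (n p) (n p) = 1" by (rule n_unit[OF p])
    have WW: "b (W p) (W p) = (w p)\<^sup>2 + b (U p) (U p)"
      unfolding We[OF p] using Un nu s2 by (simp add: bl br sym[of "n p" "U p"] power2_eq_square ac_simps)
    have Wn: "(b (W p) (n p))\<^sup>2 = (w p)\<^sup>2"
      unfolding We[OF p] using Un nu s2 by (simp add: bl power2_eq_square ac_simps)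
    have nc: "(frechet_derivative w (at p within M) (e p i))\<^sup>2 \<le> b (normal_conn b B M W p (e p i)) (normal_conn b B M W p (e p i))" for i
    proof -
      obtain h where h: "h \<in> F" "normal_conn b B M W p (e p i) = (frechet_derivative w (at p within M) (e p i) * s) *\<^sub>R n p + h"
        using normal_conn_split[OF p frame_tangent[OF p e[OF p]] We ws Us UF] by blast
      have "b h (n p) = 0" using h(1) n_L by (simp add: F_def)
      then have "b (normal_conn b B M W p (e p i)) (normal_conn b B M W p (e p i)) = (frechet_derivative w (at p within M) (e p i))\<^sup>2 + b h h"
        unfolding h(2) using nu s2 by (simp add: bl br sym[of "n p" h] power2_eq_square ac_simps)
      then show ?thesis using F_nonneg[OF p h(1)] by simp
    qed
    have "qq p \<le> normal_conn_norm_sq b B M (e p) W p"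
      unfolding qq_def normal_conn_norm_sq_def by (rule sum_mono) (rule nc)
    moreover have "0 \<le> - (real CARD('m) * \<epsilon> * b (U p) (U p))"
      using eps0 F_nonneg[OF p UF[OF p]] by (simp add: mult_nonneg_nonpos mult_nonpos_nonneg)
    moreover have "real CARD('m) / \<rho>\<^sup>2 = real CARD('m) * \<epsilon> + real CARD('m) * (\<beta> / \<rho>)\<^sup>2"
    proof -
      have "real CARD('m) / \<rho>\<^sup>2 = real CARD('m) * (\<beta>\<^sup>2 + \<epsilon> * \<rho>\<^sup>2) / \<rho>\<^sup>2" using \<beta>2 by simp
      also have "\<dots> = real CARD('m) * \<epsilon> + real CARD('m) * (\<beta> / \<rho>)\<^sup>2" using rho by (simp add: field_simps power_divide)
      finally show ?thesis .
    qed
    ultimately show ?thesis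
      unfolding integrand_N[where W=W, OF p WN[OF p]] WW Wn e_def[symmetric] by (simp add: algebra_simps)
  qed
  have C: "AE p in mu. p \<in> M \<longrightarrow> C_op b B M \<Omega> \<nu> W p = 0"
    by (rule C_op_zero(2)[OF sk]) (use WN in \<open>simp add: N_iff\<close>)
  show ?thesis
  proof (cases "integrable mu (\<lambda>p. indicator M p *\<^sub>R integrand W p)")
    case False
    then show ?thesis by (simp add: I_form_integrand set_lebesgue_integral_def not_integrable_integral_eq)
  next
    case True
    have i: "set_integrable mu M (\<lambda>p. qq p - real CARD('m) / \<rho>\<^sup>2 * (w p)\<^sup>2)"
      using P(1,2) by (intro set_integral_diff set_integrable_mult_right) auto
    have "0 \<le> (LINT p:M|mu. qq p) - real CARD('m) / \<rho>\<^sup>2 * (LINT p:M|mu. (w p)\<^sup>2)"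
      using P(3) rho by (simp add: field_simps)
    also have "\<dots> = (LINT p:M|mu. qq p - real CARD('m) / \<rho>\<^sup>2 * (w p)\<^sup>2)"
      using P(1,2) by (simp add: set_integral_diff set_integrable_mult_right)
    also have "\<dots> \<le> I_form b B M \<Omega> \<nu> W"
      unfolding I_form_integrand set_lebesgue_integral_def
    proof (rule integral_mono_AE[OF i[unfolded set_integrable_def] True])
      show "AE p in mu. indicator M p *\<^sub>R (qq p - real CARD('m) / \<rho>\<^sup>2 * (w p)\<^sup>2) \<le> indicator M p *\<^sub>R integrand W p"
        using C
      proof eventually_elim
        case (elim p)
        then show ?case using lower[of p] by (auto simp: bl split: split_indicator)
      qed
    qed
    finally show ?thesis .
  qed
qed

theorem stable:
  assumes sk: skew and eps0: "\<epsilon> \<le> 0" and \<beta>0: "\<beta> \<noteq> 0"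
  shows "omega_stable b B M \<Omega> \<nu>"
  unfolding omega_stable_def
proof (intro allI impI, elim conjE)
  fix W l
  assume "\<forall>k::nat. W k \<in> test_sections TYPE('m) b B M \<nu>" and l: "(\<lambda>k. I_form b B M \<Omega> \<nu> (W k)) \<longlonglongrightarrow> l"
  then have "0 \<le> I_form b B M \<Omega> \<nu> (W k)" for k using I_form_nonneg[OF sk eps0 \<beta>0] by blast
  then show "0 \<le> l" using l by (intro LIMSEQ_le_const) auto
qed

lemma sum_lessThan_double:
  fixes d :: nat
  shows "(\<Sum>k<d + d. g k) = (\<Sum>k<d. g k) + (\<Sum>k<d. (g (d + k) :: 'z::comm_monoid_add))"
proof -
  have "(\<Sum>k<d + e. g k) = (\<Sum>k<d. g k) + (\<Sum>k<e. g (d + k))" for e :: nat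
    by (induction e) (simp_all add: add.assoc)
  then show ?thesis .
qed

theorem unstable:
  assumes sk: skew and eps0: "0 < \<epsilon>" and N0: "N0 \<in> F" "N0 \<noteq> 0"
  shows "\<not> omega_stable b B M \<Omega> \<nu>"
proof
  assume stab: "omega_stable b B M \<Omega> \<nu>"
  define d where "d = card (Basis :: ((real^'m::_) \<times> real) set)"
  obtain h where h: "bij_betw h {..<d} (Basis :: ((real^'m::_) \<times> real) set)"
    unfolding d_def using ex_bij_betw_nat_finite[OF finite_Basis] by (metis atLeast0LessThan)
  define l where "l k = (if k < d then h k else - h (k - d))" for k
  define f where "f k p = Ei p \<bullet> l k" for k p
  define Nk where "Nk k p = (if k < d then f k p *\<^sub>R N0 else 0)" for k p
  define W where "W p = (\<Sum>k<d + d. f k p *\<^sub>R (\<nu> p + Nk k p))" for p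
  have fs: "smooth_on S (f k)" for k S
    unfolding f_def[abs_def] by (rule smooth_onI[of UNIV]) (auto intro!: Ck_on_inner Ck_Ei)
  have NkF: "Nk k p \<in> F" for k p
    unfolding Nk_def using N0(1) subspace_F by (simp add: subspace_mul subspace_0)
  have W_test: "W \<in> test_sections TYPE('m) b B M \<nu>"
    unfolding test_sections_def
  proof (intro CollectI exI[of _ "d + d"] exI[of _ f] exI[of _ Nk] conjI allI impI ballI)
    show "W = (\<lambda>p. \<Sum>k<d + d. f k p *\<^sub>R (\<nu> p + Nk k p))" by (simp add: W_def[abs_def])
    fix k
    show "f k \<in> mean_zero_functions TYPE('m) b M"
      unfolding mean_zero_functions_def using fs integral_mu_odd[of "l k"] by (simp add: f_def[abs_def])
    have "smooth_on M (Nk k)"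
      by (cases "k < d") (auto simp: Nk_def[abs_def] intro!: smooth_on_scaleR fs)
    then show "Nk k \<in> normal_sections b B M"
      unfolding normal_sections_def N_def[symmetric] using NkF F_N by simp
    show "b (Nk k p) (\<nu> p) = 0" if "p \<in> M" for p
      using NkF nu_props(3)[OF that] by (simp add: F_def)
  qed
  have We: "W p = N0" if p: "p \<in> M" for p
  proof -
    have "W p = (\<Sum>k<d. f k p *\<^sub>R (\<nu> p + f k p *\<^sub>R N0) - f k p *\<^sub>R \<nu> p)"
      unfolding W_def sum_lessThan_double by (simp add: Nk_def f_def l_def sum_negf sum_subtractf)
    also have "\<dots> = (\<Sum>k<d. (Ei p \<bullet> h k)\<^sup>2 *\<^sub>R N0)"
      by (intro sum.cong) (auto simp: f_def l_def scaleR_add_right power2_eq_square)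
    also have "\<dots> = (\<Sum>k<d. (Ei p \<bullet> h k)\<^sup>2) *\<^sub>R N0" by (simp add: scaleR_sum_left)
    also have "(\<Sum>k<d. (Ei p \<bullet> h k)\<^sup>2) = (\<Sum>k\<in>Basis. (Ei p \<bullet> k)\<^sup>2)"
      using sum.reindex_bij_betw[OF h, of "\<lambda>k. (Ei p \<bullet> k)\<^sup>2"] .
    also have "\<dots> = Ei p \<bullet> Ei p" unfolding euclidean_inner[of "Ei p" "Ei p"] by (simp add: power2_eq_square)
    finally show ?thesis using Ei_unit[OF p] by simp
  qed
  have WN: "W p \<in> N p" if "p \<in> M" for p using We[OF that] F_N[OF that N0(1)] by simp
  have "M \<noteq> {}" unfolding M_def by simp
  then obtain p0 where p0: "p0 \<in> M" by blast
  have N0pos: "0 < b N0 N0" using pos_TB[OF p_B[OF p0] F_TB[OF p_L[OF p0] p_B[OF p0] N0(1)] N0(2)] .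
  define Z where "Z = C_op b B M \<Omega> \<nu> W"
  define c where "c = real CARD('m) * (\<bar>\<beta>\<bar> / \<rho>)"
  define k where "k = - (real CARD('m) * \<epsilon> * b N0 N0)"
  have Z: "Z \<in> normal_sections b B M" "AE p in mu. p \<in> M \<longrightarrow> Z p = 0"
    unfolding Z_def using C_op_zero[OF sk, of W] WN by (auto simp: N_iff)
  have int: "integrand W p = k + c * b (Z p) N0" if p: "p \<in> M" for p
  proof -
    have e: "frame p (direct_frame b M \<Omega> \<nu> p)" using direct_frame_adapted[OF p] by (simp add: adapted_frame_def)
    have "normal_conn_norm_sq b B M (direct_frame b M \<Omega> \<nu> p) W p = 0"
      unfolding normal_conn_norm_sq_def
      using normal_conn_constant[OF p frame_tangent[OF p e] We] by (simp add: bl)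
    moreover have "b N0 (n p) = 0" using N0(1) n_L by (simp add: F_def)
    ultimately show ?thesis
      unfolding integrand_N[where W=W, OF p WN[OF p]] We[OF p] Z_def[symmetric] by (simp add: k_def c_def)
  qed
  have contZ: "continuous_on M (\<lambda>p. k + c * b (Z p) N0)"
  proof -
    have "continuous_on M Z" using Z(1) by (auto simp: normal_sections_def intro: smooth_on_imp_continuous_on)
    then have "continuous_on M (\<lambda>p. b (Z p) N0)"
      by (rule bounded_bilinear.continuous_on[OF bounded_bilinear_b]) auto
    then show ?thesis by (intro continuous_intros)
  qed
  have "I_form b B M \<Omega> \<nu> W = (LINT p:M|mu. k + c * b (Z p) N0)"
    unfolding I_form_integrand by (rule set_lebesgue_integral_cong) (auto simp: int sets_mu)
  also have "\<dots> = (\<integral>p. k \<partial>mu)"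
    unfolding set_lebesgue_integral_def
  proof (rule integral_cong_AE)
    show "(\<lambda>p. indicator M p *\<^sub>R (k + c * b (Z p) N0)) \<in> borel_measurable mu"
      using integrable_mu_continuous[OF contZ] by (simp add: set_integrable_def)
    show "AE p in mu. indicator M p *\<^sub>R (k + c * b (Z p) N0) = k"
      using Z(2) mu_AE_M by eventually_elim (auto simp: bl)
  qed simp
  also have "\<dots> = V * k" by (simp add: V_def)
  finally have I: "I_form b B M \<Omega> \<nu> W = V * k" .
  have H1: "H1_norm_sq b B M \<Omega> \<nu> (\<lambda>p. W p - W p) = 0"
  proof -
    have "H1_norm_sq b B M \<Omega> \<nu> (\<lambda>p. W p - W p) = (LINT p:M|mu. 0)"
      unfolding H1_norm_sq_def
    proof (rule set_lebesgue_integral_cong)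
      show "\<forall>p. p \<in> M \<longrightarrow> b (W p - W p) (W p - W p) + normal_conn_norm_sq b B M (direct_frame b M \<Omega> \<nu> p) (\<lambda>p. W p - W p) p = 0"
      proof (intro allI impI)
        fix p assume p: "p \<in> M"
        have e: "frame p (direct_frame b M \<Omega> \<nu> p)" using direct_frame_adapted[OF p] by (simp add: adapted_frame_def)
        have "normal_conn b B M (\<lambda>p. W p - W p) p (direct_frame b M \<Omega> \<nu> p i) = 0" for i
          by (rule normal_conn_constant[OF p frame_tangent[OF p e], of _ 0]) simp
        then show "b (W p - W p) (W p - W p) + normal_conn_norm_sq b B M (direct_frame b M \<Omega> \<nu> p) (\<lambda>p. W p - W p) p = 0"
          unfolding normal_conn_norm_sq_def by (simp add: bl)
      qed
    qed (simp add: sets_mu)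
    then show ?thesis by simp
  qed
  have "0 \<le> V * k"
    using stab[unfolded omega_stable_def, rule_format, of "\<lambda>_. W" "V * k"] W_test H1 I by auto
  moreover have "V * k < 0"
    using mu_mass(1) eps0 N0pos by (simp add: k_def mult_pos_pos)
  ultimately show False by simp
qed

end

section \<open>Riemannian submersions\<close>

lemma second_difference:
  fixes f :: "'a::real_normed_vector \<Rightarrow> real"
  assumes Q: "open Q" "Ck_on 2 Q f" and h: "0 < h"
    and sub: "\<And>s t. 0 \<le> s \<Longrightarrow> s \<le> h \<Longrightarrow> 0 \<le> t \<Longrightarrow> t \<le> h \<Longrightarrow> p + s *\<^sub>R v + t *\<^sub>R w \<in> Q"
  shows "\<exists>s t. 0 \<le> s \<and> s \<le> h \<and> 0 \<le> t \<and> t \<le> h \<and>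
    f (p + h *\<^sub>R v + h *\<^sub>R w) - f (p + h *\<^sub>R v) - f (p + h *\<^sub>R w) + f p
    = h * h * frechet_derivative (\<lambda>x. frechet_derivative f (at x) v) (at (p + s *\<^sub>R v + t *\<^sub>R w)) w"
proof -
  let ?D = "\<lambda>x. frechet_derivative f (at x)"
  let ?D2 = "\<lambda>x. frechet_derivative (\<lambda>x. ?D x v) (at x)"
  have C: "Ck_on (Suc (Suc 0)) Q f" using Q(2) by (simp add: numeral_2_eq_2)
  then have C1: "Ck_on (Suc 0) Q (\<lambda>x. ?D x v)" by simp
  have d: "(f has_derivative ?D x) (at x)" if "x \<in> Q" for x by (rule Ck_on_SucD[OF Q(1) C that])
  have d2: "((\<lambda>x. ?D x v) has_derivative ?D2 x) (at x)" if "x \<in> Q" for x by (rule Ck_on_SucD[OF Q(1) C1 that])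
  define k where "k s = f (p + s *\<^sub>R v + h *\<^sub>R w) - f (p + s *\<^sub>R v)" for s
  have dk: "(k has_real_derivative ?D (p + s *\<^sub>R v + h *\<^sub>R w) v - ?D (p + s *\<^sub>R v) v) (at s)" if "0 \<le> s" "s \<le> h" for s
  proof -
    have 1: "((\<lambda>s. f (p + s *\<^sub>R v + h *\<^sub>R w)) has_derivative (\<lambda>r. ?D (p + s *\<^sub>R v + h *\<^sub>R w) (r *\<^sub>R v))) (at s)"
      by (rule has_derivative_compose[of "\<lambda>s. p + s *\<^sub>R v + h *\<^sub>R w", OF _ d])
        (use sub[of s h] that h in \<open>auto intro!: derivative_eq_intros\<close>)
    have 2: "((\<lambda>s. f (p + s *\<^sub>R v)) has_derivative (\<lambda>r. ?D (p + s *\<^sub>R v) (r *\<^sub>R v))) (at s)"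
      by (rule has_derivative_compose[of "\<lambda>s. p + s *\<^sub>R v", OF _ d])
        (use sub[of s 0] that h in \<open>auto intro!: derivative_eq_intros\<close>)
    have l: "linear (?D (p + s *\<^sub>R v + h *\<^sub>R w))" "linear (?D (p + s *\<^sub>R v))"
      using d[THEN has_derivative_linear] sub[of s h] sub[of s 0] that h by auto
    show ?thesis unfolding has_field_derivative_def k_def[abs_def]
      by (rule has_derivative_eq_rhs[OF has_derivative_diff[OF 1 2]]) (simp add: fun_eq_iff linear_scale[OF l(1)] linear_scale[OF l(2)] right_diff_distrib mult.commute)
  qed
  obtain s where s: "0 < s" "s < h" "k h - k 0 = (h - 0) * (?D (p + s *\<^sub>R v + h *\<^sub>R w) v - ?D (p + s *\<^sub>R v) v)"
    using MVT2[OF h dk] by blast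
  define l where "l t = ?D (p + s *\<^sub>R v + t *\<^sub>R w) v" for t
  have dl: "(l has_real_derivative ?D2 (p + s *\<^sub>R v + t *\<^sub>R w) w) (at t)" if "0 \<le> t" "t \<le> h" for t
  proof -
    have 1: "(l has_derivative (\<lambda>r. ?D2 (p + s *\<^sub>R v + t *\<^sub>R w) (r *\<^sub>R w))) (at t)" unfolding l_def[abs_def]
      by (rule has_derivative_compose[of "\<lambda>t. p + s *\<^sub>R v + t *\<^sub>R w", OF _ d2])
        (use sub[of s t] that s in \<open>auto intro!: derivative_eq_intros\<close>)
    have l: "linear (?D2 (p + s *\<^sub>R v + t *\<^sub>R w))"
      using d2[THEN has_derivative_linear] sub[of s t] that s by auto
    show ?thesis unfolding has_field_derivative_def
      by (rule has_derivative_eq_rhs[OF 1]) (simp add: fun_eq_iff linear_scale[OF l] mult.commute)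
  qed
  obtain t where t: "0 < t" "t < h" "l h - l 0 = (h - 0) * ?D2 (p + s *\<^sub>R v + t *\<^sub>R w) w"
    using MVT2[OF h dl] by blast
  show ?thesis
    using s t by (intro exI[of _ s] exI[of _ t]) (simp add: k_def l_def algebra_simps)
qed

lemma second_derivative_symmetric:
  fixes f :: "'a::real_normed_vector \<Rightarrow> real"
  assumes Q: "open Q" "Ck_on 2 Q f" "p \<in> Q"
  shows "frechet_derivative (\<lambda>x. frechet_derivative f (at x) v) (at p) w
    = frechet_derivative (\<lambda>x. frechet_derivative f (at x) w) (at p) v"
proof -
  define A where "A v w x = frechet_derivative (\<lambda>x. frechet_derivative f (at x) v) (at x) w" for v w x
  have C: "Ck_on (Suc (Suc 0)) Q f" using Q(2) by (simp add: numeral_2_eq_2)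
  have cA: "continuous_on Q (A v w)" for v w using C by (simp add: A_def[abs_def])
  have "\<bar>A v w p - A w v p\<bar> \<le> e" if e: "0 < e" for e
  proof -
    have "\<forall>\<^sub>F x in at p. dist (A v w x) (A v w p) < e / 2" "\<forall>\<^sub>F x in at p. dist (A w v x) (A w v p) < e / 2"
      using cA[unfolded continuous_on_eq_continuous_at[OF Q(1)]] Q(3) e
      unfolding continuous_at tendsto_iff by (metis half_gt_zero)+
    moreover have "\<forall>\<^sub>F x in at p. x \<in> Q" using Q by (auto simp: eventually_at_topological)
    ultimately have "\<forall>\<^sub>F x in at p. x \<in> Q \<and> dist (A v w x) (A v w p) < e / 2 \<and> dist (A w v x) (A w v p) < e / 2"
      by eventually_elim blast
    then obtain d where d: "0 < d" "\<And>x. x \<noteq> p \<Longrightarrow> dist x p < d \<Longrightarrow> x \<in> Q \<and> dist (A v w x) (A v w p) < e / 2 \<and> dist (A w v x) (A w v p) < e / 2"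
      unfolding eventually_at by blast
    have d': "x \<in> Q \<and> dist (A v w x) (A v w p) < e / 2 \<and> dist (A w v x) (A w v p) < e / 2" if "dist x p < d" for x
      using d(2)[of x] that e Q(3) by (cases "x = p") auto
    define h where "h = d / (norm v + norm w + 1)"
    have h: "0 < h" using d(1) by (simp add: h_def add_nonneg_pos)
    have hd: "dist (p + s *\<^sub>R x + t *\<^sub>R y) p < d"
      if "0 \<le> s" "s \<le> h" "0 \<le> t" "t \<le> h" "norm x + norm y = norm v + norm w" for s t x y
    proof -
      have "norm (s *\<^sub>R x + t *\<^sub>R y) \<le> s * norm x + t * norm y" using norm_triangle_ineq[of "s *\<^sub>R x" "t *\<^sub>R y"] that by simp
      also have "\<dots> \<le> h * norm x + h * norm y" using that by (intro add_mono mult_right_mono) auto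
      also have "\<dots> = h * (norm v + norm w)" using that(5) by (metis distrib_left)
      also have "\<dots> < h * (norm v + norm w + 1)" using h by simp
      also have "\<dots> = d" using norm_ge_zero[of v] norm_ge_zero[of w] unfolding h_def by (simp add: add_nonneg_pos order_less_imp_not_eq2)
      finally show ?thesis by (simp add: dist_norm algebra_simps)
    qed
    obtain s t where 1: "0 \<le> s" "s \<le> h" "0 \<le> t" "t \<le> h"
      "f (p + h *\<^sub>R v + h *\<^sub>R w) - f (p + h *\<^sub>R v) - f (p + h *\<^sub>R w) + f p = h * h * A v w (p + s *\<^sub>R v + t *\<^sub>R w)"
      using second_difference[OF Q(1,2) h, of p v w] d' hd unfolding A_def by blast
    obtain s' t' where 2: "0 \<le> s'" "s' \<le> h" "0 \<le> t'" "t' \<le> h"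
      "f (p + h *\<^sub>R w + h *\<^sub>R v) - f (p + h *\<^sub>R w) - f (p + h *\<^sub>R v) + f p = h * h * A w v (p + s' *\<^sub>R w + t' *\<^sub>R v)"
      using second_difference[OF Q(1,2) h, of p w v] d' hd[where x=w and y=v] unfolding A_def by (metis add.commute)
    have "h * h * A v w (p + s *\<^sub>R v + t *\<^sub>R w) = h * h * A w v (p + s' *\<^sub>R w + t' *\<^sub>R v)"
      using 1(5) 2(5) by (simp add: algebra_simps)
    then have "A v w (p + s *\<^sub>R v + t *\<^sub>R w) = A w v (p + s' *\<^sub>R w + t' *\<^sub>R v)" using h by simp
    moreover have "dist (A v w (p + s *\<^sub>R v + t *\<^sub>R w)) (A v w p) < e / 2" using d' hd 1 by blast
    moreover have "dist (A w v (p + s' *\<^sub>R w + t' *\<^sub>R v)) (A w v p) < e / 2"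
      using d' hd[OF 2(1-4), of w v] by (simp add: add.commute)
    ultimately show ?thesis unfolding dist_real_def by linarith
  qed
  then have "A v w p = A w v p" by (metis abs_le_zero_iff eq_iff_diff_eq_0 field_le_epsilon add_0)
  then show ?thesis by (simp add: A_def)
qed

lemma tangent_space_Int_open:
  assumes v: "v \<in> tangent_space S p" and Q: "open Q" "p \<in> Q"
  shows "v \<in> tangent_space (S \<inter> Q) p"
proof -
  obtain c r where c: "0 < r" "smooth_on {-r<..<r} c" "\<And>t. t \<in> {-r<..<r} \<Longrightarrow> c t \<in> S" "c 0 = p"
    "(c has_vector_derivative v) (at (0::real))"
    by (rule tangent_spaceE[OF v]) (rule that)
  have "isCont c 0" using c(5) by (rule has_vector_derivative_continuous)
  then have "\<forall>\<^sub>F t in at 0. c t \<in> Q" using Q c(4) by (simp add: isCont_def topological_tendstoD)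
  then obtain d where d: "0 < d" "\<And>t. t \<noteq> 0 \<Longrightarrow> dist t 0 < d \<Longrightarrow> c t \<in> Q" unfolding eventually_at by blast
  define e where "e = min r d"
  have "0 < e" using c(1) d(1) by (simp add: e_def)
  moreover have "smooth_on {-e<..<e} c" by (rule smooth_on_cong[OF c(2)]) (auto simp: e_def)
  moreover have "c t \<in> S \<inter> Q" if "t \<in> {-e<..<e}" for t
    using c(3)[of t] d(2)[of t] that Q c(4) by (cases "t = 0") (auto simp: e_def)
  ultimately show ?thesis
    unfolding tangent_space_def using c(4,5) by (intro CollectI exI[of _ c] exI[of _ e]) blast
qed

lemma tangent_space_curve:
  assumes v: "v \<in> tangent_space S p" and Q: "open Q" "p \<in> Q"
  obtains c r where "0 < r" "\<And>t. t \<in> {-r<..<r} \<Longrightarrow> c t \<in> S \<inter> Q" "c 0 = p"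
    "(c has_vector_derivative v) (at (0::real))"
  using tangent_space_Int_open[OF assms] by (rule tangent_spaceE) (rule that)

context fibred_sphere
begin

lemma nondegenerate:
  assumes p: "p \<in> M" and v: "\<And>w. b v w = 0" shows "v = 0"
proof (rule ccontr)
  assume "v \<noteq> 0"
  then have "0 < b v v" using pos[OF p_B[OF p]] v[of p] by (simp add: sym[of p v])
  then show False using v by simp
qed

lemma metric_dual_exists:
  assumes p: "p \<in> M"
  shows "\<exists>S. linear S \<and> (\<forall>v. S (\<Sum>k\<in>Basis. b v k *\<^sub>R k) = v)"
proof -
  let ?T = "\<lambda>v. \<Sum>k\<in>Basis. b v k *\<^sub>R k"
  have l: "linear ?T" by (intro linearI) (simp_all add: bl scaleR_add_left sum.distrib scaleR_sum_right)
  have "inj ?T"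
    unfolding linear_injective_0[OF l]
  proof (intro allI impI)
    fix v assume 0: "?T v = 0"
    have "b v k = 0" if "k \<in> Basis" for k using arg_cong[OF 0, of "\<lambda>z. z \<bullet> k"] that by simp
    then have "b v w = 0" for w
      using linear_eq_0_on_span[of "b v" Basis w] lin_b by (metis span_Basis UNIV_I)
    then show "v = 0" by (rule nondegenerate[OF p])
  qed
  then obtain S where "linear S" "S \<circ> ?T = id" using linear_injective_left_inverse[OF l] by blast
  then show ?thesis by (intro exI[of _ S]) (simp add: fun_eq_iff)
qed

definition Vf where "Vf e x = (\<Sum>j\<in>UNIV. om x (case_option (u x j) e) *\<^sub>R u x j)"

lemma Vf_vertical: "x \<in> B \<Longrightarrow> Vf e x \<in> vertical B \<pi> x"
  unfolding Vf_def by (intro subspace_sum subspace_mul subspace_vertical u_in)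

lemma om_sum: "om x (case_option (\<Sum>j\<in>I. c j *\<^sub>R Y j) e) = (\<Sum>j\<in>I. c j * om x (case_option (Y j) e))"
proof (induction I rule: infinite_finite_induct)
  case (insert i I)
  show ?case unfolding sum.insert[OF insert(1,2)] om_linear insert(3) ..
qed (auto intro!: om_zero[of _ None] simp: bl)

lemma b_Vf:
  assumes x: "x \<in> B" shows "b (Vf e x) Z = om x (case_option Z e)"
proof -
  have r: "b (case_option (\<Sum>j\<in>UNIV. b Z (u x j) *\<^sub>R u x j) e i) (u x k) = b (case_option Z e i) (u x k)" for i k
    using orthonormal_coeff[OF bil u_vertical(1)[OF x], of "\<lambda>j. b Z (u x j)" k] by (simp split: option.splits)
  have lin1: "linear (b Z)" using lin_b by auto
  have "om x (case_option Z e) = om x (case_option (\<Sum>j\<in>UNIV. b Z (u x j) *\<^sub>R u x j) e)"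
    unfolding om_def r ..
  also have "\<dots> = (\<Sum>j\<in>UNIV. b Z (u x j) * om x (case_option (u x j) e))" by (rule om_sum)
  also have "\<dots> = b (Vf e x) Z"
    unfolding sym[of _ Z] Vf_def by (simp add: linear_sum[OF lin1] br mult.commute)
  finally show ?thesis by simp
qed

lemma Vf_smooth:
  assumes p: "p \<in> M" shows "smooth_on B (Vf e)"
proof -
  obtain S where S: "linear S" "\<And>v. S (\<Sum>k\<in>Basis. b v k *\<^sub>R k) = v" using metric_dual_exists[OF p] by blast
  have "smooth_on B (\<lambda>x. \<Sum>k\<in>Basis. om x (case_option k e) *\<^sub>R S k)"
    by (intro smooth_on_sum smooth_on_scaleR om_smooth smooth_on_const)
  then show ?thesis
  proof (rule smooth_on_cong)
    fix x assume "x \<in> B"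
    then have "(\<Sum>k\<in>Basis. om x (case_option k e) *\<^sub>R S k) = S (\<Sum>k\<in>Basis. b (Vf e x) k *\<^sub>R k)"
      by (simp add: b_Vf linear_sum[OF S(1)] linear_scale[OF S(1)])
    then show "(\<Sum>k\<in>Basis. om x (case_option k e) *\<^sub>R S k) = Vf e x" by (simp add: S(2))
  qed simp
qed

lemma Vf_nu:
  assumes p: "p \<in> M" and e: "adapted_frame p e" shows "Vf e p = \<nu> p"
proof -
  let ?w = "case_option (\<nu> p) e"
  have fe: "frame p e" and om1: "om p ?w = 1" using e by (auto simp: adapted_frame_def)
  have B: "p \<in> B" by (rule p_B[OF p])
  have o: "orthonormal b ?w" and s: "span (range ?w) = vertical B \<pi> p" using nu_frame[OF p fe] by auto
  have "b (Vf e p) (?w i) = (if i = None then 1 else 0)" for i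
  proof (cases i)
    case None
    then show ?thesis using om1 by (simp add: b_Vf[OF B])
  next
    case (Some k)
    have "om p (case_option (e k) e) = 0"
      by (rule om_proportional[of None "Some k" _ _ 1 "\<lambda>j. b (e k) (u p j)" 1]) auto
    then show ?thesis using Some by (simp add: b_Vf[OF B])
  qed
  then have "Vf e p = (\<Sum>i\<in>UNIV. (if i = None then 1 else 0) *\<^sub>R ?w i)"
    using orthonormal_expand[OF bil o, of "Vf e p"] s Vf_vertical[OF B] by simp
  also have "\<dots> = (\<Sum>i\<in>UNIV. if i = None then ?w i else 0)" by (intro sum.cong) auto
  finally show ?thesis by simp
qed

lemma horizontal_F:
  assumes p: "p \<in> M" and z: "z \<in> tangent_space B p" "\<And>v. v \<in> vertical B \<pi> p \<Longrightarrow> b z v = 0"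
  shows "z \<in> F"
proof -
  have "tangent_space M p \<subseteq> vertical B \<pi> p"
    unfolding vertical_fibre[OF M_Phi[OF p]] by (rule tangent_space_mono[OF M_fibre])
  then have zN: "z \<in> N p" using z by (auto simp: N_iff)
  obtain c h where c: "h \<in> F" "z = c *\<^sub>R \<nu> p + h" using N_decomp_nu[OF p zN] by blast
  have "b z (\<nu> p) = 0" by (rule z(2)[OF nu_props(1)[OF p]])
  moreover have "b h (\<nu> p) = 0" using c(1) nu_props(3)[OF p] by (simp add: F_def)
  ultimately have "c = 0" using nu_props(4)[OF p] by (simp add: c(2) bl)
  then show ?thesis using c by simp
qed

lemma skew_at:
  fixes g :: "'v \<Rightarrow> 'w::euclidean_space" and G :: "'w \<Rightarrow> 'w \<Rightarrow> real"
  defines "D \<equiv> \<lambda>x. frechet_derivative g (at x)"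
  assumes p: "p \<in> M" and e: "adapted_frame p e" and X: "X \<in> F" and Y: "Y \<in> F"
    and Q: "open Q" "p \<in> Q" and g: "\<And>k. Ck_on k Q g"
    and fib: "\<And>x x'. x \<in> B \<inter> Q \<Longrightarrow> x' \<in> B \<inter> Q \<Longrightarrow> \<pi> x = \<pi> x' \<Longrightarrow> g x = g x'"
    and G: "bilinear G" and iso: "\<And>x X Y. x \<in> \<Phi> \<inter> Q \<Longrightarrow> X \<in> F \<Longrightarrow> Y \<in> F \<Longrightarrow> G (D x X) (D x Y) = b X Y"
    and Gsym: "\<And>x X Y. x \<in> \<Phi> \<inter> Q \<Longrightarrow> X \<in> F \<Longrightarrow> Y \<in> F \<Longrightarrow> G (D x X) (D p Y) = G (D p Y) (D x X)"
  shows "Dom p X Y e + Dom p Y X e = 0"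
proof -
  have B: "p \<in> B" by (rule p_B[OF p])
  have dg: "(g has_derivative D x) (at x)" if "x \<in> Q" for x
    unfolding D_def by (rule Ck_on_SucD[OF Q(1) g that])
  have linD: "linear (D x)" if "x \<in> Q" for x using dg[OF that] by (rule has_derivative_linear)
  have C1: "Ck_on k Q (\<lambda>x. D x v)" for k v
    using g[of "Suc k"] by (simp add: D_def)
  have dD: "((\<lambda>x. D x v) has_derivative frechet_derivative (\<lambda>x. D x v) (at p)) (at p within T)" for v T
    by (rule has_derivative_at_withinI[OF Ck_on_SucD[OF Q(1) C1 Q(2)]])
  define D2 where "D2 v w = frechet_derivative (\<lambda>x. D x v) (at p) w" for v w
  have bG: "bounded_bilinear G" using G by (simp add: bilinear_conv_bounded_bilinear)
  have Gl: "bounded_linear (\<lambda>z. G z w)" for w by (rule bounded_bilinear.bounded_linear_left[OF bG])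
  have sym2: "G (D2 v w) c = G (D2 w v) c" for v w c
  proof -
    define f where "f x = G (g x) c" for x
    have fC: "Ck_on k Q f" for k unfolding f_def[abs_def] by (rule Ck_on_linear_comp[OF Q(1) Gl g])
    have df: "frechet_derivative f (at x) v = G (D x v) c" if "x \<in> Q" for x v
      unfolding f_def[abs_def] using frechet_derivative_at[OF bounded_linear.has_derivative[OF Gl dg[OF that], of c]] by metis
    have h: "frechet_derivative (\<lambda>x. frechet_derivative f (at x) v) (at p) w = G (D2 v w) c" for v w
    proof -
      have "((\<lambda>x. G (D x v) c) has_derivative (\<lambda>w. G (D2 v w) c)) (at p)"
        unfolding D2_def by (rule bounded_linear.has_derivative[OF Gl dD])
      then have "((\<lambda>x. frechet_derivative f (at x) v) has_derivative (\<lambda>w. G (D2 v w) c)) (at p)"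
        by (rule has_derivative_transform_within_open[OF _ Q]) (simp add: df)
      then show ?thesis using frechet_derivative_at by metis
    qed
    show ?thesis unfolding h[symmetric] by (rule second_derivative_symmetric[OF Q(1) fC Q(2)])
  qed
  have fibre_curve: "D x v = 0" if x: "x \<in> B \<inter> Q" and v: "v \<in> vertical B \<pi> x" for x v
  proof -
    obtain c r' where r': "0 < r'" and cx: "\<And>t. t \<in> {-r'<..<r'} \<Longrightarrow> c t \<in> fibre B \<pi> (\<pi> x) \<inter> Q" and c: "c 0 = x" "(c has_vector_derivative v) (at (0::real))"
      by (rule tangent_space_curve[OF v[unfolded vertical_def] Q(1) IntD2[OF x]]) (rule that)
    have "((\<lambda>t. g (c t)) has_vector_derivative D x v) (at 0)"
      by (rule curve_has_vector_derivative[OF has_derivative_at_withinI[OF dg] c(1) r' cx c(2)]) (use x in auto)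
    then show ?thesis
    proof (rule vector_derivative_const_on_interval[OF _ r'])
      fix t assume "t \<in> {-r'<..<r'}"
      from cx[OF this] show "g (c t) = g x" by (intro fib[OF _ x]) (auto simp: fibre_def)
    qed
  qed
  have main: "Dom p X Y e = - G (D2 X (\<nu> p)) (D p Y)" if X: "X \<in> F" and Y: "Y \<in> F" for X Y
  proof -
    have XT: "X \<in> tangent_space B p" by (rule F_TB[OF p_L[OF p] B X])
    obtain c r' where r': "0 < r'" and cx: "\<And>t. t \<in> {-r'<..<r'} \<Longrightarrow> c t \<in> B \<inter> Q" and c: "c 0 = p" "(c has_vector_derivative X) (at (0::real))"
      by (rule tangent_space_curve[OF XT Q]) (rule that)
    have cB: "c t \<in> B" if "t \<in> {-r'<..<r'}" for t using cx[OF that] by simp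
    define V where "V t = Vf e (c t)" for t
    define Z where "Z = frechet_derivative (Vf e) (at p within B) X"
    have dV: "(V has_vector_derivative Z) (at 0)"
      unfolding V_def[abs_def] Z_def
      by (rule curve_has_vector_derivative[OF smooth_on_has_derivative[OF Vf_smooth[OF p] B] c(1) r' cB c(2)])
    have V0: "V 0 = \<nu> p" by (simp add: V_def c(1) Vf_nu[OF p e])
    have "\<epsilon> * b p Z = 0"
    proof -
      have "((\<lambda>t. \<epsilon> * b (c t) (V t)) has_vector_derivative \<epsilon> * (b (c 0) Z + b X (V 0))) (at 0)"
        by (intro has_vector_derivative_mult_right bounded_bilinear.has_vector_derivative[OF bounded_bilinear_b] dV c(2))
      then have "\<epsilon> * (b (c 0) Z + b X (V 0)) = 0"
        by (rule vector_derivative_const_on_interval[OF _ r', where k=0])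
          (use vertical_TB[OF Vf_vertical[OF cB]] TB[OF cB] in \<open>auto simp: V_def\<close>)
      moreover have "b X (V 0) = 0" unfolding V0 using X nu_props(3)[OF p] by (simp add: F_def)
      ultimately show ?thesis by (simp add: c(1))
    qed
    then have ZT: "Z \<in> tangent_space B p" by (simp add: TB[OF B])
    have DZ: "D p Z = - D2 (\<nu> p) X"
    proof -
      have dV': "((\<lambda>t. \<Sum>k\<in>Basis. (V t \<bullet> k) *\<^sub>R D (c t) k) has_vector_derivative
          (\<Sum>k\<in>Basis. (V 0 \<bullet> k) *\<^sub>R D2 k X + (Z \<bullet> k) *\<^sub>R D (c 0) k)) (at 0)"
        unfolding D2_def
        by (intro has_vector_derivative_sum bounded_bilinear.has_vector_derivative[OF bounded_bilinear_scaleR]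
            bounded_linear.has_vector_derivative[OF bounded_linear_inner_left dV] curve_has_vector_derivative[OF dD c(1) r' cx c(2)])
      have DD: "(\<Sum>k\<in>Basis. (v \<bullet> k) *\<^sub>R D x k) = D x v" if "x \<in> Q" for x v
      proof -
        have "D x v = D x (\<Sum>k\<in>Basis. (v \<bullet> k) *\<^sub>R k)" by (simp add: euclidean_representation)
        then show ?thesis by (simp add: linear_sum[OF linD[OF that]] linear_scale[OF linD[OF that]])
      qed
      have lin2: "D2 v X = (\<Sum>k\<in>Basis. (v \<bullet> k) *\<^sub>R D2 k X)" for v
      proof -
        have "((\<lambda>x. \<Sum>k\<in>Basis. (v \<bullet> k) *\<^sub>R D x k) has_derivative (\<lambda>w. \<Sum>k\<in>Basis. (v \<bullet> k) *\<^sub>R D2 k w)) (at p)"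
          unfolding D2_def by (intro has_derivative_sum bounded_linear.has_derivative[OF bounded_linear_scaleR_right] dD)
        then have "((\<lambda>x. D x v) has_derivative (\<lambda>w. \<Sum>k\<in>Basis. (v \<bullet> k) *\<^sub>R D2 k w)) (at p)"
          by (rule has_derivative_transform_within_open[OF _ Q]) (simp add: DD)
        from fun_cong[OF frechet_derivative_at[OF this], of X] show ?thesis by (simp only: D2_def)
      qed
      have "(\<Sum>k\<in>Basis. (V 0 \<bullet> k) *\<^sub>R D2 k X + (Z \<bullet> k) *\<^sub>R D (c 0) k) = 0"
        by (rule vector_derivative_const_on_interval[OF dV' r', where k=0])
          (use cx DD fibre_curve Vf_vertical in \<open>auto simp: V_def\<close>)
      then have "D2 (V 0) X + D (c 0) Z = 0"
        unfolding lin2[of "V 0"] using DD[of "c 0" Z] Q(2) c(1) by (simp add: sum.distrib)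
      then show ?thesis by (simp add: V0 c(1) add_eq_0_iff2)
    qed
    have DomZ: "Dom p X Y e = b Z Y"
    proof -
      have "((\<lambda>t. om (c t) (case_option Y e)) has_vector_derivative Dom p X Y e) (at 0)"
        unfolding Dom_def by (rule curve_has_vector_derivative[OF om_has_derivative[OF B] c(1) r' cB c(2)])
      moreover have "((\<lambda>t. b (V t) Y) has_vector_derivative b Z Y) (at 0)"
        by (rule bounded_linear.has_vector_derivative[OF bounded_bilinear.bounded_linear_left[OF bounded_bilinear_b] dV])
      ultimately have "((\<lambda>t. om (c t) (case_option Y e) - b (V t) Y) has_vector_derivative Dom p X Y e - b Z Y) (at 0)"
        by (rule has_vector_derivative_diff)
      then have "Dom p X Y e - b Z Y = 0"
        by (rule vector_derivative_const_on_interval[OF _ r', where k=0]) (use b_Vf[OF cB] in \<open>auto simp: V_def\<close>)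
      then show ?thesis by simp
    qed
    define P where "P = (\<Sum>j\<in>UNIV. b Z (u p j) *\<^sub>R u p j)"
    have Pv: "P \<in> vertical B \<pi> p" unfolding P_def by (intro subspace_sum subspace_mul subspace_vertical[OF B] u_in[OF B])
    have "Z - P \<in> F"
    proof (rule horizontal_F[OF p])
      show "Z - P \<in> tangent_space B p" by (rule subspace_diff[OF subspace_TB[OF B] ZT vertical_TB[OF Pv]])
      fix v assume "v \<in> vertical B \<pi> p"
      then have v: "v \<in> span (range (u p))" using u_vertical(2)[OF B] by simp
      have "b (Z - P) (u p j) = 0" for j
        unfolding P_def using orthonormal_coeff[OF bil u_vertical(1)[OF B]] by (simp add: bl)
      then show "b (Z - P) v = 0" using orthonormal_Parseval[OF bil u_vertical(1)[OF B] v] by simp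
    qed
    then have "b (Z - P) Y = G (D p (Z - P)) (D p Y)" using iso[of p "Z - P" Y] M_Phi[OF p] Q(2) Y by simp
    moreover have "D p (Z - P) = D p Z"
      using fibre_curve[OF _ Pv] B Q(2) by (simp add: linear_diff[OF linD])
    moreover have "b P Y = 0"
      using Y vertical_L[OF M_Phi[OF p] Pv] by (simp add: F_def sym[of P])
    ultimately have "b Z Y = G (- D2 (\<nu> p) X) (D p Y)" by (simp add: bl DZ)
    also have "\<dots> = - G (D2 (\<nu> p) X) (D p Y)" by (simp add: bilinear_lneg[OF G])
    finally show ?thesis unfolding DomZ by (simp add: sym2[of "\<nu> p" X])
  qed
  obtain c r' where r': "0 < r'" and cx: "\<And>t. t \<in> {-r'<..<r'} \<Longrightarrow> c t \<in> \<Phi> \<inter> Q" and c: "c 0 = p" "(c has_vector_derivative \<nu> p) (at (0::real))"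
      by (rule tangent_space_curve[OF nu_props(1)[OF p, unfolded vertical_fibre[OF M_Phi[OF p]]] Q]) (rule that)
  have dc: "((\<lambda>t. D (c t) v) has_vector_derivative D2 v (\<nu> p)) (at 0)" for v
    unfolding D2_def by (rule curve_has_vector_derivative[OF dD c(1) r' cx c(2)])
  have DpY: "((\<lambda>t. G (D (c t) Y) (D p X) - G (D p X) (D (c t) Y)) has_vector_derivative
      G (D2 Y (\<nu> p)) (D p X) - G (D p X) (D2 Y (\<nu> p))) (at 0)"
    by (intro has_vector_derivative_diff bounded_linear.has_vector_derivative[OF Gl]
        bounded_linear.has_vector_derivative[OF bounded_bilinear.bounded_linear_right[OF bG]] dc)
  have s: "G (D2 Y (\<nu> p)) (D p X) - G (D p X) (D2 Y (\<nu> p)) = 0"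
    by (rule vector_derivative_const_on_interval[OF DpY r', where k=0]) (use Gsym[OF cx Y X] in auto)
  have "((\<lambda>t. G (D (c t) X) (D (c t) Y)) has_vector_derivative
      G (D (c 0) X) (D2 Y (\<nu> p)) + G (D2 X (\<nu> p)) (D (c 0) Y)) (at 0)"
    by (rule bounded_bilinear.has_vector_derivative[OF bG dc dc])
  then have "G (D (c 0) X) (D2 Y (\<nu> p)) + G (D2 X (\<nu> p)) (D (c 0) Y) = 0"
    by (rule vector_derivative_const_on_interval[OF _ r', where k="b X Y"]) (use iso[OF cx X Y] in auto)
  then show ?thesis using main[OF X Y] main[OF Y X] s by (simp add: c(1))
qed

end

context fibred_sphere
begin

lemma skew_riemannian_fibration:
  assumes fib: "riemannian_fibration b B \<pi> NN"
  shows skew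
  unfolding skew_def
proof (intro allI impI, elim conjE)
  fix p e X Y
  assume p: "p \<in> M" and e: "adapted_frame p e" and X: "X \<in> F" and Y: "Y \<in> F"
  have NN: "riemannian_manifold NN" and cont: "continuous_map (top_of_set B) (mtop NN) \<pi>"
    and surj: "\<pi> ` B = topspace (mtop NN)"
    and sub: "\<And>U \<phi>. (U, \<phi>) \<in> atlas NN \<Longrightarrow> smooth_on {x\<in>B. \<pi> x \<in> U} (\<phi> \<circ> \<pi>) \<and>
        (\<forall>x\<in>B. \<pi> x \<in> U \<longrightarrow>
           (let D = frechet_derivative (\<phi> \<circ> \<pi>) (at x within {x\<in>B. \<pi> x \<in> U})
            in D ` tangent_space B x = model NN \<and>
               (\<forall>X\<in>horizontal b B \<pi> x. \<forall>Y\<in>horizontal b B \<pi> x.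
                  metric NN (U, \<phi>) (\<phi> (\<pi> x)) (D X) (D Y) = b X Y)))"
    using fib unfolding riemannian_fibration_def by auto
  have pB: "p \<in> B" "\<pi> p = yy" using M_Phi[OF p] by (auto simp: fibre_def)
  have "yy \<in> topspace (mtop NN)" using surj pB by auto
  then obtain U \<phi> where U: "(U, \<phi>) \<in> atlas NN" "yy \<in> U" using NN unfolding riemannian_manifold_def by auto
  have chart: "openin (mtop NN) U"
    "bilinear (metric NN (U, \<phi>) (\<phi> yy))"
    "\<And>v w. v \<in> model NN \<Longrightarrow> w \<in> model NN \<Longrightarrow> metric NN (U, \<phi>) (\<phi> yy) v w = metric NN (U, \<phi>) (\<phi> yy) w v"
    using NN U unfolding riemannian_manifold_def by fastforce+
  define S where "S = {x\<in>B. \<pi> x \<in> U}"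
  define D where "D x = frechet_derivative (\<phi> \<circ> \<pi>) (at x within S)" for x
  have sm: "smooth_on S (\<phi> \<circ> \<pi>)" using sub[OF U(1)] by (simp add: S_def)
  have onto: "D x ` tangent_space B x = model NN"
    and isom: "\<And>X Y. X \<in> horizontal b B \<pi> x \<Longrightarrow> Y \<in> horizontal b B \<pi> x \<Longrightarrow> metric NN (U, \<phi>) (\<phi> (\<pi> x)) (D x X) (D x Y) = b X Y"
    if "x \<in> S" for x
    using sub[OF U(1)] that unfolding S_def[symmetric] Let_def D_def by (auto simp: S_def)
  have "openin (top_of_set B) S"
    using openin_continuous_map_preimage[OF cont chart(1)] by (simp add: S_def)
  then obtain Q' where Q': "open Q'" "S = B \<inter> Q'" by (auto simp: openin_open)
  have pS: "p \<in> S" using pB U(2) by (simp add: S_def)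
  obtain Q g where Q: "open Q" "p \<in> Q" "\<And>k. Ck_on k Q g" "\<And>x. x \<in> S \<Longrightarrow> x \<in> Q \<Longrightarrow> g x = (\<phi> \<circ> \<pi>) x"
    using smooth_onE[OF sm pS] by blast
  let ?Q = "Q \<inter> Q'"
  have Dg: "frechet_derivative g (at x) v = D x v" if x: "x \<in> B \<inter> ?Q" and v: "v \<in> tangent_space B x" for x v
  proof (rule tangent_derivative_unique[where f=g and D="frechet_derivative g (at x)" and D'="D x" and S="S \<inter> Q" and p=x and X=v])
    show "v \<in> tangent_space (S \<inter> Q) x" unfolding Q'(2) Int_assoc
      by (rule tangent_space_Int_open[OF v]) (use x Q(1) Q' in auto)
    have xS: "x \<in> S" using x Q' by auto
    have "((\<phi> \<circ> \<pi>) has_derivative D x) (at x within S \<inter> Q)"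
      unfolding D_def by (rule has_derivative_subset[OF smooth_on_has_derivative[OF sm xS]]) simp
    then show "(g has_derivative D x) (at x within S \<inter> Q)"
      by (rule has_derivative_transform[rotated 2]) (use xS x Q(4) in auto)
    show "(g has_derivative frechet_derivative g (at x)) (at x within S \<inter> Q)"
      by (rule has_derivative_at_withinI[OF Ck_on_SucD[OF Q(1) Q(3)]]) (use x in auto)
  qed
  have FT: "v \<in> tangent_space B x" "v \<in> horizontal b B \<pi> x" if "x \<in> \<Phi>" "v \<in> F" for x v
  proof -
    have "x \<in> L" "x \<in> B" using that(1) fibre_L fibre_B by auto
    then show "v \<in> tangent_space B x" using F_TB that(2) by blast
    then show "v \<in> horizontal b B \<pi> x"
      using that vertical_L[OF that(1)] by (auto simp: horizontal_def F_def)
  qed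
  have \<Phi>S: "x \<in> S" "\<pi> x = yy" if "x \<in> \<Phi>" for x using that U(2) by (auto simp: fibre_def S_def)
  show "Dom p X Y e + Dom p Y X e = 0"
  proof (rule skew_at[OF p e X Y, of ?Q g "metric NN (U, \<phi>) (\<phi> yy)"])
    show "open ?Q" using Q(1) Q'(1) by blast
    show "p \<in> ?Q" using Q(2) Q'(2) pS by blast
    show "Ck_on k ?Q g" for k by (rule Ck_on_subset[OF \<open>open ?Q\<close> _ Q(3)]) simp
    show "g x = g x'" if "x \<in> B \<inter> ?Q" "x' \<in> B \<inter> ?Q" "\<pi> x = \<pi> x'" for x x'
      using Q(4)[of x] Q(4)[of x'] that Q'(2) by auto
    show "bilinear (metric NN (U, \<phi>) (\<phi> yy))" by (rule chart(2))
    have DgF: "frechet_derivative g (at x) v = D x v" if "x \<in> \<Phi> \<inter> ?Q" "v \<in> F" for x v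
      by (rule Dg) (use that FT(1) fibre_B in auto)
    have mod: "D x v \<in> model NN" if "x \<in> \<Phi>" "v \<in> F" for x v
      using onto[OF \<Phi>S(1)[OF that(1)]] FT(1)[OF that] by blast
    fix x X Y assume x: "x \<in> \<Phi> \<inter> ?Q" and X: "X \<in> F" and Y: "Y \<in> F"
    show "metric NN (U, \<phi>) (\<phi> yy) (frechet_derivative g (at x) X) (frechet_derivative g (at x) Y) = b X Y"
      unfolding DgF[OF x X] DgF[OF x Y] using isom[OF \<Phi>S(1), of x X Y] \<Phi>S(2)[of x] FT(2) x X Y by auto
    have p': "p \<in> \<Phi> \<inter> ?Q" using M_Phi[OF p] \<open>p \<in> ?Q\<close> by simp
    show "metric NN (U, \<phi>) (\<phi> yy) (frechet_derivative g (at x) X) (frechet_derivative g (at p) Y)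
        = metric NN (U, \<phi>) (\<phi> yy) (frechet_derivative g (at p) Y) (frechet_derivative g (at x) X)"
      unfolding DgF[OF x X] DgF[OF p' Y] by (rule chart(3)) (use mod x p' X Y in auto)
  qed
qed

lemma skew_submersion:
  fixes g :: "'v \<Rightarrow> 'w::euclidean_space" and G :: "'w \<Rightarrow> 'w \<Rightarrow> real"
  assumes g: "\<And>k. Ck_on k UNIV g" and fib: "\<And>x x'. x \<in> B \<Longrightarrow> x' \<in> B \<Longrightarrow> \<pi> x = \<pi> x' \<Longrightarrow> g x = g x'"
    and D: "\<And>x. (g has_derivative D x) (at x)"
    and G: "bilinear G" "\<And>v w. G v w = G w v"
    and iso: "\<And>x X Y. x \<in> \<Phi> \<Longrightarrow> X \<in> F \<Longrightarrow> Y \<in> F \<Longrightarrow> G (D x X) (D x Y) = b X Y"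
  shows skew
  unfolding skew_def
proof (intro allI impI, elim conjE)
  fix p e X Y
  assume h: "p \<in> M" "adapted_frame p e" "X \<in> F" "Y \<in> F"
  have d: "frechet_derivative g (at x) = D x" for x by (rule frechet_derivative_at[OF D, symmetric])
  show "Dom p X Y e + Dom p Y X e = 0"
  proof (rule skew_at[OF h open_UNIV UNIV_I g _ G(1)])
    show "g x = g x'" if "x \<in> B \<inter> UNIV" "x' \<in> B \<inter> UNIV" "\<pi> x = \<pi> x'" for x x' by (rule fib) (use that in auto)
    fix x X Y assume "x \<in> \<Phi> \<inter> UNIV" "X \<in> F" "Y \<in> F"
    then show "G (frechet_derivative g (at x) X) (frechet_derivative g (at x) Y) = b X Y" unfolding d using iso by simp
    show "G (frechet_derivative g (at x) X) (frechet_derivative g (at p) Y) = G (frechet_derivative g (at p) Y) (frechet_derivative g (at x) X)"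
      by (rule G(2))
  qed
qed

end

section \<open>Model spaces\<close>

lemma isometry_onto_exists:
  fixes b :: "'v::euclidean_space \<Rightarrow> 'v \<Rightarrow> real"
  assumes b: "bilinear b" "\<And>x y. b x y = b y x" and K: "subspace K" "dim K = CARD('m) + 1"
    and pos: "\<And>k. k \<in> K \<Longrightarrow> k \<noteq> 0 \<Longrightarrow> 0 < b k k"
  shows "\<exists>J :: (real^'m::finite) \<times> real \<Rightarrow> 'v. linear J \<and> range J = K \<and> (\<forall>x y. b (J x) (J y) = x \<bullet> y)"
proof -
  have "dim K = CARD('m option)" using K(2) by (simp add: card_option)
  then obtain e :: "'m option \<Rightarrow> 'v" where e: "orthonormal b e" "span (range e) = K"
    using orthonormal_exists[OF b K(1) _ pos] by blast
  define c :: "(real^'m::_) \<times> real \<Rightarrow> 'm option \<Rightarrow> real" where "c z i = (case i of None \<Rightarrow> snd z | Some k \<Rightarrow> fst z $ k)" for z i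
  define J where "J z = (\<Sum>i\<in>UNIV. c z i *\<^sub>R e i)" for z
  have lin: "linear J"
    by (rule linearI) (simp_all add: J_def c_def scaleR_add_left sum.distrib scaleR_sum_right scaleR_add_right UNIV_option_conv sum.reindex)
  have bJ: "b (J x) (J y) = x \<bullet> y" for x y
  proof -
    have l: "linear (b (J x))" using b(1) by (simp add: bilinear_def)
    have "b (J x) (J y) = (\<Sum>i\<in>UNIV. c y i * c x i)"
      unfolding J_def[of y] linear_sum[OF l] bilinear_rmul[OF b(1)]
      by (simp add: J_def[of x] orthonormal_coeff[OF b(1) e(1)])
    also have "\<dots> = x \<bullet> y"
      by (simp add: c_def UNIV_option_conv sum.reindex inner_prod_def inner_vec_def mult.commute)
    finally show ?thesis .
  qed
  have "range J = K"
  proof (intro equalityI subsetI)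
    fix x assume "x \<in> range J"
    then show "x \<in> K" unfolding J_def e(2)[symmetric] by (auto intro!: span_sum span_scale intro: span_base)
  next
    fix x assume "x \<in> K"
    then have x: "x = (\<Sum>i\<in>UNIV. b x (e i) *\<^sub>R e i)" using orthonormal_expand[OF b(1) e(1)] e(2) by blast
    have "c (\<chi> k. b x (e (Some k)), b x (e None)) i = b x (e i)" for i by (simp add: c_def split: option.splits)
    then have "J (\<chi> k. b x (e (Some k)), b x (e None)) = x" unfolding J_def using x by simp
    then show "x \<in> range J" by (metis rangeI)
  qed
  with lin bJ show ?thesis by blast
qed

lemma space_form_sphere_curved:
  fixes b :: "'v::euclidean_space \<Rightarrow> 'v \<Rightarrow> real"
  assumes b: "bilinear b" "\<And>x y. b x y = b y x" and eps: "\<epsilon> * \<epsilon> = 1"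
    and TB: "\<And>p. p \<in> B \<Longrightarrow> tangent_space B p = {v. b p v = 0}"
    and Bn: "\<And>p. p \<in> B \<Longrightarrow> b p p = \<epsilon>"
    and pos: "\<And>p v. p \<in> B \<Longrightarrow> b p v = 0 \<Longrightarrow> v \<noteq> 0 \<Longrightarrow> 0 < b v v"
    and L: "subspace L" "dim L = CARD('m) + 2" and c: "c \<in> B" "c \<in> L"
    and \<sigma>: "0 < \<sigma>" "\<kappa>\<^sup>2 + \<epsilon> * \<sigma>\<^sup>2 = 1"
    and memB: "\<And>x. b x x = \<epsilon> \<Longrightarrow> \<epsilon> * b c x = \<kappa> \<Longrightarrow> x \<in> B"
  shows "\<exists>J :: (real^'m::{finite,wellorder}) \<times> real \<Rightarrow> 'v. space_form_sphere b (\<kappa> *\<^sub>R c) \<sigma> J \<epsilon> B (- (\<epsilon> * \<sigma>) *\<^sub>R c) \<kappa> L \<and>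
    sphere_embedding.M (\<kappa> *\<^sub>R c) \<sigma> J = {x \<in> B \<inter> L. \<epsilon> * b c x = \<kappa>}"
proof -
  note bl = bilinear_ladd[OF b(1)] bilinear_lmul[OF b(1)] bilinear_lsub[OF b(1)] bilinear_lneg[OF b(1)] bilinear_lzero[OF b(1)]
  note br = bilinear_radd[OF b(1)] bilinear_rmul[OF b(1)] bilinear_rsub[OF b(1)] bilinear_rneg[OF b(1)] bilinear_rzero[OF b(1)]
  have cc: "b c c = \<epsilon>" by (rule Bn[OF c(1)])
  have e0: "\<epsilon> \<noteq> 0" using eps by auto
  define K where "K = {v\<in>L. b c v = 0}"
  have K: "subspace K" using L(1) by (auto simp: K_def subspace_def br)
  have posK: "0 < b k k" if "k \<in> K" "k \<noteq> 0" for k using pos[OF c(1)] that by (simp add: K_def)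
  have split: "x = (\<epsilon> * b c x) *\<^sub>R c + (x - (\<epsilon> * b c x) *\<^sub>R c)" for x by simp
  have splitK: "x - (\<epsilon> * b c x) *\<^sub>R c \<in> K" if "x \<in> L" for x
  proof -
    have "b c (x - (\<epsilon> * b c x) *\<^sub>R c) = b c x - (\<epsilon> * \<epsilon>) * b c x" by (simp add: br cc)
    then show ?thesis using that c(2) L(1) by (simp add: K_def eps subspace_diff subspace_mul)
  qed
  have "dim K = CARD('m) + 1"
  proof -
    have "c \<notin> span K" using K cc e0 by (simp add: span_eq_iff[THEN iffD2] K_def)
    moreover have "span (insert c K) = L"
    proof
      show "span (insert c K) \<subseteq> L" by (rule span_minimal) (use c(2) L(1) in \<open>auto simp: K_def\<close>)
      show "L \<subseteq> span (insert c K)"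
      proof
        fix x assume "x \<in> L"
        then have "x - (\<epsilon> * b c x) *\<^sub>R c \<in> span (insert c K)" using splitK by (simp add: span_base)
        then show "x \<in> span (insert c K)"
          by (subst split[of x]) (intro span_add span_scale, auto intro: span_base)
      qed
    qed
    ultimately show ?thesis using dim_insert[of c K] L(2) dim_span[of "insert c K"] by simp
  qed
  then obtain J :: "(real^'m::_) \<times> real \<Rightarrow> 'v" where J: "linear J" "range J = K" "\<And>x y. b (J x) (J y) = x \<bullet> y"
    using isometry_onto_exists[OF b K _ posK] by blast
  have JK: "b c (J z) = 0" "J z \<in> L" for z using J(2) by (auto simp: K_def)
  interpret sphere_embedding b "\<kappa> *\<^sub>R c" \<sigma> J
    by (rule sphere_embedding.intro) (use b J \<sigma> in auto)
  have M: "M = {x \<in> B \<inter> L. \<epsilon> * b c x = \<kappa>}"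
  proof (intro equalityI subsetI)
    fix x assume "x \<in> M"
    then obtain z where z: "norm z = 1" "x = \<kappa> *\<^sub>R c + \<sigma> *\<^sub>R J z" by (auto simp: M_def E_def)
    have cx: "b c x = \<kappa> * \<epsilon>" by (simp add: z(2) br cc JK)
    have "b x x = \<kappa>\<^sup>2 * \<epsilon> + \<sigma>\<^sup>2"
      using z(1) by (simp add: z(2) br bl cc JK J(3) b(2)[of "J z" c] norm_eq_1 power2_eq_square)
    also have "\<dots> = \<epsilon> * (\<kappa>\<^sup>2 + \<epsilon> * \<sigma>\<^sup>2)" using eps by (simp add: algebra_simps flip: mult.assoc)
    finally have xx: "b x x = \<epsilon>" using \<sigma>(2) by simp
    have e: "\<epsilon> * b c x = \<kappa>" using eps by (simp add: cx)
    have "x \<in> L" unfolding z(2) using L(1) c(2) JK(2) by (intro subspace_add subspace_mul)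
    then show "x \<in> {x \<in> B \<inter> L. \<epsilon> * b c x = \<kappa>}" using memB[OF xx e] e by simp
  next
    fix x assume "x \<in> {x \<in> B \<inter> L. \<epsilon> * b c x = \<kappa>}"
    then have x: "x \<in> B" "x \<in> L" "\<epsilon> * b c x = \<kappa>" by auto
    obtain w where w: "x - \<kappa> *\<^sub>R c = J w" using splitK[OF x(2)] J(2) x(3) by auto
    have xw: "x = \<kappa> *\<^sub>R c + J w" using w by (simp add: algebra_simps)
    have "\<epsilon> = b x x" using Bn[OF x(1)] by simp
    also have "\<dots> = \<kappa>\<^sup>2 * \<epsilon> + w \<bullet> w"
      by (simp add: xw br bl cc JK J(3) b(2)[of "J w" c] power2_eq_square)
    finally have "w \<bullet> w = \<epsilon> * (1 - \<kappa>\<^sup>2)" by (simp add: algebra_simps)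
    also have "1 - \<kappa>\<^sup>2 = \<epsilon> * \<sigma>\<^sup>2" using \<sigma>(2) by simp
    finally have "w \<bullet> w = \<sigma>\<^sup>2" using eps by (simp flip: mult.assoc)
    then have "norm w = \<sigma>" using \<sigma>(1) by (simp add: norm_eq_square)
    then have "norm ((1 / \<sigma>) *\<^sub>R w) = 1" using \<sigma>(1) by simp
    moreover have "x = E ((1 / \<sigma>) *\<^sub>R w)" using \<sigma>(1) by (simp add: E_def xw linear_scale[OF J(1)])
    ultimately show "x \<in> M" unfolding M_def by (metis image_eqI mem_sphere_0)
  qed
  have "space_form_sphere b (\<kappa> *\<^sub>R c) \<sigma> J \<epsilon> B (- (\<epsilon> * \<sigma>) *\<^sub>R c) \<kappa> L"
  proof unfold_locales
    show "\<epsilon> * \<epsilon> * \<epsilon> = \<epsilon>" by (simp add: eps)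
    show "tangent_space B p = {v. \<epsilon> * b p v = 0}" if "p \<in> B" for p using TB[OF that] e0 by simp
    show "\<epsilon> * b p p = \<epsilon> * \<epsilon>" if "p \<in> B" for p using Bn[OF that] by simp
    show "0 < b v v" if "p \<in> B" "\<epsilon> * b p v = 0" "v \<noteq> 0" for p v using pos that e0 by auto
    show "M \<subseteq> B" using M by auto
    show "\<epsilon> * b (\<kappa> *\<^sub>R c) (J z) = 0" "b (- (\<epsilon> * \<sigma>) *\<^sub>R c) (J z) = 0" "J z \<in> L" for z
      using JK by (simp_all add: bl)
    show "\<kappa> *\<^sub>R (- (\<epsilon> * \<sigma>) *\<^sub>R c) = - (\<epsilon> * \<sigma>) *\<^sub>R (\<kappa> *\<^sub>R c)" by (simp add: mult.commute)
    show "\<kappa>\<^sup>2 + \<epsilon> * \<sigma>\<^sup>2 = 1" by (rule \<sigma>(2))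
    have "b (- (\<epsilon> * \<sigma>) *\<^sub>R c) (- (\<epsilon> * \<sigma>) *\<^sub>R c) = (\<epsilon> * \<epsilon>) * \<epsilon> * \<sigma>\<^sup>2"
      by (simp add: bl br cc power2_eq_square ac_simps)
    then show "b (- (\<epsilon> * \<sigma>) *\<^sub>R c) (- (\<epsilon> * \<sigma>) *\<^sub>R c) + \<kappa>\<^sup>2 = 1" using \<sigma>(2) eps by simp
    have "b (\<kappa> *\<^sub>R c) (- (\<epsilon> * \<sigma>) *\<^sub>R c) = - ((\<epsilon> * \<epsilon>) * \<kappa> * \<sigma>)" by (simp add: bl br cc)
    then show "\<epsilon> * (b (\<kappa> *\<^sub>R c) (- (\<epsilon> * \<sigma>) *\<^sub>R c) + \<sigma> * \<kappa>) = 0" using eps by simp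
    show "subspace L" "\<kappa> *\<^sub>R c \<in> L" "- (\<epsilon> * \<sigma>) *\<^sub>R c \<in> L" using L(1) c(2) by (auto intro: subspace_mul simp del: scaleR_minus_left)
    fix v l assume v: "\<And>z. b v (J z) = 0" "b (- (\<epsilon> * \<sigma>) *\<^sub>R c) v = 0" and l: "l \<in> L"
    have "b v c = 0" using v(2) e0 \<sigma>(1) by (simp add: bl b(2)[of v c])
    obtain z where z: "l - (\<epsilon> * b c l) *\<^sub>R c = J z" using splitK[OF l] J(2) by auto
    have "l = (\<epsilon> * b c l) *\<^sub>R c + J z" using z by (simp add: algebra_simps)
    from arg_cong[OF this, of "b v"] show "b v l = 0" unfolding br v(1) \<open>b v c = 0\<close> by simp
  qed
  with M show ?thesis by blast
qed

lemma space_form_sphere_flat: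
  fixes c :: "'v::euclidean_space"
  assumes L: "subspace L" "dim L = CARD('m) + 1" and c: "c \<in> L" and r: "0 < r"
  shows "\<exists>J :: (real^'m::{finite,wellorder}) \<times> real \<Rightarrow> 'v. space_form_sphere inner c r J 0 UNIV 0 1 L \<and>
    sphere_embedding.M c r J = {x \<in> L. dist c x = r}"
proof -
  have bil: "bilinear (inner :: 'v \<Rightarrow> 'v \<Rightarrow> real)"
    using bounded_bilinear_inner bilinear_conv_bounded_bilinear by blast
  obtain J :: "(real^'m::_) \<times> real \<Rightarrow> 'v" where J: "linear J" "range J = L" "\<And>x y. J x \<bullet> J y = x \<bullet> y"
    using isometry_onto_exists[OF bil inner_commute L] by auto
  interpret sphere_embedding inner c r J
    by (rule sphere_embedding.intro) (use bil J r in \<open>auto simp: inner_commute\<close>)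
  have M: "M = {x \<in> L. dist c x = r}"
  proof (intro equalityI subsetI)
    fix x assume "x \<in> M"
    then obtain z where z: "norm z = 1" "x = c + r *\<^sub>R J z" by (auto simp: M_def E_def)
    have "x \<in> L" unfolding z(2) using L(1) c J(2) by (intro subspace_add subspace_mul) auto
    moreover have "norm (J z) = 1" using z(1) J(3)[of z z] by (simp add: norm_eq_1)
    ultimately show "x \<in> {x \<in> L. dist c x = r}" using r by (simp add: z(2) dist_norm)
  next
    fix x assume "x \<in> {x \<in> L. dist c x = r}"
    then have x: "x \<in> L" "dist c x = r" by auto
    have "x - c \<in> L" using x(1) c L(1) by (simp add: subspace_diff)
    then obtain w where w: "x - c = J w" using J(2) by auto
    have "norm (J w) = r" using x(2) unfolding w[symmetric] by (simp only: dist_norm norm_minus_commute[of c x])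
    then have "norm w = r" using J(3)[of w w] by (simp add: norm_eq_sqrt_inner)
    then have "norm ((1 / r) *\<^sub>R w) = 1" using r by simp
    moreover have "x = E ((1 / r) *\<^sub>R w)" using r w by (simp add: E_def linear_scale[OF J(1)] algebra_simps)
    ultimately show "x \<in> M" unfolding M_def by (metis image_eqI mem_sphere_0)
  qed
  have T: "tangent_space UNIV p = UNIV" for p :: 'v
  proof -
    have "v \<in> tangent_space UNIV p" for v :: 'v
    proof (rule tangent_spaceI[of "\<lambda>t. p + t *\<^sub>R v"])
      show "Ck_on k UNIV (\<lambda>t. p + t *\<^sub>R v)" for k
        by (intro Ck_on_add Ck_on_const Ck_on_bounded_linear) (auto intro: bounded_linear_scaleR_left)
      show "((\<lambda>t. p + t *\<^sub>R v) has_vector_derivative v) (at 0)" by (auto intro!: derivative_eq_intros)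
    qed auto
    then show ?thesis by auto
  qed
  have "space_form_sphere inner c r J 0 UNIV 0 1 L"
  proof unfold_locales
    show "J z \<in> L" for z using J(2) by auto
    show "v \<bullet> l = 0" if "\<And>z. v \<bullet> J z = 0" "l \<in> L" for v l using that unfolding J(2)[symmetric] by blast
  qed (use T L(1) c subspace_0[OF L(1)] in auto)
  with M show ?thesis by blast
qed

lemma tangent_space_level_set:
  assumes b: "bounded_bilinear b" "\<And>x y. b x y = b y x" and B: "\<And>x. x \<in> B \<Longrightarrow> b x x = k"
    and v: "v \<in> tangent_space B p"
  shows "b p v = (0::real)"
proof -
  obtain c e where c: "0 < e" "\<And>t. t \<in> {-e<..<e} \<Longrightarrow> c t \<in> B" "c 0 = p" "(c has_vector_derivative v) (at (0::real))"
    using v by (blast elim: tangent_spaceE)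
  have "((\<lambda>t. b (c t) (c t)) has_vector_derivative b (c 0) v + b v (c 0)) (at 0)"
    by (rule bounded_bilinear.has_vector_derivative[OF b(1) c(4) c(4)])
  then have "b (c 0) v + b v (c 0) = 0"
    by (rule vector_derivative_const_on_interval[OF _ c(1)]) (rule B[OF c(2)])
  then show ?thesis using b(2)[of v p] by (simp add: c(3))
qed

lemma tangent_space_sphere:
  fixes p :: "'a::euclidean_space"
  assumes p: "p \<in> sphere 0 1"
  shows "tangent_space (sphere 0 1) p = {v. p \<bullet> v = 0}"
proof (intro equalityI subsetI)
  fix v assume "v \<in> tangent_space (sphere 0 1) p"
  then show "v \<in> {v. p \<bullet> v = 0}"
    using tangent_space_level_set[OF bounded_bilinear_inner inner_commute, of "sphere 0 1" 1 v p] by (simp add: norm_eq_1)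
next
  fix v assume "v \<in> {v. p \<bullet> v = 0}"
  then have v: "p \<bullet> v = 0" by simp
  show "v \<in> tangent_space (sphere 0 1) p"
  proof (cases "v = 0")
    case False
    define w where "w = sgn v"
    define c where "c t = cos (norm v * t) *\<^sub>R p + sin (norm v * t) *\<^sub>R w" for t
    have w: "p \<bullet> w = 0" "w \<bullet> w = 1" "p \<bullet> p = 1"
      using v False p by (simp_all add: w_def sgn_div_norm dot_square_norm power2_eq_square norm_eq_1)
    show ?thesis
    proof (rule tangent_spaceI[of c])
      show "Ck_on k UNIV c" for k unfolding c_def[abs_def] by (rule Ck_trig)
      have "c t \<bullet> c t = (cos (norm v * t))\<^sup>2 + (sin (norm v * t))\<^sup>2" for t
        using w by (simp add: c_def inner_simps inner_commute power2_eq_square)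
      then show "c t \<in> sphere 0 1" for t by (simp add: norm_eq_1)
      show "c 0 = p" by (simp add: c_def)
      have "(c has_vector_derivative norm v *\<^sub>R w) (at 0)"
        unfolding c_def[abs_def] by (auto intro!: derivative_eq_intros)
      then show "(c has_vector_derivative v) (at 0)" using False by (simp add: w_def sgn_div_norm)
    qed
  qed (use zero_tangent[OF p] in simp)
qed

lemma bilinear_minkowski: "bilinear (minkowski :: 'a::euclidean_space \<times> real \<Rightarrow> _)"
  unfolding bilinear_def minkowski_def
  by (intro conjI allI linearI) (simp_all add: inner_simps algebra_simps)

lemma minkowski_commute: "minkowski x y = minkowski y x"
  by (simp add: minkowski_def inner_commute)

lemma hyperboloidD:
  assumes "p \<in> hyperboloid"
  shows "minkowski p p = -1" "0 < snd p" "(snd p)\<^sup>2 = 1 + (norm (fst p))\<^sup>2"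
  using assms by (auto simp: hyperboloid_def minkowski_def dot_square_norm power2_eq_square)

lemma minkowski_pos:
  fixes p v :: "'a::euclidean_space \<times> real"
  assumes p: "p \<in> hyperboloid" and v: "minkowski p v = 0" "v \<noteq> 0"
  shows "0 < minkowski v v"
proof -
  let ?y = "norm (fst v)"
  have e: "fst p \<bullet> fst v = snd p * snd v" using v(1) by (simp add: minkowski_def)
  have y: "0 < ?y"
  proof (rule ccontr)
    assume "\<not> 0 < ?y"
    then have f: "fst v = 0" by simp
    then have "snd v = 0" using e hyperboloidD(2)[OF p] by simp
    then show False using f v(2) by (simp add: prod_eq_iff)
  qed
  have "(snd p * snd v)\<^sup>2 \<le> (norm (fst p) * ?y)\<^sup>2"
    unfolding e[symmetric] using Cauchy_Schwarz_ineq2[of "fst p" "fst v"] by (metis abs_le_square_iff abs_mult abs_norm_cancel)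
  also have "\<dots> = ((snd p)\<^sup>2 - 1) * ?y\<^sup>2" using hyperboloidD(3)[OF p] by (simp add: power_mult_distrib)
  finally have "?y\<^sup>2 \<le> (snd p)\<^sup>2 * (?y\<^sup>2 - (snd v)\<^sup>2)" by (simp add: power_mult_distrib algebra_simps)
  moreover have "0 < ?y\<^sup>2" using y by simp
  ultimately have "0 < (snd p)\<^sup>2 * (?y\<^sup>2 - (snd v)\<^sup>2)" by linarith
  then have "0 < ?y\<^sup>2 - (snd v)\<^sup>2" using zero_less_mult_pos hyperboloidD(2)[OF p] by (metis zero_less_power)
  then show ?thesis by (simp add: minkowski_def dot_square_norm power2_eq_square)
qed

lemma hyperboloidI:
  fixes p x :: "'a::euclidean_space \<times> real"
  assumes p: "p \<in> hyperboloid" and x: "minkowski x x = -1" "minkowski p x < 0"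
  shows "x \<in> hyperboloid"
proof -
  have x2: "(snd x)\<^sup>2 = 1 + (norm (fst x))\<^sup>2" using x(1) by (simp add: minkowski_def dot_square_norm power2_eq_square)
  have "norm (fst x) < \<bar>snd x\<bar>" by (rule power2_less_imp_less) (simp_all add: x2)
  moreover have "norm (fst p) < snd p" by (rule power2_less_imp_less) (use hyperboloidD[OF p] in auto)
  ultimately have "norm (fst p) * norm (fst x) < snd p * \<bar>snd x\<bar>" by (intro mult_strict_mono') auto
  then have "- (snd p * \<bar>snd x\<bar>) < fst p \<bullet> fst x" using Cauchy_Schwarz_ineq2[of "fst p" "fst x"] by linarith
  then have "snd p * - \<bar>snd x\<bar> < snd p * snd x" using x(2) by (simp add: minkowski_def)
  then have "- \<bar>snd x\<bar> < snd x" using hyperboloidD(2)[OF p] by (simp only: mult_less_cancel_left_pos)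
  then show ?thesis using x(1) by (simp add: hyperboloid_def)
qed

lemma minkowski_le:
  fixes p x :: "'a::euclidean_space \<times> real"
  assumes p: "p \<in> hyperboloid" and x: "x \<in> hyperboloid"
  shows "1 \<le> - minkowski p x"
proof -
  let ?s = "norm (fst p)" and ?t = "norm (fst x)"
  have "(1 + ?s * ?t)\<^sup>2 \<le> (1 + ?s\<^sup>2) * (1 + ?t\<^sup>2)"
    using zero_le_power2[of "?s - ?t"] by (simp add: power2_eq_square algebra_simps)
  also have "\<dots> = (snd p * snd x)\<^sup>2" using hyperboloidD(3)[OF p] hyperboloidD(3)[OF x] by (simp add: power_mult_distrib)
  finally have "1 + ?s * ?t \<le> snd p * snd x"
    by (rule power2_le_imp_le) (use hyperboloidD(2)[OF p] hyperboloidD(2)[OF x] in simp)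
  then show ?thesis using norm_cauchy_schwarz[of "fst p" "fst x"] by (simp add: minkowski_def)
qed

lemma tangent_space_hyperboloid:
  fixes p :: "'a::euclidean_space \<times> real"
  assumes p: "p \<in> hyperboloid"
  shows "tangent_space hyperboloid p = {v. minkowski p v = 0}"
proof (intro equalityI subsetI)
  fix v assume "v \<in> tangent_space hyperboloid p"
  then show "v \<in> {v. minkowski p v = 0}"
    using tangent_space_level_set[OF bilinear_minkowski[unfolded bilinear_conv_bounded_bilinear] minkowski_commute, of hyperboloid "-1" v p]
    by (simp add: hyperboloidD)
next
  note b = bilinear_minkowski
  note bl = bilinear_ladd[OF b] bilinear_lmul[OF b] bilinear_lsub[OF b]
  note br = bilinear_radd[OF b] bilinear_rmul[OF b] bilinear_rsub[OF b]
  fix v assume "v \<in> {v. minkowski p v = 0}"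
  then have v: "minkowski p v = 0" by simp
  show "v \<in> tangent_space hyperboloid p"
  proof (cases "v = 0")
    case False
    define s where "s = sqrt (minkowski v v)"
    define w where "w = (1 / s) *\<^sub>R v"
    define c where "c t = exp (s * t) *\<^sub>R ((1/2) *\<^sub>R (p + w)) + exp (- s * t) *\<^sub>R ((1/2) *\<^sub>R (p - w))" for t
    have s: "0 < s" "s * s = minkowski v v" using minkowski_pos[OF p v False] by (simp_all add: s_def)
    have w: "minkowski p w = 0" "minkowski w w = 1" "minkowski p p = -1" "minkowski w p = 0"
      using v s minkowski_commute[of v p] by (simp_all add: w_def br bl hyperboloidD(1)[OF p] flip: s(2))
    have cc: "c t = cosh (s * t) *\<^sub>R p + sinh (s * t) *\<^sub>R w" for t
      by (simp add: c_def cosh_def sinh_def algebra_simps flip: scaleR_add_left)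
    show ?thesis
    proof (rule tangent_spaceI[of c])
      show "Ck_on k UNIV c" for k unfolding c_def[abs_def] by (intro Ck_on_add Ck_exp open_UNIV)
      show "c t \<in> hyperboloid" for t
      proof (rule hyperboloidI[OF p])
        have "minkowski (c t) (c t) = (sinh (s * t))\<^sup>2 - (cosh (s * t))\<^sup>2"
          by (simp add: cc bl br w power2_eq_square)
        then show "minkowski (c t) (c t) = - 1" by (simp add: cosh_square_eq)
        show "minkowski p (c t) < 0" by (simp add: cc br w)
      qed
      show "c 0 = p" by (simp add: cc)
      have "(c has_vector_derivative s *\<^sub>R w) (at 0)"
        unfolding cc[abs_def] by (auto intro!: derivative_eq_intros)
      then show "(c has_vector_derivative v) (at 0)" using s by (simp add: w_def)
    qed
  qed (use zero_tangent[OF p] in simp)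
qed

lemma stable_flat:
  fixes \<pi> :: "'v::euclidean_space \<Rightarrow> 'p" and u :: "'v \<Rightarrow> 'm::{finite,wellorder} option \<Rightarrow> 'v"
  assumes fib: "riemannian_fibration inner UNIV \<pi> N" and u: "fibre_orientation inner UNIV \<pi> u"
    and E: "subspace E" "dim E = CARD('m) + 1" "fibre UNIV \<pi> y = E" and c: "c \<in> E" and r: "0 < r"
    and M: "M = {x\<in>E. dist c x = r}" and \<nu>: "adapted_normal TYPE('m) inner UNIV E M \<nu>"
  shows "omega_stable inner UNIV M (Omega inner UNIV \<pi> u) \<nu>"
proof -
  obtain J :: "(real^'m::_) \<times> real \<Rightarrow> 'v" where J: "space_form_sphere inner c r J 0 UNIV 0 1 E"
    "sphere_embedding.M c r J = M"
    using space_form_sphere_flat[OF E(1,2) c r] M by blast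
  interpret fibred_sphere inner c r J 0 UNIV 0 1 E \<pi> u y \<nu>
    by (rule fibred_sphere.intro[OF J(1)], unfold_locales) (use J(2) M E(3) u \<nu> in auto)
  show ?thesis using stable[OF skew_riemannian_fibration[OF fib]] by (simp add: J(2))
qed

lemma stable_hyperbolic:
  fixes \<pi> :: "'b::euclidean_space \<times> real \<Rightarrow> 'p" and u :: "'b \<times> real \<Rightarrow> 'm::{finite,wellorder} option \<Rightarrow> 'b \<times> real"
  assumes fib: "riemannian_fibration minkowski hyperboloid \<pi> N" and u: "fibre_orientation minkowski hyperboloid \<pi> u"
    and H: "subspace L" "dim L = CARD('m) + 2" "fibre hyperboloid \<pi> y = hyperboloid \<inter> L"
    and M: "geodesic_sphere_in_H (fibre hyperboloid \<pi> y) M"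
    and \<nu>: "adapted_normal TYPE('m) minkowski hyperboloid (fibre hyperboloid \<pi> y) M \<nu>"
  shows "omega_stable minkowski hyperboloid M (Omega minkowski hyperboloid \<pi> u) \<nu> \<and>
    parallel_mean_curv TYPE('m) minkowski hyperboloid M"
proof -
  obtain c r where c: "c \<in> hyperboloid" "c \<in> L" "0 < r" and M': "M = {x\<in>hyperboloid \<inter> L. arcosh (- minkowski c x) = r}"
    using M H(3) unfolding geodesic_sphere_in_H_def by auto
  have "arcosh (- minkowski c x) = r \<longleftrightarrow> (- 1) * minkowski c x = cosh r" if "x \<in> hyperboloid" for x
    using cosh_arcosh_real[OF minkowski_le[OF c(1) that]] arcosh_cosh_real[of r] c(3) by auto
  then have M'': "M = {x \<in> hyperboloid \<inter> L. (- 1) * minkowski c x = cosh r}" unfolding M' by blast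
  have mem: "x \<in> hyperboloid" if "minkowski x x = -1" "(- 1) * minkowski c x = cosh r" for x
    using hyperboloidI[OF c(1) that(1)] that(2) cosh_real_pos[of r] by linarith
  have sc: "0 < sinh r" "(cosh r)\<^sup>2 + (- 1) * (sinh r)\<^sup>2 = 1" using c(3) by (simp_all add: cosh_square_eq)
  have "\<exists>J :: (real^'m::_) \<times> real \<Rightarrow> 'b \<times> real.
      space_form_sphere minkowski (cosh r *\<^sub>R c) (sinh r) J (-1) hyperboloid (- (- 1 * sinh r) *\<^sub>R c) (cosh r) L \<and>
      sphere_embedding.M (cosh r *\<^sub>R c) (sinh r) J = M"
    unfolding M''
    by (rule space_form_sphere_curved[OF bilinear_minkowski minkowski_commute _ tangent_space_hyperboloid hyperboloidD(1) minkowski_pos H(1,2) c(1,2) sc mem])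
      simp_all
  then obtain J :: "(real^'m::_) \<times> real \<Rightarrow> 'b \<times> real" where
    J: "space_form_sphere minkowski (cosh r *\<^sub>R c) (sinh r) J (-1) hyperboloid (- (- 1 * sinh r) *\<^sub>R c) (cosh r) L"
    "sphere_embedding.M (cosh r *\<^sub>R c) (sinh r) J = M" by blast
  interpret fibred_sphere minkowski "cosh r *\<^sub>R c" "sinh r" J "-1" hyperboloid "- (- 1 * sinh r) *\<^sub>R c" "cosh r" L \<pi> u y \<nu>
    by (rule fibred_sphere.intro[OF J(1)], unfold_locales) (use J(2) M' H(3) u \<nu> in auto)
  have "cosh r \<noteq> 0" using cosh_real_pos[of r] by linarith
  then show ?thesis using stable[OF skew_riemannian_fibration[OF fib]] parallel_mean_curv_M by (simp add: J(2))
qed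

lemma unstable_sphere:
  fixes \<pi> :: "'v::euclidean_space \<Rightarrow> 'p" and u :: "'v \<Rightarrow> 'm::{finite,wellorder} option \<Rightarrow> 'v"
    and g :: "'v \<Rightarrow> 'w::euclidean_space"
  assumes u: "fibre_orientation inner (sphere 0 1) \<pi> u"
    and H: "subspace L" "dim L = CARD('m) + 2" "dim L < DIM('v)" "fibre (sphere 0 1) \<pi> y = sphere 0 1 \<inter> L"
    and M: "geodesic_sphere_in_S (fibre (sphere 0 1) \<pi> y) M"
    and \<nu>: "adapted_normal TYPE('m) inner (sphere 0 1) (fibre (sphere 0 1) \<pi> y) M \<nu>"
    and g: "\<And>k. Ck_on k UNIV g" "\<And>x. (g has_derivative D x) (at x)"
      "\<And>x x'. norm x = 1 \<Longrightarrow> norm x' = 1 \<Longrightarrow> \<pi> x = \<pi> x' \<Longrightarrow> g x = g x'"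
    and iso: "\<And>x X Y. norm x = 1 \<Longrightarrow> x \<in> L \<Longrightarrow> (\<And>l. l \<in> L \<Longrightarrow> X \<bullet> l = 0) \<Longrightarrow> (\<And>l. l \<in> L \<Longrightarrow> Y \<bullet> l = 0) \<Longrightarrow> D x X \<bullet> D x Y = k * (X \<bullet> Y)"
    and k: "k \<noteq> 0"
  shows "\<not> omega_stable inner (sphere 0 1) M (Omega inner (sphere 0 1) \<pi> u) \<nu> \<and>
    parallel_mean_curv TYPE('m) inner (sphere 0 1) M"
proof -
  obtain c r where c: "c \<in> sphere 0 1" "c \<in> L" "0 < r" "r < pi" and M': "M = {x\<in>sphere 0 1 \<inter> L. arccos (c \<bullet> x) = r}"
    using M H(4) unfolding geodesic_sphere_in_S_def by auto
  have "arccos (c \<bullet> x) = r \<longleftrightarrow> 1 * (c \<bullet> x) = cos r" if "x \<in> sphere 0 1" for x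
  proof -
    have "\<bar>c \<bullet> x\<bar> \<le> 1" using Cauchy_Schwarz_ineq2[of c x] c(1) that by simp
    then show ?thesis using cos_arccos_abs[of "c \<bullet> x"] arccos_cos[of r] c(3,4) by auto
  qed
  then have M'': "M = {x \<in> sphere 0 1 \<inter> L. 1 * (c \<bullet> x) = cos r}" unfolding M' by blast
  have "0 < sin r" "(cos r)\<^sup>2 + 1 * (sin r)\<^sup>2 = 1" using c(3,4) by (simp_all add: sin_gt_zero)
  then obtain J :: "(real^'m::_) \<times> real \<Rightarrow> 'v" where
    J: "space_form_sphere inner (cos r *\<^sub>R c) (sin r) J 1 (sphere 0 1) (- (1 * sin r) *\<^sub>R c) (cos r) L"
    "sphere_embedding.M (cos r *\<^sub>R c) (sin r) J = M"
    using space_form_sphere_curved[OF inner_bilinear inner_commute _ tangent_space_sphere _ _ H(1,2) c(1,2), of 1 "sin r" "cos r"] M''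
    by (auto simp: norm_eq_1)
  interpret fibred_sphere inner "cos r *\<^sub>R c" "sin r" J 1 "sphere 0 1" "- (1 * sin r) *\<^sub>R c" "cos r" L \<pi> u y \<nu>
    by (rule fibred_sphere.intro[OF J(1)], unfold_locales) (use J(2) M' H(4) u \<nu> in auto)
  have skew
  proof (rule skew_submersion[OF g(1) _ g(2), where G="\<lambda>v w. (1 / k) * (v \<bullet> w)"])
    show "g x = g x'" if "x \<in> sphere 0 1" "x' \<in> sphere 0 1" "\<pi> x = \<pi> x'" for x x' by (rule g(3)) (use that in auto)
    show "bilinear (\<lambda>v w::'w. (1 / k) * (v \<bullet> w))"
      unfolding bilinear_def by (intro conjI allI linearI) (simp_all add: inner_simps algebra_simps)
    show "(1 / k) * (v \<bullet> w) = (1 / k) * (w \<bullet> v)" for v w :: 'w by (simp add: inner_commute)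
    fix x X Y assume "x \<in> \<Phi>" "X \<in> F" "Y \<in> F"
    then have "D x X \<bullet> D x Y = k * (X \<bullet> Y)" by (intro iso) (auto simp: H(4) F_def)
    then show "(1 / k) * (D x X \<bullet> D x Y) = X \<bullet> Y" using k by simp
  qed
  obtain N0 where N0: "N0 \<noteq> 0" "\<And>l. l \<in> span L \<Longrightarrow> orthogonal N0 l"
    using orthogonal_to_subspace_exists[OF H(3)] by blast
  then have "N0 \<in> F" by (auto simp: F_def orthogonal_def intro: span_base)
  then show ?thesis using unstable[OF \<open>skew\<close> _ _ N0(1)] parallel_mean_curv_M by (simp add: J(2))
qed

section \<open>Hopf fibrations\<close>

lemma quadratic_map:
  fixes P :: "'a::euclidean_space \<Rightarrow> 'a \<Rightarrow> 'b::euclidean_space"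
  assumes "bilinear P"
  shows "Ck_on k UNIV (\<lambda>x. P x x)" "((\<lambda>x. P x x) has_derivative (\<lambda>h. P x h + P h x)) (at x)"
proof -
  have P: "bounded_bilinear P" using assms by (simp add: bilinear_conv_bounded_bilinear)
  show "Ck_on k UNIV (\<lambda>x. P x x)"
    by (rule Ck_on_bilinear[OF open_UNIV P]) (auto intro!: Ck_on_bounded_linear bounded_linear_ident)
  show "((\<lambda>x. P x x) has_derivative (\<lambda>h. P x h + P h x)) (at x)"
    by (rule bounded_bilinear.FDERIV[OF P has_derivative_ident has_derivative_ident])
qed

locale composition_algebra =
  fixes mult :: "'k::euclidean_space \<Rightarrow> 'k \<Rightarrow> 'k" (infixl "\<cdot>" 70) and cj :: "'k \<Rightarrow> 'k"
  assumes bilinear_mult: "bilinear (\<cdot>)" and linear_cj: "linear cj" and cj_cj: "cj (cj a) = a"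
    and cj_mult: "cj (a \<cdot> c) = cj c \<cdot> cj a"
    and adjoint_left: "(a \<cdot> c) \<bullet> d = c \<bullet> (cj a \<cdot> d)" and adjoint_right: "(a \<cdot> c) \<bullet> d = a \<bullet> (d \<cdot> cj c)"
    and norm_mult: "norm (a \<cdot> c) = norm a * norm c" and norm_cj: "norm (cj a) = norm a"
begin

lemmas ml = bilinear_ladd[OF bilinear_mult] bilinear_lmul[OF bilinear_mult] bilinear_lsub[OF bilinear_mult]
  bilinear_lneg[OF bilinear_mult] bilinear_lzero[OF bilinear_mult]
lemmas mr = bilinear_radd[OF bilinear_mult] bilinear_rmul[OF bilinear_mult] bilinear_rsub[OF bilinear_mult]
  bilinear_rneg[OF bilinear_mult] bilinear_rzero[OF bilinear_mult]
lemmas cjl = linear_add[OF linear_cj] linear_scale[OF linear_cj] linear_diff[OF linear_cj] linear_neg[OF linear_cj]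

lemma inner_mult_right: "(a \<cdot> c) \<bullet> (d \<cdot> c) = (a \<bullet> d) * (c \<bullet> c)"
proof -
  have n: "(a \<cdot> c) \<bullet> (a \<cdot> c) = (a \<bullet> a) * (c \<bullet> c)" for a by (simp add: dot_square_norm norm_mult power_mult_distrib)
  show ?thesis using n[of "a + d"] by (simp add: n ml inner_simps inner_commute algebra_simps)
qed

lemma inner_mult_left: "(c \<cdot> a) \<bullet> (c \<cdot> d) = (c \<bullet> c) * (a \<bullet> d)"
proof -
  have n: "(c \<cdot> a) \<bullet> (c \<cdot> a) = (c \<bullet> c) * (a \<bullet> a)" for a by (simp add: dot_square_norm norm_mult power_mult_distrib)
  show ?thesis using n[of "a + d"] by (simp add: n mr inner_simps inner_commute algebra_simps)
qed

lemma inner_mult_exchange: "(a \<cdot> c) \<bullet> (d \<cdot> f) = 2 * (a \<bullet> d) * (c \<bullet> f) - (a \<cdot> f) \<bullet> (d \<cdot> c)"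
  using inner_mult_right[of a "c + f" d] by (simp add: mr inner_simps inner_mult_right inner_commute algebra_simps)

lemma cj_inner: "cj a \<bullet> cj a = a \<bullet> a"
  by (simp add: dot_square_norm norm_cj)

lemma mult_cj_cancel: "a \<cdot> (cj a \<cdot> c) = (a \<bullet> a) *\<^sub>R c" "cj a \<cdot> (a \<cdot> c) = (a \<bullet> a) *\<^sub>R c"
  "(c \<cdot> a) \<cdot> cj a = (a \<bullet> a) *\<^sub>R c" "(c \<cdot> cj a) \<cdot> a = (a \<bullet> a) *\<^sub>R c"
proof -
  have 1: "cj a \<cdot> (a \<cdot> c) = (a \<bullet> a) *\<^sub>R c" "(c \<cdot> a) \<cdot> cj a = (a \<bullet> a) *\<^sub>R c" for a c
    by (rule vector_eq_rdot[THEN iffD1], rule allI,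
      simp add: adjoint_left[of "cj a"] adjoint_right[of _ "cj a"] cj_cj inner_mult_left inner_mult_right mult.commute)+
  show "cj a \<cdot> (a \<cdot> c) = (a \<bullet> a) *\<^sub>R c" "(c \<cdot> a) \<cdot> cj a = (a \<bullet> a) *\<^sub>R c" by (rule 1)+
  show "a \<cdot> (cj a \<cdot> c) = (a \<bullet> a) *\<^sub>R c" "(c \<cdot> cj a) \<cdot> a = (a \<bullet> a) *\<^sub>R c"
    using 1(1)[of "cj a" c] 1(2)[of c "cj a"] by (simp_all add: cj_cj cj_inner)
qed

definition hopf where "hopf x = (fst x \<cdot> cj (snd x), ((norm (fst x))\<^sup>2 - (norm (snd x))\<^sup>2) / 2)"
definition P where "P x y = (fst x \<cdot> cj (snd y), (fst x \<bullet> fst y - snd x \<bullet> snd y) / 2)"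

lemma hopf_P: "hopf x = P x x"
  by (simp add: hopf_def P_def dot_square_norm)

lemma bilinear_P: "bilinear P"
  unfolding bilinear_def P_def
  by (intro conjI allI linearI) (simp_all add: ml mr cjl inner_simps field_simps)

lemma hopf_isometric:
  assumes st: "s \<bullet> s + t\<^sup>2 = 1" and x: "norm x = 1" "x = (s \<cdot> z, t *\<^sub>R z)"
    and X: "\<And>w. X \<bullet> (s \<cdot> w, t *\<^sub>R w) = 0"
  shows "(P x X + P X x) \<bullet> (P x X + P X x) = X \<bullet> X"
proof -
  have "X \<bullet> (s \<cdot> w, t *\<^sub>R w) = w \<bullet> (cj s \<cdot> fst X + t *\<^sub>R snd X)" for w
    using adjoint_left[of s w "fst X"] by (simp add: inner_prod_def inner_simps inner_commute)
  then have "cj s \<cdot> fst X + t *\<^sub>R snd X = 0" using X by (metis inner_eq_zero_iff)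
  then have sX: "cj s \<cdot> fst X = - (t *\<^sub>R snd X)" by (simp add: add_eq_0_iff2)
  define p where "p = t *\<^sub>R fst X - s \<cdot> snd X"
  have "t *\<^sub>R p = (t\<^sup>2 + s \<bullet> s) *\<^sub>R fst X"
  proof -
    have "t *\<^sub>R (s \<cdot> snd X) = - (s \<cdot> (cj s \<cdot> fst X))" by (simp add: sX mr)
    then show ?thesis by (simp add: p_def mult_cj_cancel power2_eq_square algebra_simps)
  qed
  then have X1: "fst X = t *\<^sub>R p" using st by (simp add: add.commute)
  have "cj s \<cdot> p = - ((t\<^sup>2 + s \<bullet> s) *\<^sub>R snd X)"
    by (simp add: p_def mr sX mult_cj_cancel power2_eq_square algebra_simps)
  then have X2: "snd X = - (cj s \<cdot> p)" using st by (simp add: add.commute)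
  have xx: "z \<bullet> z = 1"
  proof -
    have "x \<bullet> x = (s \<bullet> s + t\<^sup>2) * (z \<bullet> z)"
      by (simp add: x(2) inner_prod_def inner_mult_left power2_eq_square algebra_simps)
    then show ?thesis using st x(1) by (simp add: norm_eq_1)
  qed
  have XX: "X \<bullet> X = p \<bullet> p"
  proof -
    have "X \<bullet> X = (t\<^sup>2 + cj s \<bullet> cj s) * (p \<bullet> p)"
      by (simp add: inner_prod_def X1 X2 inner_mult_left power2_eq_square algebra_simps)
    then show ?thesis using st by (simp add: dot_square_norm norm_cj add.commute)
  qed
  define w where "w = (s \<cdot> z) \<bullet> p"
  have cross: "(p \<cdot> cj z) \<bullet> ((s \<cdot> z) \<cdot> (cj p \<cdot> s)) = 2 * w\<^sup>2 - (s \<bullet> s) * (p \<bullet> p)"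
  proof -
    have "cj z \<bullet> (cj p \<cdot> s) = (p \<cdot> cj z) \<bullet> s" by (simp add: adjoint_left)
    also have "\<dots> = w" using adjoint_right[of p "cj z" s] by (simp add: cj_cj w_def inner_commute)
    finally have "cj z \<bullet> (cj p \<cdot> s) = w" .
    then show ?thesis
      using inner_mult_exchange[of p "cj z" "s \<cdot> z" "cj p \<cdot> s"] xx
      by (simp add: mult_cj_cancel w_def inner_commute power2_eq_square mult.commute)
  qed
  have DX: "P x X + P X x = (t\<^sup>2 *\<^sub>R (p \<cdot> cj z) - (s \<cdot> z) \<cdot> (cj p \<cdot> s), 2 * t * w)"
  proof -
    have "(t *\<^sub>R z) \<bullet> snd X = - (t * w)"
      using adjoint_left[of s z p] by (simp add: X2 w_def inner_simps)
    then show ?thesis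
      by (simp add: P_def X1 X2 x(2) ml mr cjl cj_mult cj_cj w_def inner_simps inner_commute power2_eq_square field_simps)
  qed
  have n1: "(p \<cdot> cj z) \<bullet> (p \<cdot> cj z) = p \<bullet> p"
    using xx cj_inner[of z] by (simp add: inner_mult_left)
  have n2: "((s \<cdot> z) \<cdot> (cj p \<cdot> s)) \<bullet> ((s \<cdot> z) \<cdot> (cj p \<cdot> s)) = (s \<bullet> s)\<^sup>2 * (p \<bullet> p)"
    using xx cj_inner[of p] by (simp add: inner_mult_left inner_mult_right power2_eq_square)
  have "(P x X + P X x) \<bullet> (P x X + P X x) = (t\<^sup>2)\<^sup>2 * (p \<bullet> p) - 2 * t\<^sup>2 * (2 * w\<^sup>2 - (s \<bullet> s) * (p \<bullet> p))
      + (s \<bullet> s)\<^sup>2 * (p \<bullet> p) + (2 * t * w)\<^sup>2"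
    unfolding DX inner_Pair inner_diff_left inner_diff_right inner_scaleR_left inner_scaleR_right
      inner_commute[of "(s \<cdot> z) \<cdot> (cj p \<cdot> s)" "p \<cdot> cj z"] cross n1 n2
    by (simp add: power2_eq_square algebra_simps)
  also have "\<dots> = (s \<bullet> s + t\<^sup>2)\<^sup>2 * (p \<bullet> p)" by (simp add: power2_eq_square algebra_simps)
  finally show ?thesis using st XX by simp
qed

text \<open>
  The usual parametrization \<open>z \<mapsto> (q \<cdot> z, z)\<close> of the fibre, with slope \<open>q = s / t\<close>, is normalized so that it covers \<open>t = 0\<close>.
\<close>

lemma hopf_fibre:
  assumes c: "norm c = 1"
  shows "\<exists>s t. s \<bullet> s + t\<^sup>2 = 1 \<and> fibre (sphere 0 1) hopf (hopf c) = sphere 0 1 \<inter> range (\<lambda>z. (s \<cdot> z, t *\<^sub>R z))"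
proof -
  define t where "t = norm (snd c)"
  define s where "s = (if snd c = 0 then fst c else (1 / t) *\<^sub>R (fst c \<cdot> cj (snd c)))"
  have c1: "(norm (fst c))\<^sup>2 + t\<^sup>2 = 1" using norm_sq_prod[of c] c by (simp add: t_def)
  have "norm s = norm (fst c)" by (simp add: s_def t_def norm_mult norm_cj)
  then have st: "s \<bullet> s + t\<^sup>2 = 1" using c1 by (simp add: dot_square_norm)
  have ts: "fst c \<cdot> cj (snd c) = t *\<^sub>R s" by (auto simp: s_def t_def mr linear_0[OF linear_cj])
  have hx: "hopf x = hopf c \<longleftrightarrow> fst x \<cdot> cj (snd x) = t *\<^sub>R s \<and> (norm (snd x))\<^sup>2 = t\<^sup>2" if "norm x = 1" for x
  proof -
    have "(norm (fst x))\<^sup>2 = 1 - (norm (snd x))\<^sup>2" "(norm (fst c))\<^sup>2 = 1 - t\<^sup>2" using norm_sq_prod[of x] that c1 by auto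
    then show ?thesis unfolding hopf_def ts prod.inject t_def[symmetric] by auto
  qed
  have "x \<in> range (\<lambda>z. (s \<cdot> z, t *\<^sub>R z)) \<longleftrightarrow> hopf x = hopf c" if x: "norm x = 1" for x
  proof
    assume "x \<in> range (\<lambda>z. (s \<cdot> z, t *\<^sub>R z))"
    then obtain z where z: "x = (s \<cdot> z, t *\<^sub>R z)" by blast
    have "x \<bullet> x = (s \<bullet> s + t\<^sup>2) * (z \<bullet> z)"
      by (simp add: z inner_prod_def inner_mult_left power2_eq_square algebra_simps)
    then have "z \<bullet> z = 1" using st x by (simp add: norm_eq_1)
    then show "hopf x = hopf c" unfolding hx[OF x]
      by (simp add: z cjl mr mult_cj_cancel norm_eq_1[symmetric] power_mult_distrib)
  next
    assume "hopf x = hopf c"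
    then have h: "fst x \<cdot> cj (snd x) = t *\<^sub>R s" "snd x \<bullet> snd x = t\<^sup>2"
      using hx[OF x] by (simp_all add: dot_square_norm)
    have h1: "fst x \<bullet> fst x + t\<^sup>2 = 1" using h(2) x by (simp add: norm_eq_1 inner_prod_def)
    define z where "z = cj s \<cdot> fst x + t *\<^sub>R snd x"
    have "s \<cdot> z = (s \<bullet> s) *\<^sub>R fst x + (t *\<^sub>R s) \<cdot> snd x" by (simp add: z_def mr ml mult_cj_cancel)
    also have "\<dots> = (s \<bullet> s + t\<^sup>2) *\<^sub>R fst x" by (simp add: h[symmetric] mult_cj_cancel scaleR_add_left)
    finally have z1: "s \<cdot> z = fst x" using st by simp
    have "t *\<^sub>R z = cj (t *\<^sub>R s) \<cdot> fst x + t\<^sup>2 *\<^sub>R snd x"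
      by (simp add: z_def cjl ml scaleR_add_right power2_eq_square)
    also have "\<dots> = (fst x \<bullet> fst x + t\<^sup>2) *\<^sub>R snd x"
      by (simp add: h(1)[symmetric] cj_mult cj_cj mult_cj_cancel scaleR_add_left)
    finally have "t *\<^sub>R z = snd x" using h1 by simp
    then show "x \<in> range (\<lambda>z. (s \<cdot> z, t *\<^sub>R z))" using z1 by (intro range_eqI[of _ _ z]) (simp add: prod_eq_iff)
  qed
  then have "fibre (sphere 0 1) hopf (hopf c) = sphere 0 1 \<inter> range (\<lambda>z. (s \<cdot> z, t *\<^sub>R z))"
    unfolding fibre_def set_eq_iff mem_Collect_eq Int_iff mem_sphere_0 by blast
  with st show ?thesis by blast
qed

lemma hopf_unstable:
  fixes u :: "'k \<times> 'k \<Rightarrow> 'm::{finite,wellorder} option \<Rightarrow> 'k \<times> 'k"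
  assumes dim: "DIM('k) = CARD('m) + 2" and u: "fibre_orientation inner (sphere 0 1) hopf u"
    and M: "geodesic_sphere_in_S (fibre (sphere 0 1) hopf y) M"
    and \<nu>: "adapted_normal TYPE('m) inner (sphere 0 1) (fibre (sphere 0 1) hopf y) M \<nu>"
  shows "\<not> omega_stable inner (sphere 0 1) M (Omega inner (sphere 0 1) hopf u) \<nu> \<and>
    parallel_mean_curv TYPE('m) inner (sphere 0 1) M"
proof -
  obtain c where c: "norm c = 1" "hopf c = y" using M by (auto simp: geodesic_sphere_in_S_def fibre_def)
  obtain s t where st: "s \<bullet> s + t\<^sup>2 = 1" "fibre (sphere 0 1) hopf y = sphere 0 1 \<inter> range (\<lambda>z. (s \<cdot> z, t *\<^sub>R z))"
    using hopf_fibre[OF c(1)] c(2) by blast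
  let ?f = "\<lambda>z. (s \<cdot> z, t *\<^sub>R z)"
  have lin: "linear ?f" by (rule linearI) (simp_all add: mr scaleR_add_right)
  have "inj ?f"
    unfolding linear_injective_0[OF lin]
  proof (intro allI impI)
    fix z assume "?f z = 0"
    then have "?f z \<bullet> ?f z = 0" by simp
    moreover have "?f z \<bullet> ?f z = (s \<bullet> s + t\<^sup>2) * (z \<bullet> z)"
      by (simp add: inner_mult_left power2_eq_square algebra_simps)
    ultimately show "z = 0" using st(1) by simp
  qed
  then have dimL: "dim (range ?f) = DIM('k)" using dim_image_eq[OF lin, of UNIV] by simp
  show ?thesis
  proof (rule unstable_sphere[OF u _ _ _ st(2) M \<nu>, where g=hopf and D="\<lambda>x h. P x h + P h x" and k=1])
    show "subspace (range ?f)" by (rule linear_subspace_image[OF lin subspace_UNIV])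
    show "dim (range ?f) = CARD('m) + 2" by (simp add: dimL dim)
    show "dim (range ?f) < DIM('k \<times> 'k)" by (simp add: dimL)
    show "Ck_on k UNIV hopf" "(hopf has_derivative (\<lambda>h. P x h + P h x)) (at x)" for k x
      unfolding hopf_P[abs_def] by (rule quadratic_map[OF bilinear_P])+
    fix x X Y assume x: "norm x = 1" "x \<in> range ?f"
      and X: "\<And>l. l \<in> range ?f \<Longrightarrow> X \<bullet> l = 0" and Y: "\<And>l. l \<in> range ?f \<Longrightarrow> Y \<bullet> l = 0"
    obtain z where z: "x = ?f z" using x(2) by blast
    let ?D = "\<lambda>X. P x X + P X x"
    have n: "?D X \<bullet> ?D X = X \<bullet> X" if "\<And>l. l \<in> range ?f \<Longrightarrow> X \<bullet> l = 0" for X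
      by (rule hopf_isometric[OF st(1) x(1) z]) (rule that[OF rangeI])
    have "?D (X + Y) = ?D X + ?D Y"
      by (simp add: bilinear_ladd[OF bilinear_P] bilinear_radd[OF bilinear_P])
    moreover have "?D (X + Y) \<bullet> ?D (X + Y) = (X + Y) \<bullet> (X + Y)"
      by (rule n) (simp only: inner_add_left X Y add_0)
    ultimately have "(?D X + ?D Y) \<bullet> (?D X + ?D Y) = (X + Y) \<bullet> (X + Y)" by simp
    then show "?D X \<bullet> ?D Y = 1 * (X \<bullet> Y)"
      using n[OF X] n[OF Y] by (simp add: inner_add_left inner_add_right inner_commute)
  qed auto
qed

end

lemmas quat_simps = quat_mult_def quat_cnj_def inner_prod_def inner_complex_def complex_eq_iff prod_eq_iff

lemma quat_cnj_cnj: "quat_cnj (quat_cnj a) = a"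
  by (simp add: quat_cnj_def)

lemma norm_quat_cnj: "norm (quat_cnj a) = norm a"
  by (simp add: quat_cnj_def norm_prod_def)

lemma linear_quat_cnj: "linear quat_cnj"
  by (rule linearI) (simp_all add: quat_simps)

lemma bilinear_quat_mult: "bilinear quat_mult"
  unfolding bilinear_def by (intro conjI allI linearI) (simp_all add: quat_simps algebra_simps)

lemma norm_quat_mult: "norm (quat_mult a c) = norm a * norm c"
proof -
  have "(norm (quat_mult a c))\<^sup>2 = (norm a * norm c)\<^sup>2"
    using norm_quat_mult_cnj[of a "quat_cnj c"] by (simp add: quat_cnj_cnj norm_quat_cnj power_mult_distrib)
  then show ?thesis by (rule power2_eq_imp_eq) simp_all
qed

interpretation quat: composition_algebra quat_mult quat_cnj
  rewrites "composition_algebra.hopf quat_mult quat_cnj = hopf_quat"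
proof -
  show "composition_algebra quat_mult quat_cnj"
  proof (rule composition_algebra.intro)
    fix a c d :: quat
    show "quat_cnj (quat_mult a c) = quat_mult (quat_cnj c) (quat_cnj a)"
      "quat_mult a c \<bullet> d = c \<bullet> quat_mult (quat_cnj a) d" "quat_mult a c \<bullet> d = a \<bullet> quat_mult d (quat_cnj c)"
      by (simp_all add: quat_simps algebra_simps)
  qed (rule bilinear_quat_mult linear_quat_cnj quat_cnj_cnj norm_quat_mult norm_quat_cnj)+
  then show "composition_algebra.hopf quat_mult quat_cnj = hopf_quat"
    by (simp add: composition_algebra.hopf_def hopf_quat_def fun_eq_iff)
qed

interpretation octo: composition_algebra octo_mult octo_cnj
  rewrites "composition_algebra.hopf octo_mult octo_cnj = hopf_octo"
proof -
  show "composition_algebra octo_mult octo_cnj"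
  proof (rule composition_algebra.intro)
    fix a c d :: octo
    note octo_simps = octo_mult_def octo_cnj_def quat.ml quat.mr quat.cjl
    show cc: "octo_cnj (octo_cnj a) = a" by (simp add: octo_cnj_def quat_cnj_cnj)
    show nc: "norm (octo_cnj a) = norm a" for a by (simp add: octo_cnj_def quat_cnj_def norm_prod_def)
    show "bilinear octo_mult"
      unfolding bilinear_def by (intro conjI allI linearI) (simp_all add: octo_simps algebra_simps)
    show "linear octo_cnj"
      by (rule linearI) (simp_all add: octo_simps)
    have "(norm (octo_mult a c))\<^sup>2 = (norm a * norm c)\<^sup>2"
      using norm_octo_mult_cnj[of a "octo_cnj c"] nc by (simp add: octo_cnj_def quat_cnj_cnj power_mult_distrib)
    then show "norm (octo_mult a c) = norm a * norm c" by (rule power2_eq_imp_eq) simp_all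
    show "octo_cnj (octo_mult a c) = octo_mult (octo_cnj c) (octo_cnj a)"
      by (simp add: octo_simps quat.cj_mult quat_cnj_cnj)
    show "octo_mult a c \<bullet> d = c \<bullet> octo_mult (octo_cnj a) d" "octo_mult a c \<bullet> d = a \<bullet> octo_mult d (octo_cnj c)"
      by (simp_all add: octo_mult_def octo_cnj_def quat_simps algebra_simps)
  qed
  then show "composition_algebra.hopf octo_mult octo_cnj = hopf_octo"
    by (simp add: composition_algebra.hopf_def hopf_octo_def fun_eq_iff)
qed

lemma quat_mult_assoc: "quat_mult (quat_mult a c) d = quat_mult a (quat_mult c d)"
  by (simp add: quat_simps algebra_simps)

definition HP_form :: "quat^'q \<Rightarrow> quat^'q \<Rightarrow> quat^'q^'q" where
  "HP_form x y = (\<chi> i j. quat_mult (x $ i) (quat_cnj (y $ j)))"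

lemma bilinear_HP_form: "bilinear (HP_form :: quat^'q::finite \<Rightarrow> _)"
  unfolding bilinear_def HP_form_def
  by (intro conjI allI linearI) (simp_all add: vec_eq_iff quat.ml quat.mr quat.cjl)

lemma HP_form_scale: "norm h = 1 \<Longrightarrow> HP_form (\<chi> i. quat_mult (x $ i) h) (\<chi> i. quat_mult (x $ i) h) = HP_form x x"
  by (simp add: HP_form_def vec_eq_iff quat.cj_mult quat_mult_assoc[symmetric] quat.mult_cj_cancel norm_eq_1)

lemma hopf_HP_fibre:
  assumes c: "norm (c :: quat^'q::finite) = 1"
  shows "fibre (sphere 0 1) hopf_HP (hopf_HP c) = sphere 0 1 \<inter> range (\<lambda>h. \<chi> i. quat_mult (c $ i) h)"
    and "norm x = 1 \<Longrightarrow> hopf_HP x = hopf_HP c \<Longrightarrow> \<exists>h. norm h = 1 \<and> x = (\<chi> i. quat_mult (c $ i) h)"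
proof -
  have one: "x \<in> hopf_HP x" for x :: "quat^'q"
    unfolding hopf_HP_def by (rule range_eqI[of _ _ "(1, 0)"]) (simp add: vec_eq_iff quat_mult_def)
  have nh: "norm h = 1" if "norm (\<chi> i. quat_mult (c $ i) h) = 1" for h
  proof -
    have "(\<chi> i. quat_mult (c $ i) h) \<bullet> (\<chi> i. quat_mult (c $ i) h) = (c \<bullet> c) * (h \<bullet> h)"
      by (simp add: inner_vec_def quat.inner_mult_right sum_distrib_right)
    then show ?thesis using that c by (simp add: norm_eq_1)
  qed
  have eq: "hopf_HP (\<chi> i. quat_mult (c $ i) h) = hopf_HP c" if "norm h = 1" for h
  proof (intro equalityI subsetI)
    fix z assume "z \<in> hopf_HP (\<chi> i. quat_mult (c $ i) h)"
    then show "z \<in> hopf_HP c" unfolding hopf_HP_def by (auto simp: quat_mult_assoc)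
  next
    fix z assume "z \<in> hopf_HP c"
    then obtain k where "z = (\<chi> i. quat_mult (c $ i) k)" by (auto simp: hopf_HP_def)
    then have "z = (\<chi> i. quat_mult (quat_mult (c $ i) h) (quat_mult (quat_cnj h) k))"
      using that by (simp add: vec_eq_iff quat_mult_assoc quat.mult_cj_cancel norm_eq_1)
    then show "z \<in> hopf_HP (\<chi> i. quat_mult (c $ i) h)" by (simp add: hopf_HP_def)
  qed
  show "fibre (sphere 0 1) hopf_HP (hopf_HP c) = sphere 0 1 \<inter> range (\<lambda>h. \<chi> i. quat_mult (c $ i) h)"
  proof (intro equalityI subsetI)
    fix x assume "x \<in> fibre (sphere 0 1) hopf_HP (hopf_HP c)"
    then show "x \<in> sphere 0 1 \<inter> range (\<lambda>h. \<chi> i. quat_mult (c $ i) h)"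
      using one[of x] by (auto simp: fibre_def hopf_HP_def)
  next
    fix x assume "x \<in> sphere 0 1 \<inter> range (\<lambda>h. \<chi> i. quat_mult (c $ i) h)"
    then obtain h where "norm x = 1" "x = (\<chi> i. quat_mult (c $ i) h)" by auto
    then show "x \<in> fibre (sphere 0 1) hopf_HP (hopf_HP c)" using eq[OF nh] by (simp add: fibre_def)
  qed
  show "\<exists>h. norm h = 1 \<and> x = (\<chi> i. quat_mult (c $ i) h)" if x: "norm x = 1" "hopf_HP x = hopf_HP c"
  proof -
    obtain h where "x = (\<chi> i. quat_mult (c $ i) h)" using one[of x] x(2) by (auto simp: hopf_HP_def)
    then show ?thesis using nh x(1) by blast
  qed
qed

lemma HP_unstable:
  fixes u :: "quat^'q::finite \<Rightarrow> 2 option \<Rightarrow> quat^'q"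
  assumes q: "2 \<le> CARD('q)" and u: "fibre_orientation inner (sphere 0 1) hopf_HP u"
    and M: "geodesic_sphere_in_S (fibre (sphere 0 1) hopf_HP y) M"
    and \<nu>: "adapted_normal TYPE(2) inner (sphere 0 1) (fibre (sphere 0 1) hopf_HP y) M \<nu>"
  shows "\<not> omega_stable inner (sphere 0 1) M (Omega inner (sphere 0 1) hopf_HP u) \<nu> \<and>
    parallel_mean_curv TYPE(2) inner (sphere 0 1) M"
proof -
  obtain c where c: "norm c = 1" "hopf_HP c = y" using M by (auto simp: geodesic_sphere_in_S_def fibre_def)
  let ?f = "\<lambda>h. \<chi> i. quat_mult (c $ i) h"
  have lin: "linear ?f" by (rule linearI) (simp_all add: vec_eq_iff quat.mr)
  have "inj ?f"
    unfolding linear_injective_0[OF lin]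
  proof (intro allI impI)
    fix h assume "?f h = 0"
    then have "?f h \<bullet> ?f h = 0" by simp
    moreover have "?f h \<bullet> ?f h = (c \<bullet> c) * (h \<bullet> h)"
      by (simp add: inner_vec_def quat.inner_mult_right sum_distrib_right)
    ultimately show "h = 0" using c by (auto simp: norm_eq_1)
  qed
  then have dimL: "dim (range ?f) = 4" using dim_image_eq[OF lin, of UNIV] by simp
  show ?thesis
  proof (rule unstable_sphere[OF u _ _ _ _ M \<nu>, where g="\<lambda>x. HP_form x x" and D="\<lambda>x h. HP_form x h + HP_form h x" and k=2])
    show "subspace (range ?f)" by (rule linear_subspace_image[OF lin subspace_UNIV])
    show "dim (range ?f) = CARD(2) + 2" by (simp add: dimL)
    show "dim (range ?f) < DIM(quat^'q)" using q by (simp add: dimL)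
    show "fibre (sphere 0 1) hopf_HP y = sphere 0 1 \<inter> range ?f" using hopf_HP_fibre(1)[OF c(1)] c(2) by simp
    show "Ck_on k UNIV (\<lambda>x. HP_form x x)" "((\<lambda>x. HP_form x x) has_derivative (\<lambda>h. HP_form x h + HP_form h x)) (at x)" for k and x :: "quat^'q"
      by (rule quadratic_map[OF bilinear_HP_form])+
    show "HP_form x x = HP_form x' x'" if "norm x = 1" "norm x' = 1" "hopf_HP x = hopf_HP x'" for x x' :: "quat^'q"
      using hopf_HP_fibre(2)[OF that(2,1,3)] HP_form_scale by blast
    fix x X Y :: "quat^'q" assume x: "norm x = 1" "x \<in> range ?f"
      and X: "\<And>l. l \<in> range ?f \<Longrightarrow> X \<bullet> l = 0" and Y: "\<And>l. l \<in> range ?f \<Longrightarrow> Y \<bullet> l = 0"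
    have z: "(\<Sum>j\<in>UNIV. quat_mult (quat_cnj (x $ j)) (X $ j)) = 0" if X: "\<And>l. l \<in> range ?f \<Longrightarrow> X \<bullet> l = 0" for X
    proof -
      obtain k where k: "x = ?f k" using x(2) by blast
      have "h \<bullet> (\<Sum>j\<in>UNIV. quat_mult (quat_cnj (x $ j)) (X $ j)) = X \<bullet> ?f (quat_mult k h)" for h
        unfolding k by (simp add: inner_sum_right inner_vec_def quat.adjoint_left[symmetric] quat_mult_assoc inner_commute)
      then have "h \<bullet> (\<Sum>j\<in>UNIV. quat_mult (quat_cnj (x $ j)) (X $ j)) = 0" for h using X by simp
      then show ?thesis by (metis inner_eq_zero_iff)
    qed
    have same: "HP_form a x \<bullet> HP_form d x = a \<bullet> d" "HP_form x a \<bullet> HP_form x d = a \<bullet> d" for a d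
    proof -
      have cj: "quat_cnj v \<bullet> quat_cnj w = v \<bullet> w" for v w by (simp add: quat_simps)
      have "HP_form a x \<bullet> HP_form d x = (a \<bullet> d) * (x \<bullet> x)"
        by (simp add: HP_form_def inner_vec_def quat.inner_mult_right cj sum_product)
      then show "HP_form a x \<bullet> HP_form d x = a \<bullet> d" using x(1) by (simp add: norm_eq_1)
      have "HP_form x a \<bullet> HP_form x d = (x \<bullet> x) * (a \<bullet> d)"
        by (simp add: HP_form_def inner_vec_def quat.inner_mult_left cj sum_product)
      then show "HP_form x a \<bullet> HP_form x d = a \<bullet> d" using x(1) by (simp add: norm_eq_1)
    qed
    have cross: "HP_form a x \<bullet> HP_form x d = 0" if "\<And>l. l \<in> range ?f \<Longrightarrow> d \<bullet> l = 0" for a d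
    proof -
      have "quat_mult (a $ i) (quat_cnj (x $ j)) \<bullet> quat_mult (x $ i) (quat_cnj (d $ j))
          = quat_mult (quat_cnj (x $ i)) (a $ i) \<bullet> quat_cnj (quat_mult (quat_cnj (x $ j)) (d $ j))" for i j
        by (simp add: quat.cj_mult quat_cnj_cnj quat.adjoint_left[of "quat_cnj (x $ i)"] quat.adjoint_right[of "a $ i"] quat_mult_assoc)
      then have "HP_form a x \<bullet> HP_form x d = (\<Sum>i\<in>UNIV. \<Sum>j\<in>UNIV. quat_mult (quat_cnj (x $ i)) (a $ i) \<bullet> quat_cnj (quat_mult (quat_cnj (x $ j)) (d $ j)))"
        by (simp add: HP_form_def inner_vec_def)
      also have "\<dots> = (\<Sum>i\<in>UNIV. quat_mult (quat_cnj (x $ i)) (a $ i) \<bullet> quat_cnj (\<Sum>j\<in>UNIV. quat_mult (quat_cnj (x $ j)) (d $ j)))"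
        by (simp only: inner_sum_right linear_sum[OF linear_quat_cnj])
      also have "(\<Sum>j\<in>UNIV. quat_mult (quat_cnj (x $ j)) (d $ j)) = 0" by (rule z) (rule that)
      also have "(\<Sum>i\<in>UNIV. quat_mult (quat_cnj (x $ i)) (a $ i) \<bullet> quat_cnj 0) = 0" by (simp add: linear_0[OF linear_quat_cnj])
      finally show ?thesis .
    qed
    show "(HP_form x X + HP_form X x) \<bullet> (HP_form x Y + HP_form Y x) = 2 * (X \<bullet> Y)"
      using cross[OF X, of Y] cross[OF Y, of X]
      by (simp only: inner_add_left inner_add_right same inner_commute[of "HP_form x X" "HP_form Y x"])
  qed auto
qed

theorem proposition4p6:
  shows
    \<comment> \<open>(1)\<close>
    "(\<forall>(\<pi> :: 'a::euclidean_space \<Rightarrow> 'p) (N :: ('p, 'e::euclidean_space) riem_manifold)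
        (u :: 'a \<Rightarrow> 'm::{finite,wellorder} option \<Rightarrow> 'a) (E :: 'a set) y c r M \<nu>.
        riemannian_fibration inner UNIV \<pi> N \<and>
        (\<forall>z\<in>topspace (mtop N). totally_geodesic inner UNIV (fibre UNIV \<pi> z)) \<and>
        fibre_orientation inner UNIV \<pi> u \<and>
        subspace E \<and> dim E = CARD('m) + 1 \<and> fibre UNIV \<pi> y = E \<and>
        c \<in> E \<and> r > 0 \<and> M = {x\<in>E. dist c x = r} \<and>
        adapted_normal TYPE('m) inner UNIV E M \<nu> \<longrightarrow>
          omega_stable inner UNIV M (Omega inner UNIV \<pi> u) \<nu>)
   \<and>
    (\<forall>(u :: quat \<times> quat \<Rightarrow> 2 option \<Rightarrow> quat \<times> quat) y M \<nu>.
        fibre_orientation inner (sphere 0 1) hopf_quat u \<and>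
        geodesic_sphere_in_S (fibre (sphere 0 1) hopf_quat y) M \<and>
        adapted_normal TYPE(2) inner (sphere 0 1) (fibre (sphere 0 1) hopf_quat y) M \<nu> \<longrightarrow>
          \<not> omega_stable inner (sphere 0 1) M (Omega inner (sphere 0 1) hopf_quat u) \<nu> \<and>
          parallel_mean_curv TYPE(2) inner (sphere 0 1) M)
   \<and>
    (CARD('q::finite) \<ge> 3 \<longrightarrow>
      (\<forall>(u :: quat^'q \<Rightarrow> 2 option \<Rightarrow> quat^'q) y M \<nu>.
        fibre_orientation inner (sphere 0 1) hopf_HP u \<and>
        geodesic_sphere_in_S (fibre (sphere 0 1) hopf_HP y) M \<and>
        adapted_normal TYPE(2) inner (sphere 0 1) (fibre (sphere 0 1) hopf_HP y) M \<nu> \<longrightarrow>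
          \<not> omega_stable inner (sphere 0 1) M (Omega inner (sphere 0 1) hopf_HP u) \<nu> \<and>
          parallel_mean_curv TYPE(2) inner (sphere 0 1) M))
   \<and>
    (\<forall>(u :: octo \<times> octo \<Rightarrow> 6 option \<Rightarrow> octo \<times> octo) y M \<nu>.
        fibre_orientation inner (sphere 0 1) hopf_octo u \<and>
        geodesic_sphere_in_S (fibre (sphere 0 1) hopf_octo y) M \<and>
        adapted_normal TYPE(6) inner (sphere 0 1) (fibre (sphere 0 1) hopf_octo y) M \<nu> \<longrightarrow>
          \<not> omega_stable inner (sphere 0 1) M (Omega inner (sphere 0 1) hopf_octo u) \<nu> \<and>
          parallel_mean_curv TYPE(6) inner (sphere 0 1) M)
   \<and>
    (\<forall>(\<pi> :: 'b::euclidean_space \<times> real \<Rightarrow> 'p) (N :: ('p, 'e) riem_manifold)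
        (u :: 'b \<times> real \<Rightarrow> 'm option \<Rightarrow> 'b \<times> real) (n :: nat) y L M \<nu>.
        n \<ge> 2 \<and> DIM('b) = CARD('m) + n \<and>
        riemannian_fibration minkowski hyperboloid \<pi> N \<and>
        (\<forall>z\<in>topspace (mtop N). totally_geodesic minkowski hyperboloid (fibre hyperboloid \<pi> z)) \<and>
        fibre_orientation minkowski hyperboloid \<pi> u \<and>
        subspace L \<and> dim L = CARD('m) + 2 \<and> fibre hyperboloid \<pi> y = hyperboloid \<inter> L \<and>
        geodesic_sphere_in_H (fibre hyperboloid \<pi> y) M \<and>
        adapted_normal TYPE('m) minkowski hyperboloid (fibre hyperboloid \<pi> y) M \<nu> \<longrightarrow>
          omega_stable minkowski hyperboloid M (Omega minkowski hyperboloid \<pi> u) \<nu> \<and>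
          parallel_mean_curv TYPE('m) minkowski hyperboloid M)"
proof (intro conjI[OF _ conjI[OF _ conjI[OF _ conjI]]] allI impI, goal_cases)
  case 1 then show ?case by (elim conjE) (rule stable_flat)
next
  case 2 then show ?case by (elim conjE) (rule quat.hopf_unstable; simp)
next
  case 3 then show ?case by (elim conjE) (rule HP_unstable; simp)
next
  case 4 then show ?case by (elim conjE) (rule octo.hopf_unstable; simp)
next
  case 5 then show ?case by (elim conjE) (rule stable_hyperbolic)
qed

end
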